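(* Let $\theta_1 \in [0,\pi/2)$, $\theta_2 \in [0,\pi/2]$, $p \in \mathcal{C}^2([0,1])$ with $p>0$, and $\tilde q \in \mathcal{C}^0([0,1])$. Let $q \in \mathcal{C}^0([0,1])$ and $q_c \in \mathbb{R}$ be such that $\tilde q = q - q_c$ and $q>0$ on $[0,1]$. Let $\delta>0$ and $N_0 \ge 1$ be such that $-\lambda_n + q_c < -\delta$ for all $n \ge N_0+1$. Let $K \in \mathbb{R}^{1\times N_0}\setminus\{0\}$ and $L=(l_1,\dots,l_{N_0})^\top \in \mathbb{R}^{N_0}$ be such that $A_0+\mathfrak{B}_0K$ and $A_0 - LC_0$ are Hurwitz with all eigenvalues of real part strictly less than $-\delta$. Let $h>0$. For a given $N \ge N_0+1$, assume there exist $\epsilon\in(0,1/2]$, a symmetric $P \succ 0$, $\alpha>1$ and $\beta,\gamma>0$ such that $$\Theta_1 \preceq 0, \qquad \Theta_2 \le 0, \qquad \Theta_3\ge 0,$$ where $$\Theta_1 = \begin{bmatrix} F^\top P + PF + 2\delta P + \alpha\gamma \|\mathcal{R}_N a\|_{L^2}^2 \tilde K^\top \tilde K & P\mathcal{L} \\ \mathcal{L}^\top P & -\beta e^{-2\delta h}\end{bmatrix} + \alpha\gamma\|\mathcal{R}_N b\|_{L^2}^2 E^\top E,$$ $$\Theta_2 = 2\gamma\left\{-\left(1-\tfrac{1}{\alpha}\right)\lambda_{N+1} + q_c + \delta\right\} + \beta M_\phi(\epsilon)\lambda_{N+1}^{1/2+\epsilon},\qquad \Theta_3 = 2\gamma\left(1-\tfrac1\alpha\right)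 - \frac{\beta M_\phi(\epsilon)}{\lambda_{N+1}^{1/2-\epsilon}},$$ $$M_\phi(\epsilon) = \sum_{n\ge N+1}\frac{|\phi_n'(0)|^2}{\lambda_n^{3/2+\epsilon}} < +\infty.$$ Then there exists $M>0$ such that for any initial condition $z_0 \in H^2(0,1)$ and $\hat z_n(0)\in\mathbb{R}$ ($1\le n\le N$) with $\cos\theta_1 z_0(0) - \sin\theta_1 z_0'(0) = 0$ and $\cos\theta_2 z_0(1) + \sin\theta_2 z_0'(1) = u_0 = K\hat Z_A^{N_0}(0)$, and any Lipschitz continuous $y_0 \in \mathcal{C}^0([-h,0])$ with $y_0(0)=z_0'(0)$, the (classical) trajectories of the closed-loop system consisting of the plant, the delayed Neumann measurement $y_N$, and the controller described in the context satisfy $$\|z(t,\cdot)\|_{H^1}^2 + \sum_{n=1}^N \hat z_n(t)^2 \le M e^{-2\delta t}\left(\|\mathcal{A}w_0\|_{L^2}^2 + \sum_{n=1}^N \hat z_n(0)^2 + u_0^2 + \|y_0\|_\infty^2\right)\quad\text{for all } t\ge0,$$ where $w_0(x) = z_0(x) - \frac{x^2}{\cos\theta_2+2\sin\theta_2}u_0$. Moreover, for any given $h>0$, the constraints $\Theta_1\preceq0$, $\Theta_2\le0$, $\Theta_3\ge0$ are feasible provided $N$ is selected large enough.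
   Context: Notation: $c_{\theta_i}=\cos\theta_i$, $s_{\theta_i}=\sin\theta_i$; $L^2(0,1)$ with inner product $\langle f,g\rangle=\int_0^1 fg\,dx$. The Sturm–Liouville operator $\mathcal{A}f = -(pf')' + qf$ on $D(\mathcal{A}) = \{f\in H^2(0,1): c_{\theta_1}f(0)-s_{\theta_1}f'(0) = c_{\theta_2}f(1)+s_{\theta_2}f'(1)=0\}$ has simple eigenvalues $0<\lambda_1<\lambda_2<\dots\to+\infty$ with associated unit eigenfunctions $\phi_n$ forming a Hilbert basis of $L^2(0,1)$. For $f\in L^2(0,1)$, $\mathcal{R}_N f = \sum_{n\ge N+1}\langle f,\phi_n\rangle\phi_n$. Plant: for $t>0$, $x\in(0,1)$: $z_t = (p z_x)_x - \tilde q z$, $c_{\theta_1}z(t,0)-s_{\theta_1}z_x(t,0)=0$, $c_{\theta_2}z(t,1)+s_{\theta_2}z_x(t,1)=u(t)$, $z(0,\cdot)=z_0$; $u_0 = c_{\theta_2}z_0(1)+s_{\theta_2}z_0'(1)$. Delayed Neumann measurement: $y_N(t) = z_x(t-h,0)$ for $t\ge h$ and $y_N(t)=y_0(t-h)$ for $0\le t\le h$. Coefficients: $a(x) = \frac{2p(x)+2xp'(x)-x^2\tilde q(x)}{c_{\theta_2}+2s_{\theta_2}}$, $b(x) = -\frac{x^2}{c_{\theta_2}+2s_{\theta_2}}$, $a_n=\langle a,\phi_n\rangle$, $b_n=\langle b,\phi_n\rangle$, $\beta_n = p(1)\{-c_{\theta_2}\phi_n'(1)+s_{\theta_2}\phi_n(1)\}$.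 Controller (for $t\ge0$, with convention $u(\tau)=u_0$ for $\tau\le 0$): $\hat w_n(t) = \hat z_n(t) + b_n u(t-h)$; for $1\le n\le N_0$: $\dot{\hat z}_n = (-\lambda_n+q_c)\hat z_n + \beta_n u(t-h) - l_n\{\sum_{k=1}^N \hat w_k(t)\phi_k'(0) - y_N(t)\}$; for $N_0+1\le n\le N$: $\dot{\hat z}_n = (-\lambda_n+q_c)\hat z_n + \beta_n u(t-h)$. With $\hat Z^{N_0} = (\hat z_1,\dots,\hat z_{N_0})^\top$, $A_0 = \mathrm{diag}(-\lambda_1+q_c,\dots,-\lambda_{N_0}+q_c)$, $\mathfrak{B}_0 = (\beta_1,\dots,\beta_{N_0})^\top$, the predictor is $\hat Z_A^{N_0}(t) = e^{A_0h}\hat Z^{N_0}(t) + \int_{t-h}^t e^{A_0(t-s)}\mathfrak{B}_0u(s)\,ds$ and the control is $u(t) = K\hat Z_A^{N_0}(t)$ for $t\ge 0$. Matrices: $C_0 = [\phi_1'(0)\ \cdots\ \phi_{N_0}'(0)]$, $\tilde C_1 = [\phi_{N_0+1}'(0)/\lambda_{N_0+1}\ \cdots\ \phi_N'(0)/\lambda_N]$, $A_1 = \mathrm{diag}(-\lambda_{N_0+1}+q_c,\dots,-\lambda_N+q_c)$, $\tilde{\mathfrak{B}}_1 = (\beta_{N_0+1}/\lambda_{N_0+1},\dots,\beta_N/\lambda_N)^\top$, $$F = \begin{bmatrix} A_0+\mathfrak{B}_0K & e^{A_0h}LC_0 & 0 & e^{A_0h}L\tilde C_1\\ 0 & A_0-LC_0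 & 0 & -L\tilde C_1\\ \tilde{\mathfrak{B}}_1K & 0 & A_1 & 0\\ 0&0&0&A_1\end{bmatrix},\quad \mathcal{L} = \begin{bmatrix} e^{A_0h}L\\ -L\\ 0\\ 0\end{bmatrix},$$ $\tilde K = [K\ 0\ 0\ 0]$ (size compatible with $F$), and $E = K\,[A_0+\mathfrak{B}_0K\ \ e^{A_0h}LC_0\ \ 0\ \ e^{A_0h}L\tilde C_1\ \ e^{A_0h}L]$ (a row vector of size $1\times(2N+1)$). *)

theory Defs
  imports "HOL-Analysis.Analysis" "Jordan_Normal_Form.Matrix" "Jordan_Normal_Form.Char_Poly"
begin

definition ip :: "(real \<Rightarrow> real) \<Rightarrow> (real \<Rightarrow> real) \<Rightarrow> real" where
  "ip f g = integral {0..1} (\<lambda>x. f x * g x)"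

definition nrm2 :: "(real \<Rightarrow> real) \<Rightarrow> real" where
  "nrm2 f = integral {0..1} (\<lambda>x. (f x)^2)"

definition sq_int :: "(real \<Rightarrow> real) \<Rightarrow> bool" where
  "sq_int f \<longleftrightarrow> f \<in> borel_measurable (lebesgue_on {0..1}) \<and> (\<lambda>x. (f x)^2) integrable_on {0..1}"

text \<open>f is (the continuous representative of) an element of H^2(0,1), with derivative f'
  (continuous, absolutely continuous) and weak second derivative f'' in L^2(0,1).\<close>
definition H2 :: "(real \<Rightarrow> real) \<Rightarrow> (real \<Rightarrow> real) \<Rightarrow> (real \<Rightarrow> real) \<Rightarrow> bool" where
  "H2 f f' f'' \<longleftrightarrow>
     (\<forall>x\<in>{0..1}. (f has_real_derivative f' x) (at x within {0..1})) \<and>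
     (\<forall>x\<in>{0..1}. f' x = f' 0 + integral {0..x} f'') \<and> sq_int f''"

definition SL_eigensystem ::
  "(real \<Rightarrow> real) \<Rightarrow> (real \<Rightarrow> real) \<Rightarrow> (real \<Rightarrow> real) \<Rightarrow> real \<Rightarrow> real \<Rightarrow>
   (nat \<Rightarrow> real) \<Rightarrow> (nat \<Rightarrow> real \<Rightarrow> real) \<Rightarrow> (nat \<Rightarrow> real \<Rightarrow> real) \<Rightarrow> (nat \<Rightarrow> real \<Rightarrow> real) \<Rightarrow> bool"
  where
  "SL_eigensystem p pd q \<theta>1 \<theta>2 lam phi phid phidd \<longleftrightarrow>
     (\<forall>n\<ge>1.
        (\<forall>x\<in>{0..1}. (phi n has_real_derivative phid n x) (at x within {0..1}) \<and>
                     (phid n has_real_derivative phidd n x) (at x within {0..1})) \<and>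
        continuous_on {0..1} (phidd n) \<and>
        (\<forall>x\<in>{0..1}. - (pd x * phid n x + p x * phidd n x) + q x * phi n x = lam n * phi n x) \<and>
        cos \<theta>1 * phi n 0 - sin \<theta>1 * phid n 0 = 0 \<and>
        cos \<theta>2 * phi n 1 + sin \<theta>2 * phid n 1 = 0) \<and>
     (\<forall>n\<ge>1. \<forall>m\<ge>1. ip (phi n) (phi m) = (if n = m then 1 else 0)) \<and>
     (\<forall>f. sq_int f \<and> (\<forall>n\<ge>1. ip f (phi n) = 0) \<longrightarrow> nrm2 f = 0) \<and>
     0 < lam 1 \<and> (\<forall>n\<ge>1. lam n < lam (Suc n)) \<and> filterlim lam at_top sequentially"

definition acoef :: "(real \<Rightarrow> real) \<Rightarrow> (real \<Rightarrow> real) \<Rightarrow> (real \<Rightarrow> real) \<Rightarrow> real \<Rightarrow> real \<Rightarrow> real" where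
  "acoef p pd qt \<theta>2 x = (2 * p x + 2 * x * pd x - x^2 * qt x) / (cos \<theta>2 + 2 * sin \<theta>2)"

definition bcoef :: "real \<Rightarrow> real \<Rightarrow> real" where
  "bcoef \<theta>2 x = - (x^2) / (cos \<theta>2 + 2 * sin \<theta>2)"

definition betac :: "(real \<Rightarrow> real) \<Rightarrow> real \<Rightarrow> (nat \<Rightarrow> real \<Rightarrow> real) \<Rightarrow> (nat \<Rightarrow> real \<Rightarrow> real) \<Rightarrow> nat \<Rightarrow> real" where
  "betac p \<theta>2 phi phid n = p 1 * (- cos \<theta>2 * phid n 1 + sin \<theta>2 * phi n 1)"

text \<open>squared L2 norm of R_N f, i.e. sum over n \<ge> N+1 of <f,phi_n>^2 (Parseval)\<close>
definition tail2 :: "(nat \<Rightarrow> real \<Rightarrow> real) \<Rightarrow> (real \<Rightarrow> real) \<Rightarrow> nat \<Rightarrow> real" where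
  "tail2 phi f N = (\<Sum>n. if N + 1 \<le> n then (ip f (phi n))^2 else 0)"

definition Mphi :: "(nat \<Rightarrow> real) \<Rightarrow> (nat \<Rightarrow> real \<Rightarrow> real) \<Rightarrow> nat \<Rightarrow> real \<Rightarrow> real" where
  "Mphi lam phid N \<epsilon> = (\<Sum>n. if N + 1 \<le> n then (phid n 0)^2 / lam n powr (3/2 + \<epsilon>) else 0)"

section \<open>Matrices (JNF indices start at 0; mode indices at 1)\<close>

definition diagm :: "nat \<Rightarrow> (nat \<Rightarrow> real) \<Rightarrow> real mat" where
  "diagm n f = mat n n (\<lambda>(i,j). if i = j then f i else 0)"

definition hcat :: "real mat \<Rightarrow> real mat \<Rightarrow> real mat" where
  "hcat X Y = four_block_mat X Y (0\<^sub>m 0 (dim_col X)) (0\<^sub>m 0 (dim_col Y))"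

definition eig_re_lt :: "real mat \<Rightarrow> real \<Rightarrow> bool" where
  "eig_re_lt M d \<longleftrightarrow> (\<forall>\<mu>. eigenvalue (map_mat complex_of_real M) \<mu> \<longrightarrow> Re \<mu> < d)"

definition neg_semidef :: "real mat \<Rightarrow> nat \<Rightarrow> bool" where
  "neg_semidef M n \<longleftrightarrow> M \<in> carrier_mat n n \<and> (\<forall>v \<in> carrier_vec n. v \<bullet> (M *\<^sub>v v) \<le> 0)"

definition pos_def :: "real mat \<Rightarrow> nat \<Rightarrow> bool" where
  "pos_def M n \<longleftrightarrow> M \<in> carrier_mat n n \<and> transpose_mat M = M \<and>
     (\<forall>v \<in> carrier_vec n. v \<noteq> 0\<^sub>v n \<longrightarrow> v \<bullet> (M *\<^sub>v v) > 0)"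

text \<open>Common parameters: lam (eigenvalues), qc, bet (beta_n), c (c n = phi_n'(0)),
  K (K = [K 1 .. K N0]), l (L = (l 1, ..., l N0)), N0, N, h.\<close>

definition A0m :: "(nat \<Rightarrow> real) \<Rightarrow> real \<Rightarrow> nat \<Rightarrow> real mat" where
  "A0m lam qc N0 = diagm N0 (\<lambda>i. - lam (i+1) + qc)"

text \<open>e^{A0 h}; A0 is diagonal\<close>
definition eA0hm :: "(nat \<Rightarrow> real) \<Rightarrow> real \<Rightarrow> nat \<Rightarrow> real \<Rightarrow> real mat" where
  "eA0hm lam qc N0 h = diagm N0 (\<lambda>i. exp ((- lam (i+1) + qc) * h))"

definition B0m :: "(nat \<Rightarrow> real) \<Rightarrow> nat \<Rightarrow> real mat" where
  "B0m bet N0 = mat N0 1 (\<lambda>(i,j). bet (i+1))"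

definition Km :: "(nat \<Rightarrow> real) \<Rightarrow> nat \<Rightarrow> real mat" where
  "Km K N0 = mat 1 N0 (\<lambda>(i,j). K (j+1))"

definition Lm :: "(nat \<Rightarrow> real) \<Rightarrow> nat \<Rightarrow> real mat" where
  "Lm l N0 = mat N0 1 (\<lambda>(i,j). l (i+1))"

definition C0m :: "(nat \<Rightarrow> real) \<Rightarrow> nat \<Rightarrow> real mat" where
  "C0m c N0 = mat 1 N0 (\<lambda>(i,j). c (j+1))"

definition A1m :: "(nat \<Rightarrow> real) \<Rightarrow> real \<Rightarrow> nat \<Rightarrow> nat \<Rightarrow> real mat" where
  "A1m lam qc N0 N = diagm (N - N0) (\<lambda>i. - lam (N0+i+1) + qc)"

definition C1tm :: "(nat \<Rightarrow> real) \<Rightarrow> (nat \<Rightarrow> real) \<Rightarrow> nat \<Rightarrow> nat \<Rightarrow> real mat" where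
  "C1tm lam c N0 N = mat 1 (N - N0) (\<lambda>(i,j). c (N0+j+1) / lam (N0+j+1))"

definition B1tm :: "(nat \<Rightarrow> real) \<Rightarrow> (nat \<Rightarrow> real) \<Rightarrow> nat \<Rightarrow> nat \<Rightarrow> real mat" where
  "B1tm lam bet N0 N = mat (N - N0) 1 (\<lambda>(i,j). bet (N0+i+1) / lam (N0+i+1))"

definition Fm :: "(nat \<Rightarrow> real) \<Rightarrow> real \<Rightarrow> (nat \<Rightarrow> real) \<Rightarrow> (nat \<Rightarrow> real) \<Rightarrow> (nat \<Rightarrow> real) \<Rightarrow>
                  (nat \<Rightarrow> real) \<Rightarrow> nat \<Rightarrow> nat \<Rightarrow> real \<Rightarrow> real mat" where
  "Fm lam qc bet c K l N0 N h =
    (let A0 = A0m lam qc N0; E0 = eA0hm lam qc N0 h; B0 = B0m bet N0; K' = Km K N0;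
         L = Lm l N0; C0 = C0m c N0; A1 = A1m lam qc N0 N; C1 = C1tm lam c N0 N;
         B1 = B1tm lam bet N0 N; M = N - N0 in
     four_block_mat
       (four_block_mat (A0 + B0 * K') (E0 * L * C0) (0\<^sub>m N0 N0) (A0 - L * C0))
       (four_block_mat (0\<^sub>m N0 M) (E0 * L * C1) (0\<^sub>m N0 M) (- (L * C1)))
       (four_block_mat (B1 * K') (0\<^sub>m M N0) (0\<^sub>m M N0) (0\<^sub>m M N0))
       (four_block_mat A1 (0\<^sub>m M M) (0\<^sub>m M M) A1))"

definition Lcalm :: "(nat \<Rightarrow> real) \<Rightarrow> real \<Rightarrow> (nat \<Rightarrow> real) \<Rightarrow> nat \<Rightarrow> nat \<Rightarrow> real \<Rightarrow> real mat" where
  "Lcalm lam qc l N0 N h = mat (2*N) 1 (\<lambda>(i,j).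
      if i < N0 then exp ((- lam (i+1) + qc) * h) * l (i+1)
      else if i < 2*N0 then - l (i - N0 + 1) else 0)"

definition Ktm :: "(nat \<Rightarrow> real) \<Rightarrow> nat \<Rightarrow> nat \<Rightarrow> real mat" where
  "Ktm K N0 N = mat 1 (2*N) (\<lambda>(i,j). if j < N0 then K (j+1) else 0)"

definition Em :: "(nat \<Rightarrow> real) \<Rightarrow> real \<Rightarrow> (nat \<Rightarrow> real) \<Rightarrow> (nat \<Rightarrow> real) \<Rightarrow> (nat \<Rightarrow> real) \<Rightarrow>
                  (nat \<Rightarrow> real) \<Rightarrow> nat \<Rightarrow> nat \<Rightarrow> real \<Rightarrow> real mat" where
  "Em lam qc bet c K l N0 N h =
    (let A0 = A0m lam qc N0; E0 = eA0hm lam qc N0 h; B0 = B0m bet N0; K' = Km K N0;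
         L = Lm l N0; C0 = C0m c N0; C1 = C1tm lam c N0 N in
     K' * hcat (A0 + B0 * K') (hcat (E0 * L * C0) (hcat (0\<^sub>m N0 (N - N0))
            (hcat (E0 * L * C1) (E0 * L)))))"

definition Theta1 :: "(nat \<Rightarrow> real) \<Rightarrow> real \<Rightarrow> (nat \<Rightarrow> real) \<Rightarrow> (nat \<Rightarrow> real) \<Rightarrow> (nat \<Rightarrow> real) \<Rightarrow>
                  (nat \<Rightarrow> real) \<Rightarrow> nat \<Rightarrow> nat \<Rightarrow> real \<Rightarrow> real \<Rightarrow> real \<Rightarrow> real \<Rightarrow>
                  real mat \<Rightarrow> real \<Rightarrow> real \<Rightarrow> real \<Rightarrow> real mat" where
  "Theta1 lam qc bet c K l N0 N h \<delta> ra rb P \<alpha> \<beta> \<gamma> =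
    (let F = Fm lam qc bet c K l N0 N h; Lc = Lcalm lam qc l N0 N h; Kt = Ktm K N0 N;
         E = Em lam qc bet c K l N0 N h in
     four_block_mat
       (transpose_mat F * P + P * F + (2 * \<delta>) \<cdot>\<^sub>m P + (\<alpha> * \<gamma> * ra) \<cdot>\<^sub>m (transpose_mat Kt * Kt))
       (P * Lc) (transpose_mat Lc * P) (mat 1 1 (\<lambda>_. - \<beta> * exp (- 2 * \<delta> * h)))
     + (\<alpha> * \<gamma> * rb) \<cdot>\<^sub>m (transpose_mat E * E))"

definition feasible ::
  "(real \<Rightarrow> real) \<Rightarrow> (real \<Rightarrow> real) \<Rightarrow> (real \<Rightarrow> real) \<Rightarrow> real \<Rightarrow> real \<Rightarrow>
   (nat \<Rightarrow> real) \<Rightarrow> (nat \<Rightarrow> real \<Rightarrow> real) \<Rightarrow> (nat \<Rightarrow> real \<Rightarrow> real) \<Rightarrow>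
   (nat \<Rightarrow> real) \<Rightarrow> (nat \<Rightarrow> real) \<Rightarrow> nat \<Rightarrow> real \<Rightarrow> real \<Rightarrow> nat \<Rightarrow> bool" where
  "feasible p pd qt qc \<theta>2 lam phi phid K l N0 \<delta> h N \<longleftrightarrow>
     (\<exists>\<epsilon> P \<alpha> \<beta> \<gamma>. 0 < \<epsilon> \<and> \<epsilon> \<le> 1/2 \<and> pos_def P (2*N) \<and> \<alpha> > 1 \<and> \<beta> > 0 \<and> \<gamma> > 0 \<and>
       neg_semidef (Theta1 lam qc (betac p \<theta>2 phi phid) (\<lambda>n. phid n 0) K l N0 N h \<delta>
                       (tail2 phi (acoef p pd qt \<theta>2) N) (tail2 phi (bcoef \<theta>2) N) P \<alpha> \<beta> \<gamma>) (2*N+1) \<and>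
       2 * \<gamma> * (- (1 - 1/\<alpha>) * lam (N+1) + qc + \<delta>)
         + \<beta> * Mphi lam phid N \<epsilon> * lam (N+1) powr (1/2 + \<epsilon>) \<le> 0 \<and>
       2 * \<gamma> * (1 - 1/\<alpha>) - \<beta> * Mphi lam phid N \<epsilon> / lam (N+1) powr (1/2 - \<epsilon>) \<ge> 0)"

definition yN :: "(real \<Rightarrow> real \<Rightarrow> real) \<Rightarrow> (real \<Rightarrow> real) \<Rightarrow> real \<Rightarrow> real \<Rightarrow> real" where
  "yN zx y0 h t = (if h \<le> t then zx (t - h) 0 else y0 (t - h))"

definition ZA :: "(nat \<Rightarrow> real) \<Rightarrow> real \<Rightarrow> (nat \<Rightarrow> real) \<Rightarrow> real \<Rightarrow> (nat \<Rightarrow> real \<Rightarrow> real) \<Rightarrow>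
                  (real \<Rightarrow> real) \<Rightarrow> nat \<Rightarrow> real \<Rightarrow> real" where
  "ZA lam qc bet h zh u n t = exp ((- lam n + qc) * h) * zh n t
      + integral {t - h..t} (\<lambda>s. exp ((- lam n + qc) * (t - s)) * bet n * u s)"

text \<open>(z, zx, zxx, zt, zh, u) is a classical solution of the closed loop (plant + delayed
  Neumann measurement + observer/predictor controller) with initial data (z0, zh(0), y0):
  z \<in> C^0([0,\<infinity>); H^2(0,1)) \<inter> C^1((0,\<infinity>); L^2(0,1)), the PDE holding in L^2 for t > 0,
  boundary conditions holding for all t \<ge> 0, zh_n \<in> C^1([0,\<infinity>)).\<close>
definition closed_loop ::
  "(real \<Rightarrow> real) \<Rightarrow> (real \<Rightarrow> real) \<Rightarrow> (real \<Rightarrow> real) \<Rightarrow> real \<Rightarrow> real \<Rightarrow> real \<Rightarrow>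
   (nat \<Rightarrow> real) \<Rightarrow> (nat \<Rightarrow> real \<Rightarrow> real) \<Rightarrow> (nat \<Rightarrow> real \<Rightarrow> real) \<Rightarrow>
   (nat \<Rightarrow> real) \<Rightarrow> (nat \<Rightarrow> real) \<Rightarrow> nat \<Rightarrow> nat \<Rightarrow> real \<Rightarrow>
   (real \<Rightarrow> real) \<Rightarrow> (real \<Rightarrow> real) \<Rightarrow>
   (real \<Rightarrow> real \<Rightarrow> real) \<Rightarrow> (real \<Rightarrow> real \<Rightarrow> real) \<Rightarrow> (real \<Rightarrow> real \<Rightarrow> real) \<Rightarrow> (real \<Rightarrow> real \<Rightarrow> real) \<Rightarrow>
   (nat \<Rightarrow> real \<Rightarrow> real) \<Rightarrow> (real \<Rightarrow> real) \<Rightarrow> bool" where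
  "closed_loop p pd qt qc \<theta>1 \<theta>2 lam phi phid K l N0 N h z0 y0 z zx zxx zt zh u \<longleftrightarrow>
    (let bet = betac p \<theta>2 phi phid; b = (\<lambda>n. ip (bcoef \<theta>2) (phi n));
         u0 = cos \<theta>2 * z0 1 + sin \<theta>2 * zx 0 1 in
     (\<forall>x\<in>{0..1}. z 0 x = z0 x) \<and>
     (\<forall>t\<ge>0. H2 (z t) (zx t) (zxx t)) \<and>
     (\<forall>t\<ge>0. ((\<lambda>s. nrm2 (\<lambda>x. z s x - z t x) + nrm2 (\<lambda>x. zx s x - zx t x)
                     + nrm2 (\<lambda>x. zxx s x - zxx t x)) \<longlongrightarrow> 0) (at t within {0..})) \<and>
     (\<forall>t>0. ((\<lambda>s. nrm2 (\<lambda>x. (z s x - z t x) / (s - t) - zt t x)) \<longlongrightarrow> 0) (at t) \<and>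
            ((\<lambda>s. nrm2 (\<lambda>x. zt s x - zt t x)) \<longlongrightarrow> 0) (at t) \<and>
            sq_int (zt t) \<and>
            nrm2 (\<lambda>x. zt t x - (pd x * zx t x + p x * zxx t x - qt x * z t x)) = 0) \<and>
     (\<forall>t\<ge>0. cos \<theta>1 * z t 0 - sin \<theta>1 * zx t 0 = 0 \<and> cos \<theta>2 * z t 1 + sin \<theta>2 * zx t 1 = u t) \<and>
     (\<forall>\<tau>\<le>0. u \<tau> = u0) \<and>
     continuous_on {0..} u \<and>
     (\<forall>t\<ge>0. u t = (\<Sum>n=1..N0. K n * ZA lam qc bet h zh u n t)) \<and>
     (\<forall>n\<in>{1..N}. \<forall>t\<ge>0. (zh n has_real_derivative
         ((- lam n + qc) * zh n t + bet n * u (t - h)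
          - (if n \<le> N0 then l n * ((\<Sum>k=1..N. (zh k t + b k * u (t - h)) * phid k 0) - yN zx y0 h t)
             else 0))) (at t within {0..})))"

end

theory Submission
  imports Defs "Jordan_Normal_Form.Schur_Decomposition"
begin

text \<open>Subtracting the quadratic lifting of the boundary input homogenises the boundary conditions, so
  that the modes \<open>w\<^sub>n = z\<^sub>n + b\<^sub>n u\<close> carry the \<open>H\<^sup>1\<close> norm through \<open>\<Sum> \<lambda>\<^sub>n w\<^sub>n\<^sup>2\<close>. In the predictor
  coordinates the finite part of the closed loop is driven by the delayed output error of the modes
  \<open>n > N\<close>, and \<open>X\<^sup>T P X + \<gamma> \<Sum>\<^sub>n\<^sub>>\<^sub>N \<lambda>\<^sub>n w\<^sub>n\<^sup>2\<close> plus the integral of the squared error over the last \<open>h\<close>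
  time units, weighted by \<open>\<beta> e\<^bsup>2\<delta>s\<^esup>\<close>, is a Lyapunov functional: Young's inequality with parameter \<open>\<alpha>\<close>
  and Cauchy--Schwarz with the weight of \<open>M\<^sub>\<phi>\<close> turn its derivative into \<open>\<Theta>\<^sub>1, \<Theta>\<^sub>2, \<Theta>\<^sub>3\<close>.
  Feasibility: the nominal matrix is a cascade with blocks stable beyond \<open>\<delta>\<close>, whose Lyapunov matrices
  can be chosen uniformly in \<open>N\<close> because the infinite sequences in \<open>C\<^sub>1\<close> and \<open>B\<^sub>1\<close> are
  square-summable, while the perturbing tails tend to \<open>0\<close>.\<close>

section \<open>Square-integrable functions on the unit interval\<close>

text \<open>The measured flux is not controlled by the energy \<open>\<Sum> lam n * (w n)^2\<close>,
  only by higher powers of \<open>lam n\<close>. The energy still works as a functional because its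
  derivative dissipates \<open>\<Sum> (lam n)^2 * (w n)^2\<close>, and the weight
  \<open>lam n powr (3/2 + \<epsilon>)\<close> with \<open>\<epsilon> \<le> 1/2\<close> fits below
  that. Infinite sums are never differentiated in time: the functional is truncated at a mode M
  while the full error keeps driving the finite-dimensional part, and the resulting defect vanishes
  uniformly on compact time intervals as M grows. Before time \<open>h\<close> the measurement is
  the prescribed history \<open>y0\<close>, which is not the flux of the plant. The functional is
  therefore used only from \<open>t = h\<close> on, and Gronwall estimates bridge
  \<open>[0, h]\<close>. One constant has to serve all initial data, so every a priori estimate
  fixes its constant before the trajectory is quantified.\<close>

lemma abs_integral_le_integral:
  fixes f g :: "real \<Rightarrow> real"
  assumes "f integrable_on S" "g integrable_on S" "\<And>x. x \<in> S \<Longrightarrow> \<bar>f x\<bar> \<le> g x"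
  shows "\<bar>integral S f\<bar> \<le> integral S g"
  using Henstock_Kurzweil_Integration.integral_norm_bound_integral[of f S g] assms by simp

lemma sq_int_mult_absolutely_integrable:
  assumes "sq_int f" "sq_int g"
  shows "(\<lambda>x. f x * g x) absolutely_integrable_on {0..1}"
proof (rule measurable_bounded_by_integrable_imp_absolutely_integrable)
  show "(\<lambda>x. f x * g x) \<in> borel_measurable (lebesgue_on {0..1})"
    using assms unfolding sq_int_def by (intro borel_measurable_times) auto
  show "(\<lambda>x. (f x)^2 + (g x)^2) integrable_on {0..1}"
    using assms unfolding sq_int_def by (intro integrable_add) auto
  have "\<bar>a * b\<bar> \<le> a^2 + b^2" for a b :: real
  proof -
    have "2 * (\<bar>a\<bar> * \<bar>b\<bar>) \<le> a^2 + b^2"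
      using sum_squares_bound[of "\<bar>a\<bar>" "\<bar>b\<bar>"] by simp
    moreover have "0 \<le> \<bar>a\<bar> * \<bar>b\<bar>" by simp
    ultimately show ?thesis unfolding abs_mult by linarith
  qed
  then show "norm (f x * g x) \<le> (f x)^2 + (g x)^2" for x
    by simp
qed auto

lemma sq_int_mult_integrable:
  assumes "sq_int f" "sq_int g"
  shows "(\<lambda>x. f x * g x) integrable_on {0..1}"
  using sq_int_mult_absolutely_integrable[OF assms] absolutely_integrable_on_def by blast

lemma sq_int_continuous:
  assumes "continuous_on {0..1} f" shows "sq_int f"
  unfolding sq_int_def
proof
  show "f \<in> borel_measurable (lebesgue_on {0..1})"
    using assms by (intro continuous_imp_measurable_on_sets_lebesgue) auto
  show "(\<lambda>x. (f x)^2) integrable_on {0..1}"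
    using assms by (intro integrable_continuous_interval continuous_intros) auto
qed

lemma continuous_on_01_bounded:
  fixes g :: "real \<Rightarrow> real"
  assumes "continuous_on {0..1} g"
  obtains B where "B > 0" "\<And>x. x \<in> {0..1} \<Longrightarrow> \<bar>g x\<bar> \<le> B"
proof -
  have "bounded (g ` {0..1})"
    using assms by (intro compact_imp_bounded compact_continuous_image) auto
  then show ?thesis
    unfolding bounded_pos using that by fastforce
qed

lemma sq_int_mult_continuous:
  assumes f: "sq_int f" and g: "continuous_on {0..1} g" shows "sq_int (\<lambda>x. g x * f x)"
  unfolding sq_int_def
proof
  show m: "(\<lambda>x. g x * f x) \<in> borel_measurable (lebesgue_on {0..1})"
    using f sq_int_continuous[OF g] unfolding sq_int_def by (intro borel_measurable_times) auto
  obtain B where B: "\<And>x. x \<in> {0..1} \<Longrightarrow> \<bar>g x\<bar> \<le> B"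
    using continuous_on_01_bounded[OF g] by blast
  show "(\<lambda>x. (g x * f x)^2) integrable_on {0..1}"
  proof (rule measurable_bounded_by_integrable_imp_integrable_real)
    show "(\<lambda>x. (g x * f x)^2) \<in> borel_measurable (lebesgue_on {0..1})"
      using m by (intro borel_measurable_power) auto
    show "(\<lambda>x. B^2 * (f x)^2) integrable_on {0..1}"
      using f unfolding sq_int_def by (intro integrable_on_mult_right) auto
    show "\<bar>(g x * f x)^2\<bar> \<le> B^2 * (f x)^2" if "x \<in> {0..1}" for x
      using B[OF that] by (simp add: power_mult_distrib mult_right_mono abs_le_square_iff[symmetric])
  qed auto
qed

lemma sq_int_add:
  assumes "sq_int f" "sq_int g" shows "sq_int (\<lambda>x. f x + g x)"
  unfolding sq_int_def
proof
  show "(\<lambda>x. f x + g x) \<in> borel_measurable (lebesgue_on {0..1})"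
    using assms unfolding sq_int_def by (intro borel_measurable_add) auto
  have "(\<lambda>x. (f x)^2 + (g x)^2 + 2 * (f x * g x)) integrable_on {0..1}"
    using assms sq_int_mult_integrable[OF assms] unfolding sq_int_def
    by (intro integrable_add integrable_on_mult_right) auto
  then show "(\<lambda>x. (f x + g x)^2) integrable_on {0..1}"
    by (simp add: power2_sum algebra_simps)
qed

lemma sq_int_cmult:
  assumes "sq_int f" shows "sq_int (\<lambda>x. c * f x)"
  using sq_int_mult_continuous[OF assms, of "\<lambda>_. c"] by simp

lemma sq_int_diff:
  assumes "sq_int f" "sq_int g" shows "sq_int (\<lambda>x. f x - g x)"
  using sq_int_add[OF assms(1) sq_int_cmult[OF assms(2), of "-1"]] by simp

lemma sq_int_sum:
  assumes "\<And>i. i \<in> I \<Longrightarrow> sq_int (f i)" shows "sq_int (\<lambda>x. \<Sum>i\<in>I. f i x)"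
  using assms
  by (induction I rule: infinite_finite_induct) (auto intro: sq_int_add sq_int_continuous)

section \<open>The inner product and norm of square-integrable functions\<close>

lemma ip_commute: "ip f g = ip g f"
  by (simp add: ip_def mult.commute)

lemma ip_add:
  assumes "sq_int f" "sq_int g" "sq_int k"
  shows "ip (\<lambda>x. f x + g x) k = ip f k + ip g k"
  unfolding ip_def distrib_right
  by (intro integral_add sq_int_mult_integrable assms)

lemma ip_cmult: "ip (\<lambda>x. c * f x) k = c * ip f k"
  unfolding ip_def mult.assoc by simp

lemma ip_diff:
  assumes "sq_int f" "sq_int g" "sq_int k"
  shows "ip (\<lambda>x. f x - g x) k = ip f k - ip g k"
  unfolding ip_def left_diff_distrib
  by (intro integral_diff sq_int_mult_integrable assms)

lemma ip_sum:
  assumes "finite I" "\<And>i. i \<in> I \<Longrightarrow> sq_int (f i)" "sq_int k"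
  shows "ip (\<lambda>x. \<Sum>i\<in>I. f i x) k = (\<Sum>i\<in>I. ip (f i) k)"
  using assms
proof (induction I rule: finite_induct)
  case empty
  then show ?case by (simp add: ip_def)
next
  case (insert i I)
  then show ?case by (simp add: ip_add sq_int_sum)
qed

lemma ip_cong: "(\<And>x. x \<in> {0..1} \<Longrightarrow> f x = g x) \<Longrightarrow> ip f k = ip g k"
  unfolding ip_def by (intro integral_cong) auto

lemma nrm2_cong: "(\<And>x. x \<in> {0..1} \<Longrightarrow> f x = g x) \<Longrightarrow> nrm2 f = nrm2 g"
  unfolding nrm2_def by (intro integral_cong) auto

lemma nrm2_eq_ip: "nrm2 f = ip f f"
  by (simp add: nrm2_def ip_def power2_eq_square)

lemma nrm2_nonneg [simp]: "nrm2 f \<ge> 0"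
  unfolding nrm2_def by (cases "(\<lambda>x. (f x)^2) integrable_on {0..1}")
    (auto intro: integral_nonneg simp: not_integrable_integral)

lemma nrm2_add:
  assumes "sq_int f" "sq_int g"
  shows "nrm2 (\<lambda>x. f x + g x) = nrm2 f + 2 * ip f g + nrm2 g"
proof -
  have "nrm2 (\<lambda>x. f x + g x) = ip f (\<lambda>x. f x + g x) + ip g (\<lambda>x. f x + g x)"
    unfolding nrm2_eq_ip by (intro ip_add assms sq_int_add)
  also have "ip f (\<lambda>x. f x + g x) = ip f f + ip g f"
    by (subst ip_commute) (intro ip_add assms)
  also have "ip g (\<lambda>x. f x + g x) = ip f g + ip g g"
    by (subst ip_commute) (intro ip_add assms)
  finally show ?thesis
    by (simp add: nrm2_eq_ip ip_commute[of g f])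
qed

lemma nrm2_cmult: "nrm2 (\<lambda>x. c * f x) = c^2 * nrm2 f"
  unfolding nrm2_def power_mult_distrib by simp

text \<open>Nonnegativity of the quadratic polynomial \<open>*\<close> in \<open>t\<close>,
  evaluated at its minimum. The case \<open>nrm2 g = 0\<close> is separate because the polynomial is
  then affine; if its slope were nonzero, the chosen \<open>t\<close> would give it the value
  -1.\<close>

lemma ip_Cauchy_Schwarz:
  assumes "sq_int f" "sq_int g"
  shows "(ip f g)^2 \<le> nrm2 f * nrm2 g"
proof -
  have *: "0 \<le> nrm2 f + 2 * t * ip f g + t^2 * nrm2 g" for t
    using nrm2_nonneg[of "\<lambda>x. f x + t * g x"]
    by (simp add: nrm2_add[OF assms(1) sq_int_cmult[OF assms(2)]] nrm2_cmult ip_cmult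
        ip_commute[of f "\<lambda>x. t * g x"] ip_commute[of g f])
  show ?thesis
  proof (cases "nrm2 g = 0")
    case True
    have "ip f g = 0"
    proof (rule ccontr)
      assume "ip f g \<noteq> 0"
      then show False
        using *[of "- (nrm2 f + 1) / (2 * ip f g)"] True nrm2_nonneg[of f]
        by (simp add: field_simps)
    qed
    then show ?thesis by simp
  next
    case False
    then have "nrm2 g > 0" using nrm2_nonneg[of g] by linarith
    then show ?thesis
      using *[of "- ip f g / nrm2 g"] by (simp add: field_simps power2_eq_square)
  qed
qed

lemma nrm2_add_le:
  assumes "sq_int f" "sq_int g"
  shows "nrm2 (\<lambda>x. f x + g x) \<le> 2 * nrm2 f + 2 * nrm2 g"
proof -
  have "0 \<le> nrm2 (\<lambda>x. f x + (-1) * g x)" by (rule nrm2_nonneg)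
  also have "\<dots> = nrm2 f + 2 * ip f (\<lambda>x. (-1) * g x) + nrm2 (\<lambda>x. (-1) * g x)"
    by (intro nrm2_add assms sq_int_cmult)
  also have "ip f (\<lambda>x. (-1) * g x) = - ip f g"
    by (subst ip_commute, subst ip_cmult) (simp add: ip_commute[of g f])
  also have "nrm2 (\<lambda>x. (-1) * g x) = nrm2 g"
    by (subst nrm2_cmult) simp
  finally show ?thesis
    unfolding nrm2_add[OF assms] by linarith
qed

lemma nrm2_mult_le:
  assumes f: "sq_int f" and g: "continuous_on {0..1} g" and B: "\<And>x. x \<in> {0..1} \<Longrightarrow> \<bar>g x\<bar> \<le> B"
  shows "nrm2 (\<lambda>x. g x * f x) \<le> B^2 * nrm2 f"
proof -
  have "nrm2 (\<lambda>x. g x * f x) \<le> integral {0..1} (\<lambda>x. B^2 * (f x)^2)"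
    unfolding nrm2_def
  proof (rule integral_le)
    show "(\<lambda>x. (g x * f x)^2) integrable_on {0..1}"
      using sq_int_mult_continuous[OF f g] by (simp add: sq_int_def)
    show "(\<lambda>x. B^2 * (f x)^2) integrable_on {0..1}"
      using f unfolding sq_int_def by (intro integrable_on_mult_right) auto
    show "(g x * f x)^2 \<le> B^2 * (f x)^2" if "x \<in> {0..1}" for x
      using B[OF that] by (simp add: power_mult_distrib mult_right_mono abs_le_square_iff[symmetric])
  qed
  then show ?thesis by (simp add: nrm2_def)
qed

lemma continuous_on_01_lower_bound:
  fixes g :: "real \<Rightarrow> real"
  assumes "continuous_on {0..1} g" "\<forall>x\<in>{0..1}. g x > 0"
  obtains m where "m > 0" "\<And>x. x \<in> {0..1} \<Longrightarrow> m \<le> g x"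
proof -
  obtain x where "x \<in> {0..1}" "\<And>y. y \<in> {0..1} \<Longrightarrow> g x \<le> g y"
    using continuous_attains_inf[of "{0..1::real}" g] assms by auto
  then show ?thesis using that[of "g x"] assms by auto
qed

lemma sq_int_integrable:
  assumes "sq_int f"
  shows "f absolutely_integrable_on {0..1}"
  using sq_int_mult_absolutely_integrable[OF assms sq_int_continuous[of "\<lambda>_. 1"]] by simp

section \<open>Integration by parts and pointwise bounds on the unit interval\<close>

lemma absolutely_integrable_on_subinterval_01:
  fixes f :: "real \<Rightarrow> real"
  assumes "f absolutely_integrable_on {0..1}" "{a..b} \<subseteq> {0..1}"
  shows "f absolutely_integrable_on {a..b}"
  using assms by (meson absolutely_integrable_on_subinterval absolutely_integrable_on_subcbox interval_cbox
      set_integrable_subset sets_completionI_sets lborelD  lmeasurable_cbox fmeasurableD box_real(2) lmeasurable_interval(1))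

lemma FTC_subinterval_01:
  fixes G g :: "real \<Rightarrow> real"
  assumes G: "\<forall>x\<in>{0..1}. (G has_real_derivative g x) (at x within {0..1})"
    and "0 \<le> a" "a \<le> b" "b \<le> 1"
  shows "(g has_integral G b - G a) {a..b}"
proof (rule fundamental_theorem_of_calculus[OF assms(3)])
  fix x assume x: "x \<in> {a..b}"
  then have "(G has_real_derivative g x) (at x within {0..1})" using G assms by auto
  then have "(G has_real_derivative g x) (at x within {a..b})"
    by (rule DERIV_subset) (use assms in auto)
  then show "(G has_vector_derivative g x) (at x within {a..b})"
    by (simp add: has_real_derivative_iff_has_vector_derivative)
qed

lemma integral_diff_le_abs:
  fixes f :: "real \<Rightarrow> real"
  assumes "f absolutely_integrable_on {0..1}" "0 \<le> x" "x \<le> y" "y \<le> 1"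
  shows "integral {0..y} f - integral {0..x} f = integral {x..y} f"
    and "integral {x..y} (\<lambda>s. \<bar>f s\<bar>) = integral {0..y} (\<lambda>s. \<bar>f s\<bar>) - integral {0..x} (\<lambda>s. \<bar>f s\<bar>)"
proof -
  have i: "f integrable_on {0..y}" "(\<lambda>s. \<bar>f s\<bar>) integrable_on {0..y}"
    using absolutely_integrable_on_subinterval_01[OF assms(1), of 0 y] assms
    by (auto simp: absolutely_integrable_on_def)
  show "integral {0..y} f - integral {0..x} f = integral {x..y} f"
    using Henstock_Kurzweil_Integration.integral_combine[OF assms(2,3) i(1)] by linarith
  show "integral {x..y} (\<lambda>s. \<bar>f s\<bar>) = integral {0..y} (\<lambda>s. \<bar>f s\<bar>) - integral {0..x} (\<lambda>s. \<bar>f s\<bar>)"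
    using Henstock_Kurzweil_Integration.integral_combine[OF assms(2,3) i(2)] by linarith
qed

text \<open>The defect \<open>H\<close> of the product rule satisfies
  \<open>\<bar>H y - H x\<bar> \<le> 2 L \<bar>y - x\<bar> \<bar>A y - A x\<bar>\<close> with \<open>A\<close> the continuous primitive of \<open>\<bar>f\<bar>\<close>; hence
  its derivative vanishes everywhere and no differentiation theorem for Lebesgue integrals is needed.\<close>

lemma weak_integration_by_parts:
  fixes f F g G :: "real \<Rightarrow> real"
  assumes F: "\<forall>x\<in>{0..1}. F x = F 0 + integral {0..x} f" and f: "sq_int f"
    and G: "\<forall>x\<in>{0..1}. (G has_real_derivative g x) (at x within {0..1})"
    and g: "continuous_on {0..1} g"
  shows "integral {0..1} (\<lambda>x. f x * G x) = F 1 * G 1 - F 0 * G 0 - integral {0..1} (\<lambda>x. F x * g x)"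
proof -
  note af = sq_int_integrable[OF f]
  have fi: "f integrable_on {0..1}" and afi: "(\<lambda>x. \<bar>f x\<bar>) integrable_on {0..1}"
    using af by (auto simp: absolutely_integrable_on_def)
  define A where "A = (\<lambda>x. integral {0..x} (\<lambda>s. \<bar>f s\<bar>))"
  have Acont: "continuous_on {0..1} A"
    unfolding A_def by (rule indefinite_integral_continuous_1[OF afi])
  have Fcont: "continuous_on {0..1} F"
    using continuous_on_add[OF continuous_on_const indefinite_integral_continuous_1[OF fi], of "F 0"]
    by (rule continuous_on_eq) (rule F[rule_format, symmetric])
  have Gcont: "continuous_on {0..1} G"
    using G by (meson DERIV_continuous continuous_on_eq_continuous_within)
  obtain L where L: "L > 0" "\<And>x. x \<in> {0..1} \<Longrightarrow> \<bar>g x\<bar> \<le> L"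
    using continuous_on_01_bounded[OF g] by blast
  have GL: "\<bar>G x - G y\<bar> \<le> L * \<bar>x - y\<bar>" if "x \<in> {0..1}" "y \<in> {0..1}" for x y
    using field_differentiable_bound[of "{0..1}" G g L x y] G L that by auto
  define k where "k = (\<lambda>s. f s * G s + F s * g s)"
  have fG: "(\<lambda>s. f s * G s) integrable_on {0..1}"
    by (intro sq_int_mult_integrable f sq_int_continuous Gcont)
  have Fg: "(\<lambda>s. F s * g s) integrable_on {0..1}"
    by (intro integrable_continuous_interval continuous_intros Fcont g)
  have ki: "k integrable_on {0..1}"
    unfolding k_def by (intro integrable_add fG Fg)
  define H where "H = (\<lambda>y. integral {0..y} k - F y * G y)"
  have Hdiff: "\<bar>H y - H x\<bar> \<le> 2 * L * (y - x) * (A y - A x)" if xy: "0 \<le> x" "x \<le> y" "y \<le> 1" for x y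
  proof -
    have sub: "{x..y} \<subseteq> {0..1}" using xy by auto
    have i1: "f integrable_on {x..y}" "(\<lambda>s. f s * G s) integrable_on {x..y}"
      "(\<lambda>s. F s * g s) integrable_on {x..y}" "g integrable_on {x..y}"
      using integrable_on_subinterval[OF _ sub] fi fG Fg integrable_continuous_interval[OF g] by auto
    have Gint: "integral {x..y} g = G y - G x"
      by (rule integral_unique, rule FTC_subinterval_01[OF G xy])
    have fint: "integral {x..y} f = F y - F x"
      using F[rule_format, of x] F[rule_format, of y] xy integral_diff_le_abs(1)[OF af xy] by simp
    have "integral {0..y} k - integral {0..x} k = integral {x..y} k"
      using Henstock_Kurzweil_Integration.integral_combine[of 0 x y k] xy
        integrable_on_subinterval[OF ki, of 0 y] by auto
    then have "H y - H x = integral {x..y} k - F y * G y + F x * G x"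
      by (simp add: H_def)
    also have "integral {x..y} k = integral {x..y} (\<lambda>s. f s * G s) + integral {x..y} (\<lambda>s. F s * g s)"
      unfolding k_def by (intro integral_add i1)
    \<comment> \<open>The subtracted integrals equal \<open>(F y - F x) * G y\<close> and
      \<open>F x * (G y - G x)\<close>, which add up to \<open>F y * G y - F x * G x\<close>.
      Freezing \<open>G\<close> at the right end and \<open>F\<close> at the left end makes both
      remainders a product of two small increments.\<close>
    also have "\<dots> - F y * G y + F x * G x =
        (integral {x..y} (\<lambda>s. f s * G s) - integral {x..y} (\<lambda>s. f s * G y)) +
        (integral {x..y} (\<lambda>s. F s * g s) - integral {x..y} (\<lambda>s. F x * g s))"
    proof -
      have "integral {x..y} (\<lambda>s. f s * G y) = (F y - F x) * G y"
        "integral {x..y} (\<lambda>s. F x * g s) = F x * (G y - G x)"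
        unfolding fint[symmetric] Gint[symmetric] by simp_all
      then show ?thesis by (simp only: left_diff_distrib right_diff_distrib)
    qed
    also have "integral {x..y} (\<lambda>s. f s * G s) - integral {x..y} (\<lambda>s. f s * G y)
        = integral {x..y} (\<lambda>s. f s * G s - f s * G y)"
      by (intro integral_diff[symmetric] i1 integrable_on_mult_left)
    also have "integral {x..y} (\<lambda>s. F s * g s) - integral {x..y} (\<lambda>s. F x * g s)
        = integral {x..y} (\<lambda>s. F s * g s - F x * g s)"
      by (intro integral_diff[symmetric] i1 integrable_on_mult_right)
    finally have eq: "H y - H x = integral {x..y} (\<lambda>s. f s * G s - f s * G y)
        + integral {x..y} (\<lambda>s. F s * g s - F x * g s)" .
    have b1: "\<bar>integral {x..y} (\<lambda>s. f s * G s - f s * G y)\<bar>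
        \<le> integral {x..y} (\<lambda>s. L * (y - x) * \<bar>f s\<bar>)"
    proof (rule abs_integral_le_integral)
      show "(\<lambda>s. f s * G s - f s * G y) integrable_on {x..y}"
        by (intro integrable_diff i1 integrable_on_mult_left)
      show "(\<lambda>s. L * (y - x) * \<bar>f s\<bar>) integrable_on {x..y}"
        using integrable_on_subinterval[OF afi sub] by (intro integrable_on_mult_right) auto
      show "\<bar>f s * G s - f s * G y\<bar> \<le> L * (y - x) * \<bar>f s\<bar>" if "s \<in> {x..y}" for s
      proof -
        have "\<bar>G s - G y\<bar> \<le> L * \<bar>s - y\<bar>" using that xy by (intro GL) auto
        also have "\<dots> \<le> L * (y - x)" using that L by (intro mult_left_mono) auto
        finally have "\<bar>f s\<bar> * \<bar>G s - G y\<bar> \<le> \<bar>f s\<bar> * (L * (y - x))" by (intro mult_left_mono) auto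
        then show ?thesis by (simp add: abs_mult[symmetric] algebra_simps)
      qed
    qed
    have b2: "\<bar>integral {x..y} (\<lambda>s. F s * g s - F x * g s)\<bar>
        \<le> integral {x..y} (\<lambda>s. (A y - A x) * L)"
    proof (rule abs_integral_le_integral)
      show "(\<lambda>s. F s * g s - F x * g s) integrable_on {x..y}"
        by (intro integrable_diff i1 integrable_on_mult_right)
      show "\<bar>F s * g s - F x * g s\<bar> \<le> (A y - A x) * L" if s: "s \<in> {x..y}" for s
      proof -
        have "F s - F x = integral {x..s} f"
          using F[rule_format, of x] F[rule_format, of s] s xy integral_diff_le_abs(1)[OF af, of x s] by simp
        also have "\<bar>\<dots>\<bar> \<le> integral {x..s} (\<lambda>r. \<bar>f r\<bar>)"
          using s xy by (intro abs_integral_le_integral integrable_on_subinterval[OF fi]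
              integrable_on_subinterval[OF afi]) auto
        also have "\<dots> \<le> integral {x..y} (\<lambda>r. \<bar>f r\<bar>)"
          using s xy by (intro integral_subset_le integrable_on_subinterval[OF afi]) auto
        also have "\<dots> = A y - A x"
          using integral_diff_le_abs(2)[OF af xy] by (simp add: A_def)
        finally have "\<bar>F s - F x\<bar> * \<bar>g s\<bar> \<le> (A y - A x) * L"
          using L(2)[of s] s xy by (intro mult_mono) auto
        then show ?thesis by (simp add: abs_mult[symmetric] algebra_simps)
      qed
    qed auto
    have "integral {x..y} (\<lambda>s. L * (y - x) * \<bar>f s\<bar>) = L * (y - x) * (A y - A x)"
      using integral_diff_le_abs(2)[OF af xy] by (simp add: A_def)
    moreover have "integral {x..y} (\<lambda>s. (A y - A x) * L) = L * (y - x) * (A y - A x)"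
      using xy by simp
    ultimately show ?thesis
      using b1 b2 unfolding eq by linarith
  qed
  have Hdiff': "\<bar>H y - H x\<bar> \<le> 2 * L * \<bar>y - x\<bar> * \<bar>A y - A x\<bar>" if "x \<in> {0..1}" "y \<in> {0..1}" for x y
  proof (cases "x \<le> y")
    case True
    have "2 * L * (y - x) * (A y - A x) \<le> 2 * L * \<bar>y - x\<bar> * \<bar>A y - A x\<bar>"
      using L(1) True by (simp add: mult_left_mono)
    then show ?thesis using Hdiff[of x y] that True by auto
  next
    case False
    have "2 * L * (x - y) * (A x - A y) \<le> 2 * L * \<bar>y - x\<bar> * \<bar>A y - A x\<bar>"
      using L(1) False by (simp add: mult_left_mono)
    then show ?thesis using Hdiff[of y x] that False by auto
  qed
  have "(H has_field_derivative 0) (at x within {0..1})" if x: "x \<in> {0..1}" for x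
    unfolding has_field_derivative_iff
  proof (rule Lim_null_comparison)
    show "\<forall>\<^sub>F y in at x within {0..1}. norm ((H y - H x) / (y - x)) \<le> 2 * L * \<bar>A y - A x\<bar>"
      unfolding eventually_at_filter
    proof (rule always_eventually, intro allI impI)
      fix y assume y: "y \<noteq> x" "y \<in> {0..1}"
      then show "norm ((H y - H x) / (y - x)) \<le> 2 * L * \<bar>A y - A x\<bar>"
        using Hdiff'[OF x y(2)] by (simp add: divide_simps mult_ac)
    qed
    have "(A \<longlongrightarrow> A x) (at x within {0..1})"
      using Acont x by (auto simp: continuous_on_def)
    from tendsto_mult_left[OF tendsto_rabs[OF tendsto_diff[OF this tendsto_const[of "A x"]]], of "2 * L"]
    show "((\<lambda>y. 2 * L * \<bar>A y - A x\<bar>) \<longlongrightarrow> 0) (at x within {0..1})" by simp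
  qed
  then obtain c where "\<And>x. x \<in> {0..1} \<Longrightarrow> H x = c"
    using has_field_derivative_zero_constant[of "{0..1::real}" H] by auto
  then have "H 1 = H 0" by auto
  moreover have "integral {0..1} k = integral {0..1} (\<lambda>x. f x * G x) + integral {0..1} (\<lambda>x. F x * g x)"
    unfolding k_def by (intro integral_add fG Fg)
  ultimately show ?thesis by (simp add: H_def)
qed

lemma classical_integration_by_parts:
  fixes f F g G :: "real \<Rightarrow> real"
  assumes F: "\<forall>x\<in>{0..1}. (F has_real_derivative f x) (at x within {0..1})" and f: "continuous_on {0..1} f"
    and G: "\<forall>x\<in>{0..1}. (G has_real_derivative g x) (at x within {0..1})" and g: "continuous_on {0..1} g"
  shows "integral {0..1} (\<lambda>x. f x * G x) = F 1 * G 1 - F 0 * G 0 - integral {0..1} (\<lambda>x. F x * g x)"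
proof (rule weak_integration_by_parts[OF _ sq_int_continuous[OF f] G g])
  show "\<forall>x\<in>{0..1}. F x = F 0 + integral {0..x} f"
  proof
    fix x :: real assume x: "x \<in> {0..1}"
    have "(f has_integral F x - F 0) {0..x}"
      using x by (intro FTC_subinterval_01[OF F]) auto
    then show "F x = F 0 + integral {0..x} f" by (simp add: integral_unique)
  qed
qed

text \<open>A one-dimensional Agmon inequality. Since the derivative of \<open>g^2\<close> is
  \<open>2 * g * g'\<close>, the values \<open>(g x)^2\<close> and \<open>(g y)^2\<close> differ by
  at most \<open>2 * I\<close>, and averaging over \<open>y\<close> turns \<open>(g y)^2\<close>
  into \<open>nrm2 g\<close>. The geometric mean on the right is the source of the exponent 3/2 in
  the counting of fluxes.\<close>

lemma pointwise_square_bound: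
  fixes g g' :: "real \<Rightarrow> real"
  assumes g: "\<forall>x\<in>{0..1}. (g has_real_derivative g' x) (at x within {0..1})"
    and g': "continuous_on {0..1} g'" and x: "x \<in> {0..1}"
  shows "(g x)^2 \<le> nrm2 g + 2 * sqrt (nrm2 g * nrm2 g')"
proof -
  have gc: "continuous_on {0..1} g"
    using g by (meson DERIV_continuous continuous_on_eq_continuous_within)
  define I where "I = ip (\<lambda>x. \<bar>g x\<bar>) (\<lambda>x. \<bar>g' x\<bar>)"
  have int: "(\<lambda>s. \<bar>g s\<bar> * \<bar>g' s\<bar>) integrable_on {0..1}"
    by (intro integrable_continuous_interval continuous_intros gc g')
  have *: "\<bar>(g b)^2 - (g a)^2\<bar> \<le> 2 * I" if ab: "0 \<le> a" "a \<le> b" "b \<le> 1" for a b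
  proof -
    have sub: "{a..b} \<subseteq> {0..1}" using ab by auto
    have "((\<lambda>s. 2 * (g s * g' s)) has_integral (g b)^2 - (g a)^2) {a..b}"
    proof (rule FTC_subinterval_01[OF _ ab, of "\<lambda>s. (g s)^2"], rule ballI)
      fix s :: real assume s: "s \<in> {0..1}"
      show "((\<lambda>s. (g s)^2) has_real_derivative 2 * (g s * g' s)) (at s within {0..1})"
        using g s by (auto intro!: derivative_eq_intros)
    qed
    then have "\<bar>(g b)^2 - (g a)^2\<bar> = \<bar>integral {a..b} (\<lambda>s. 2 * (g s * g' s))\<bar>"
      by (simp only: integral_unique)
    also have "\<dots> \<le> integral {a..b} (\<lambda>s. 2 * (\<bar>g s\<bar> * \<bar>g' s\<bar>))"
    proof (rule abs_integral_le_integral)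
      show "(\<lambda>s. 2 * (g s * g' s)) integrable_on {a..b}"
        "(\<lambda>s. 2 * (\<bar>g s\<bar> * \<bar>g' s\<bar>)) integrable_on {a..b}"
        by (intro integrable_continuous_interval continuous_intros
          continuous_on_subset[OF gc sub] continuous_on_subset[OF g' sub])+
    qed (simp add: abs_mult)
    also have "\<dots> = 2 * integral {a..b} (\<lambda>s. \<bar>g s\<bar> * \<bar>g' s\<bar>)" by simp
    also have "\<dots> \<le> 2 * I"
      unfolding I_def ip_def
      by (intro mult_left_mono integral_subset_le sub int integrable_on_subinterval[OF int]) auto
    finally show ?thesis .
  qed
  have **: "(g x)^2 - 2 * I \<le> (g y)^2" if "y \<in> {0..1}" for y
    using *[of x y] *[of y x] x that by (cases "x \<le> y") auto
  have "integral {0..1::real} (\<lambda>y. (g x)^2 - 2 * I) \<le> integral {0..1} (\<lambda>y. (g y)^2)"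
    by (rule integral_le) (auto intro!: integrable_continuous_interval continuous_intros gc **)
  then have "(g x)^2 - 2 * I \<le> nrm2 g" by (simp add: nrm2_def)
  moreover have "I \<le> sqrt (nrm2 g * nrm2 g')"
  proof (rule real_le_rsqrt)
    have "I^2 \<le> nrm2 (\<lambda>x. \<bar>g x\<bar>) * nrm2 (\<lambda>x. \<bar>g' x\<bar>)"
      unfolding I_def by (intro ip_Cauchy_Schwarz sq_int_continuous continuous_intros gc g')
    then show "I^2 \<le> nrm2 g * nrm2 g'" by (simp add: nrm2_def)
  qed
  ultimately show ?thesis by linarith
qed

section \<open>Sturm--Liouville spectral estimates\<close>

lemma H2_continuous:
  assumes "H2 f f' f''"
  shows "continuous_on {0..1} f" "continuous_on {0..1} f'" "sq_int f''"
proof -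
  show "continuous_on {0..1} f"
    using assms unfolding H2_def by (meson DERIV_continuous continuous_on_eq_continuous_within)
  show s: "sq_int f''" using assms unfolding H2_def by blast
  have "f'' integrable_on {0..1}"
    using sq_int_integrable[OF s] by (simp add: absolutely_integrable_on_def)
  from continuous_on_add[OF continuous_on_const indefinite_integral_continuous_1[OF this], of "f' 0"]
  show "continuous_on {0..1} f'"
    by (rule continuous_on_eq) (use assms in \<open>unfold H2_def, metis\<close>)
qed

lemma derivative_unique_01:
  fixes f :: "real \<Rightarrow> real"
  assumes "(f has_real_derivative a) (at x within {0..1})" "(f has_real_derivative b) (at x within {0..1})"
    "x \<in> {0..1}"
  shows "a = b"
  using vector_derivative_unique_within_closed_interval[of 0 1 x f a b] assms
  by (simp add: has_real_derivative_iff_has_vector_derivative)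

lemma nrm2_le_of_pointwise:
  assumes "continuous_on {0..1} g" "\<And>x. x \<in> {0..1} \<Longrightarrow> (g x)^2 \<le> B"
  shows "nrm2 g \<le> B"
proof -
  have "nrm2 g \<le> integral {0..1::real} (\<lambda>x. B)"
    unfolding nrm2_def using assms
    by (intro integral_le) (auto intro!: integrable_continuous_interval continuous_intros)
  then show ?thesis by simp
qed

lemma nrm2_zero_imp_zero:
  assumes f: "continuous_on {0..1} f" and 0: "nrm2 f = 0" and x: "x \<in> {0..1}"
  shows "f x = 0"
proof -
  have "(\<lambda>x. (f x)^2) integrable_on {0..1}"
    by (intro integrable_continuous_interval continuous_intros f)
  then have "((\<lambda>x. (f x)^2) has_integral 0) (cbox 0 1)"
    using 0 by (simp add: nrm2_def has_integral_integral)
  then have "(f x)^2 = 0"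
    using has_integral_0_cbox_imp_0[of 0 1 "\<lambda>x. (f x)^2" x] x f
    by (auto intro!: continuous_intros)
  then show ?thesis by simp
qed

text \<open>A counting bound of order \<open>\<Lambda>\<^sup>3\<^sup>/\<^sup>2\<close> is summed over the dyadic shells
  \<open>2\<^sup>k\<^sup>-\<^sup>1 < lam n / lam 1 \<le> 2\<^sup>k\<close>.\<close>

lemma dyadic_sum_bound:
  fixes d lam :: "nat \<Rightarrow> real"
  assumes d: "\<And>n. d n \<ge> 0" and \<mu>: "0 < \<mu>" and lam: "\<And>n. n \<ge> 1 \<Longrightarrow> \<mu> \<le> lam n" and C: "C \<ge> 0"
    and cnt: "\<And>\<Lambda> I. finite I \<Longrightarrow> I \<subseteq> {1..} \<Longrightarrow> (\<forall>n\<in>I. lam n \<le> \<Lambda>) \<Longrightarrow> \<Lambda> > 0 \<Longrightarrow> (\<Sum>n\<in>I. d n) \<le> C * \<Lambda> powr s"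
    and \<epsilon>: "\<epsilon> > 0" and s: "s > 0"
  shows "\<exists>B. \<forall>I. finite I \<and> I \<subseteq> {1..} \<longrightarrow> (\<Sum>n\<in>I. d n / lam n powr (s + \<epsilon>)) \<le> B"
proof -
  define k where "k = (\<lambda>n. LEAST k::nat. lam n \<le> \<mu> * 2 ^ k)"
  have k: "lam n \<le> \<mu> * 2 ^ k n" "\<mu> / 2 * 2 ^ k n \<le> lam n" if "n \<ge> 1" for n
  proof -
    have "\<exists>k::nat. lam n \<le> \<mu> * 2 ^ k"
    proof -
      obtain j :: nat where "lam n / \<mu> < 2 ^ j"
        using real_arch_pow[of 2 "lam n / \<mu>"] by auto
      then show ?thesis using \<mu> by (auto simp: field_simps intro!: exI[of _ j])
    qed
    then show 1: "lam n \<le> \<mu> * 2 ^ k n" unfolding k_def by (rule LeastI_ex)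
    show "\<mu> / 2 * 2 ^ k n \<le> lam n"
    proof (cases "k n")
      case 0
      then show ?thesis using lam[OF that] \<mu> by simp
    next
      case (Suc j)
      then have "\<not> lam n \<le> \<mu> * 2 ^ j"
        using not_less_Least[of j "\<lambda>k. lam n \<le> \<mu> * 2 ^ k"] by (simp add: k_def)
      then show ?thesis using Suc by simp
    qed
  qed
  define r where "r = (2::real) powr (- \<epsilon>)"
  have r: "0 < r" "r < 1" using \<epsilon> by (auto simp: r_def powr_less_one)
  \<comment> \<open>On shell \<open>j\<close> the counting bound gives at most
    \<open>C * (\<mu> * 2^j) powr s\<close> and every weight is at most
    \<open>(\<mu>/2 * 2^j) powr (- (s + \<epsilon>))\<close>. In the product the powers of
    \<open>2^j\<close> leave \<open>r^j\<close> and \<open>D\<close> collects the rest;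
    \<open>\<epsilon>\<close> is what makes the geometric series converge.\<close>
  define D where "D = C * \<mu> powr s * (\<mu> / 2) powr (- (s + \<epsilon>))"
  have D: "D \<ge> 0" using C by (simp add: D_def)
  show ?thesis
  proof (intro exI[of _ "D / (1 - r)"] allI impI)
    fix I :: "nat set" assume I: "finite I \<and> I \<subseteq> {1..}"
    have shell: "(\<Sum>n\<in>{n\<in>I. k n = j}. d n / lam n powr (s + \<epsilon>)) \<le> D * r ^ j" for j
    proof -
      have "(\<Sum>n\<in>{n\<in>I. k n = j}. d n / lam n powr (s + \<epsilon>))
          \<le> (\<Sum>n\<in>{n\<in>I. k n = j}. d n * (\<mu> / 2 * 2 ^ j) powr (- (s + \<epsilon>)))"
      proof (rule sum_mono)
        fix n assume n: "n \<in> {n\<in>I. k n = j}"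
        then have "n \<ge> 1" using I by auto
        have "lam n powr (- (s + \<epsilon>)) \<le> (\<mu> / 2 * 2 ^ j) powr (- (s + \<epsilon>))"
          using k(2)[OF \<open>n \<ge> 1\<close>] n s \<epsilon> \<mu> by (intro powr_mono2') auto
        then have "d n * lam n powr (- (s + \<epsilon>)) \<le> d n * (\<mu> / 2 * 2 ^ j) powr (- (s + \<epsilon>))"
          by (intro mult_left_mono d)
        then show "d n / lam n powr (s + \<epsilon>) \<le> d n * (\<mu> / 2 * 2 ^ j) powr (- (s + \<epsilon>))"
          by (simp only: powr_minus_divide) simp
      qed
      also have "\<dots> = (\<Sum>n\<in>{n\<in>I. k n = j}. d n) * (\<mu> / 2 * 2 ^ j) powr (- (s + \<epsilon>))"
        by (simp add: sum_distrib_right)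
      also have "\<dots> \<le> (C * (\<mu> * 2 ^ j) powr s) * (\<mu> / 2 * 2 ^ j) powr (- (s + \<epsilon>))"
        using I k(1) \<mu> by (intro mult_right_mono cnt) auto
      also have "(\<mu> * 2 ^ j) powr s = \<mu> powr s * (2 powr j) powr s"
        using \<mu> by (simp add: powr_mult powr_realpow)
      also have "(\<mu> / 2 * 2 ^ j) powr (- (s + \<epsilon>)) = (\<mu> / 2) powr (- (s + \<epsilon>)) * (2 powr j) powr (- (s + \<epsilon>))"
        using \<mu> by (subst powr_mult) (auto simp: powr_realpow)
      also have "C * (\<mu> powr s * (2 powr j) powr s) * ((\<mu> / 2) powr (- (s + \<epsilon>)) * (2 powr j) powr (- (s + \<epsilon>)))
          = D * ((2 powr j) powr s * (2 powr j) powr (- (s + \<epsilon>)))"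
        by (simp add: D_def)
      also have "(2 powr j) powr s * (2 powr j) powr (- (s + \<epsilon>)) = (2::real) powr (real j * (- \<epsilon>))"
        by (simp add: powr_powr powr_add[symmetric] algebra_simps)
      also have "\<dots> = r ^ j"
        unfolding r_def by (simp add: powr_powr powr_realpow[symmetric] mult.commute)
      finally show ?thesis .
    qed
    have "(\<Sum>n\<in>I. d n / lam n powr (s + \<epsilon>)) =
        (\<Sum>j\<in>k ` I. \<Sum>n\<in>{n\<in>I. k n = j}. d n / lam n powr (s + \<epsilon>))"
      using I by (intro sum.image_gen) auto
    also have "\<dots> \<le> (\<Sum>j\<in>k ` I. D * r ^ j)" by (intro sum_mono shell)
    also have "\<dots> \<le> (\<Sum>j. D * r ^ j)"
      using I r D by (intro sum_le_suminf summable_mult summable_geometric) auto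
    also have "\<dots> = D / (1 - r)"
      using r by (simp add: suminf_mult suminf_geometric summable_geometric)
    finally show "(\<Sum>n\<in>I. d n / lam n powr (s + \<epsilon>)) \<le> D / (1 - r)" .
  qed
qed

lemma summable_tail_of_bounded_sums:
  fixes f :: "nat \<Rightarrow> real"
  assumes "\<And>n. f n \<ge> 0" "\<And>I. finite I \<Longrightarrow> I \<subseteq> {1..} \<Longrightarrow> sum f I \<le> B"
  shows "summable (\<lambda>n. if N + 1 \<le> n then f n else 0)"
proof (rule bounded_imp_summable)
  fix n
  show "(\<Sum>k\<le>n. if N + 1 \<le> k then f k else 0) \<le> B"
  proof -
    have "{..n} \<inter> {k. N + 1 \<le> k} \<subseteq> {1..}" by auto
    then show ?thesis using assms(2)[of "{..n} \<inter> {k. N + 1 \<le> k}"] by (simp add: sum.If_cases)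
  qed
qed (use assms in auto)

locale sturm_liouville =
  fixes \<theta>1 \<theta>2 qc :: real and p pd qt q :: "real \<Rightarrow> real"
    and lam :: "nat \<Rightarrow> real" and phi phid phidd :: "nat \<Rightarrow> real \<Rightarrow> real"
  assumes th1: "0 \<le> \<theta>1" "\<theta>1 < pi/2"
    and th2: "0 \<le> \<theta>2" "\<theta>2 \<le> pi/2"
    and p_deriv: "\<forall>x\<in>{0..1}. (p has_real_derivative pd x) (at x within {0..1})"
    and pd_cont: "continuous_on {0..1} pd"
    and p_pos: "\<forall>x\<in>{0..1}. p x > 0"
    and qt_cont: "continuous_on {0..1} qt"
    and q_cont: "continuous_on {0..1} q"
    and qt_q: "\<forall>x\<in>{0..1}. qt x = q x - qc"
    and q_pos: "\<forall>x\<in>{0..1}. q x > 0"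
    and SL: "SL_eigensystem p pd q \<theta>1 \<theta>2 lam phi phid phidd"
begin

definition Aop :: "(real \<Rightarrow> real) \<Rightarrow> (real \<Rightarrow> real) \<Rightarrow> (real \<Rightarrow> real) \<Rightarrow> real \<Rightarrow> real" where
  "Aop f f' f'' = (\<lambda>x. - (pd x * f' x + p x * f'' x) + q x * f x)"

lemma p_cont: "continuous_on {0..1} p"
  using p_deriv by (meson DERIV_continuous continuous_on_eq_continuous_within)

lemma cos_th1_pos: "cos \<theta>1 > 0" and sin_th1: "sin \<theta>1 \<ge> 0"
  using th1 by (auto intro!: cos_gt_zero_pi sin_ge_zero)

lemma cos_th2: "cos \<theta>2 \<ge> 0" and sin_th2: "sin \<theta>2 \<ge> 0"
  using th2 by (auto intro!: cos_ge_zero sin_ge_zero)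

lemma eig:
  assumes "n \<ge> 1"
  shows phi_deriv: "\<forall>x\<in>{0..1}. (phi n has_real_derivative phid n x) (at x within {0..1})"
    and phid_deriv: "\<forall>x\<in>{0..1}. (phid n has_real_derivative phidd n x) (at x within {0..1})"
    and phidd_cont: "continuous_on {0..1} (phidd n)"
    and phi_ode: "\<And>x. x \<in> {0..1} \<Longrightarrow> - (pd x * phid n x + p x * phidd n x) + q x * phi n x = lam n * phi n x"
    and phi_bc0: "cos \<theta>1 * phi n 0 - sin \<theta>1 * phid n 0 = 0"
    and phi_bc1: "cos \<theta>2 * phi n 1 + sin \<theta>2 * phid n 1 = 0"
  using SL assms unfolding SL_eigensystem_def by blast+

lemma phi_cont: "n \<ge> 1 \<Longrightarrow> continuous_on {0..1} (phi n)"
  and phid_cont: "n \<ge> 1 \<Longrightarrow> continuous_on {0..1} (phid n)"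
  using phi_deriv phid_deriv by (meson DERIV_continuous continuous_on_eq_continuous_within)+

lemma phi_orthonormal: "n \<ge> 1 \<Longrightarrow> m \<ge> 1 \<Longrightarrow> ip (phi n) (phi m) = (if n = m then 1 else 0)"
  using SL unfolding SL_eigensystem_def by blast

lemma phi_total: "sq_int f \<Longrightarrow> (\<And>n. n \<ge> 1 \<Longrightarrow> ip f (phi n) = 0) \<Longrightarrow> nrm2 f = 0"
  using SL unfolding SL_eigensystem_def by blast

lemma phi_sq_int: "n \<ge> 1 \<Longrightarrow> sq_int (phi n)"
  by (intro sq_int_continuous phi_cont)

lemma lam_mono:
  assumes "1 \<le> m" "m \<le> n" shows "lam m \<le> lam n"
  using assms(2,1)
proof (induction n rule: dec_induct)
  case (step n)
  have "\<forall>n\<ge>1. lam n < lam (Suc n)" using SL unfolding SL_eigensystem_def by blast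
  then have "lam n < lam (Suc n)" using step by auto
  then show ?case using step by linarith
qed simp

lemma lam1_pos: "lam 1 > 0"
  using SL unfolding SL_eigensystem_def by blast

lemma lam_pos: "n \<ge> 1 \<Longrightarrow> lam n > 0"
  using lam1_pos lam_mono[of 1 n] by linarith

lemma lam_at_top: "filterlim lam at_top sequentially"
  using SL unfolding SL_eigensystem_def by blast

abbreviation coef :: "(real \<Rightarrow> real) \<Rightarrow> nat \<Rightarrow> real" where
  "coef f n \<equiv> ip f (phi n)"

lemma Aop_sq_int: "H2 f f' f'' \<Longrightarrow> sq_int (Aop f f' f'')"
proof -
  assume H: "H2 f f' f''"
  note c = H2_continuous[OF H]
  have "sq_int (\<lambda>x. (q x * f x - pd x * f' x) - p x * f'' x)"
    by (intro sq_int_diff sq_int_continuous sq_int_mult_continuous continuous_intros c q_cont pd_cont p_cont)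
  then show ?thesis by (simp add: Aop_def algebra_simps)
qed

text \<open>Green's identity: two integrations by parts, the first one weak because
  \<open>f''\<close> is only square-integrable. The boundary terms at 0 cancel since
  \<open>f\<close> and the eigenfunction satisfy the same homogeneous condition; those at 1 leave
  the boundary value \<open>v\<close> with the factor \<open>betac\<close>. The boundary input
  enters the modal equations through this term.\<close>

lemma coef_Aop:
  assumes H: "H2 f f' f''" and bc0: "cos \<theta>1 * f 0 - sin \<theta>1 * f' 0 = 0"
    and bc1: "cos \<theta>2 * f 1 + sin \<theta>2 * f' 1 = v" and n: "n \<ge> 1"
  shows "coef (Aop f f' f'') n = lam n * coef f n - betac p \<theta>2 phi phid n * v"
proof -
  note c = H2_continuous[OF H]
  note pc = phi_cont[OF n] phid_cont[OF n] phidd_cont[OF n]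
  note cc = c(1,2) pc p_cont pd_cont q_cont
  have dG: "\<forall>x\<in>{0..1}. ((\<lambda>x. p x * phi n x) has_real_derivative (pd x * phi n x + p x * phid n x)) (at x within {0..1})"
    using p_deriv phi_deriv[OF n] by (auto intro!: derivative_eq_intros)
  have dG2: "\<forall>x\<in>{0..1}. ((\<lambda>x. p x * phid n x) has_real_derivative (pd x * phid n x + p x * phidd n x)) (at x within {0..1})"
    using p_deriv phid_deriv[OF n] by (auto intro!: derivative_eq_intros)
  have F: "\<forall>x\<in>{0..1}. f' x = f' 0 + integral {0..x} f''" and
    f: "\<forall>x\<in>{0..1}. (f has_real_derivative f' x) (at x within {0..1})"
    using H unfolding H2_def by blast+
  have I1: "integral {0..1} (\<lambda>x. f'' x * (p x * phi n x)) = f' 1 * (p 1 * phi n 1) - f' 0 * (p 0 * phi n 0)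
      - integral {0..1} (\<lambda>x. f' x * (pd x * phi n x + p x * phid n x))"
    by (rule weak_integration_by_parts[OF F c(3) dG]) (intro continuous_intros cc)
  have I2: "integral {0..1} (\<lambda>x. f' x * (p x * phid n x)) = f 1 * (p 1 * phid n 1) - f 0 * (p 0 * phid n 0)
      - integral {0..1} (\<lambda>x. f x * (pd x * phid n x + p x * phidd n x))"
    by (rule classical_integration_by_parts[OF f c(2) dG2]) (intro continuous_intros cc)
  have int: "(\<lambda>x. f'' x * (p x * phi n x)) integrable_on {0..1}"
    by (intro sq_int_mult_integrable c sq_int_continuous continuous_intros cc)
  have i1: "(\<lambda>x. f' x * (p x * phid n x)) integrable_on {0..1}"
    and i2: "(\<lambda>x. f' x * (pd x * phi n x)) integrable_on {0..1}"
    and i3: "(\<lambda>x. q x * f x * phi n x) integrable_on {0..1}"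
    and i4: "(\<lambda>x. f x * (pd x * phid n x + p x * phidd n x)) integrable_on {0..1}"
    by (intro integrable_continuous_interval continuous_intros cc)+
  have "coef (Aop f f' f'') n = integral {0..1} (\<lambda>x. q x * f x * phi n x - f' x * (pd x * phi n x) - f'' x * (p x * phi n x))"
    unfolding ip_def Aop_def by (rule arg_cong[where f = "integral {0..1}"]) (auto simp: algebra_simps)
  also have "\<dots> = integral {0..1} (\<lambda>x. q x * f x * phi n x) - integral {0..1} (\<lambda>x. f' x * (pd x * phi n x))
      - integral {0..1} (\<lambda>x. f'' x * (p x * phi n x))"
    by (simp add: integral_diff integrable_diff i3 i2 int)
  also have "integral {0..1} (\<lambda>x. f'' x * (p x * phi n x)) = f' 1 * (p 1 * phi n 1) - f' 0 * (p 0 * phi n 0)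
      - integral {0..1} (\<lambda>x. f' x * (pd x * phi n x)) - integral {0..1} (\<lambda>x. f' x * (p x * phid n x))"
    unfolding I1 distrib_left by (simp add: integral_add i1 i2)
  finally have E: "coef (Aop f f' f'') n = integral {0..1} (\<lambda>x. q x * f x * phi n x)
      - integral {0..1} (\<lambda>x. f x * (pd x * phid n x + p x * phidd n x))
      - f' 1 * (p 1 * phi n 1) + f' 0 * (p 0 * phi n 0) + f 1 * (p 1 * phid n 1) - f 0 * (p 0 * phid n 0)"
    using I2 by linarith
  have "integral {0..1} (\<lambda>x. q x * f x * phi n x)
      - integral {0..1} (\<lambda>x. f x * (pd x * phid n x + p x * phidd n x))
      = integral {0..1} (\<lambda>x. q x * f x * phi n x - f x * (pd x * phid n x + p x * phidd n x))"
    by (simp add: integral_diff i3 i4)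
  also have "\<dots> = integral {0..1} (\<lambda>x. lam n * (f x * phi n x))"
  proof (rule integral_cong)
    fix x :: real assume "x \<in> {0..1}"
    from phi_ode[OF n this]
    have "f x * (- (pd x * phid n x + p x * phidd n x) + q x * phi n x) = f x * (lam n * phi n x)" by simp
    then show "q x * f x * phi n x - f x * (pd x * phid n x + p x * phidd n x) = lam n * (f x * phi n x)"
      by (simp add: algebra_simps)
  qed
  also have "\<dots> = lam n * coef f n" by (simp add: ip_def)
  finally have E2: "coef (Aop f f' f'') n = lam n * coef f n + p 0 * (f' 0 * phi n 0 - f 0 * phid n 0)
      + p 1 * (f 1 * phid n 1 - f' 1 * phi n 1)"
    using E by (simp add: algebra_simps)
  have "f 0 = sin \<theta>1 / cos \<theta>1 * f' 0" "phi n 0 = sin \<theta>1 / cos \<theta>1 * phid n 0"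
    using bc0 phi_bc0[OF n] cos_th1_pos by (auto simp: field_simps)
  then have Z: "f' 0 * phi n 0 - f 0 * phid n 0 = 0" by simp
  have b: "sin \<theta>2 * phid n 1 = - cos \<theta>2 * phi n 1" using phi_bc1[OF n] by simp
  \<comment> \<open>Rotates the boundary data at 1: the Wronskian is expressed through the boundary
    functional of \<open>f\<close>, which is \<open>v\<close>, and that of the eigenfunction, which
    is 0. No division by the sine or cosine of \<open>\<theta>2\<close> occurs; either of them may
    vanish.\<close>
  have alg: "(s^2 + c^2) * (a * y - b * x) = - (- c * y + s * x) * (c * a + s * b)
      + (s * a - c * b) * (s * y + c * x)" for s c a b x y :: real
    by (simp add: algebra_simps power2_eq_square)
  have "f 1 * phid n 1 - f' 1 * phi n 1 = ((sin \<theta>2)^2 + (cos \<theta>2)^2) * (f 1 * phid n 1 - f' 1 * phi n 1)" by simp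
  also have "\<dots> = - (- cos \<theta>2 * phid n 1 + sin \<theta>2 * phi n 1) * v
     + (sin \<theta>2 * f 1 - cos \<theta>2 * f' 1) * (sin \<theta>2 * phid n 1 + cos \<theta>2 * phi n 1)"
    unfolding bc1[symmetric] by (rule alg)
  also have "sin \<theta>2 * phid n 1 + cos \<theta>2 * phi n 1 = 0" using b by simp
  finally have D: "f 1 * phid n 1 - f' 1 * phi n 1 = - (- cos \<theta>2 * phid n 1 + sin \<theta>2 * phi n 1) * v" by simp
  show ?thesis unfolding E2 Z D betac_def by (simp add: algebra_simps)
qed

lemma bessel:
  assumes f: "sq_int f" and I: "finite I" "I \<subseteq> {1..}"
  shows "(\<Sum>n\<in>I. (coef f n)^2) \<le> nrm2 f"
proof -
  define g where "g = (\<lambda>x. \<Sum>n\<in>I. coef f n * phi n x)"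
  have s: "sq_int (\<lambda>x. coef f n * phi n x)" if "n \<in> I" for n
    using that I by (intro sq_int_cmult phi_sq_int) auto
  have g: "sq_int g" unfolding g_def by (intro sq_int_sum s)
  have fg: "ip g f = (\<Sum>n\<in>I. (coef f n)^2)"
    unfolding g_def using I f s by (simp add: ip_sum ip_cmult ip_commute[of "phi _" f] power2_eq_square)
  have gphi: "ip g (phi m) = coef f m" if "m \<in> I" for m
  proof -
    have "ip g (phi m) = (\<Sum>n\<in>I. coef f n * ip (phi n) (phi m))"
      unfolding g_def using I s that phi_sq_int[of m] by (subst ip_sum) (auto simp: ip_cmult)
    also have "\<dots> = (\<Sum>n\<in>I. if n = m then coef f n else 0)"
      using I that by (intro sum.cong) (auto simp: phi_orthonormal subset_iff)
    also have "\<dots> = coef f m" using I that by simp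
    finally show ?thesis .
  qed
  have "nrm2 g = ip g g" by (rule nrm2_eq_ip)
  also have "\<dots> = (\<Sum>n\<in>I. coef f n * ip (phi n) g)"
    by (subst (1) g_def) (simp add: ip_sum ip_cmult I s g)
  also have "\<dots> = (\<Sum>n\<in>I. (coef f n)^2)"
    by (intro sum.cong) (auto simp: gphi ip_commute[of "phi _" g] power2_eq_square)
  finally have gg: "nrm2 g = (\<Sum>n\<in>I. (coef f n)^2)" .
  have "0 \<le> nrm2 (\<lambda>x. f x + (-1) * g x)" by (rule nrm2_nonneg)
  also have "\<dots> = nrm2 f + 2 * ip f (\<lambda>x. (-1) * g x) + nrm2 (\<lambda>x. (-1) * g x)"
    by (intro nrm2_add f sq_int_cmult g)
  also have "ip f (\<lambda>x. (-1) * g x) = - ip g f"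
    by (subst ip_commute, subst ip_cmult) simp
  also have "nrm2 (\<lambda>x. (-1) * g x) = nrm2 g"
    by (subst nrm2_cmult) simp
  finally show ?thesis unfolding gg fg by linarith
qed

lemma summable_coef_square:
  assumes "sq_int f"
  shows "summable (\<lambda>n. if N + 1 \<le> n then (coef f n)^2 else 0)"
  by (rule summable_tail_of_bounded_sums[of _ "nrm2 f"]) (use bessel[OF assms] in auto)

section \<open>Finite combinations of eigenfunctions: energy and flux estimates\<close>

definition comb :: "(nat \<Rightarrow> real) \<Rightarrow> nat set \<Rightarrow> real \<Rightarrow> real" where
  "comb a I x = (\<Sum>n\<in>I. a n * phi n x)"
definition combd :: "(nat \<Rightarrow> real) \<Rightarrow> nat set \<Rightarrow> real \<Rightarrow> real" where
  "combd a I x = (\<Sum>n\<in>I. a n * phid n x)"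
definition combdd :: "(nat \<Rightarrow> real) \<Rightarrow> nat set \<Rightarrow> real \<Rightarrow> real" where
  "combdd a I x = (\<Sum>n\<in>I. a n * phidd n x)"

lemma comb_deriv:
  assumes "I \<subseteq> {1..}"
  shows "\<forall>x\<in>{0..1}. (comb a I has_real_derivative combd a I x) (at x within {0..1})"
    and "\<forall>x\<in>{0..1}. (combd a I has_real_derivative combdd a I x) (at x within {0..1})"
  using assms phi_deriv phid_deriv unfolding comb_def combd_def combdd_def
  by (auto intro!: DERIV_sum DERIV_cmult)

lemma comb_cont:
  assumes "I \<subseteq> {1..}"
  shows "continuous_on {0..1} (comb a I)" "continuous_on {0..1} (combd a I)" "continuous_on {0..1} (combdd a I)"
  using assms phi_cont phid_cont phidd_cont unfolding comb_def combd_def combdd_def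
  by (auto intro!: continuous_intros)

lemma ip_comb:
  assumes "finite I" "I \<subseteq> {1..}"
  shows "ip (comb a I) (comb b I) = (\<Sum>n\<in>I. a n * b n)"
proof -
  have s: "sq_int (\<lambda>x. c n * phi n x)" if "n \<in> I" for n c
    using that assms by (intro sq_int_cmult phi_sq_int) auto
  have m: "ip (comb b I) (phi m) = b m" if "m \<in> I" for m
  proof -
    have "ip (comb b I) (phi m) = (\<Sum>n\<in>I. b n * ip (phi n) (phi m))"
      unfolding comb_def using assms s that phi_sq_int[of m] by (subst ip_sum) (auto simp: ip_cmult)
    also have "\<dots> = (\<Sum>n\<in>I. if n = m then b n else 0)"
      using assms that by (intro sum.cong) (auto simp: phi_orthonormal subset_iff)
    also have "\<dots> = b m" using assms that by simp
    finally show ?thesis .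
  qed
  have "ip (comb a I) (comb b I) = (\<Sum>n\<in>I. a n * ip (phi n) (comb b I))"
    using sq_int_continuous[OF comb_cont(1)[OF assms(2)], of b]
    by (subst (1) comb_def[abs_def]) (simp add: ip_sum ip_cmult assms s)
  also have "\<dots> = (\<Sum>n\<in>I. a n * b n)"
    by (intro sum.cong) (auto simp: m ip_commute[of "phi _"])
  finally show ?thesis .
qed

lemma Aop_comb:
  assumes "I \<subseteq> {1..}" "x \<in> {0..1}"
  shows "Aop (comb a I) (combd a I) (combdd a I) x = comb (\<lambda>n. lam n * a n) I x"
proof -
  have "Aop (comb a I) (combd a I) (combdd a I) x
      = (\<Sum>n\<in>I. a n * (- (pd x * phid n x + p x * phidd n x) + q x * phi n x))"
    unfolding Aop_def comb_def combd_def combdd_def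
    by (simp add: sum_distrib_left sum.distrib sum_subtractf sum_negf algebra_simps)
  also have "\<dots> = (\<Sum>n\<in>I. a n * (lam n * phi n x))"
  proof (rule sum.cong)
    fix n assume "n \<in> I"
    then have "n \<ge> 1" using assms(1) by auto
    from phi_ode[OF this assms(2)]
    show "a n * (- (pd x * phid n x + p x * phidd n x) + q x * phi n x) = a n * (lam n * phi n x)" by simp
  qed simp
  finally show ?thesis by (simp add: comb_def mult_ac)
qed

text \<open>The admissible angles make the boundary coefficients nonnegative, so both boundary terms
  of the energy identity have the favourable sign. At 1 a case split is made because for
  \<open>\<theta>2 = pi/2\<close> the value \<open>f1\<close> is not determined by the slope; the
  slope is then 0.\<close>

lemma boundary_term_nonneg:
  assumes "cos \<theta>1 * f0 - sin \<theta>1 * d0 = 0" "cos \<theta>2 * f1 + sin \<theta>2 * d1 = 0"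
  shows "d0 * f0 \<ge> 0" "d1 * f1 \<le> 0"
proof -
  have "f0 = sin \<theta>1 / cos \<theta>1 * d0"
    using assms(1) cos_th1_pos by (auto simp: field_simps)
  then have "d0 * f0 = sin \<theta>1 / cos \<theta>1 * (d0 * d0)" by simp
  also have "\<dots> \<ge> 0" using sin_th1 cos_th1_pos by simp
  finally show "d0 * f0 \<ge> 0" .
  show "d1 * f1 \<le> 0"
  proof (cases "cos \<theta>2 = 0")
    case True
    then have "sin \<theta>2 \<noteq> 0" using sin_cos_squared_add[of \<theta>2] by auto
    then show ?thesis using True assms by simp
  next
    case False
    then have "f1 = - (sin \<theta>2 / cos \<theta>2 * d1)" using assms(2) by (simp add: field_simps)
    then have "d1 * f1 = - (sin \<theta>2 / cos \<theta>2 * (d1 * d1))" by simp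
    also have "\<dots> \<le> 0" using sin_th2 cos_th2 by simp
    finally show ?thesis .
  qed
qed

text \<open>Pairing the operator with the combination itself and integrating by parts gives the
  weighted integrals of \<open>f^2\<close> and \<open>f'^2\<close> plus nonnegative boundary terms.
  The lower bounds on \<open>p\<close> and \<open>q\<close> turn this into coercivity in
  \<open>H^1\<close>.\<close>

lemma comb_energy:
  assumes I: "finite I" "I \<subseteq> {1..}" and m: "m > 0" "\<And>x. x \<in> {0..1} \<Longrightarrow> m \<le> p x" "\<And>x. x \<in> {0..1} \<Longrightarrow> m \<le> q x"
  shows "m * (nrm2 (comb a I) + nrm2 (combd a I)) \<le> (\<Sum>n\<in>I. lam n * (a n)^2)"
proof -
  define f f' f'' where "f = comb a I" and "f' = combd a I" and "f'' = combdd a I"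
  note d = comb_deriv[OF I(2), of a, folded f_def f'_def f''_def]
  note c = comb_cont[OF I(2), of a, folded f_def f'_def f''_def]
  have "(\<Sum>n\<in>I. lam n * (a n)^2) = ip (comb (\<lambda>n. lam n * a n) I) f"
    unfolding f_def ip_comb[OF I] by (simp add: power2_eq_square mult_ac)
  also have "\<dots> = ip (Aop f f' f'') f"
    unfolding f_def f'_def f''_def by (intro ip_cong Aop_comb[symmetric] I)
  also have "\<dots> = integral {0..1} (\<lambda>x. q x * (f x)^2 - (pd x * f' x + p x * f'' x) * f x)"
    unfolding ip_def Aop_def by (rule arg_cong[where f = "integral {0..1}"]) (auto simp: algebra_simps power2_eq_square)
  also have "\<dots> = integral {0..1} (\<lambda>x. q x * (f x)^2) - integral {0..1} (\<lambda>x. (pd x * f' x + p x * f'' x) * f x)"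
    by (intro integral_diff integrable_continuous_interval continuous_intros c q_cont pd_cont p_cont)
  also have "integral {0..1} (\<lambda>x. (pd x * f' x + p x * f'' x) * f x)
      = p 1 * f' 1 * f 1 - p 0 * f' 0 * f 0 - integral {0..1} (\<lambda>x. (p x * f' x) * f' x)"
  proof (rule classical_integration_by_parts)
    show "\<forall>x\<in>{0..1}. ((\<lambda>x. p x * f' x) has_real_derivative pd x * f' x + p x * f'' x) (at x within {0..1})"
      using d p_deriv by (auto intro!: derivative_eq_intros)
  qed (intro d c continuous_intros p_cont pd_cont)+
  finally have E: "(\<Sum>n\<in>I. lam n * (a n)^2) = integral {0..1} (\<lambda>x. q x * (f x)^2)
      + integral {0..1} (\<lambda>x. (p x * f' x) * f' x) + p 0 * (f' 0 * f 0) - p 1 * (f' 1 * f 1)"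
    by (simp add: algebra_simps)
  have bc: "cos \<theta>1 * f 0 - sin \<theta>1 * f' 0 = 0" "cos \<theta>2 * f 1 + sin \<theta>2 * f' 1 = 0"
  proof -
    have "cos \<theta>1 * f 0 - sin \<theta>1 * f' 0 = (\<Sum>n\<in>I. a n * (cos \<theta>1 * phi n 0 - sin \<theta>1 * phid n 0))"
      unfolding f_def f'_def comb_def combd_def by (simp add: sum_distrib_left sum_subtractf algebra_simps)
    also have "\<dots> = 0" using I phi_bc0 by (intro sum.neutral) (auto simp: subset_iff)
    finally show "cos \<theta>1 * f 0 - sin \<theta>1 * f' 0 = 0" .
    have "cos \<theta>2 * f 1 + sin \<theta>2 * f' 1 = (\<Sum>n\<in>I. a n * (cos \<theta>2 * phi n 1 + sin \<theta>2 * phid n 1))"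
      unfolding f_def f'_def comb_def combd_def by (simp add: sum_distrib_left sum.distrib algebra_simps)
    also have "\<dots> = 0" using I phi_bc1 by (intro sum.neutral) (auto simp: subset_iff)
    finally show "cos \<theta>2 * f 1 + sin \<theta>2 * f' 1 = 0" .
  qed
  have "p 0 * (f' 0 * f 0) \<ge> 0" "p 1 * (f' 1 * f 1) \<le> 0"
    using boundary_term_nonneg[OF bc] p_pos[rule_format, of 0] p_pos[rule_format, of 1]
    by (auto intro: mult_nonneg_nonneg mult_nonneg_nonpos)
  moreover have "integral {0..1} (\<lambda>x. m * (f x)^2) \<le> integral {0..1} (\<lambda>x. q x * (f x)^2)"
    by (intro integral_le integrable_continuous_interval continuous_intros c q_cont mult_right_mono m) auto
  moreover have "integral {0..1} (\<lambda>x. m * (f' x)^2) \<le> integral {0..1} (\<lambda>x. (p x * f' x) * f' x)"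
    unfolding power2_eq_square mult.assoc[symmetric]
    using m(2) by (intro integral_le integrable_continuous_interval continuous_intros c p_cont)
      (auto simp: mult.assoc intro!: mult_right_mono)
  ultimately show ?thesis
    unfolding E by (simp add: nrm2_def f_def f'_def distrib_left)
qed

lemma comb_H1_bound:
  obtains C where "C > 0" "\<And>a I. finite I \<Longrightarrow> I \<subseteq> {1..} \<Longrightarrow>
    nrm2 (comb a I) + nrm2 (combd a I) \<le> C * (\<Sum>n\<in>I. lam n * (a n)^2)"
proof -
  obtain m1 where m1: "m1 > 0" "\<And>x. x \<in> {0..1} \<Longrightarrow> m1 \<le> p x"
    using continuous_on_01_lower_bound[OF p_cont p_pos] by blast
  obtain m2 where m2: "m2 > 0" "\<And>x. x \<in> {0..1} \<Longrightarrow> m2 \<le> q x"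
    using continuous_on_01_lower_bound[OF q_cont q_pos] by blast
  define m where "m = min m1 m2"
  have m: "m > 0" "\<And>x. x \<in> {0..1} \<Longrightarrow> m \<le> p x" "\<And>x. x \<in> {0..1} \<Longrightarrow> m \<le> q x"
    using m1 m2 by (auto simp: m_def min_le_iff_disj)
  show thesis
  proof (rule that[of "1 / m"])
    fix a I assume "finite I" "I \<subseteq> {1::nat..}"
    from comb_energy[OF this m, of a]
    show "nrm2 (comb a I) + nrm2 (combd a I) \<le> 1 / m * (\<Sum>n\<in>I. lam n * (a n)^2)"
      using m by (simp add: field_simps)
  qed (use m in simp)
qed

lemma sum_lam_le:
  assumes "I \<subseteq> {1..}"
  shows "(\<Sum>n\<in>I. lam n * (a n)^2) \<le> (\<Sum>n\<in>I. (lam n)^2 * (a n)^2) / lam 1"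
    and "(\<Sum>n\<in>I. (a n)^2) \<le> (\<Sum>n\<in>I. (lam n)^2 * (a n)^2) / (lam 1)^2"
proof -
  have l: "lam 1 \<le> lam n" "lam n > 0" if "n \<in> I" for n
    using that assms lam_mono[of 1 n] lam_pos by (auto simp: subset_iff)
  have "lam n * (a n)^2 \<le> (lam n)^2 * (a n)^2 / lam 1" if "n \<in> I" for n
    using mult_right_mono[OF mult_left_mono[OF l(1)[OF that], of "lam n"], of "(a n)^2"] l(2)[OF that] lam1_pos
    by (simp add: field_simps power2_eq_square)
  from sum_mono[OF this] show "(\<Sum>n\<in>I. lam n * (a n)^2) \<le> (\<Sum>n\<in>I. (lam n)^2 * (a n)^2) / lam 1"
    by (simp add: sum_divide_distrib)
  have "(a n)^2 \<le> (lam n)^2 * (a n)^2 / (lam 1)^2" if "n \<in> I" for n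
    using mult_right_mono[OF power_mono[OF l(1)[OF that], of 2], of "(a n)^2"] lam1_pos
    by (simp add: field_simps)
  from sum_mono[OF this] show "(\<Sum>n\<in>I. (a n)^2) \<le> (\<Sum>n\<in>I. (lam n)^2 * (a n)^2) / (lam 1)^2"
    by (simp add: sum_divide_distrib)
qed

text \<open>The pointwise bound is applied to \<open>p * f'\<close> and not to \<open>f'\<close>:
  its derivative is \<open>q * f\<close> minus the operator applied to \<open>f\<close>, whose norm
  is controlled by the sum with \<open>(lam n)^2\<close> without a separate estimate of the second
  derivative. The result is the geometric mean of the energy and the squared operator norm.\<close>

lemma comb_flux_bound:
  obtains C where "C > 0" "\<And>a I x. finite I \<Longrightarrow> I \<subseteq> {1..} \<Longrightarrow> x \<in> {0..1} \<Longrightarrow>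
     (combd a I x)^2 \<le> C * sqrt ((\<Sum>n\<in>I. lam n * (a n)^2) * (\<Sum>n\<in>I. (lam n)^2 * (a n)^2))"
proof -
  obtain C0 where C0: "C0 > 0" "\<And>a I. finite I \<Longrightarrow> I \<subseteq> {1..} \<Longrightarrow>
      nrm2 (comb a I) + nrm2 (combd a I) \<le> C0 * (\<Sum>n\<in>I. lam n * (a n)^2)"
    by (rule comb_H1_bound, rule that) blast+
  obtain P where P: "P > 0" "\<And>x. x \<in> {0..1} \<Longrightarrow> \<bar>p x\<bar> \<le> P"
    using continuous_on_01_bounded[OF p_cont] by blast
  obtain Q where Q: "Q > 0" "\<And>x. x \<in> {0..1} \<Longrightarrow> \<bar>q x\<bar> \<le> Q"
    using continuous_on_01_bounded[OF q_cont] by blast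
  obtain m where m: "m > 0" "\<And>x. x \<in> {0..1} \<Longrightarrow> m \<le> p x"
    using continuous_on_01_lower_bound[OF p_cont p_pos] by blast
  define C1 where "C1 = P^2 * C0"
  define C2 where "C2 = 2 * Q^2 / (lam 1)^2 + 2"
  define C where "C = (C1 / sqrt (lam 1) + 2 * sqrt (C1 * C2)) / m^2"
  have C12: "C1 > 0" "C2 > 0" using P C0 Q lam1_pos by (auto simp: C1_def C2_def intro!: add_nonneg_pos)
  have "C > 0" using C12 lam1_pos m by (auto simp: C_def intro!: divide_pos_pos add_pos_pos)
  moreover have "(combd a I x)^2 \<le> C * sqrt ((\<Sum>n\<in>I. lam n * (a n)^2) * (\<Sum>n\<in>I. (lam n)^2 * (a n)^2))"
    if I: "finite I" "I \<subseteq> {1..}" and x: "x \<in> {0..1}" for a I x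
  proof -
    define S1 where "S1 = (\<Sum>n\<in>I. lam n * (a n)^2)"
    define S2 where "S2 = (\<Sum>n\<in>I. (lam n)^2 * (a n)^2)"
    have S1: "S1 \<ge> 0" unfolding S1_def using I lam_pos by (intro sum_nonneg) (auto simp: subset_iff less_imp_le)
    have S2: "S2 \<ge> 0" unfolding S2_def by (intro sum_nonneg) auto
    define f f' f'' where "f = comb a I" and "f' = combd a I" and "f'' = combdd a I"
    note d = comb_deriv[OF I(2), of a, folded f_def f'_def f''_def]
    note c = comb_cont[OF I(2), of a, folded f_def f'_def f''_def]
    define g where "g = (\<lambda>x. p x * f' x)"
    define g' where "g' = (\<lambda>x. pd x * f' x + p x * f'' x)"
    have "nrm2 g \<le> P^2 * nrm2 f'"
      unfolding g_def by (intro nrm2_mult_le sq_int_continuous c p_cont P)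
    also have "\<dots> \<le> P^2 * (C0 * S1)"
    proof (rule mult_left_mono)
      show "nrm2 f' \<le> C0 * S1"
        using C0(2)[OF I, of a] nrm2_nonneg[of f] unfolding f_def f'_def S1_def by linarith
    qed simp
    finally have ng: "nrm2 g \<le> C1 * S1" by (simp add: C1_def)
    have "nrm2 g' = nrm2 (\<lambda>x. q x * f x + (-1) * comb (\<lambda>n. lam n * a n) I x)"
    proof (rule nrm2_cong)
      fix x :: real assume "x \<in> {0..1}"
      from Aop_comb[OF I(2) this, of a]
      show "g' x = q x * f x + (-1) * comb (\<lambda>n. lam n * a n) I x"
        by (simp add: g'_def f_def f'_def f''_def Aop_def)
    qed
    also have "\<dots> \<le> 2 * nrm2 (\<lambda>x. q x * f x) + 2 * nrm2 (\<lambda>x. (-1) * comb (\<lambda>n. lam n * a n) I x)"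
      by (intro nrm2_add_le sq_int_continuous continuous_intros c q_cont comb_cont I)
    also have "nrm2 (\<lambda>x. (-1) * comb (\<lambda>n. lam n * a n) I x) = S2"
      by (subst nrm2_cmult) (simp add: nrm2_eq_ip ip_comb[OF I] S2_def power2_eq_square mult_ac)
    finally have 1: "nrm2 g' \<le> 2 * nrm2 (\<lambda>x. q x * f x) + 2 * S2" .
    have "nrm2 (\<lambda>x. q x * f x) \<le> Q^2 * nrm2 f"
      by (intro nrm2_mult_le sq_int_continuous c q_cont Q)
    also have "\<dots> \<le> Q^2 * (S2 / (lam 1)^2)"
      using sum_lam_le(2)[OF I(2), of a] unfolding f_def nrm2_eq_ip ip_comb[OF I] S2_def
      by (intro mult_left_mono) (simp_all add: power2_eq_square)
    finally have "nrm2 (\<lambda>x. q x * f x) \<le> Q^2 * (S2 / (lam 1)^2)" .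
    have ng': "nrm2 g' \<le> C2 * S2"
    proof -
      have "C2 * S2 = 2 * (Q^2 * (S2 / (lam 1)^2)) + 2 * S2" by (simp add: C2_def algebra_simps)
      then show ?thesis using 1 \<open>nrm2 (\<lambda>x. q x * f x) \<le> Q^2 * (S2 / (lam 1)^2)\<close> by linarith
    qed
    have "(g x)^2 \<le> nrm2 g + 2 * sqrt (nrm2 g * nrm2 g')"
    proof (rule pointwise_square_bound[OF _ _ x])
      show "\<forall>x\<in>{0..1}. (g has_real_derivative g' x) (at x within {0..1})"
        unfolding g_def g'_def using d p_deriv by (auto intro!: derivative_eq_intros)
      show "continuous_on {0..1} g'"
        unfolding g'_def by (intro continuous_intros c p_cont pd_cont)
    qed
    also have "nrm2 g * nrm2 g' \<le> (C1 * S1) * (C2 * S2)"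
      using ng ng' S1 C12 by (intro mult_mono) auto
    also have "nrm2 g \<le> C1 * S1" by (rule ng)
    finally have "(g x)^2 \<le> C1 * S1 + 2 * sqrt ((C1 * S1) * (C2 * S2))" by simp
    also have "sqrt ((C1 * S1) * (C2 * S2)) = sqrt (C1 * C2) * sqrt (S1 * S2)"
      by (simp add: real_sqrt_mult mult_ac)
    finally have 2: "(g x)^2 \<le> C1 * S1 + 2 * (sqrt (C1 * C2) * sqrt (S1 * S2))" .
    \<comment> \<open>Since \<open>S1 \<le> S2 / lam 1\<close>, the pure energy term is also bounded
      by the geometric mean, so a single constant covers both terms.\<close>
    have "S1 \<le> sqrt (S1 * S2) / sqrt (lam 1)"
    proof -
      have "S1 * S1 \<le> S1 * (S2 / lam 1)"
        using sum_lam_le(1)[OF I(2), of a] S1 unfolding S1_def S2_def by (intro mult_left_mono) auto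
      then have "sqrt (S1 * S1) \<le> sqrt (S1 * S2 / lam 1)" by (intro real_sqrt_le_mono) simp
      then show ?thesis using S1 by (simp add: real_sqrt_divide)
    qed
    then have "C1 * S1 \<le> C1 * (sqrt (S1 * S2) / sqrt (lam 1))"
      using C12 by (intro mult_left_mono) auto
    with 2 have "(g x)^2 \<le> C1 * (sqrt (S1 * S2) / sqrt (lam 1)) + 2 * (sqrt (C1 * C2) * sqrt (S1 * S2))"
      by linarith
    also have "\<dots> = m^2 * C * sqrt (S1 * S2)"
    proof -
      have "m^2 * C = C1 / sqrt (lam 1) + 2 * sqrt (C1 * C2)" using m by (simp add: C_def)
      then show ?thesis by (simp add: algebra_simps)
    qed
    finally have gx: "(g x)^2 \<le> m^2 * C * sqrt (S1 * S2)" .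
    have "m^2 * (f' x)^2 \<le> (g x)^2"
      using m(1) m(2)[OF x] unfolding g_def power_mult_distrib by (intro mult_right_mono power_mono) auto
    with gx have "m^2 * (f' x)^2 \<le> m^2 * (C * sqrt (S1 * S2))" by simp
    then show ?thesis using m(1) unfolding S1_def S2_def f'_def by simp
  qed
  ultimately show thesis by (rule that)
qed

text \<open>The right-hand side is a multiple of the squared norm of the operator applied to the
  combination, because \<open>S1 \<le> S2 / lam 1\<close> removes the energy from the earlier
  estimates. Convergence in the graph norm therefore forces convergence in
  \<open>C^1\<close>.\<close>

lemma comb_pointwise_bounds:
  obtains C where "C > 0" "\<And>a I x. finite I \<Longrightarrow> I \<subseteq> {1..} \<Longrightarrow> x \<in> {0..1} \<Longrightarrow>
     (comb a I x)^2 \<le> C * (\<Sum>n\<in>I. (lam n)^2 * (a n)^2) \<and> (combd a I x)^2 \<le> C * (\<Sum>n\<in>I. (lam n)^2 * (a n)^2)"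
proof -
  obtain C0 where C0: "C0 > 0" "\<And>a I. finite I \<Longrightarrow> I \<subseteq> {1..} \<Longrightarrow>
      nrm2 (comb a I) + nrm2 (combd a I) \<le> C0 * (\<Sum>n\<in>I. lam n * (a n)^2)"
    by (rule comb_H1_bound, rule that) blast+
  obtain C1 where C1: "C1 > 0" "\<And>a I x. finite I \<Longrightarrow> I \<subseteq> {1..} \<Longrightarrow> x \<in> {0..1} \<Longrightarrow>
     (combd a I x)^2 \<le> C1 * sqrt ((\<Sum>n\<in>I. lam n * (a n)^2) * (\<Sum>n\<in>I. (lam n)^2 * (a n)^2))"
    by (rule comb_flux_bound, rule that) blast+
  define C where "C = 2 * C0 / lam 1 + C1 / sqrt (lam 1)"
  have "C > 0" using C0 C1 lam1_pos by (auto simp: C_def intro!: add_pos_pos)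
  moreover have "(comb a I x)^2 \<le> C * (\<Sum>n\<in>I. (lam n)^2 * (a n)^2) \<and> (combd a I x)^2 \<le> C * (\<Sum>n\<in>I. (lam n)^2 * (a n)^2)"
    if I: "finite I" "I \<subseteq> {1..}" and x: "x \<in> {0..1}" for a I x
  proof -
    define S1 where "S1 = (\<Sum>n\<in>I. lam n * (a n)^2)"
    define S2 where "S2 = (\<Sum>n\<in>I. (lam n)^2 * (a n)^2)"
    have S2: "S2 \<ge> 0" unfolding S2_def by (intro sum_nonneg) auto
    have S12: "S1 \<le> S2 / lam 1" using sum_lam_le(1)[OF I(2), of a] by (simp add: S1_def S2_def)
    define f f' where "f = comb a I" and "f' = combd a I"
    have "(f x)^2 \<le> nrm2 f + 2 * sqrt (nrm2 f * nrm2 f')"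
      unfolding f_def f'_def by (intro pointwise_square_bound comb_deriv comb_cont I x)
    also have "\<dots> \<le> nrm2 f + (nrm2 f + nrm2 f')"
      using arith_geo_mean_sqrt[of "nrm2 f" "nrm2 f'"] by simp
    also have "\<dots> \<le> 2 * (nrm2 f + nrm2 f')" by (simp add: algebra_simps)
    also have "\<dots> \<le> 2 * (C0 * (S2 / lam 1))"
    proof -
      have "nrm2 f + nrm2 f' \<le> C0 * S1" using C0(2)[OF I, of a] by (simp add: f_def f'_def S1_def)
      also have "\<dots> \<le> C0 * (S2 / lam 1)" using S12 C0 by (intro mult_left_mono) auto
      finally show ?thesis by simp
    qed
    finally have 1: "(f x)^2 \<le> (2 * C0 / lam 1) * S2" by simp
    have "sqrt (S1 * S2) \<le> sqrt (S2 / lam 1 * S2)"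
      using mult_right_mono[OF S12 S2] by (intro real_sqrt_le_mono)
    also have "\<dots> = S2 / sqrt (lam 1)" using S2 by (simp add: real_sqrt_divide real_sqrt_mult)
    finally have "C1 * sqrt (S1 * S2) \<le> C1 * (S2 / sqrt (lam 1))" using C1 by (intro mult_left_mono) auto
    then have 2: "(f' x)^2 \<le> (C1 / sqrt (lam 1)) * S2"
      using C1(2)[OF I x, of a] by (simp add: f'_def S1_def S2_def)
    have "(2 * C0 / lam 1) * S2 \<le> C * S2" "(C1 / sqrt (lam 1)) * S2 \<le> C * S2"
    proof -
      have "0 \<le> 2 * C0 / lam 1" "0 \<le> C1 / sqrt (lam 1)" using C0(1) C1(1) lam1_pos by simp_all
      then show "(2 * C0 / lam 1) * S2 \<le> C * S2" "(C1 / sqrt (lam 1)) * S2 \<le> C * S2"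
        unfolding C_def using S2 by (intro mult_right_mono; linarith)+
    qed
    then show ?thesis using 1 2 unfolding f_def f'_def S2_def by linarith
  qed
  ultimately show thesis by (rule that)
qed

text \<open>Testing the flux bound with the combination whose coefficients are the fluxes \<open>\<phi>\<^sub>n'(0)\<close>
  themselves gives \<open>S\<^sup>2 \<le> C \<Lambda>\<^sup>3\<^sup>/\<^sup>2 S\<close> for \<open>S = \<Sum> \<phi>\<^sub>n'(0)\<^sup>2\<close> over \<open>lam n \<le> \<Lambda>\<close>; this replaces the Weyl
  asymptotics of the eigenpairs.\<close>

lemma flux_counting_bound:
  obtains C where "C \<ge> 0" "\<And>\<Lambda> I. finite I \<Longrightarrow> I \<subseteq> {1..} \<Longrightarrow> \<forall>n\<in>I. lam n \<le> \<Lambda> \<Longrightarrow> \<Lambda> > 0 \<Longrightarrow>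
     (\<Sum>n\<in>I. (phid n 0)^2) \<le> C * \<Lambda> powr (3/2)"
proof -
  obtain C where C: "C > 0" "\<And>a I x. finite I \<Longrightarrow> I \<subseteq> {1..} \<Longrightarrow> x \<in> {0..1} \<Longrightarrow>
     (combd a I x)^2 \<le> C * sqrt ((\<Sum>n\<in>I. lam n * (a n)^2) * (\<Sum>n\<in>I. (lam n)^2 * (a n)^2))"
    by (rule comb_flux_bound, rule that) blast+
  have "(\<Sum>n\<in>I. (phid n 0)^2) \<le> C * \<Lambda> powr (3/2)"
    if I: "finite I" "I \<subseteq> {1..}" and \<Lambda>: "\<forall>n\<in>I. lam n \<le> \<Lambda>" "\<Lambda> > 0" for \<Lambda> I
  proof -
    define S where "S = (\<Sum>n\<in>I. (phid n 0)^2)"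
    have S: "S \<ge> 0" unfolding S_def by (intro sum_nonneg) auto
    have lp: "0 < lam n" if "n \<in> I" for n using that I lam_pos by (auto simp: subset_iff)
    have "S^2 = (combd (\<lambda>n. phid n 0) I 0)^2" by (simp add: S_def combd_def power2_eq_square)
    also have "\<dots> \<le> C * sqrt ((\<Sum>n\<in>I. lam n * (phid n 0)^2) * (\<Sum>n\<in>I. (lam n)^2 * (phid n 0)^2))"
      by (intro C I) simp
    also have "(\<Sum>n\<in>I. lam n * (phid n 0)^2) * (\<Sum>n\<in>I. (lam n)^2 * (phid n 0)^2) \<le> (\<Lambda> * S) * (\<Lambda>^2 * S)"
    proof (rule mult_mono)
      show "(\<Sum>n\<in>I. lam n * (phid n 0)^2) \<le> \<Lambda> * S"
        unfolding S_def sum_distrib_left using \<Lambda> by (intro sum_mono mult_right_mono) auto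
      show "(\<Sum>n\<in>I. (lam n)^2 * (phid n 0)^2) \<le> \<Lambda>^2 * S"
        unfolding S_def sum_distrib_left using \<Lambda> lp by (intro sum_mono mult_right_mono power_mono) (auto simp: less_imp_le)
    qed (use S \<Lambda> in \<open>auto intro!: sum_nonneg\<close>)
    also have "(\<Lambda> * S) * (\<Lambda>^2 * S) = (\<Lambda> powr (3/2) * S)^2"
    proof -
      have "(\<Lambda> powr (3/2))^2 = \<Lambda> ^ 3"
        using \<Lambda>(2) powr_numeral[of "\<Lambda> powr (3/2)" "num.Bit0 num.One"] by (simp add: powr_powr)
      then show ?thesis by (simp add: power_mult_distrib power2_eq_square power3_eq_cube)
    qed
    also have "sqrt \<dots> = \<Lambda> powr (3/2) * S" using S by simp
    finally have "S * S \<le> (C * \<Lambda> powr (3/2)) * S" using C by (simp add: power2_eq_square)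
    then show ?thesis
      unfolding S_def[symmetric] using S C by (cases "S = 0") auto
  qed
  with less_imp_le[OF C(1)] show thesis by (rule that)
qed

lemma flux_sum_bounded:
  assumes "\<epsilon> > 0"
  shows "\<exists>B. \<forall>I. finite I \<and> I \<subseteq> {1..} \<longrightarrow> (\<Sum>n\<in>I. (phid n 0)^2 / lam n powr (3/2 + \<epsilon>)) \<le> B"
proof (rule flux_counting_bound)
  fix C assume C: "C \<ge> 0" "\<And>\<Lambda> I. finite I \<Longrightarrow> I \<subseteq> {1..} \<Longrightarrow> \<forall>n\<in>I. lam n \<le> \<Lambda> \<Longrightarrow> \<Lambda> > 0 \<Longrightarrow>
     (\<Sum>n\<in>I. (phid n 0)^2) \<le> C * \<Lambda> powr (3/2)"
  show ?thesis
  proof (rule dyadic_sum_bound)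
    show "0 < lam 1" "0 \<le> C" "0 < \<epsilon>" "(0::real) < 3/2" using C assms lam1_pos by auto
    show "lam 1 \<le> lam n" if "n \<ge> 1" for n using lam_mono[of 1 n] that by simp
  qed (use C in auto)
qed

lemma summable_Mphi:
  assumes "\<epsilon> > 0"
  shows "summable (\<lambda>n. if N + 1 \<le> n then (phid n 0)^2 / lam n powr (3/2 + \<epsilon>) else 0)"
proof -
  obtain B where "\<And>I. finite I \<Longrightarrow> I \<subseteq> {1..} \<Longrightarrow> (\<Sum>n\<in>I. (phid n 0)^2 / lam n powr (3/2 + \<epsilon>)) \<le> B"
    using flux_sum_bounded[OF assms] by metis
  then show ?thesis by (intro summable_tail_of_bounded_sums) auto
qed

section \<open>The quadratic lifting and the spectral expansion of the domain\<close>

lemma th2_denominator_pos: "cos \<theta>2 + 2 * sin \<theta>2 > 0"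
proof -
  have "cos \<theta>2 \<noteq> 0 \<or> sin \<theta>2 \<noteq> 0" using sin_cos_squared_add[of \<theta>2] by force
  then show ?thesis using cos_th2 sin_th2 by linarith
qed

lemma acoef_cont: "continuous_on {0..1} (acoef p pd qt \<theta>2)"
  unfolding acoef_def using th2_denominator_pos
  by (intro continuous_intros p_cont pd_cont qt_cont) auto

lemma bcoef_cont: "continuous_on {0..1} (bcoef \<theta>2)"
  unfolding bcoef_def using th2_denominator_pos by (intro continuous_intros) auto

text \<open>The quadratic lifting of a unit boundary value at \<open>1\<close> is \<open>- bcoef \<theta>2\<close>.\<close>

lemma H2_lift: "H2 (\<lambda>x. x^2 / d * c) (\<lambda>x. 2 * x / d * c) (\<lambda>x. 2 / d * c)"
  unfolding H2_def
proof (intro conjI ballI)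
  fix x :: real assume x: "x \<in> {0..1}"
  show "((\<lambda>x. x^2 / d * c) has_real_derivative 2 * x / d * c) (at x within {0..1})"
    by (cases "d = 0") (auto intro!: derivative_eq_intros)
  show "2 * x / d * c = 2 * 0 / d * c + integral {0..x} (\<lambda>x. 2 / d * c)"
    using x by simp
qed (auto intro: sq_int_continuous)

lemma H2_diff:
  assumes "H2 f f' f''" "H2 g g' g''"
  shows "H2 (\<lambda>x. f x - g x) (\<lambda>x. f' x - g' x) (\<lambda>x. f'' x - g'' x)"
  unfolding H2_def
proof (intro conjI ballI)
  fix x :: real assume x: "x \<in> {0..1}"
  show "((\<lambda>x. f x - g x) has_real_derivative f' x - g' x) (at x within {0..1})"
    using DERIV_diff[of f "f' x" x "{0..1}" g "g' x"] assms x unfolding H2_def by blast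
  have i: "f'' integrable_on {0..x}" "g'' integrable_on {0..x}"
    using sq_int_integrable[OF H2_continuous(3)[OF assms(1)]] sq_int_integrable[OF H2_continuous(3)[OF assms(2)]] x
      integrable_on_subinterval[of f'' "{0..1}" 0 x] integrable_on_subinterval[of g'' "{0..1}" 0 x]
    by (simp_all add: absolutely_integrable_on_def)
  have "f' x = f' 0 + integral {0..x} f''" "g' x = g' 0 + integral {0..x} g''"
    using assms x unfolding H2_def by metis+
  then show "f' x - g' x = f' 0 - g' 0 + integral {0..x} (\<lambda>x. f'' x - g'' x)"
    by (simp add: integral_diff[OF i])
qed (intro sq_int_diff H2_continuous(3)[OF assms(1)] H2_continuous(3)[OF assms(2)])

text \<open>Green's identity applied to the lifting \<open>x^2 / d\<close>, which has boundary value
  1 at the right end; the operator maps it to \<open>- acoef - qc * bcoef\<close>. With this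
  relation the coefficients \<open>bet n\<close> can be replaced, in the homogenised modes, by the
  square-summable coefficients of \<open>acoef\<close> and \<open>bcoef\<close>.\<close>

lemma betac_eq:
  assumes "n \<ge> 1"
  shows "betac p \<theta>2 phi phid n = coef (acoef p pd qt \<theta>2) n + (qc - lam n) * coef (bcoef \<theta>2) n"
proof -
  define d where "d = cos \<theta>2 + 2 * sin \<theta>2"
  have d: "d > 0" using th2_denominator_pos by (simp add: d_def)
  have "coef (Aop (\<lambda>x. x^2 / d * 1) (\<lambda>x. 2 * x / d * 1) (\<lambda>x. 2 / d * 1)) n
      = lam n * coef (\<lambda>x. x^2 / d * 1) n - betac p \<theta>2 phi phid n * 1"
  proof (rule coef_Aop[OF H2_lift])
    have "cos \<theta>2 * (1^2 / d * 1) + sin \<theta>2 * (2 * 1 / d * 1) = d / d"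
      unfolding d_def by (simp only: add_divide_distrib) simp
    then show "cos \<theta>2 * (1^2 / d * 1) + sin \<theta>2 * (2 * 1 / d * 1) = 1" using d by simp
  qed (use assms in auto)
  moreover have "coef (\<lambda>x. x^2 / d * 1) n = - coef (bcoef \<theta>2) n"
    unfolding bcoef_def d_def using ip_cmult[of "-1" "\<lambda>x. x^2 / (cos \<theta>2 + 2 * sin \<theta>2)" "phi n"] by simp
  moreover have "coef (Aop (\<lambda>x. x^2 / d * 1) (\<lambda>x. 2 * x / d * 1) (\<lambda>x. 2 / d * 1)) n
      = coef (\<lambda>x. (-1) * acoef p pd qt \<theta>2 x + (- qc) * bcoef \<theta>2 x) n"
  proof (rule ip_cong)
    fix x :: real assume x: "x \<in> {0..1}"
    have ab: "acoef p pd qt \<theta>2 x = (2 * p x + 2 * x * pd x - x^2 * (q x - qc)) / d" "bcoef \<theta>2 x = - (x^2) / d"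
      using qt_q x by (auto simp: acoef_def bcoef_def d_def)
    show "Aop (\<lambda>x. x^2 / d * 1) (\<lambda>x. 2 * x / d * 1) (\<lambda>x. 2 / d * 1) x
        = (-1) * acoef p pd qt \<theta>2 x + (- qc) * bcoef \<theta>2 x"
      unfolding ab Aop_def using d by (simp add: field_simps power2_eq_square)
  qed
  moreover have "\<dots> = coef (\<lambda>x. (-1) * acoef p pd qt \<theta>2 x) n + coef (\<lambda>x. (- qc) * bcoef \<theta>2 x) n"
    by (intro ip_add sq_int_cmult sq_int_continuous acoef_cont bcoef_cont phi_cont assms)
  ultimately show ?thesis
    by (simp only: ip_cmult) (simp add: algebra_simps)
qed

lemma coef_tendsto:
  assumes "(\<lambda>M. nrm2 (\<lambda>x. g x - S M x)) \<longlonglongrightarrow> 0" "sq_int g" "\<And>M. sq_int (S M)" "n \<ge> 1"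
  shows "(\<lambda>M. coef (S M) n) \<longlonglongrightarrow> coef g n"
proof -
  have "(\<lambda>M. coef g n - coef (S M) n) \<longlonglongrightarrow> 0"
  proof (rule Lim_null_comparison)
    show "\<forall>\<^sub>F M in sequentially. norm (coef g n - coef (S M) n) \<le> sqrt (nrm2 (\<lambda>x. g x - S M x))"
    proof (rule always_eventually, rule allI)
      fix M
      have "(coef g n - coef (S M) n)^2 = (coef (\<lambda>x. g x - S M x) n)^2"
        using assms by (simp add: ip_diff phi_sq_int)
      also have "\<dots> \<le> nrm2 (\<lambda>x. g x - S M x) * nrm2 (phi n)"
        by (intro ip_Cauchy_Schwarz sq_int_diff assms phi_sq_int)
      also have "nrm2 (phi n) = 1"
        using assms(4) by (simp add: nrm2_eq_ip phi_orthonormal)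
      finally show "norm (coef g n - coef (S M) n) \<le> sqrt (nrm2 (\<lambda>x. g x - S M x))"
        by (intro real_le_rsqrt) simp
    qed
    show "(\<lambda>M. sqrt (nrm2 (\<lambda>x. g x - S M x))) \<longlonglongrightarrow> 0"
      using tendsto_real_sqrt[OF assms(1)] by simp
  qed
  from tendsto_diff[OF tendsto_const[of "coef g n"] this] show ?thesis by simp
qed

lemma coef_comb:
  assumes "finite I" "I \<subseteq> {1..}" "n \<in> I"
  shows "coef (comb a I) n = a n"
proof -
  have e: "phi n = comb (\<lambda>m. if m = n then 1 else 0) I"
    using assms by (auto simp: comb_def fun_eq_iff if_distrib[of "\<lambda>x. x * _"] cong: if_cong)
  have "coef (comb a I) n = (\<Sum>m\<in>I. a m * (if m = n then 1 else 0))"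
    by (subst e) (rule ip_comb[OF assms(1,2)])
  also have "\<dots> = (\<Sum>m\<in>I. if m = n then a m else 0)" by (intro sum.cong) auto
  finally show ?thesis using assms by simp
qed

text \<open>By the pointwise bounds the spectral partial sums of \<open>f \<in> D(\<A>)\<close> are Cauchy in
  \<open>C\<^sup>1([0,1])\<close>; by totality of the eigenfunctions their limit is \<open>f\<close>. Working in \<open>C\<^sup>1\<close> avoids
  the completeness of \<open>L\<^sup>2\<close>.\<close>

lemma spectral_expansion:
  assumes H: "H2 f f' f''" and bc0: "cos \<theta>1 * f 0 - sin \<theta>1 * f' 0 = 0"
    and bc1: "cos \<theta>2 * f 1 + sin \<theta>2 * f' 1 = 0"
  shows "uniform_limit {0..1} (\<lambda>M. comb (coef f) {1..M}) f sequentially"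
    and "uniform_limit {0..1} (\<lambda>M. combd (coef f) {1..M}) f' sequentially"
proof -
  define a where "a = coef f"
  note c = H2_continuous[OF H]
  obtain C where C: "C > 0" "\<And>a I x. finite I \<Longrightarrow> I \<subseteq> {1..} \<Longrightarrow> x \<in> {0..1} \<Longrightarrow>
     (comb a I x)^2 \<le> C * (\<Sum>n\<in>I. (lam n)^2 * (a n)^2) \<and> (combd a I x)^2 \<le> C * (\<Sum>n\<in>I. (lam n)^2 * (a n)^2)"
    by (rule comb_pointwise_bounds, rule that) blast+
  have lc: "coef (Aop f f' f'') n = lam n * a n" if "n \<ge> 1" for n
    using coef_Aop[OF H bc0 bc1 that] by (simp add: a_def)
  \<comment> \<open>These are the squared coefficients of the operator applied to \<open>f\<close>,
    hence summable by Bessel's inequality. The tail \<open>tl\<close> controls the Cauchy property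
    of the values and of the derivatives at once.\<close>
  define s where "s = (\<lambda>n. if n \<ge> 1 then (lam n)^2 * (a n)^2 else 0)"
  have s_nonneg: "s n \<ge> 0" for n by (simp add: s_def)
  have "summable (\<lambda>n. if 0 + 1 \<le> n then (coef (Aop f f' f'') n)^2 else 0)"
    by (rule summable_coef_square[OF Aop_sq_int[OF H]])
  also have "(\<lambda>n. if 0 + 1 \<le> n then (coef (Aop f f' f'') n)^2 else 0) = s"
    by (auto simp: fun_eq_iff s_def lc power_mult_distrib)
  finally have s_sum: "summable s" .
  define tl where "tl = (\<lambda>m. \<Sum>n. s (n + m))"
  have tl: "tl \<longlonglongrightarrow> 0" unfolding tl_def by (rule suminf_exist_split2[OF s_sum])
  have seg: "(\<Sum>n\<in>{m..<M}. s n) \<le> tl m" for m M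
  proof (cases "m \<le> M")
    case True
    have "(\<Sum>n\<in>{m..<M}. s n) = (\<Sum>n<M-m. s (n + m))"
      using sum.shift_bounds_nat_ivl[of s 0 m "M - m"] True by (simp add: lessThan_atLeast0)
    also have "\<dots> \<le> tl m"
      unfolding tl_def using s_nonneg s_sum by (intro sum_le_suminf) auto
    finally show ?thesis .
  next
    case False
    then show ?thesis unfolding tl_def using s_nonneg s_sum by (auto intro!: suminf_nonneg)
  qed
  define t where "t = (\<lambda>n x. if n \<ge> 1 then a n * phi n x else 0)"
  define td where "td = (\<lambda>n x. if n \<ge> 1 then a n * phid n x else 0)"
  have part: "(\<Sum>n\<in>{m..<M}. t n x) = comb a ({m..<M} \<inter> {1..}) x"
    "(\<Sum>n\<in>{m..<M}. td n x) = combd a ({m..<M} \<inter> {1..}) x" for m M x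
    unfolding t_def td_def comb_def combd_def
    by (intro sum.mono_neutral_cong_right; auto split: if_splits)+
  have bnd: "(\<Sum>n\<in>{m..<M}. t n x)^2 \<le> C * tl m" "(\<Sum>n\<in>{m..<M}. td n x)^2 \<le> C * tl m"
    if "x \<in> {0..1}" for m M x
  proof -
    have "(\<Sum>n\<in>{m..<M} \<inter> {1..}. (lam n)^2 * (a n)^2) = (\<Sum>n\<in>{m..<M}. s n)"
      unfolding s_def by (intro sum.mono_neutral_cong_left; auto split: if_splits)
    also have "\<dots> \<le> tl m" by (rule seg)
    finally have "C * (\<Sum>n\<in>{m..<M} \<inter> {1..}. (lam n)^2 * (a n)^2) \<le> C * tl m"
      using C(1) by (intro mult_left_mono) auto
    then show "(\<Sum>n\<in>{m..<M}. t n x)^2 \<le> C * tl m" "(\<Sum>n\<in>{m..<M}. td n x)^2 \<le> C * tl m"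
      unfolding part using C(2)[of "{m..<M} \<inter> {1..}" x a] that by auto
  qed
  have Ctl: "(\<lambda>m. sqrt (C * tl m)) \<longlonglongrightarrow> 0"
    using tendsto_real_sqrt[OF tendsto_mult_left[OF tl, of C]] by simp
  have cauchy: "uniformly_convergent_on {0..1} (\<lambda>M x. \<Sum>n<M. r n x)"
    if r: "\<And>m M x. x \<in> {0..1} \<Longrightarrow> (\<Sum>n\<in>{m..<M}. r n x)^2 \<le> C * tl m" for r :: "nat \<Rightarrow> real \<Rightarrow> real"
  proof (rule Cauchy_uniformly_convergent, rule uniformly_Cauchy_onI')
    fix e :: real assume "e > 0"
    from order_tendstoD(2)[OF Ctl this] obtain N where N: "\<And>m. m \<ge> N \<Longrightarrow> sqrt (C * tl m) < e"
      by (auto simp: eventually_sequentially)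
    show "\<exists>N. \<forall>x\<in>{0..1}. \<forall>m\<ge>N. \<forall>n>m. dist (\<Sum>n<m. r n x) (\<Sum>n<n. r n x) < e"
    proof (intro exI[of _ N] ballI allI impI)
      fix x :: real and m n :: nat assume x: "x \<in> {0..1}" and mn: "N \<le> m" "m < n"
      have "(\<Sum>n<n. r n x) - (\<Sum>n<m. r n x) = (\<Sum>n\<in>{m..<n}. r n x)"
        using mn sum.atLeastLessThan_concat[of 0 m n "\<lambda>n. r n x"] by (simp add: lessThan_atLeast0)
      then have "dist (\<Sum>n<m. r n x) (\<Sum>n<n. r n x) = \<bar>\<Sum>n\<in>{m..<n}. r n x\<bar>"
        by (simp add: dist_real_def abs_minus_commute)
      also have "\<dots> \<le> sqrt (C * tl m)" using r[OF x] by (intro real_le_rsqrt) simp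
      also have "\<dots> < e" by (rule N[OF mn(1)])
      finally show "dist (\<Sum>n<m. r n x) (\<Sum>n<n. r n x) < e" .
    qed
  qed
  obtain g1 where g1: "uniform_limit {0..1} (\<lambda>M x. \<Sum>n<M. td n x) g1 sequentially"
    using cauchy[of td] bnd(2) unfolding uniformly_convergent_on_def by metis
  obtain g0 where g0: "uniform_limit {0..1} (\<lambda>M x. \<Sum>n<M. t n x) g0 sequentially"
    using cauchy[of t] bnd(1) unfolding uniformly_convergent_on_def by metis
  have tder: "(t n has_field_derivative td n x) (at x within {0..1})" if "x \<in> {0..1}" for n x
    using phi_deriv[of n] that unfolding t_def td_def by (cases "n \<ge> 1") (auto intro!: DERIV_cmult)
  have s0: "(\<lambda>n. t n x) sums g0 x" if "x \<in> {0..1}" for x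
    unfolding sums_def using tendsto_uniform_limitI[OF g0 that] .
  obtain g where g: "\<And>x. x \<in> {0..1} \<Longrightarrow> (\<lambda>n. t n x) sums g x \<and> (g has_field_derivative g1 x) (at x within {0..1})"
  proof -
    have "\<exists>g. \<forall>x\<in>{0..1}. (\<lambda>n. t n x) sums g x \<and> (g has_field_derivative g1 x) (at x within {0..1})"
      using has_field_derivative_series[of "{0..1::real}" t td g1 0, OF _ tder g1] sums_summable[OF s0, of 0] by auto
    then show thesis using that by blast
  qed
  have gg0: "g x = g0 x" if "x \<in> {0..1}" for x
    using sums_unique2[of "\<lambda>n. t n x" "g x" "g0 x"] g[OF that] s0[OF that] by auto
  have gc: "continuous_on {0..1} g"
    using g by (meson DERIV_continuous continuous_on_eq_continuous_within)
  have t_comb: "(\<Sum>n<Suc M. t n x) = comb a {1..M} x" "(\<Sum>n<Suc M. td n x) = combd a {1..M} x" for M x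
    unfolding t_def td_def comb_def combd_def
    by (intro sum.mono_neutral_cong_right; auto split: if_splits)+
  have U0: "uniform_limit {0..1} (\<lambda>M. comb a {1..M}) g sequentially"
  proof -
    have "uniform_limit {0..1} (\<lambda>M x. \<Sum>n<Suc M. t n x) g0 sequentially"
      using filterlim_compose[OF g0 filterlim_Suc] by simp
    then show ?thesis unfolding t_comb by (rule uniform_limit_cong'[THEN iffD1, rotated 2]) (auto simp: gg0)
  qed
  have U1: "uniform_limit {0..1} (\<lambda>M. combd a {1..M}) g1 sequentially"
    using filterlim_compose[OF g1 filterlim_Suc] unfolding t_comb by simp
  have "nrm2 (\<lambda>x. f x - g x) = 0"
  proof (rule phi_total)
    show "sq_int (\<lambda>x. f x - g x)" by (intro sq_int_continuous continuous_intros c gc)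
    fix n :: nat assume n: "n \<ge> 1"
    have "(\<lambda>M. nrm2 (\<lambda>x. g x - comb a {1..M} x)) \<longlonglongrightarrow> 0"
    proof (rule LIMSEQ_I)
      fix r :: real assume r: "r > 0"
      from uniform_limitD[OF U0, of "sqrt (r/2)"] r obtain N where
        N: "\<forall>M\<ge>N. \<forall>x\<in>{0..1}. dist (comb a {1..M} x) (g x) < sqrt (r/2)"
        unfolding eventually_sequentially by auto
      have "nrm2 (\<lambda>x. g x - comb a {1..M} x) \<le> r/2" if "M \<ge> N" for M
      proof (rule nrm2_le_of_pointwise)
        show "continuous_on {0..1} (\<lambda>x. g x - comb a {1..M} x)"
          by (intro continuous_intros gc comb_cont) auto
        fix x :: real assume x: "x \<in> {0..1}"
        have "\<bar>g x - comb a {1..M} x\<bar> \<le> sqrt (r/2)"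
          using N that x by (fastforce simp: dist_real_def abs_minus_commute)
        from power_mono[OF this, of 2] show "(g x - comb a {1..M} x)^2 \<le> r/2" using r by simp
      qed
      then show "\<exists>no. \<forall>M\<ge>no. norm (nrm2 (\<lambda>x. g x - comb a {1..M} x) - 0) < r"
        using r by (intro exI[of _ N]) force
    qed
    then have "(\<lambda>M. coef (comb a {1..M}) n) \<longlonglongrightarrow> coef g n"
      by (rule coef_tendsto) (use gc comb_cont n in \<open>auto intro!: sq_int_continuous\<close>)
    moreover have "(\<lambda>M. coef (comb a {1..M}) n) \<longlonglongrightarrow> a n"
    proof (rule tendsto_eventually)
      show "\<forall>\<^sub>F M in sequentially. coef (comb a {1..M}) n = a n"
        using n by (intro eventually_sequentiallyI[of n] coef_comb) auto
    qed
    ultimately have "coef g n = a n" by (rule LIMSEQ_unique)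
    then show "coef (\<lambda>x. f x - g x) n = 0"
      using ip_diff[OF sq_int_continuous[OF c(1)] sq_int_continuous[OF gc] phi_sq_int[OF n]] by (simp add: a_def)
  qed
  then have fg: "f x = g x" if "x \<in> {0..1}" for x
    using nrm2_zero_imp_zero[of "\<lambda>x. f x - g x" x] that c(1) gc by (auto intro!: continuous_intros)
  have fg1: "f' x = g1 x" if x: "x \<in> {0..1}" for x
  proof -
    have "(f has_real_derivative g1 x) (at x within {0..1})"
    proof (rule has_field_derivative_transform_within[of g "g1 x" x "{0..1}" 1])
      show "(g has_real_derivative g1 x) (at x within {0..1})" using g[OF x] by blast
    qed (use x fg in auto)
    moreover have "(f has_real_derivative f' x) (at x within {0..1})" using H x unfolding H2_def by blast
    ultimately show ?thesis using derivative_unique_01 x by blast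
  qed
  show "uniform_limit {0..1} (\<lambda>M. comb (coef f) {1..M}) f sequentially"
    using U0 unfolding a_def by (rule uniform_limit_cong'[THEN iffD1, rotated 2]) (auto simp: fg)
  show "uniform_limit {0..1} (\<lambda>M. combd (coef f) {1..M}) f' sequentially"
    using U1 unfolding a_def by (rule uniform_limit_cong'[THEN iffD1, rotated 2]) (auto simp: fg1)
qed

text \<open>The convergence of derivatives at the boundary point is the reason why the expansion is
  proved in \<open>C^1\<close>: it writes the boundary measurement as a series in the modes.\<close>

lemma flux_expansion:
  assumes H: "H2 f f' f''" and bc0: "cos \<theta>1 * f 0 - sin \<theta>1 * f' 0 = 0"
    and bc1: "cos \<theta>2 * f 1 + sin \<theta>2 * f' 1 = 0"
  shows "(\<lambda>M. \<Sum>n=1..M. coef f n * phid n 0) \<longlonglongrightarrow> f' 0"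
  using tendsto_uniform_limitI[OF spectral_expansion(2)[OF assms], of 0] by (simp add: combd_def)

text \<open>Coercivity for finite combinations passes to the limit by uniform convergence of the
  expansion and of its derivative. Splitting off the remainder costs the factor 2; remainders of
  size \<open>e/4\<close> for the function and the derivative add up to \<open>e\<close>.\<close>

lemma H1_le_of_partial_sums:
  obtains C where "C > 0" "\<And>f f' f'' B. H2 f f' f'' \<Longrightarrow> cos \<theta>1 * f 0 - sin \<theta>1 * f' 0 = 0 \<Longrightarrow>
    cos \<theta>2 * f 1 + sin \<theta>2 * f' 1 = 0 \<Longrightarrow> (\<And>M. (\<Sum>n=1..M. lam n * (coef f n)^2) \<le> B) \<Longrightarrow>
    nrm2 f + nrm2 f' \<le> C * B"
proof -
  obtain C0 where C0: "C0 > 0" "\<And>a I. finite I \<Longrightarrow> I \<subseteq> {1..} \<Longrightarrow>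
      nrm2 (comb a I) + nrm2 (combd a I) \<le> C0 * (\<Sum>n\<in>I. lam n * (a n)^2)"
    by (rule comb_H1_bound, rule that) blast+
  have "nrm2 f + nrm2 f' \<le> (2 * C0) * B"
    if f: "H2 f f' f''" "cos \<theta>1 * f 0 - sin \<theta>1 * f' 0 = 0" "cos \<theta>2 * f 1 + sin \<theta>2 * f' 1 = 0"
      and B: "\<And>M. (\<Sum>n=1..M. lam n * (coef f n)^2) \<le> B" for f f' f'' B
  proof (rule field_le_epsilon)
    fix e :: real assume e: "e > 0"
    note c = H2_continuous[OF f(1)]
    have "\<forall>\<^sub>F M in sequentially. (\<forall>x\<in>{0..1}. dist (comb (coef f) {1..M} x) (f x) < sqrt (e/4)) \<and>
        (\<forall>x\<in>{0..1}. dist (combd (coef f) {1..M} x) (f' x) < sqrt (e/4))"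
      using uniform_limitD[OF spectral_expansion(1)[OF f], of "sqrt (e/4)"]
        uniform_limitD[OF spectral_expansion(2)[OF f], of "sqrt (e/4)"] e by (auto intro: eventually_conj)
    then obtain M where M: "\<forall>x\<in>{0..1}. dist (comb (coef f) {1..M} x) (f x) < sqrt (e/4)"
        "\<forall>x\<in>{0..1}. dist (combd (coef f) {1..M} x) (f' x) < sqrt (e/4)"
      by (auto simp: eventually_sequentially)
    define S S' where "S = comb (coef f) {1..M}" and "S' = combd (coef f) {1..M}"
    have cS: "continuous_on {0..1} S" "continuous_on {0..1} S'"
      unfolding S_def S'_def by (intro comb_cont; auto)+
    have close: "nrm2 (\<lambda>x. k x - K x) \<le> e/4"
      if "continuous_on {0..1} k" "continuous_on {0..1} K" "\<forall>x\<in>{0..1}. dist (K x) (k x) < sqrt (e/4)" for k K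
    proof (rule nrm2_le_of_pointwise)
      show "continuous_on {0..1} (\<lambda>x. k x - K x)" by (intro continuous_intros that)
      fix x :: real assume "x \<in> {0..1}"
      then have "\<bar>k x - K x\<bar> \<le> sqrt (e/4)" using that(3) by (fastforce simp: dist_real_def abs_minus_commute)
      from power_mono[OF this, of 2] show "(k x - K x)^2 \<le> e/4" using e by simp
    qed
    have tri: "nrm2 k \<le> 2 * nrm2 K + 2 * nrm2 (\<lambda>x. k x - K x)"
      if "continuous_on {0..1} k" "continuous_on {0..1} K" for k K
      using nrm2_add_le[of K "\<lambda>x. k x - K x"] that by (auto intro!: sq_int_continuous continuous_intros)
    have "nrm2 S + nrm2 S' \<le> C0 * (\<Sum>n=1..M. lam n * (coef f n)^2)"
      unfolding S_def S'_def by (intro C0) auto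
    also have "\<dots> \<le> C0 * B" using B C0 by (intro mult_left_mono) auto
    finally have 1: "nrm2 S + nrm2 S' \<le> C0 * B" .
    show "nrm2 f + nrm2 f' \<le> (2 * C0) * B + e"
      using 1 tri[OF c(1) cS(1)] tri[OF c(2) cS(2)] close[OF c(1) cS(1)] close[OF c(2) cS(2)] M
      unfolding S_def S'_def by linarith
  qed
  then show thesis using C0(1) by (intro that[of "2 * C0"]) auto
qed

end

section \<open>Lyapunov functions of Hurwitz matrices\<close>

lemma sum_Cauchy_Schwarz:
  fixes f g :: "'i \<Rightarrow> real"
  shows "(\<Sum>i\<in>I. f i * g i)^2 \<le> (\<Sum>i\<in>I. (f i)^2) * (\<Sum>i\<in>I. (g i)^2)"
  using Cauchy_Schwarz_ineq_sum[of f g I] .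

text \<open>Schur decomposition of the complexified matrix, restated as the identities
  \<open>Q A = T Q\<close> and \<open>R Q = 1\<close> between entries so that later computations are
  plain finite sums. The diagonal of \<open>T\<close> consists of roots of the characteristic
  polynomial, which are eigenvalues.\<close>

lemma real_similar_upper_triangular:
  fixes A :: "real mat"
  assumes A: "A \<in> carrier_mat n n" and e: "eig_re_lt A d"
  obtains Q R T :: "nat \<Rightarrow> nat \<Rightarrow> complex" where
    "\<And>m j. m < n \<Longrightarrow> j < n \<Longrightarrow> (\<Sum>k\<in>{0..<n}. Q m k * complex_of_real (A $$ (k,j))) = (\<Sum>k\<in>{0..<n}. T m k * Q k j)"
    "\<And>m j. m < n \<Longrightarrow> j < n \<Longrightarrow> (\<Sum>k\<in>{0..<n}. R m k * Q k j) = (if m = j then 1 else 0)"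
    "\<And>m j. m < n \<Longrightarrow> j < m \<Longrightarrow> T m j = 0" "\<And>m. m < n \<Longrightarrow> Re (T m m) < d"
proof -
  define B where "B = map_mat complex_of_real A"
  have B: "B \<in> carrier_mat n n" using A by (simp add: B_def)
  obtain es where es: "char_poly B = (\<Prod>a\<leftarrow>es. [:- a, 1:])"
    using char_poly_factorized[OF B] by blast
  obtain T P Q where s: "schur_decomposition B es = (T, P, Q)" by (cases "schur_decomposition B es") auto
  from schur_decomposition[OF B es s] have sim: "similar_mat_wit B T P Q" and ut: "upper_triangular T"
    and dg: "diag_mat T = es" by auto
  note sd = similar_mat_witD2[OF B sim]
  have "Q * B = Q * (P * T * Q)" using sd(3) by simp
  also have "\<dots> = (Q * P) * (T * Q)" using sd(4-7) by (simp add: assoc_mult_mat[of _ n n _ n _ n])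
  also have "\<dots> = T * Q" using sd by simp
  finally have QB: "Q * B = T * Q" .
  show thesis
  proof (rule that[of "\<lambda>i j. Q $$ (i,j)" "\<lambda>i j. T $$ (i,j)" "\<lambda>i j. P $$ (i,j)"])
    fix m j assume mj: "m < n" "j < n"
    have "(Q * B) $$ (m,j) = (T * Q) $$ (m,j)" using QB by simp
    then show "(\<Sum>k\<in>{0..<n}. Q $$ (m,k) * complex_of_real (A $$ (k,j))) = (\<Sum>k\<in>{0..<n}. T $$ (m,k) * Q $$ (k,j))"
      using mj sd A by (simp add: scalar_prod_def B_def)
    have "(P * Q) $$ (m,j) = 1\<^sub>m n $$ (m,j)" using sd(1) by simp
    then show "(\<Sum>k\<in>{0..<n}. P $$ (m,k) * Q $$ (k,j)) = (if m = j then 1 else 0)"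
      using mj sd(4-7) by (simp add: scalar_prod_def)
  next
    fix m j assume "m < n" "j < m"
    then show "T $$ (m,j) = 0" using upper_triangularD[OF ut] sd(5) by auto
  next
    fix m assume m: "m < n"
    have "T $$ (m,m) \<in> set es" unfolding dg[symmetric] diag_mat_def using m sd(5) by auto
    then have "poly (char_poly B) (T $$ (m,m)) = 0"
      unfolding es by (induction es) (auto simp: poly_mult)
    then have "eigenvalue B (T $$ (m,m))" using eigenvalue_root_char_poly[OF B] by blast
    then show "Re (T $$ (m,m)) < d" using e unfolding eig_re_lt_def B_def by blast
  qed
qed

text \<open>In triangularising coordinates \<open>y = Q x\<close> the weights \<open>r ^ m\<close> with \<open>r\<close> large make
  the strictly upper triangular part negligible.\<close>

lemma hurwitz_lyapunov:
  fixes A :: "real mat"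
  assumes A: "A \<in> carrier_mat n n" and e: "eig_re_lt A (- \<delta>)"
  obtains S :: "nat \<Rightarrow> nat \<Rightarrow> real" and \<kappa> :: real where "\<kappa> > 0" "\<And>i j. S i j = S j i"
    "\<And>x. \<kappa> * (\<Sum>i\<in>{0..<n}. (x i)^2) \<le> (\<Sum>i\<in>{0..<n}. \<Sum>j\<in>{0..<n}. S i j * x i * x j)"
    "\<And>x. 2 * (\<Sum>i\<in>{0..<n}. \<Sum>j\<in>{0..<n}. S i j * x i * (\<Sum>k\<in>{0..<n}. A $$ (j,k) * x k))
      + 2 * \<delta> * (\<Sum>i\<in>{0..<n}. \<Sum>j\<in>{0..<n}. S i j * x i * x j) \<le> - \<kappa> * (\<Sum>i\<in>{0..<n}. (x i)^2)"
proof -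
  let ?I = "{0..<n}"
  obtain Q R T :: "nat \<Rightarrow> nat \<Rightarrow> complex" where
    QA: "\<And>m j. m < n \<Longrightarrow> j < n \<Longrightarrow> (\<Sum>k\<in>?I. Q m k * complex_of_real (A $$ (k,j))) = (\<Sum>k\<in>?I. T m k * Q k j)"
    and RQ: "\<And>m j. m < n \<Longrightarrow> j < n \<Longrightarrow> (\<Sum>k\<in>?I. R m k * Q k j) = (if m = j then 1 else 0)"
    and T0: "\<And>m j. m < n \<Longrightarrow> j < m \<Longrightarrow> T m j = 0" and Td: "\<And>m. m < n \<Longrightarrow> Re (T m m) < - \<delta>"
    by (rule real_similar_upper_triangular[OF A e]) (rule that)
  \<comment> \<open>Spectral margin beyond \<open>\<delta>\<close>. The inserted 1 keeps the set
    nonempty when \<open>n = 0\<close>.\<close>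
  define \<eta> where "\<eta> = Min (insert 1 ((\<lambda>m. - \<delta> - Re (T m m)) ` ?I))"
  have \<eta>: "\<eta> > 0" using Td by (auto simp: \<eta>_def)
  have \<eta>': "Re (T m m) \<le> - \<delta> - \<eta>" if "m < n" for m
  proof -
    have "\<eta> \<le> - \<delta> - Re (T m m)" unfolding \<eta>_def using that by (intro Min_le) auto
    then show ?thesis by simp
  qed
  define b where "b = 1 + (\<Sum>i\<in>?I. \<Sum>j\<in>?I. cmod (T i j))"
  have b1: "b \<ge> 1" unfolding b_def by (simp add: sum_nonneg)
  have bT: "cmod (T i j) \<le> b" if "i < n" "j < n" for i j
  proof -
    have "cmod (T i j) \<le> (\<Sum>j\<in>?I. cmod (T i j))" using that by (intro member_le_sum) auto
    also have "\<dots> \<le> (\<Sum>i\<in>?I. \<Sum>j\<in>?I. cmod (T i j))"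
      using that by (intro member_le_sum[of i ?I "\<lambda>i. \<Sum>j\<in>?I. cmod (T i j)"]) (auto intro: sum_nonneg)
    finally show ?thesis by (simp add: b_def)
  qed
  \<comment> \<open>The off-diagonal terms will sum to at most \<open>2 * n * b * \<tau>\<close>
    times the form, hence at most \<open>\<eta>\<close> times it, while the diagonal supplies
    \<open>2 * \<eta>\<close>; half of the margin survives. Using \<open>n + 1\<close> avoids a
    division by zero.\<close>
  define \<tau> where "\<tau> = \<eta> / (2 * (real n + 1) * b)"
  have \<tau>: "\<tau> > 0" using \<eta> b1 by (simp add: \<tau>_def)
  \<comment> \<open>Young's inequality with weight \<open>\<tau>\<close> leaves the factor
    \<open>1 / \<tau>\<close> on the component \<open>k > m\<close>. The weight \<open>r^k\<close>
    exceeds \<open>r^m\<close> by at least one factor \<open>r\<close>, and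
    \<open>1 / (\<tau> * r) \<le> \<tau>\<close> makes that component as cheap as the other.\<close>
  define r where "r = 1 + 1 / \<tau>^2"
  have r1: "r \<ge> 1" using \<tau> by (simp add: r_def)
  have "\<tau> * (\<tau> * r) = \<tau>^2 + 1" using \<tau> by (simp add: r_def power2_eq_square distrib_left)
  then have "1 \<le> \<tau> * (\<tau> * r)" by simp
  then have r: "r \<ge> 1" "1 / (\<tau> * r) \<le> \<tau>" using \<tau> r1 by (simp_all add: pos_divide_le_eq)
  define y where "y = (\<lambda>(x::nat\<Rightarrow>real) m. \<Sum>i\<in>?I. Q m i * complex_of_real (x i))"
  \<comment> \<open>Real part of the Hermitian matrix of the weighted squared norm in the
    coordinates \<open>y\<close>. On real vectors the real part gives the same quadratic form, so
    the Lyapunov matrix is real and symmetric.\<close>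
  define S where "S = (\<lambda>i j. Re (\<Sum>m\<in>?I. complex_of_real (r^m) * cnj (Q m i) * Q m j))"
  have Ssym: "S i j = S j i" for i j
  proof -
    have "cnj (\<Sum>m\<in>?I. complex_of_real (r^m) * cnj (Q m i) * Q m j) = (\<Sum>m\<in>?I. complex_of_real (r^m) * cnj (Q m j) * Q m i)"
      by (simp add: mult_ac)
    from arg_cong[OF this, of Re] show ?thesis unfolding S_def by (simp only: cnj.simps(1))
  qed
  have form: "(\<Sum>i\<in>?I. \<Sum>j\<in>?I. S i j * x i * z j) = Re (\<Sum>m\<in>?I. complex_of_real (r^m) * (cnj (y x m) * y z m))" for x z
  proof -
    have "(\<Sum>i\<in>?I. \<Sum>j\<in>?I. S i j * x i * z j)
        = Re (\<Sum>i\<in>?I. \<Sum>j\<in>?I. (\<Sum>m\<in>?I. complex_of_real (r^m) * cnj (Q m i) * Q m j) * complex_of_real (x i) * complex_of_real (z j))"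
      unfolding S_def by (simp add: mult.assoc flip: of_real_mult)
    also have "(\<Sum>i\<in>?I. \<Sum>j\<in>?I. (\<Sum>m\<in>?I. complex_of_real (r^m) * cnj (Q m i) * Q m j) * complex_of_real (x i) * complex_of_real (z j))
        = (\<Sum>i\<in>?I. \<Sum>j\<in>?I. \<Sum>m\<in>?I. complex_of_real (r^m) * ((cnj (Q m i) * complex_of_real (x i)) * (Q m j * complex_of_real (z j))))"
      by (simp add: sum_distrib_right sum_distrib_left mult_ac)
    also have "\<dots> = (\<Sum>i\<in>?I. \<Sum>m\<in>?I. \<Sum>j\<in>?I. complex_of_real (r^m) * ((cnj (Q m i) * complex_of_real (x i)) * (Q m j * complex_of_real (z j))))"
      by (intro sum.cong refl sum.swap)
    also have "\<dots> = (\<Sum>m\<in>?I. \<Sum>i\<in>?I. \<Sum>j\<in>?I. complex_of_real (r^m) * ((cnj (Q m i) * complex_of_real (x i)) * (Q m j * complex_of_real (z j))))"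
      by (rule sum.swap)
    also have "\<dots> = (\<Sum>m\<in>?I. complex_of_real (r^m) * (cnj (y x m) * y z m))"
    proof (rule sum.cong[OF refl])
      fix m
      have "cnj (y x m) = (\<Sum>i\<in>?I. cnj (Q m i) * complex_of_real (x i))" unfolding y_def by simp
      then have "cnj (y x m) * y z m = (\<Sum>i\<in>?I. \<Sum>j\<in>?I. (cnj (Q m i) * complex_of_real (x i)) * (Q m j * complex_of_real (z j)))"
        by (simp only: y_def sum_product)
      then show "(\<Sum>i\<in>?I. \<Sum>j\<in>?I. complex_of_real (r^m) * ((cnj (Q m i) * complex_of_real (x i)) * (Q m j * complex_of_real (z j))))
          = complex_of_real (r^m) * (cnj (y x m) * y z m)"
        by (simp only: sum_distrib_left)
    qed
    finally show ?thesis .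
  qed
  have yA: "y (\<lambda>j. \<Sum>k\<in>?I. A $$ (j,k) * x k) m = (\<Sum>k\<in>?I. T m k * y x k)" if m: "m < n" for x m
  proof -
    have "y (\<lambda>j. \<Sum>k\<in>?I. A $$ (j,k) * x k) m = (\<Sum>i\<in>?I. \<Sum>k\<in>?I. Q m i * complex_of_real (A $$ (i,k)) * complex_of_real (x k))"
      unfolding y_def by (simp add: sum_distrib_left mult_ac)
    also have "\<dots> = (\<Sum>k\<in>?I. (\<Sum>i\<in>?I. Q m i * complex_of_real (A $$ (i,k))) * complex_of_real (x k))"
      by (subst sum.swap) (simp add: sum_distrib_right)
    also have "\<dots> = (\<Sum>k\<in>?I. (\<Sum>i\<in>?I. T m i * Q i k) * complex_of_real (x k))"
      using m by (intro sum.cong refl) (simp add: QA)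
    also have "\<dots> = (\<Sum>i\<in>?I. \<Sum>k\<in>?I. T m i * Q i k * complex_of_real (x k))"
      by (subst sum.swap) (simp add: sum_distrib_right)
    also have "\<dots> = (\<Sum>k\<in>?I. T m k * y x k)"
      unfolding y_def by (simp add: sum_distrib_left mult_ac)
    finally show ?thesis .
  qed
  define V where "V = (\<lambda>x. \<Sum>m\<in>?I. r^m * (cmod (y x m))^2)"
  have V: "(\<Sum>i\<in>?I. \<Sum>j\<in>?I. S i j * x i * x j) = V x" for x
    unfolding form V_def by (simp add: mult.commute[of "cnj _"] complex_norm_square[symmetric] flip: of_real_mult of_real_power)
  \<comment> \<open>One plus the squared Frobenius norm of the inverse transformation; it transfers
    bounds from the coordinates \<open>y\<close> back to \<open>x\<close>.\<close>
  define Rn where "Rn = 1 + (\<Sum>i\<in>?I. \<Sum>m\<in>?I. (cmod (R i m))^2)"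
  have Rn: "Rn \<ge> 1" unfolding Rn_def by (simp add: sum_nonneg)
  have lower: "(\<Sum>i\<in>?I. (x i)^2) \<le> Rn * V x" for x
  proof -
    have x_eq: "complex_of_real (x i) = (\<Sum>m\<in>?I. R i m * y x m)" if "i < n" for i
    proof -
      have "(\<Sum>m\<in>?I. R i m * y x m) = (\<Sum>m\<in>?I. \<Sum>j\<in>?I. R i m * Q m j * complex_of_real (x j))"
        unfolding y_def by (simp add: sum_distrib_left mult_ac)
      also have "\<dots> = (\<Sum>j\<in>?I. (\<Sum>m\<in>?I. R i m * Q m j) * complex_of_real (x j))"
        by (subst sum.swap) (simp add: sum_distrib_right)
      also have "\<dots> = (\<Sum>j\<in>?I. if i = j then complex_of_real (x j) else 0)"
        using that by (intro sum.cong refl) (simp add: RQ)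
      finally show ?thesis using that by simp
    qed
    have nV: "(\<Sum>m\<in>?I. (cmod (y x m))^2) \<le> V x"
      unfolding V_def
    proof (rule sum_mono)
      fix m
      have "1 * (cmod (y x m))^2 \<le> r^m * (cmod (y x m))^2" using r by (intro mult_right_mono) auto
      then show "(cmod (y x m))^2 \<le> r^m * (cmod (y x m))^2" by simp
    qed
    have V0: "V x \<ge> 0" unfolding V_def using r by (intro sum_nonneg) auto
    have "(x i)^2 \<le> (\<Sum>m\<in>?I. (cmod (R i m))^2) * V x" if "i < n" for i
    proof -
      have "\<bar>x i\<bar> = cmod (\<Sum>m\<in>?I. R i m * y x m)" unfolding x_eq[OF that, symmetric] by simp
      also have "\<dots> \<le> (\<Sum>m\<in>?I. cmod (R i m) * cmod (y x m))"
        by (intro sum_norm_le) (simp add: norm_mult)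
      finally have "(x i)^2 \<le> (\<Sum>m\<in>?I. cmod (R i m) * cmod (y x m))^2"
        using power_mono[of "\<bar>x i\<bar>" _ 2] by simp
      also have "\<dots> \<le> (\<Sum>m\<in>?I. (cmod (R i m))^2) * (\<Sum>m\<in>?I. (cmod (y x m))^2)"
        by (rule sum_Cauchy_Schwarz)
      also have "\<dots> \<le> (\<Sum>m\<in>?I. (cmod (R i m))^2) * V x"
        by (intro mult_left_mono nV sum_nonneg) auto
      finally show ?thesis .
    qed
    then have "(\<Sum>i\<in>?I. (x i)^2) \<le> (\<Sum>i\<in>?I. (\<Sum>m\<in>?I. (cmod (R i m))^2) * V x)"
      by (intro sum_mono) auto
    also have "\<dots> \<le> Rn * V x"
      unfolding Rn_def using V0 by (simp add: sum_distrib_right[symmetric] distrib_right)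
    finally show ?thesis .
  qed
  have decay: "2 * Re (\<Sum>m\<in>?I. complex_of_real (r^m) * (cnj (y x m) * y (\<lambda>j. \<Sum>k\<in>?I. A $$ (j,k) * x k) m)) + 2 * \<delta> * V x
      \<le> - \<eta> * V x" for x
  proof -
    define w where "w = (\<lambda>m. cmod (y x m))"
    have pm: "2 * Re (complex_of_real (r^m) * (cnj (y x m) * y (\<lambda>j. \<Sum>k\<in>?I. A $$ (j,k) * x k) m))
        \<le> 2 * (- \<delta> - \<eta>) * (r^m * (w m)^2) + (\<Sum>k\<in>?I. b * (\<tau> * (r^m * (w m)^2) + \<tau> * (r^k * (w k)^2)))"
      if m: "m < n" for m
    proof -
      have "cnj (y x m) * y (\<lambda>j. \<Sum>k\<in>?I. A $$ (j,k) * x k) m = (\<Sum>k\<in>?I. cnj (y x m) * (T m k * y x k))"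
        unfolding yA[OF m] by (simp add: sum_distrib_left)
      then have "2 * Re (complex_of_real (r^m) * (cnj (y x m) * y (\<lambda>j. \<Sum>k\<in>?I. A $$ (j,k) * x k) m))
          = (\<Sum>k\<in>?I. 2 * r^m * Re (cnj (y x m) * (T m k * y x k)))"
      proof -
        have "Re (complex_of_real c * (\<Sum>k\<in>?I. g k)) = (\<Sum>k\<in>?I. c * Re (g k))" for c and g :: "nat \<Rightarrow> complex"
          by (simp add: sum_distrib_left)
        then show ?thesis
          unfolding \<open>cnj (y x m) * y (\<lambda>j. \<Sum>k\<in>?I. A $$ (j,k) * x k) m = _\<close>
          by (simp only: sum_distrib_left mult.assoc)
      qed
      also have "\<dots> \<le> (\<Sum>k\<in>?I. (if k = m then 2 * (- \<delta> - \<eta>) * (r^m * (w m)^2) else 0)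
          + b * (\<tau> * (r^m * (w m)^2) + \<tau> * (r^k * (w k)^2)))"
      proof (rule sum_mono)
        fix k assume k: "k \<in> ?I"
        have nn: "0 \<le> b * (\<tau> * (r^m * (w m)^2) + \<tau> * (r^k * (w k)^2))"
          using b1 \<tau> r by auto
        consider "k = m" | "k < m" | "m < k" by linarith
        then show "2 * r^m * Re (cnj (y x m) * (T m k * y x k)) \<le> (if k = m then 2 * (- \<delta> - \<eta>) * (r^m * (w m)^2) else 0)
          + b * (\<tau> * (r^m * (w m)^2) + \<tau> * (r^k * (w k)^2))"
        proof cases
          case 1
          have "cnj (y x m) * (T m m * y x m) = T m m * complex_of_real ((w m)^2)"
            unfolding w_def complex_norm_square by (simp only: mult_ac)
          then have "Re (cnj (y x m) * (T m m * y x m)) = Re (T m m * complex_of_real ((w m)^2))"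
            by (rule arg_cong)
          also have "\<dots> = Re (T m m) * (w m)^2" by (simp only: Re_complex_of_real Im_complex_of_real times_complex.sel mult_zero_right diff_zero)
          finally have "2 * r^m * Re (cnj (y x m) * (T m m * y x m)) = 2 * (r^m * (w m)^2) * Re (T m m)"
            by (simp only: mult_ac)
          also have "\<dots> \<le> 2 * (r^m * (w m)^2) * (- \<delta> - \<eta>)"
            using \<eta>'[OF m] r by (intro mult_left_mono) auto
          finally have "2 * r^m * Re (cnj (y x m) * (T m m * y x m)) \<le> 2 * (- \<delta> - \<eta>) * (r^m * (w m)^2)"
            by (simp only: mult_ac)
          from add_mono[OF this nn] show ?thesis unfolding 1 by (simp only: add_0_right simp_thms if_True)
        next
          case 2
          then show ?thesis using T0[OF m 2] nn by simp
        next
          case 3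
          have "Re (cnj (y x m) * (T m k * y x k)) \<le> cmod (cnj (y x m) * (T m k * y x k))" by (rule complex_Re_le_cmod)
          also have "\<dots> = cmod (T m k) * (w m * w k)" unfolding w_def by (simp add: norm_mult)
          also have "\<dots> \<le> b * (w m * w k)" using bT[OF m, of k] k by (intro mult_right_mono) (auto simp: w_def)
          finally have "2 * r^m * Re (cnj (y x m) * (T m k * y x k)) \<le> 2 * r^m * (b * (w m * w k))"
            using r by (intro mult_left_mono) auto
          also have "\<dots> = b * r^m * (2 * (w m * w k))" by simp
          also have "\<dots> \<le> b * r^m * (\<tau> * (w m)^2 + \<tau> * r * (w k)^2)"
          proof (rule mult_left_mono)
            have "0 \<le> (\<tau> * w m - w k)^2 / \<tau>" using \<tau> by simp
            also have "(\<tau> * w m - w k)^2 / \<tau> = \<tau> * (w m)^2 - 2 * (w m * w k) + (w k)^2 / \<tau>"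
              using \<tau> by (simp add: field_simps power2_eq_square)
            finally have "2 * (w m * w k) \<le> \<tau> * (w m)^2 + (w k)^2 / \<tau>" by simp
            also have "(w k)^2 / \<tau> \<le> \<tau> * r * (w k)^2"
              using mult_right_mono[OF r(2), of "r * (w k)^2"] r(1) \<tau> by (simp add: field_simps)
            finally show "2 * (w m * w k) \<le> \<tau> * (w m)^2 + \<tau> * r * (w k)^2" by simp
          qed (use b1 r in auto)
          also have "\<dots> = b * (\<tau> * (r^m * (w m)^2) + \<tau> * (r^Suc m * (w k)^2))"
            by (simp add: algebra_simps)
          also have "\<dots> \<le> b * (\<tau> * (r^m * (w m)^2) + \<tau> * (r^k * (w k)^2))"
            using 3 r b1 \<tau> by (intro mult_left_mono add_left_mono mult_right_mono power_increasing) auto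
          finally show ?thesis using 3 by simp
        qed
      qed
      also have "\<dots> = 2 * (- \<delta> - \<eta>) * (r^m * (w m)^2) + (\<Sum>k\<in>?I. b * (\<tau> * (r^m * (w m)^2) + \<tau> * (r^k * (w k)^2)))"
        using m by (simp add: sum.distrib)
      finally show ?thesis .
    qed
    have V0: "V x \<ge> 0" unfolding V_def using r by (intro sum_nonneg) auto
    have Vw: "V x = (\<Sum>m\<in>?I. r^m * (w m)^2)" by (simp add: V_def w_def)
    have "2 * Re (\<Sum>m\<in>?I. complex_of_real (r^m) * (cnj (y x m) * y (\<lambda>j. \<Sum>k\<in>?I. A $$ (j,k) * x k) m))
        = (\<Sum>m\<in>?I. 2 * Re (complex_of_real (r^m) * (cnj (y x m) * y (\<lambda>j. \<Sum>k\<in>?I. A $$ (j,k) * x k) m)))"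
      by (simp only: Re_sum sum_distrib_left)
    also have "\<dots> \<le> (\<Sum>m\<in>?I. 2 * (- \<delta> - \<eta>) * (r^m * (w m)^2) + (\<Sum>k\<in>?I. b * (\<tau> * (r^m * (w m)^2) + \<tau> * (r^k * (w k)^2))))"
      by (intro sum_mono pm) auto
    also have "\<dots> = 2 * (- \<delta> - \<eta>) * V x + (real n * b * \<tau> * V x + real n * b * \<tau> * V x)"
    proof -
      have "(\<Sum>m\<in>?I. \<Sum>k\<in>?I. b * (\<tau> * (r^m * (w m)^2) + \<tau> * (r^k * (w k)^2)))
          = (\<Sum>m\<in>?I. real n * b * \<tau> * (r^m * (w m)^2) + b * \<tau> * V x)"
        unfolding Vw by (intro sum.cong refl) (simp add: sum.distrib sum_distrib_left algebra_simps)
      also have "\<dots> = real n * b * \<tau> * V x + real n * b * \<tau> * V x"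
        unfolding sum.distrib by (simp add: Vw sum_distrib_left mult_ac)
      finally show ?thesis by (simp only: sum.distrib Vw sum_distrib_left[symmetric])
    qed
    also have "real n * b * \<tau> * V x + real n * b * \<tau> * V x \<le> \<eta> * V x"
    proof -
      have "2 * (real n * b * \<tau>) \<le> 2 * ((real n + 1) * b * \<tau>)" using b1 \<tau> by simp
      also have "\<dots> = \<eta>"
      proof -
        have "(real n + 1) * b \<noteq> 0" using b1 by auto
        then show ?thesis unfolding \<tau>_def by (simp add: field_simps)
      qed
      finally have "2 * (real n * b * \<tau>) * V x \<le> \<eta> * V x" using V0 by (rule mult_right_mono)
      then show ?thesis by (simp only: mult_2 distrib_right)
    qed
    finally show ?thesis by (simp add: algebra_simps)
  qed
  \<comment> \<open>The minimum lets the same constant serve for coercivity, which needs a factor at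
    most 1, and for decay, which needs a factor at most \<open>\<eta>\<close>.\<close>
  define \<kappa> where "\<kappa> = min 1 \<eta> / Rn"
  have \<kappa>: "\<kappa> > 0" using \<eta> Rn by (simp add: \<kappa>_def)
  have low: "\<kappa> * (\<Sum>i\<in>?I. (x i)^2) \<le> min 1 \<eta> * V x" for x
  proof -
    have "\<kappa> * (\<Sum>i\<in>?I. (x i)^2) \<le> \<kappa> * (Rn * V x)" using lower \<kappa> by (intro mult_left_mono) auto
    then show ?thesis using Rn by (simp add: \<kappa>_def)
  qed
  have V0: "V x \<ge> 0" for x unfolding V_def using r by (intro sum_nonneg) auto
  show thesis
  proof (rule that[OF \<kappa> Ssym])
    fix x
    have "min 1 \<eta> * V x \<le> 1 * V x" using V0 by (intro mult_right_mono) auto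
    then show "\<kappa> * (\<Sum>i\<in>?I. (x i)^2) \<le> (\<Sum>i\<in>?I. \<Sum>j\<in>?I. S i j * x i * x j)"
      using low[of x] unfolding V by simp
    have "min 1 \<eta> * V x \<le> \<eta> * V x" using V0 by (intro mult_right_mono) auto
    then show "2 * (\<Sum>i\<in>?I. \<Sum>j\<in>?I. S i j * x i * (\<Sum>k\<in>?I. A $$ (j,k) * x k))
      + 2 * \<delta> * (\<Sum>i\<in>?I. \<Sum>j\<in>?I. S i j * x i * x j) \<le> - \<kappa> * (\<Sum>i\<in>?I. (x i)^2)"
      using low[of x] decay[of x] unfolding V form by linarith
  qed
qed

text \<open>Compactness of the unit sphere, realised inside the product space of functions supported
  on \<open>{..<n}\<close>.\<close>

lemma quadratic_form_coercive:
  fixes S :: "nat \<Rightarrow> nat \<Rightarrow> real"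
  assumes pos: "\<And>x. (\<exists>i<n. x i \<noteq> 0) \<Longrightarrow> 0 < (\<Sum>i\<in>{0..<n}. \<Sum>j\<in>{0..<n}. S i j * x i * x j)"
  obtains c where "c > 0" "\<And>x. c * (\<Sum>i\<in>{0..<n}. (x i)^2) \<le> (\<Sum>i\<in>{0..<n}. \<Sum>j\<in>{0..<n}. S i j * x i * x j)"
proof (cases "n = 0")
  case True
  then show ?thesis by (intro that[of 1]) auto
next
  case False
  define q where "q = (\<lambda>x. \<Sum>i\<in>{0..<n}. \<Sum>j\<in>{0..<n}. S i j * x i * x j)"
  define s where "s = (\<lambda>x::nat\<Rightarrow>real. \<Sum>i\<in>{0..<n}. (x i)^2)"
  define K where "K = (\<Pi>\<^sub>E i\<in>UNIV. if i < n then {-1..1} else {0::real})"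
  have "compactin (product_topology (\<lambda>i. euclidean) UNIV) K"
    unfolding K_def compactin_PiE by auto
  then have K: "compact K" by (simp add: euclidean_product_topology)
  have c: "continuous_on A q" "continuous_on A s" for A
    unfolding q_def s_def by (intro continuous_intros continuous_on_product_coordinates continuous_on_subset[OF continuous_on_product_coordinates]; simp)+
  have cl: "closed {x. s x = 1}"
    using continuous_closed_preimage_constant[OF c(2)[of UNIV], of 1] by simp
  define Z where "Z = K \<inter> {x. s x = 1}"
  have "compact Z" unfolding Z_def by (intro compact_Int_closed K cl)
  moreover have "(\<lambda>i. if i = 0 then 1 else 0) \<in> Z"
    using False by (auto simp: Z_def K_def s_def if_distrib[of "\<lambda>x. x^2"] cong: if_cong)
  ultimately obtain x0 where x0: "x0 \<in> Z" "\<And>x. x \<in> Z \<Longrightarrow> q x0 \<le> q x"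
    using continuous_attains_inf[of Z q] c by blast
  have "q x0 > 0"
  proof -
    have "\<exists>i<n. x0 i \<noteq> 0"
    proof (rule ccontr)
      assume "\<not> ?thesis"
      then have "s x0 = 0" by (simp add: s_def)
      then show False using x0(1) by (simp add: Z_def)
    qed
    then show ?thesis using pos unfolding q_def by blast
  qed
  moreover have "q x0 * s x \<le> q x" for x
  proof (cases "s x = 0")
    case True
    then have "x i = 0" if "i < n" for i using that unfolding s_def by (subst (asm) sum_nonneg_eq_0_iff) auto
    then show ?thesis using True by (simp add: q_def)
  next
    case False
    have s0: "s x \<ge> 0" for x unfolding s_def by (intro sum_nonneg) auto
    define t where "t = sqrt (s x)"
    have t: "t > 0" "t^2 = s x" using False s0[of x] by (auto simp: t_def)
    define x' where "x' = (\<lambda>i. if i < n then x i / t else 0)"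
    have sx': "s x' = 1"
    proof -
      have "s x' = (\<Sum>i\<in>{0..<n}. (x i)^2 / t^2)" unfolding s_def x'_def by (intro sum.cong) (auto simp: power_divide)
      also have "\<dots> = s x / t^2" by (simp add: s_def sum_divide_distrib)
      finally show ?thesis using t False by simp
    qed
    have "\<bar>x' i\<bar> \<le> 1" if "i < n" for i
    proof -
      have "(x' i)^2 \<le> s x'" unfolding s_def using that by (intro member_le_sum) auto
      then show ?thesis unfolding sx' by (simp add: abs_square_le_1)
    qed
    then have "- 1 \<le> x' i \<and> x' i \<le> 1" if "i < n" for i
      using that by (auto simp: abs_le_iff minus_le_iff)
    then have "x' \<in> K" by (auto simp: K_def PiE_iff) (simp add: x'_def)
    then have "q x0 \<le> q x'" using x0 sx' by (simp add: Z_def)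
    also have "q x' = q x / t^2"
      unfolding q_def sum_divide_distrib x'_def by (intro sum.cong refl) (auto simp: power2_eq_square)
    finally have "q x0 \<le> q x / t^2" .
    then have "q x0 * t^2 \<le> q x" using t(1) by (simp add: pos_le_divide_eq)
    then show ?thesis using t(2) by simp
  qed
  ultimately show thesis using that[of "q x0"] unfolding q_def s_def by blast
qed

section \<open>Block form of the constraints\<close>

lemma diagm_carrier [simp]: "diagm n f \<in> carrier_mat n n" "dim_row (diagm n f) = n" "dim_col (diagm n f) = n"
  by (auto simp: diagm_def)

lemma vec_append_assoc: "(a @\<^sub>v b) @\<^sub>v c = a @\<^sub>v (b @\<^sub>v c)"
  by (intro eq_vecI) auto

lemma scalar_prod_vec: "vec n f \<bullet> vec n g = (\<Sum>i\<in>{0..<n}. f i * g i)"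
  by (simp add: scalar_prod_def)

lemma mat_mult_vec: "mat m n a *\<^sub>v vec n x = vec m (\<lambda>i. \<Sum>j\<in>{0..<n}. a (i,j) * x j)"
  by (intro eq_vecI) (auto simp: scalar_prod_def)

lemma diagm_mult_vec: "diagm n f *\<^sub>v vec n x = vec n (\<lambda>i. f i * x i)"
  unfolding diagm_def mat_mult_vec
  by (intro eq_vecI) (auto simp: if_distrib[of "\<lambda>y. y * _"] cong: if_cong)

lemma hcat_mult_vec:
  assumes "X \<in> carrier_mat r n1" "Y \<in> carrier_mat r n2" "a \<in> carrier_vec n1" "b \<in> carrier_vec n2"
  shows "hcat X Y *\<^sub>v (a @\<^sub>v b) = X *\<^sub>v a + Y *\<^sub>v b"
proof -
  have "hcat X Y *\<^sub>v (a @\<^sub>v b) = (X *\<^sub>v a + Y *\<^sub>v b) @\<^sub>v (0\<^sub>m 0 n1 *\<^sub>v a + 0\<^sub>m 0 n2 *\<^sub>v b)"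
    unfolding hcat_def using assms by (subst four_block_mat_mult_vec[of _ r n1 _ n2 _ 0]) auto
  also have "\<dots> = X *\<^sub>v a + Y *\<^sub>v b"
    using assms by (intro eq_vecI) auto
  finally show ?thesis .
qed

lemma hcat_carrier:
  assumes "X \<in> carrier_mat r n1" "Y \<in> carrier_mat r n2"
  shows "hcat X Y \<in> carrier_mat r (n1 + n2)"
  using assms unfolding hcat_def by auto

text \<open>The block order of \<open>Fm\<close>. In the application \<open>m = N0\<close> and
  \<open>k = N - N0\<close>: the four blocks are predictor and observation error for the controlled
  modes, then predictor and observation error for the remaining observed modes, the latter two
  rescaled by \<open>lam\<close>.\<close>

definition stack4 :: "nat \<Rightarrow> nat \<Rightarrow> (nat \<Rightarrow> real) \<Rightarrow> (nat \<Rightarrow> real) \<Rightarrow> (nat \<Rightarrow> real) \<Rightarrow> (nat \<Rightarrow> real) \<Rightarrow> real vec" where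
  "stack4 m k x1 x2 x3 x4 = (vec m x1 @\<^sub>v vec m x2) @\<^sub>v (vec k x3 @\<^sub>v vec k x4)"

lemma stack4_carrier [simp]: "stack4 m k x1 x2 x3 x4 \<in> carrier_vec ((m + m) + (k + k))"
  unfolding stack4_def by (intro append_carrier_vec vec_carrier)

lemma stack4_scalar_prod:
  "stack4 m k x1 x2 x3 x4 \<bullet> stack4 m k y1 y2 y3 y4 = (\<Sum>i\<in>{0..<m}. x1 i * y1 i) + (\<Sum>i\<in>{0..<m}. x2 i * y2 i)
     + (\<Sum>i\<in>{0..<k}. x3 i * y3 i) + (\<Sum>i\<in>{0..<k}. x4 i * y4 i)"
  unfolding stack4_def
  by (simp add: scalar_prod_append[of _ "m+m" _ "k+k"] scalar_prod_append[of _ m _ m] scalar_prod_append[of _ k _ k]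
      append_carrier_vec scalar_prod_vec)

lemma stack4_add:
  "stack4 m k x1 x2 x3 x4 + stack4 m k y1 y2 y3 y4
    = stack4 m k (\<lambda>i. x1 i + y1 i) (\<lambda>i. x2 i + y2 i) (\<lambda>i. x3 i + y3 i) (\<lambda>i. x4 i + y4 i)"
  unfolding stack4_def by (intro eq_vecI) auto

lemma stack4_cong:
  assumes "\<And>i. i < m \<Longrightarrow> x1 i = y1 i" "\<And>i. i < m \<Longrightarrow> x2 i = y2 i" "\<And>i. i < k \<Longrightarrow> x3 i = y3 i" "\<And>i. i < k \<Longrightarrow> x4 i = y4 i"
  shows "stack4 m k x1 x2 x3 x4 = stack4 m k y1 y2 y3 y4"
  unfolding stack4_def using assms by (intro eq_vecI) auto

lemma ex_stack4:
  assumes "v \<in> carrier_vec ((m + m) + (k + k) + 1)"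
  obtains x1 x2 x3 x4 \<zeta> where "v = stack4 m k x1 x2 x3 x4 @\<^sub>v vec 1 (\<lambda>_. \<zeta>)"
proof
  show "v = stack4 m k (\<lambda>i. v $ i) (\<lambda>i. v $ (m + i)) (\<lambda>i. v $ (m + m + i)) (\<lambda>i. v $ (m + m + k + i))
      @\<^sub>v vec 1 (\<lambda>_. v $ (m + m + k + k))"
    unfolding stack4_def using assms
    by (intro eq_vecI) (auto simp: less_Suc_eq add.assoc)
qed

text \<open>The closed-loop vector field \<open>F X + \<L> \<zeta>\<close> written on the blocks of \<open>X\<close>; \<open>k\<close> stands
  for the feedback value \<open>K x1\<close> and \<open>e\<close> for the innovation \<open>C0 x2 + C1 x4 + \<zeta>\<close>.\<close>

definition feedback_val :: "(nat \<Rightarrow> real) \<Rightarrow> nat \<Rightarrow> (nat \<Rightarrow> real) \<Rightarrow> real" where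
  "feedback_val K N0 x1 = (\<Sum>j\<in>{0..<N0}. K (j+1) * x1 j)"

definition innovation :: "(nat \<Rightarrow> real) \<Rightarrow> (nat \<Rightarrow> real) \<Rightarrow> nat \<Rightarrow> nat \<Rightarrow> (nat \<Rightarrow> real) \<Rightarrow> (nat \<Rightarrow> real) \<Rightarrow> real \<Rightarrow> real" where
  "innovation lam c N0 N x2 x4 \<zeta> = (\<Sum>j\<in>{0..<N0}. c (j+1) * x2 j)
     + (\<Sum>j\<in>{0..<N-N0}. c (N0+j+1) / lam (N0+j+1) * x4 j) + \<zeta>"

context
  fixes lam :: "nat \<Rightarrow> real" and qc :: real and bet c K l :: "nat \<Rightarrow> real" and N0 N :: nat and h :: real
begin

definition field1 :: "(nat \<Rightarrow> real) \<Rightarrow> real \<Rightarrow> real \<Rightarrow> nat \<Rightarrow> real" where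
  "field1 x1 k e i = (- lam (i+1) + qc) * x1 i + bet (i+1) * k + exp ((- lam (i+1) + qc) * h) * l (i+1) * e"
definition field2 :: "(nat \<Rightarrow> real) \<Rightarrow> real \<Rightarrow> nat \<Rightarrow> real" where
  "field2 x2 e i = (- lam (i+1) + qc) * x2 i - l (i+1) * e"
definition field3 :: "(nat \<Rightarrow> real) \<Rightarrow> real \<Rightarrow> nat \<Rightarrow> real" where
  "field3 x3 k j = (- lam (N0+j+1) + qc) * x3 j + bet (N0+j+1) / lam (N0+j+1) * k"
definition field4 :: "(nat \<Rightarrow> real) \<Rightarrow> nat \<Rightarrow> real" where
  "field4 x4 j = (- lam (N0+j+1) + qc) * x4 j"

lemma diagm_mult_col: "diagm n f * mat n 1 g = mat n 1 (\<lambda>(i,j). f i * g (i,j))"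
  unfolding diagm_def
  by (intro eq_matI) (auto simp: scalar_prod_def if_distrib[of "\<lambda>y. y * _"] cong: if_cong)

lemma col_mult_row: "mat n 1 a * mat 1 m b = mat n m (\<lambda>(i,j). a (i,0) * b (0,j))"
  by (intro eq_matI) (auto simp: scalar_prod_def)

lemma A0B0K_mult_vec:
  "(A0m lam qc N0 + B0m bet N0 * Km K N0) *\<^sub>v vec N0 x1
    = vec N0 (\<lambda>i. (- lam (i+1) + qc) * x1 i + bet (i+1) * feedback_val K N0 x1)"
proof -
  have "(A0m lam qc N0 + B0m bet N0 * Km K N0) *\<^sub>v vec N0 x1
      = A0m lam qc N0 *\<^sub>v vec N0 x1 + (B0m bet N0 * Km K N0) *\<^sub>v vec N0 x1"
    unfolding A0m_def B0m_def Km_def col_mult_row by (intro add_mult_distrib_mat_vec[of _ N0 N0]) auto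
  then show ?thesis
    unfolding A0m_def B0m_def Km_def col_mult_row diagm_mult_vec mat_mult_vec feedback_val_def
    by (intro eq_vecI) (auto simp: sum_distrib_left mult_ac)
qed

lemma A0LC0_mult_vec:
  "(A0m lam qc N0 - Lm l N0 * C0m c N0) *\<^sub>v vec N0 x2
    = vec N0 (\<lambda>i. (- lam (i+1) + qc) * x2 i - l (i+1) * (\<Sum>j\<in>{0..<N0}. c (j+1) * x2 j))"
proof -
  have "(A0m lam qc N0 - Lm l N0 * C0m c N0) *\<^sub>v vec N0 x2
      = A0m lam qc N0 *\<^sub>v vec N0 x2 - (Lm l N0 * C0m c N0) *\<^sub>v vec N0 x2"
    unfolding A0m_def Lm_def C0m_def col_mult_row by (intro minus_mult_distrib_mat_vec[of _ N0 N0]) auto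
  then show ?thesis
    unfolding A0m_def Lm_def C0m_def col_mult_row diagm_mult_vec mat_mult_vec
    by (intro eq_vecI) (auto simp: sum_distrib_left mult_ac)
qed

lemma Fm_mult_vec:
  "Fm lam qc bet c K l N0 N h *\<^sub>v stack4 N0 (N - N0) x1 x2 x3 x4
     + Lcalm lam qc l N0 N h *\<^sub>v vec 1 (\<lambda>_. \<zeta>)
   = (let k = feedback_val K N0 x1; e = innovation lam c N0 N x2 x4 \<zeta> in
      stack4 N0 (N - N0) (field1 x1 k e) (field2 x2 e) (field3 x3 k) (field4 x4))" if N: "N0 \<le> N"
proof -
  define M where "M = N - N0"
  define A0 E0 B0 K' L C0 A1 C1 B1 where "A0 = A0m lam qc N0" and "E0 = eA0hm lam qc N0 h" and "B0 = B0m bet N0"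
    and "K' = Km K N0" and "L = Lm l N0" and "C0 = C0m c N0" and "A1 = A1m lam qc N0 N"
    and "C1 = C1tm lam c N0 N" and "B1 = B1tm lam bet N0 N"
  note defs = A0_def E0_def B0_def K'_def L_def C0_def A1_def C1_def B1_def
  have car: "A0 \<in> carrier_mat N0 N0" "E0 \<in> carrier_mat N0 N0" "B0 \<in> carrier_mat N0 1" "K' \<in> carrier_mat 1 N0"
    "L \<in> carrier_mat N0 1" "C0 \<in> carrier_mat 1 N0" "A1 \<in> carrier_mat M M" "C1 \<in> carrier_mat 1 M" "B1 \<in> carrier_mat M 1"
    unfolding defs M_def A0m_def eA0hm_def B0m_def Km_def Lm_def C0m_def A1m_def C1tm_def B1tm_def by auto
  define v1 v2 v3 v4 where "v1 = vec N0 x1" and "v2 = vec N0 x2" and "v3 = vec M x3" and "v4 = vec M x4"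
  have vc: "v1 \<in> carrier_vec N0" "v2 \<in> carrier_vec N0" "v3 \<in> carrier_vec M" "v4 \<in> carrier_vec M"
    by (auto simp: v1_def v2_def v3_def v4_def)
  define s0 where "s0 = (\<Sum>j\<in>{0..<N0}. c (j+1) * x2 j)"
  define s1 where "s1 = (\<Sum>j\<in>{0..<M}. c (N0+j+1) / lam (N0+j+1) * x4 j)"
  define k where "k = feedback_val K N0 x1"
  have EL: "E0 * L = mat N0 1 (\<lambda>(i,j). exp ((- lam (i+1) + qc) * h) * l (i+1))"
    unfolding E0_def L_def eA0hm_def Lm_def diagm_mult_col by (intro eq_matI) auto
  have p1: "(A0 + B0 * K') *\<^sub>v v1 = vec N0 (\<lambda>i. (- lam (i+1) + qc) * x1 i + bet (i+1) * k)"
    unfolding A0_def B0_def K'_def v1_def k_def by (rule A0B0K_mult_vec)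
  have p2: "(E0 * L * C0) *\<^sub>v v2 = vec N0 (\<lambda>i. exp ((- lam (i+1) + qc) * h) * l (i+1) * s0)"
    unfolding EL C0_def C0m_def col_mult_row v2_def mat_mult_vec s0_def by (intro eq_vecI) (auto simp: sum_distrib_left mult_ac)
  have p4: "(E0 * L * C1) *\<^sub>v v4 = vec N0 (\<lambda>i. exp ((- lam (i+1) + qc) * h) * l (i+1) * s1)"
    unfolding EL C1_def C1tm_def M_def[symmetric] col_mult_row v4_def mat_mult_vec s1_def by (intro eq_vecI) (auto simp: sum_distrib_left mult_ac)
  have q2: "(A0 - L * C0) *\<^sub>v v2 = vec N0 (\<lambda>i. (- lam (i+1) + qc) * x2 i - l (i+1) * s0)"
    unfolding A0_def L_def C0_def v2_def s0_def by (rule A0LC0_mult_vec)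
  have LC1: "L * C1 = mat N0 M (\<lambda>(i,j). l (i+1) * (c (N0+j+1) / lam (N0+j+1)))"
    unfolding L_def Lm_def C1_def C1tm_def M_def[symmetric] col_mult_row by (intro eq_matI) auto
  have q4: "(- (L * C1)) *\<^sub>v v4 = vec N0 (\<lambda>i. - l (i+1) * s1)"
    unfolding LC1 v4_def s1_def
    by (intro eq_vecI) (auto simp: scalar_prod_def sum_distrib_left sum_negf[symmetric] mult_ac)
  have r1: "(B1 * K') *\<^sub>v v1 = vec M (\<lambda>j. bet (N0+j+1) / lam (N0+j+1) * k)"
    unfolding B1_def B1tm_def M_def[symmetric] K'_def Km_def col_mult_row v1_def mat_mult_vec k_def feedback_val_def
    by (intro eq_vecI) (auto simp: sum_distrib_left sum_divide_distrib mult_ac)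
  have r3: "A1 *\<^sub>v v3 = vec M (\<lambda>j. (- lam (N0+j+1) + qc) * x3 j)"
    "A1 *\<^sub>v v4 = vec M (\<lambda>j. (- lam (N0+j+1) + qc) * x4 j)"
    unfolding A1_def A1m_def M_def[symmetric] v3_def v4_def by (rule diagm_mult_vec)+
  have F: "Fm lam qc bet c K l N0 N h = four_block_mat
       (four_block_mat (A0 + B0 * K') (E0 * L * C0) (0\<^sub>m N0 N0) (A0 - L * C0))
       (four_block_mat (0\<^sub>m N0 M) (E0 * L * C1) (0\<^sub>m N0 M) (- (L * C1)))
       (four_block_mat (B1 * K') (0\<^sub>m M N0) (0\<^sub>m M N0) (0\<^sub>m M N0))
       (four_block_mat A1 (0\<^sub>m M M) (0\<^sub>m M M) A1)"
    unfolding Fm_def Let_def defs M_def ..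
  have c2: "A0 + B0 * K' \<in> carrier_mat N0 N0" "E0 * L * C0 \<in> carrier_mat N0 N0" "A0 - L * C0 \<in> carrier_mat N0 N0"
    "E0 * L * C1 \<in> carrier_mat N0 M" "- (L * C1) \<in> carrier_mat N0 M" "B1 * K' \<in> carrier_mat M N0"
    using car by auto
  note z = zero_carrier_mat
  have "Fm lam qc bet c K l N0 N h *\<^sub>v ((v1 @\<^sub>v v2) @\<^sub>v (v3 @\<^sub>v v4)) =
     ((((A0 + B0 * K') *\<^sub>v v1 + (E0 * L * C0) *\<^sub>v v2) @\<^sub>v (0\<^sub>m N0 N0 *\<^sub>v v1 + (A0 - L * C0) *\<^sub>v v2))
       + ((0\<^sub>m N0 M *\<^sub>v v3 + (E0 * L * C1) *\<^sub>v v4) @\<^sub>v (0\<^sub>m N0 M *\<^sub>v v3 + (- (L * C1)) *\<^sub>v v4))) @\<^sub>v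
     ((((B1 * K') *\<^sub>v v1 + 0\<^sub>m M N0 *\<^sub>v v2) @\<^sub>v (0\<^sub>m M N0 *\<^sub>v v1 + 0\<^sub>m M N0 *\<^sub>v v2))
       + ((A1 *\<^sub>v v3 + 0\<^sub>m M M *\<^sub>v v4) @\<^sub>v (0\<^sub>m M M *\<^sub>v v3 + A1 *\<^sub>v v4)))"
    unfolding F
    by (subst four_block_mat_mult_vec[OF four_block_carrier_mat[OF c2(1) c2(3)] four_block_carrier_mat[OF z c2(5)]
        four_block_carrier_mat[OF c2(6) z] four_block_carrier_mat[OF car(7) car(7)]
        append_carrier_vec[OF vc(1,2)] append_carrier_vec[OF vc(3,4)]])
      (simp only: four_block_mat_mult_vec[OF c2(1,2) z c2(3) vc(1,2)] four_block_mat_mult_vec[OF z c2(4) z c2(5) vc(3,4)]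
          four_block_mat_mult_vec[OF c2(6) z z z vc(1,2)] four_block_mat_mult_vec[OF car(7) z z car(7) vc(3,4)])
  moreover have "0\<^sub>m n m *\<^sub>v w = 0\<^sub>v n" if "w \<in> carrier_vec m" for n m and w :: "real vec"
    using that by (intro eq_vecI) (auto simp: scalar_prod_def)
  ultimately have Fv: "Fm lam qc bet c K l N0 N h *\<^sub>v ((v1 @\<^sub>v v2) @\<^sub>v (v3 @\<^sub>v v4)) =
     (((vec N0 (\<lambda>i. (- lam (i+1) + qc) * x1 i + bet (i+1) * k) + vec N0 (\<lambda>i. exp ((- lam (i+1) + qc) * h) * l (i+1) * s0))
       @\<^sub>v (0\<^sub>v N0 + vec N0 (\<lambda>i. (- lam (i+1) + qc) * x2 i - l (i+1) * s0)))
       + ((0\<^sub>v N0 + vec N0 (\<lambda>i. exp ((- lam (i+1) + qc) * h) * l (i+1) * s1)) @\<^sub>v (0\<^sub>v N0 + vec N0 (\<lambda>i. - l (i+1) * s1)))) @\<^sub>v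
     (((vec M (\<lambda>j. bet (N0+j+1) / lam (N0+j+1) * k) + 0\<^sub>v M) @\<^sub>v (0\<^sub>v M + 0\<^sub>v M))
       + ((vec M (\<lambda>j. (- lam (N0+j+1) + qc) * x3 j) + 0\<^sub>v M) @\<^sub>v (0\<^sub>v M + vec M (\<lambda>j. (- lam (N0+j+1) + qc) * x4 j))))"
    by (simp only: p1 p2 p4 q2 q4 r1 r3 vc)
  have Lv: "Lcalm lam qc l N0 N h *\<^sub>v vec 1 (\<lambda>_. \<zeta>) = stack4 N0 M (\<lambda>i. exp ((- lam (i+1) + qc) * h) * l (i+1) * \<zeta>)
      (\<lambda>i. - l (i+1) * \<zeta>) (\<lambda>_. 0) (\<lambda>_. 0)"
    unfolding Lcalm_def mat_mult_vec stack4_def using N by (intro eq_vecI) (auto simp: M_def)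
  have "Fm lam qc bet c K l N0 N h *\<^sub>v ((v1 @\<^sub>v v2) @\<^sub>v (v3 @\<^sub>v v4)) =
     stack4 N0 M (\<lambda>i. (- lam (i+1) + qc) * x1 i + bet (i+1) * k + exp ((- lam (i+1) + qc) * h) * l (i+1) * (s0 + s1))
      (\<lambda>i. (- lam (i+1) + qc) * x2 i - l (i+1) * (s0 + s1))
      (\<lambda>j. (- lam (N0+j+1) + qc) * x3 j + bet (N0+j+1) / lam (N0+j+1) * k) (\<lambda>j. (- lam (N0+j+1) + qc) * x4 j)"
    unfolding Fv stack4_def by (intro eq_vecI) (auto simp: algebra_simps)
  then have res: "Fm lam qc bet c K l N0 N h *\<^sub>v stack4 N0 M x1 x2 x3 x4
     + Lcalm lam qc l N0 N h *\<^sub>v vec 1 (\<lambda>_. \<zeta>) = stack4 N0 M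
      (\<lambda>i. (- lam (i+1) + qc) * x1 i + bet (i+1) * k + exp ((- lam (i+1) + qc) * h) * l (i+1) * (s0 + s1)
         + exp ((- lam (i+1) + qc) * h) * l (i+1) * \<zeta>)
      (\<lambda>i. (- lam (i+1) + qc) * x2 i - l (i+1) * (s0 + s1) + - l (i+1) * \<zeta>)
      (\<lambda>j. (- lam (N0+j+1) + qc) * x3 j + bet (N0+j+1) / lam (N0+j+1) * k + 0) (\<lambda>j. (- lam (N0+j+1) + qc) * x4 j + 0)"
    unfolding stack4_add[symmetric] Lv unfolding stack4_def[of N0 M x1 x2 x3 x4] v1_def v2_def v3_def v4_def by simp
  have inn: "innovation lam c N0 N x2 x4 \<zeta> = s0 + s1 + \<zeta>"
    by (simp add: innovation_def s0_def s1_def M_def)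
  show ?thesis
    unfolding Let_def M_def[symmetric] k_def[symmetric] inn res
    by (intro stack4_cong) (simp_all add: field1_def field2_def field3_def field4_def algebra_simps)
qed

text \<open>The row \<open>E\<close>, applied to the state and the residual, is \<open>K\<close>
  times the predictor component of the vector field, that is, the time derivative of the control.
  The term with \<open>E\<close> in the first constraint thus accounts for the input
  \<open>b n * u'\<close> of the homogenised modes.\<close>

lemma Em_mult_vec:
  assumes N: "N0 \<le> N"
  shows "Em lam qc bet c K l N0 N h *\<^sub>v (stack4 N0 (N - N0) x1 x2 x3 x4 @\<^sub>v vec 1 (\<lambda>_. \<zeta>))
    = vec 1 (\<lambda>_. \<Sum>i\<in>{0..<N0}. K (i+1) * field1 x1 (feedback_val K N0 x1) (innovation lam c N0 N x2 x4 \<zeta>) i)"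
    (is "_ = vec 1 (\<lambda>_. ?rhs)")
proof -
  define M where "M = N - N0"
  define A0 E0 B0 K' L C0 C1 where "A0 = A0m lam qc N0" and "E0 = eA0hm lam qc N0 h" and "B0 = B0m bet N0"
    and "K' = Km K N0" and "L = Lm l N0" and "C0 = C0m c N0" and "C1 = C1tm lam c N0 N"
  note defs = A0_def E0_def B0_def K'_def L_def C0_def C1_def
  have car: "A0 \<in> carrier_mat N0 N0" "E0 \<in> carrier_mat N0 N0" "B0 \<in> carrier_mat N0 1" "K' \<in> carrier_mat 1 N0"
    "L \<in> carrier_mat N0 1" "C0 \<in> carrier_mat 1 N0" "C1 \<in> carrier_mat 1 M"
    unfolding defs M_def A0m_def eA0hm_def B0m_def Km_def Lm_def C0m_def C1tm_def by auto
  define v1 v2 v3 v4 z where "v1 = vec N0 x1" and "v2 = vec N0 x2" and "v3 = vec M x3" and "v4 = vec M x4"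
    and "z = vec 1 (\<lambda>_::nat. \<zeta>)"
  have vc: "v1 \<in> carrier_vec N0" "v2 \<in> carrier_vec N0" "v3 \<in> carrier_vec M" "v4 \<in> carrier_vec M" "z \<in> carrier_vec 1"
    by (auto simp: v1_def v2_def v3_def v4_def z_def)
  define s0 where "s0 = (\<Sum>j\<in>{0..<N0}. c (j+1) * x2 j)"
  define s1 where "s1 = (\<Sum>j\<in>{0..<M}. c (N0+j+1) / lam (N0+j+1) * x4 j)"
  define k where "k = feedback_val K N0 x1"
  have EL: "E0 * L = mat N0 1 (\<lambda>(i,j). exp ((- lam (i+1) + qc) * h) * l (i+1))"
    unfolding E0_def L_def eA0hm_def Lm_def diagm_mult_col by (intro eq_matI) auto
  have p1: "(A0 + B0 * K') *\<^sub>v v1 = vec N0 (\<lambda>i. (- lam (i+1) + qc) * x1 i + bet (i+1) * k)"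
    unfolding A0_def B0_def K'_def v1_def k_def by (rule A0B0K_mult_vec)
  have p2: "(E0 * L * C0) *\<^sub>v v2 = vec N0 (\<lambda>i. exp ((- lam (i+1) + qc) * h) * l (i+1) * s0)"
    unfolding EL C0_def C0m_def col_mult_row v2_def mat_mult_vec s0_def by (intro eq_vecI) (auto simp: sum_distrib_left mult_ac)
  have p3: "0\<^sub>m N0 M *\<^sub>v v3 = 0\<^sub>v N0" using vc by (intro eq_vecI) (auto simp: scalar_prod_def)
  have p4: "(E0 * L * C1) *\<^sub>v v4 = vec N0 (\<lambda>i. exp ((- lam (i+1) + qc) * h) * l (i+1) * s1)"
    unfolding EL C1_def C1tm_def M_def[symmetric] col_mult_row v4_def mat_mult_vec s1_def by (intro eq_vecI) (auto simp: sum_distrib_left mult_ac)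
  have p5: "(E0 * L) *\<^sub>v z = vec N0 (\<lambda>i. exp ((- lam (i+1) + qc) * h) * l (i+1) * \<zeta>)"
    unfolding EL z_def mat_mult_vec by (intro eq_vecI) auto
  have c2: "A0 + B0 * K' \<in> carrier_mat N0 N0" "E0 * L * C0 \<in> carrier_mat N0 N0"
    "E0 * L * C1 \<in> carrier_mat N0 M" "E0 * L \<in> carrier_mat N0 1"
    using car by auto
  note z = zero_carrier_mat[of N0 M]
  note h4 = hcat_carrier[OF c2(3,4)] and h3 = hcat_carrier[OF z hcat_carrier[OF c2(3,4)]]
  note h2 = hcat_carrier[OF c2(2) h3]
  note h1 = hcat_carrier[OF c2(1) h2]
  note a4 = append_carrier_vec[OF vc(4,5)]
  note a3 = append_carrier_vec[OF vc(3) a4]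
  note a2 = append_carrier_vec[OF vc(2) a3]
  note a1 = append_carrier_vec[OF vc(1) a2]
  have E: "Em lam qc bet c K l N0 N h = K' * hcat (A0 + B0 * K') (hcat (E0 * L * C0) (hcat (0\<^sub>m N0 M)
            (hcat (E0 * L * C1) (E0 * L))))"
    unfolding Em_def Let_def defs M_def ..
  have "Em lam qc bet c K l N0 N h *\<^sub>v (v1 @\<^sub>v (v2 @\<^sub>v (v3 @\<^sub>v (v4 @\<^sub>v z))))
    = K' *\<^sub>v (vec N0 (\<lambda>i. (- lam (i+1) + qc) * x1 i + bet (i+1) * k)
       + (vec N0 (\<lambda>i. exp ((- lam (i+1) + qc) * h) * l (i+1) * s0) + (0\<^sub>v N0
       + (vec N0 (\<lambda>i. exp ((- lam (i+1) + qc) * h) * l (i+1) * s1) + vec N0 (\<lambda>i. exp ((- lam (i+1) + qc) * h) * l (i+1) * \<zeta>)))))"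
    unfolding E assoc_mult_mat_vec[OF car(4) h1 a1]
    by (simp only: hcat_mult_vec[OF c2(1) h2 vc(1) a2] hcat_mult_vec[OF c2(2) h3 vc(2) a3]
        hcat_mult_vec[OF z h4 vc(3) a4] hcat_mult_vec[OF c2(3,4) vc(4,5)] p1 p2 p3 p4 p5)
  also have "\<dots> = K' *\<^sub>v vec N0 (field1 x1 k (innovation lam c N0 N x2 x4 \<zeta>))"
  proof -
    have inn: "innovation lam c N0 N x2 x4 \<zeta> = s0 + s1 + \<zeta>"
      by (simp add: innovation_def s0_def s1_def M_def)
    show ?thesis unfolding inn
      by (rule arg_cong[where f = "mult_mat_vec K'"], intro eq_vecI) (auto simp: field1_def algebra_simps)
  qed
  also have "\<dots> = vec 1 (\<lambda>_. ?rhs)"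
    unfolding K'_def Km_def mat_mult_vec k_def by (intro eq_vecI) auto
  finally show ?thesis
    unfolding stack4_def vec_append_assoc M_def[symmetric] v1_def v2_def v3_def v4_def z_def .
qed

lemma Ktm_mult_vec:
  assumes N: "N0 \<le> N"
  shows "Ktm K N0 N *\<^sub>v stack4 N0 (N - N0) x1 x2 x3 x4 = vec 1 (\<lambda>_. feedback_val K N0 x1)"
proof -
  have s: "stack4 N0 (N - N0) x1 x2 x3 x4 = vec (2*N) (\<lambda>j. stack4 N0 (N - N0) x1 x2 x3 x4 $ j)"
    unfolding stack4_def using N by (intro eq_vecI) auto
  have "(\<Sum>j\<in>{0..<2*N}. (if j < N0 then K (j+1) else 0) * stack4 N0 (N - N0) x1 x2 x3 x4 $ j) = feedback_val K N0 x1"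
    unfolding feedback_val_def using N
    by (intro sum.mono_neutral_cong_right) (auto simp: stack4_def)
  then show ?thesis
    by (subst s, unfold Ktm_def mat_mult_vec) (intro eq_vecI, auto)
qed

lemma scalar_prod_transpose_mult:
  fixes A :: "real mat"
  assumes "A \<in> carrier_mat m n" "x \<in> carrier_vec n" "y \<in> carrier_vec m"
  shows "x \<bullet> (transpose_mat A *\<^sub>v y) = (A *\<^sub>v x) \<bullet> y"
proof -
  have "x \<bullet> (transpose_mat A *\<^sub>v y) = (transpose_mat A *\<^sub>v y) \<bullet> x"
    using assms by (intro comm_scalar_prod[of _ n]) auto
  also have "\<dots> = y \<bullet> (A *\<^sub>v x)" by (rule transpose_vec_mult_scalar[OF assms])
  also have "\<dots> = (A *\<^sub>v x) \<bullet> y" using assms by (intro comm_scalar_prod[of _ m]) auto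
  finally show ?thesis .
qed

text \<open>Symmetry of \<open>P\<close> merges the Lyapunov terms and the two off-diagonal blocks
  into twice the pairing of the vector field with \<open>P X\<close>. This one evaluation serves in
  both directions: to verify the constraint when \<open>P\<close> is constructed, and to extract a
  decay rate when the constraint is assumed.\<close>

lemma Theta1_form:
  assumes N: "N0 \<le> N" and P: "P \<in> carrier_mat (2*N) (2*N)" and Pt: "transpose_mat P = P"
    and k: "k = feedback_val K N0 x1" and e: "e = innovation lam c N0 N x2 x4 \<zeta>"
    and X: "X = stack4 N0 (N - N0) x1 x2 x3 x4"
    and Y: "Y = stack4 N0 (N - N0) (field1 x1 k e) (field2 x2 e) (field3 x3 k) (field4 x4)"
  shows "Theta1 lam qc bet c K l N0 N h \<delta> ra rb P \<alpha> \<beta> \<gamma> \<in> carrier_mat (2*N+1) (2*N+1)"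
    and "(X @\<^sub>v vec 1 (\<lambda>_. \<zeta>)) \<bullet> (Theta1 lam qc bet c K l N0 N h \<delta> ra rb P \<alpha> \<beta> \<gamma> *\<^sub>v (X @\<^sub>v vec 1 (\<lambda>_. \<zeta>)))
      = 2 * (Y \<bullet> (P *\<^sub>v X)) + 2 * \<delta> * (X \<bullet> (P *\<^sub>v X)) + \<alpha> * \<gamma> * ra * k^2 - \<beta> * exp (- 2 * \<delta> * h) * \<zeta>^2
        + \<alpha> * \<gamma> * rb * (\<Sum>i\<in>{0..<N0}. K (i+1) * field1 x1 k e i)^2"
proof -
  define n where "n = 2 * N"
  define F Lc Kt E where "F = Fm lam qc bet c K l N0 N h" and "Lc = Lcalm lam qc l N0 N h"
    and "Kt = Ktm K N0 N" and "E = Em lam qc bet c K l N0 N h"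
  have nM: "(N0 + N0) + ((N - N0) + (N - N0)) = n" using N by (simp add: n_def)
  have F: "F \<in> carrier_mat n n"
    unfolding F_def Fm_def Let_def nM[symmetric]
    by (auto simp: A0m_def A1m_def B0m_def Km_def Lm_def C0m_def intro!: four_block_carrier_mat add_carrier_mat minus_carrier_mat)
  have Lc: "Lc \<in> carrier_mat n 1" by (auto simp: Lc_def Lcalm_def n_def)
  have Kt: "Kt \<in> carrier_mat 1 n" by (auto simp: Kt_def Ktm_def n_def)
  have E: "E \<in> carrier_mat 1 (n + 1)"
    unfolding E_def Em_def Let_def hcat_def nM[symmetric]
    by (auto simp: A0m_def A1m_def Km_def Lm_def C0m_def C1tm_def eA0hm_def B0m_def)
  define z where "z = vec 1 (\<lambda>_::nat. \<zeta>)"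
  have z: "z \<in> carrier_vec 1" by (simp add: z_def)
  have Xc: "X \<in> carrier_vec n" using stack4_carrier[of N0 "N - N0"] unfolding X nM by blast
  define TL where "TL = transpose_mat F * P + P * F + (2 * \<delta>) \<cdot>\<^sub>m P + (\<alpha> * \<gamma> * ra) \<cdot>\<^sub>m (transpose_mat Kt * Kt)"
  define BR where "BR = mat 1 1 (\<lambda>_::nat\<times>nat. - \<beta> * exp (- 2 * \<delta> * h))"
  define T where "T = four_block_mat TL (P * Lc) (transpose_mat Lc * P) BR"
  have P': "P \<in> carrier_mat n n" using P by (simp add: n_def)
  have TL: "TL \<in> carrier_mat n n" using F P' Kt by (auto simp: TL_def)
  have PL: "P * Lc \<in> carrier_mat n 1" "transpose_mat Lc * P \<in> carrier_mat 1 n" using P' Lc by auto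
  have BR: "BR \<in> carrier_mat 1 1" by (simp add: BR_def)
  have T: "T \<in> carrier_mat (n+1) (n+1)" unfolding T_def by (rule four_block_carrier_mat[OF TL BR])
  have EE: "transpose_mat E * E \<in> carrier_mat (n+1) (n+1)" using E by auto
  have Th: "Theta1 lam qc bet c K l N0 N h \<delta> ra rb P \<alpha> \<beta> \<gamma> = T + (\<alpha> * \<gamma> * rb) \<cdot>\<^sub>m (transpose_mat E * E)"
    unfolding Theta1_def Let_def T_def TL_def BR_def F_def Lc_def Kt_def E_def ..
  show "Theta1 lam qc bet c K l N0 N h \<delta> ra rb P \<alpha> \<beta> \<gamma> \<in> carrier_mat (2*N+1) (2*N+1)"
    unfolding Th using T EE by (simp add: n_def)
  define v where "v = X @\<^sub>v z"
  have v: "v \<in> carrier_vec (n+1)" unfolding v_def by (rule append_carrier_vec[OF Xc z])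
  have PX: "P *\<^sub>v X \<in> carrier_vec n" using P' Xc by auto
  have smult: "(a \<cdot>\<^sub>m A) *\<^sub>v w = a \<cdot>\<^sub>v (A *\<^sub>v w)" if "A \<in> carrier_mat r s" "w \<in> carrier_vec s" for a r s and A :: "real mat" and w
    using that by (intro eq_vecI) auto
  have "v \<bullet> ((T + (\<alpha> * \<gamma> * rb) \<cdot>\<^sub>m (transpose_mat E * E)) *\<^sub>v v)
      = v \<bullet> (T *\<^sub>v v) + v \<bullet> ((\<alpha> * \<gamma> * rb) \<cdot>\<^sub>v ((transpose_mat E * E) *\<^sub>v v))"
  proof -
    have tv: "T *\<^sub>v v \<in> carrier_vec (n+1)" by (rule mult_mat_vec_carrier[OF T v])
    have ev: "(\<alpha> * \<gamma> * rb) \<cdot>\<^sub>v ((transpose_mat E * E) *\<^sub>v v) \<in> carrier_vec (n+1)"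
      by (intro smult_carrier_vec[THEN iffD2] mult_mat_vec_carrier[OF EE v])
    have "(T + (\<alpha> * \<gamma> * rb) \<cdot>\<^sub>m (transpose_mat E * E)) *\<^sub>v v
        = T *\<^sub>v v + (\<alpha> * \<gamma> * rb) \<cdot>\<^sub>v ((transpose_mat E * E) *\<^sub>v v)"
      using add_mult_distrib_mat_vec[OF T smult_carrier_mat[OF EE] v] smult[OF EE v] by simp
    then show ?thesis using scalar_prod_add_distrib[OF v tv ev] by simp
  qed
  also have "v \<bullet> ((\<alpha> * \<gamma> * rb) \<cdot>\<^sub>v ((transpose_mat E * E) *\<^sub>v v)) = \<alpha> * \<gamma> * rb * (v \<bullet> (transpose_mat E *\<^sub>v (E *\<^sub>v v)))"
    using v E by (simp add: assoc_mult_mat_vec[of _ "n+1" 1 _ "n+1"])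
  also have "v \<bullet> (transpose_mat E *\<^sub>v (E *\<^sub>v v)) = (E *\<^sub>v v) \<bullet> (E *\<^sub>v v)"
    using v E by (intro scalar_prod_transpose_mult[of _ 1 "n+1"]) auto
  also have "\<dots> = (\<Sum>i\<in>{0..<N0}. K (i+1) * field1 x1 k e i)^2"
    unfolding v_def E_def X z_def Em_mult_vec[OF N] k e scalar_prod_vec by (simp add: power2_eq_square)
  finally have A: "v \<bullet> ((T + (\<alpha> * \<gamma> * rb) \<cdot>\<^sub>m (transpose_mat E * E)) *\<^sub>v v)
      = v \<bullet> (T *\<^sub>v v) + \<alpha> * \<gamma> * rb * (\<Sum>i\<in>{0..<N0}. K (i+1) * field1 x1 k e i)^2" .
  have "T *\<^sub>v v = (TL *\<^sub>v X + (P * Lc) *\<^sub>v z) @\<^sub>v ((transpose_mat Lc * P) *\<^sub>v X + BR *\<^sub>v z)"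
    unfolding T_def v_def by (rule four_block_mat_mult_vec[OF TL PL(1) PL(2) BR Xc z])
  then have "v \<bullet> (T *\<^sub>v v) = X \<bullet> (TL *\<^sub>v X + (P * Lc) *\<^sub>v z) + z \<bullet> ((transpose_mat Lc * P) *\<^sub>v X + BR *\<^sub>v z)"
    unfolding v_def using TL PL BR Xc z by (simp add: scalar_prod_append[of _ n _ 1])
  also have "\<dots> = X \<bullet> (TL *\<^sub>v X) + X \<bullet> ((P * Lc) *\<^sub>v z) + (z \<bullet> ((transpose_mat Lc * P) *\<^sub>v X) + z \<bullet> (BR *\<^sub>v z))"
    using TL PL BR Xc z by (subst (1 2) scalar_prod_add_distrib) (auto intro: mult_mat_vec_carrier)
  also have "X \<bullet> ((P * Lc) *\<^sub>v z) = (Lc *\<^sub>v z) \<bullet> (P *\<^sub>v X)"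
  proof -
    have "X \<bullet> ((P * Lc) *\<^sub>v z) = X \<bullet> (transpose_mat P *\<^sub>v (Lc *\<^sub>v z))"
      unfolding Pt using P' Lc z by (simp add: assoc_mult_mat_vec[of _ n n _ 1])
    also have "\<dots> = (P *\<^sub>v X) \<bullet> (Lc *\<^sub>v z)"
      using P' Lc z Xc by (intro scalar_prod_transpose_mult) auto
    also have "\<dots> = (Lc *\<^sub>v z) \<bullet> (P *\<^sub>v X)" using P' Lc z Xc by (intro comm_scalar_prod[of _ n]) auto
    finally show ?thesis .
  qed
  also have "z \<bullet> ((transpose_mat Lc * P) *\<^sub>v X) = (Lc *\<^sub>v z) \<bullet> (P *\<^sub>v X)"
  proof -
    have "(transpose_mat Lc * P) *\<^sub>v X = transpose_mat Lc *\<^sub>v (P *\<^sub>v X)"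
      using P' Lc Xc by (intro assoc_mult_mat_vec[of _ 1 n _ n]) auto
    then show ?thesis using Lc z PX by (simp add: scalar_prod_transpose_mult)
  qed
  also have "z \<bullet> (BR *\<^sub>v z) = - \<beta> * exp (- 2 * \<delta> * h) * \<zeta>^2"
    unfolding z_def BR_def mat_mult_vec scalar_prod_vec by (simp add: power2_eq_square)
  also have "X \<bullet> (TL *\<^sub>v X) = 2 * ((F *\<^sub>v X) \<bullet> (P *\<^sub>v X)) + 2 * \<delta> * (X \<bullet> (P *\<^sub>v X)) + \<alpha> * \<gamma> * ra * k^2"
  proof -
    have m: "transpose_mat F * P \<in> carrier_mat n n" "P * F \<in> carrier_mat n n" "(2 * \<delta>) \<cdot>\<^sub>m P \<in> carrier_mat n n"
      "(\<alpha> * \<gamma> * ra) \<cdot>\<^sub>m (transpose_mat Kt * Kt) \<in> carrier_mat n n" "transpose_mat Kt * Kt \<in> carrier_mat n n"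
      using F P' Kt by auto
    have "TL *\<^sub>v X = (transpose_mat F * P) *\<^sub>v X + (P * F) *\<^sub>v X + ((2 * \<delta>) \<cdot>\<^sub>m P) *\<^sub>v X
        + ((\<alpha> * \<gamma> * ra) \<cdot>\<^sub>m (transpose_mat Kt * Kt)) *\<^sub>v X"
      unfolding TL_def
      by (simp only: add_mult_distrib_mat_vec[OF add_carrier_mat[OF m(3)] m(4) Xc]
          add_mult_distrib_mat_vec[OF add_carrier_mat[OF m(2)] m(3) Xc] add_mult_distrib_mat_vec[OF m(1,2) Xc])
    also have "\<dots> = transpose_mat F *\<^sub>v (P *\<^sub>v X) + transpose_mat P *\<^sub>v (F *\<^sub>v X) + (2 * \<delta>) \<cdot>\<^sub>v (P *\<^sub>v X)
        + (\<alpha> * \<gamma> * ra) \<cdot>\<^sub>v (transpose_mat Kt *\<^sub>v (Kt *\<^sub>v X))"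
      using F P' Kt Xc unfolding Pt
      by (simp add: assoc_mult_mat_vec[of _ n n _ n] assoc_mult_mat_vec[of _ n 1 _ n] smult[OF P'] smult[OF m(5)])
    finally have eq: "TL *\<^sub>v X = transpose_mat F *\<^sub>v (P *\<^sub>v X) + transpose_mat P *\<^sub>v (F *\<^sub>v X) + (2 * \<delta>) \<cdot>\<^sub>v (P *\<^sub>v X)
        + (\<alpha> * \<gamma> * ra) \<cdot>\<^sub>v (transpose_mat Kt *\<^sub>v (Kt *\<^sub>v X))" .
    have cs: "transpose_mat F *\<^sub>v (P *\<^sub>v X) \<in> carrier_vec n" "transpose_mat P *\<^sub>v (F *\<^sub>v X) \<in> carrier_vec n"
      "(2 * \<delta>) \<cdot>\<^sub>v (P *\<^sub>v X) \<in> carrier_vec n" "(\<alpha> * \<gamma> * ra) \<cdot>\<^sub>v (transpose_mat Kt *\<^sub>v (Kt *\<^sub>v X)) \<in> carrier_vec n"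
      using F P' Kt Xc by auto
    have "X \<bullet> (TL *\<^sub>v X) = X \<bullet> (transpose_mat F *\<^sub>v (P *\<^sub>v X)) + X \<bullet> (transpose_mat P *\<^sub>v (F *\<^sub>v X))
        + X \<bullet> ((2 * \<delta>) \<cdot>\<^sub>v (P *\<^sub>v X)) + X \<bullet> ((\<alpha> * \<gamma> * ra) \<cdot>\<^sub>v (transpose_mat Kt *\<^sub>v (Kt *\<^sub>v X)))"
      unfolding eq
      by (simp only: scalar_prod_add_distrib[OF Xc add_carrier_vec[OF add_carrier_vec[OF cs(1,2)] cs(3)] cs(4)]
          scalar_prod_add_distrib[OF Xc add_carrier_vec[OF cs(1,2)] cs(3)] scalar_prod_add_distrib[OF Xc cs(1,2)])
    also have "X \<bullet> (transpose_mat F *\<^sub>v (P *\<^sub>v X)) = (F *\<^sub>v X) \<bullet> (P *\<^sub>v X)"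
      using F Xc PX by (intro scalar_prod_transpose_mult) auto
    also have "X \<bullet> (transpose_mat P *\<^sub>v (F *\<^sub>v X)) = (P *\<^sub>v X) \<bullet> (F *\<^sub>v X)"
      using F Xc P' by (intro scalar_prod_transpose_mult) auto
    also have "(P *\<^sub>v X) \<bullet> (F *\<^sub>v X) = (F *\<^sub>v X) \<bullet> (P *\<^sub>v X)" using F Xc P' by (intro comm_scalar_prod[of _ n]) auto
    also have "X \<bullet> ((2 * \<delta>) \<cdot>\<^sub>v (P *\<^sub>v X)) = 2 * \<delta> * (X \<bullet> (P *\<^sub>v X))" using Xc PX by simp
    also have "X \<bullet> ((\<alpha> * \<gamma> * ra) \<cdot>\<^sub>v (transpose_mat Kt *\<^sub>v (Kt *\<^sub>v X))) = \<alpha> * \<gamma> * ra * (X \<bullet> (transpose_mat Kt *\<^sub>v (Kt *\<^sub>v X)))"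
      using Xc Kt by simp
    also have "X \<bullet> (transpose_mat Kt *\<^sub>v (Kt *\<^sub>v X)) = (Kt *\<^sub>v X) \<bullet> (Kt *\<^sub>v X)"
      using Kt Xc by (intro scalar_prod_transpose_mult) auto
    also have "\<dots> = k^2" unfolding Kt_def X Ktm_mult_vec[OF N] k scalar_prod_vec by (simp add: power2_eq_square)
    finally show ?thesis by simp
  qed
  finally have B: "v \<bullet> (T *\<^sub>v v) = 2 * ((F *\<^sub>v X) \<bullet> (P *\<^sub>v X) + (Lc *\<^sub>v z) \<bullet> (P *\<^sub>v X)) + 2 * \<delta> * (X \<bullet> (P *\<^sub>v X)) + \<alpha> * \<gamma> * ra * k^2
      - \<beta> * exp (- 2 * \<delta> * h) * \<zeta>^2" by simp
  have "(F *\<^sub>v X) \<bullet> (P *\<^sub>v X) + (Lc *\<^sub>v z) \<bullet> (P *\<^sub>v X) = (F *\<^sub>v X + Lc *\<^sub>v z) \<bullet> (P *\<^sub>v X)"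
    using F Lc Xc z PX by (intro add_scalar_prod_distrib[symmetric, of _ n]) auto
  also have "F *\<^sub>v X + Lc *\<^sub>v z = Y"
    unfolding F_def Lc_def X z_def Fm_mult_vec[OF N] Y k e Let_def ..
  finally show "(X @\<^sub>v vec 1 (\<lambda>_. \<zeta>)) \<bullet> (Theta1 lam qc bet c K l N0 N h \<delta> ra rb P \<alpha> \<beta> \<gamma> *\<^sub>v (X @\<^sub>v vec 1 (\<lambda>_. \<zeta>)))
      = 2 * (Y \<bullet> (P *\<^sub>v X)) + 2 * \<delta> * (X \<bullet> (P *\<^sub>v X)) + \<alpha> * \<gamma> * ra * k^2 - \<beta> * exp (- 2 * \<delta> * h) * \<zeta>^2
        + \<alpha> * \<gamma> * rb * (\<Sum>i\<in>{0..<N0}. K (i+1) * field1 x1 k e i)^2"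
    using A B unfolding Th v_def z_def by simp
qed

end

section \<open>Feasibility for large N\<close>

lemma tail_suminf_tendsto_0:
  fixes g :: "nat \<Rightarrow> real"
  assumes "summable (\<lambda>n. if 0 + 1 \<le> n then g n else 0)"
  shows "(\<lambda>N. \<Sum>n. if N + 1 \<le> n then g n else 0) \<longlonglongrightarrow> 0"
proof -
  define f where "f = (\<lambda>n. if 1 \<le> n then g n else 0)"
  have f: "summable f" using assms by (simp add: f_def)
  have "(\<Sum>n. if N + 1 \<le> n then g n else 0) = (\<Sum>n. f (n + Suc N))" for N
  proof -
    define k where "k = (\<lambda>n. if N + 1 \<le> n then g n else 0)"
    have kf: "(\<lambda>n. k (n + Suc N)) = (\<lambda>n. f (n + Suc N))" by (auto simp: k_def f_def)
    have "summable (\<lambda>n. k (n + Suc N))" unfolding kf using f by (rule summable_ignore_initial_segment)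
    then have "summable k" by (rule summable_iff_shift[THEN iffD1])
    then have "suminf k = (\<Sum>n. k (n + Suc N)) + sum k {..<Suc N}" by (rule suminf_split_initial_segment)
    moreover have "sum k {..<Suc N} = 0" by (intro sum.neutral) (auto simp: k_def)
    ultimately show ?thesis using kf by (simp add: k_def)
  qed
  moreover have "(\<lambda>N. \<Sum>n. f (n + Suc N)) \<longlonglongrightarrow> 0"
    using LIMSEQ_Suc[OF suminf_exist_split2[OF f]] .
  ultimately show ?thesis by simp
qed

lemma young_ineq:
  fixes a b s :: real
  assumes "s > 0" shows "2 * (a * b) \<le> s * a^2 + b^2 / s"
proof -
  have "0 \<le> (s * a - b)^2 / s" using assms by simp
  also have "\<dots> = s * a^2 - 2 * (a * b) + b^2 / s"
    using assms by (simp add: field_simps power2_eq_square)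
  finally show ?thesis by simp
qed

lemma square_sum3_le: "(a + b + c)^2 \<le> 3 * (a^2 + b^2 + c^2)" for a b c :: real
proof -
  have "0 \<le> (a - b)^2 + (b - c)^2 + (a - c)^2" by simp
  then show ?thesis by (simp add: power2_eq_square algebra_simps)
qed

lemma square_sum2_le: "(a + b)^2 \<le> 2 * (a^2 + b^2)" for a b :: real
proof -
  have "0 \<le> (a - b)^2" by simp
  then show ?thesis by (simp add: power2_eq_square algebra_simps)
qed

text \<open>Input-to-state form of the Lyapunov inequality: half of the decay is kept and the other
  half absorbs the cross term with the scalar input \<open>d\<close> by Young's inequality with
  weight \<open>\<kappa> / (2 * G)\<close>. \<open>G\<close> bounds the squared norm of
  \<open>S w\<close>; its summand 1 keeps it positive.\<close>

lemma hurwitz_lyapunov_input: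
  fixes A :: "real mat" and w :: "nat \<Rightarrow> real"
  assumes A: "A \<in> carrier_mat n n" and e: "eig_re_lt A (- \<delta>)"
  obtains S :: "nat \<Rightarrow> nat \<Rightarrow> real" and \<kappa> D :: real where "\<kappa> > 0" "D \<ge> 0" "\<And>i j. S i j = S j i"
    "\<And>x. \<kappa> * (\<Sum>i\<in>{0..<n}. (x i)^2) \<le> (\<Sum>i\<in>{0..<n}. \<Sum>j\<in>{0..<n}. S i j * x i * x j)"
    "\<And>x d. 2 * (\<Sum>i\<in>{0..<n}. \<Sum>j\<in>{0..<n}. S i j * x i * ((\<Sum>k\<in>{0..<n}. A $$ (j,k) * x k) + w j * d))
      + 2 * \<delta> * (\<Sum>i\<in>{0..<n}. \<Sum>j\<in>{0..<n}. S i j * x i * x j) \<le> - \<kappa> * (\<Sum>i\<in>{0..<n}. (x i)^2) + D * d^2"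
proof -
  let ?I = "{0..<n}"
  obtain S \<kappa> where S: "\<kappa> > 0" "\<And>i j. S i j = S j i"
    "\<And>x. \<kappa> * (\<Sum>i\<in>?I. (x i)^2) \<le> (\<Sum>i\<in>?I. \<Sum>j\<in>?I. S i j * x i * x j)"
    "\<And>x. 2 * (\<Sum>i\<in>?I. \<Sum>j\<in>?I. S i j * x i * (\<Sum>k\<in>?I. A $$ (j,k) * x k))
      + 2 * \<delta> * (\<Sum>i\<in>?I. \<Sum>j\<in>?I. S i j * x i * x j) \<le> - \<kappa> * (\<Sum>i\<in>?I. (x i)^2)"
    by (rule hurwitz_lyapunov[OF A e]) (rule that)
  define g where "g = (\<lambda>i. \<Sum>j\<in>?I. S i j * w j)"
  define G where "G = 1 + (\<Sum>i\<in>?I. (g i)^2)"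
  have G: "G \<ge> 1" by (simp add: G_def sum_nonneg)
  show thesis
  proof (rule that[of "\<kappa>/2" "2 * G / \<kappa>" S])
    fix x :: "nat \<Rightarrow> real" and d :: real
    define nx where "nx = (\<Sum>i\<in>?I. (x i)^2)"
    have nx: "nx \<ge> 0" by (simp add: nx_def sum_nonneg)
    have "\<kappa>/2 * nx \<le> \<kappa> * nx" using S(1) nx by simp
    then show "\<kappa>/2 * (\<Sum>i\<in>?I. (x i)^2) \<le> (\<Sum>i\<in>?I. \<Sum>j\<in>?I. S i j * x i * x j)"
      using S(3)[of x] unfolding nx_def by linarith
    define t where "t = (\<Sum>i\<in>?I. g i * x i)"
    have "(\<Sum>i\<in>?I. \<Sum>j\<in>?I. S i j * x i * ((\<Sum>k\<in>?I. A $$ (j,k) * x k) + w j * d))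
       = (\<Sum>i\<in>?I. \<Sum>j\<in>?I. S i j * x i * (\<Sum>k\<in>?I. A $$ (j,k) * x k)) + (\<Sum>i\<in>?I. \<Sum>j\<in>?I. S i j * x i * (w j * d))"
      unfolding distrib_left sum.distrib ..
    also have "(\<Sum>i\<in>?I. \<Sum>j\<in>?I. S i j * x i * (w j * d)) = t * d"
      unfolding t_def g_def by (simp add: sum_distrib_left sum_distrib_right mult_ac)
    finally have split: "(\<Sum>i\<in>?I. \<Sum>j\<in>?I. S i j * x i * ((\<Sum>k\<in>?I. A $$ (j,k) * x k) + w j * d))
       = (\<Sum>i\<in>?I. \<Sum>j\<in>?I. S i j * x i * (\<Sum>k\<in>?I. A $$ (j,k) * x k)) + t * d" .
    have "t^2 \<le> (\<Sum>i\<in>?I. (g i)^2) * nx" unfolding t_def nx_def by (rule sum_Cauchy_Schwarz)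
    also have "\<dots> \<le> G * nx" using nx by (intro mult_right_mono) (auto simp: G_def)
    finally have t2: "t^2 \<le> G * nx" .
    have "2 * (t * d) \<le> \<kappa> / (2 * G) * t^2 + d^2 / (\<kappa> / (2 * G))"
      using S(1) G by (intro young_ineq) auto
    also have "\<kappa> / (2 * G) * t^2 \<le> \<kappa> / (2 * G) * (G * nx)" using t2 S(1) G by (intro mult_left_mono) auto
    also have "\<kappa> / (2 * G) * (G * nx) = \<kappa> / 2 * nx" using G by simp
    also have "d^2 / (\<kappa> / (2 * G)) = 2 * G / \<kappa> * d^2" by simp
    finally have "2 * (t * d) \<le> \<kappa> / 2 * nx + 2 * G / \<kappa> * d^2" by simp
    then show "2 * (\<Sum>i\<in>?I. \<Sum>j\<in>?I. S i j * x i * ((\<Sum>k\<in>?I. A $$ (j,k) * x k) + w j * d))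
      + 2 * \<delta> * (\<Sum>i\<in>?I. \<Sum>j\<in>?I. S i j * x i * x j) \<le> - (\<kappa>/2) * (\<Sum>i\<in>?I. (x i)^2) + 2 * G / \<kappa> * d^2"
      using S(4)[of x] unfolding split nx_def[symmetric] by (simp add: algebra_simps)
  qed (use S G in auto)
qed

text \<open>Multiples of the identity are enough on the last two blocks, since \<open>A1\<close> is
  diagonal and all its entries lie below \<open>- \<delta>\<close>. Only the dimension of these
  blocks changes with \<open>N\<close>, not their weights.\<close>

definition blockP :: "nat \<Rightarrow> nat \<Rightarrow> (nat \<Rightarrow> nat \<Rightarrow> real) \<Rightarrow> (nat \<Rightarrow> nat \<Rightarrow> real) \<Rightarrow> real \<Rightarrow> real \<Rightarrow> real \<Rightarrow> real mat" where
  "blockP m k S1 S2 s2 s3 s4 = four_block_mat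
     (four_block_mat (mat m m (\<lambda>(i,j). S1 i j)) (0\<^sub>m m m) (0\<^sub>m m m) (mat m m (\<lambda>(i,j). s2 * S2 i j)))
     (0\<^sub>m (m+m) (k+k)) (0\<^sub>m (k+k) (m+m))
     (four_block_mat (diagm k (\<lambda>_. s3)) (0\<^sub>m k k) (0\<^sub>m k k) (diagm k (\<lambda>_. s4)))"

lemma blockP_carrier: "blockP m k S1 S2 s2 s3 s4 \<in> carrier_mat ((m+m)+(k+k)) ((m+m)+(k+k))"
  unfolding blockP_def by (intro four_block_carrier_mat) auto

lemma blockP_transpose:
  assumes "\<And>i j. S1 i j = S1 j i" "\<And>i j. S2 i j = S2 j i"
  shows "transpose_mat (blockP m k S1 S2 s2 s3 s4) = blockP m k S1 S2 s2 s3 s4"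
proof -
  have 1: "transpose_mat (mat m m (\<lambda>(i,j). S1 i j)) = mat m m (\<lambda>(i,j). S1 i j)"
    "transpose_mat (mat m m (\<lambda>(i,j). s2 * S2 i j)) = mat m m (\<lambda>(i,j). s2 * S2 i j)"
    "transpose_mat (diagm k (\<lambda>_. s)) = diagm k (\<lambda>_. s)" for s :: real
    by (intro eq_matI; auto simp: assms diagm_def)+
  show ?thesis
    unfolding blockP_def
    by (subst transpose_four_block_mat[of _ "m+m" "m+m" _ "k+k" _ "k+k"])
      (auto simp: transpose_four_block_mat[of _ m m _ m _ m] transpose_four_block_mat[of _ k k _ k _ k] 1)
qed

lemma blockP_mult_vec:
  "blockP m k S1 S2 s2 s3 s4 *\<^sub>v stack4 m k x1 x2 x3 x4
    = stack4 m k (\<lambda>i. \<Sum>j\<in>{0..<m}. S1 i j * x1 j) (\<lambda>i. s2 * (\<Sum>j\<in>{0..<m}. S2 i j * x2 j)) (\<lambda>i. s3 * x3 i) (\<lambda>i. s4 * x4 i)"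
proof -
  have z: "0\<^sub>m r s *\<^sub>v w = 0\<^sub>v r" if "w \<in> carrier_vec s" for r s and w :: "real vec"
    using that by (intro eq_vecI) (auto simp: scalar_prod_def)
  have c: "vec m f @\<^sub>v vec m g \<in> carrier_vec (m+m)" "vec k f @\<^sub>v vec k g \<in> carrier_vec (k+k)" for f g :: "nat \<Rightarrow> real"
    by (intro append_carrier_vec vec_carrier)+
  have e: "(0\<^sub>v n :: real vec) + vec n f = vec n f" "vec n f + 0\<^sub>v n = vec n f" for n and f :: "nat \<Rightarrow> real"
    by auto
  have b1: "four_block_mat (mat m m (\<lambda>(i,j). S1 i j)) (0\<^sub>m m m) (0\<^sub>m m m) (mat m m (\<lambda>(i,j). s2 * S2 i j)) *\<^sub>v (vec m x1 @\<^sub>v vec m x2)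
    = vec m (\<lambda>i. \<Sum>j\<in>{0..<m}. S1 i j * x1 j) @\<^sub>v vec m (\<lambda>i. s2 * (\<Sum>j\<in>{0..<m}. S2 i j * x2 j))"
    by (subst four_block_mat_mult_vec[of _ m m _ m _ m])
      (auto simp: mat_mult_vec z[OF vec_carrier] e sum_distrib_left mult_ac)
  have b2: "four_block_mat (diagm k (\<lambda>_. s3)) (0\<^sub>m k k) (0\<^sub>m k k) (diagm k (\<lambda>_. s4)) *\<^sub>v (vec k x3 @\<^sub>v vec k x4)
    = vec k (\<lambda>i. s3 * x3 i) @\<^sub>v vec k (\<lambda>i. s4 * x4 i)"
    by (subst four_block_mat_mult_vec[of _ k k _ k _ k])
      (auto simp: diagm_mult_vec z[OF vec_carrier] e)
  show ?thesis
    unfolding blockP_def stack4_def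
    by (subst four_block_mat_mult_vec[of _ "m+m" "m+m" _ "k+k" _ "k+k"])
      (auto simp: b1 b2 z[OF c(1)] z[OF c(2)] intro!: four_block_carrier_mat right_zero_vec left_zero_vec arg_cong2[where f = "(@\<^sub>v)"])
qed

lemma stack4_blockP_form:
  assumes S: "\<And>i j. S1 i j = S1 j i" "\<And>i j. S2 i j = S2 j i"
  shows "stack4 m k y1 y2 y3 y4 \<bullet> (blockP m k S1 S2 s2 s3 s4 *\<^sub>v stack4 m k x1 x2 x3 x4)
    = (\<Sum>i\<in>{0..<m}. \<Sum>j\<in>{0..<m}. S1 i j * x1 i * y1 j) + s2 * (\<Sum>i\<in>{0..<m}. \<Sum>j\<in>{0..<m}. S2 i j * x2 i * y2 j)
      + s3 * (\<Sum>i\<in>{0..<k}. x3 i * y3 i) + s4 * (\<Sum>i\<in>{0..<k}. x4 i * y4 i)"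
proof -
  have sw: "(\<Sum>i\<in>{0..<m}. y i * (\<Sum>j\<in>{0..<m}. S i j * x j)) = (\<Sum>i\<in>{0..<m}. \<Sum>j\<in>{0..<m}. S i j * x i * y j)"
    if "\<And>i j. S i j = S j i" for S :: "nat \<Rightarrow> nat \<Rightarrow> real" and x y
  proof -
    have "(\<Sum>i\<in>{0..<m}. y i * (\<Sum>j\<in>{0..<m}. S i j * x j)) = (\<Sum>i\<in>{0..<m}. \<Sum>j\<in>{0..<m}. S j i * x j * y i)"
      unfolding sum_distrib_left by (intro sum.cong refl) (simp add: that[of _ _] mult_ac)
    also have "\<dots> = (\<Sum>i\<in>{0..<m}. \<Sum>j\<in>{0..<m}. S i j * x i * y j)" by (rule sum.swap)
    finally show ?thesis .
  qed
  have eq: "(\<Sum>i\<in>{0..<m}. y2 i * (s2 * (\<Sum>j\<in>{0..<m}. S2 i j * x2 j))) = s2 * (\<Sum>i\<in>{0..<m}. y2 i * (\<Sum>j\<in>{0..<m}. S2 i j * x2 j))"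
    unfolding sum_distrib_left by (intro sum.cong refl) simp
  have "(\<Sum>i\<in>{0..<k}. y i * (s * x i)) = s * (\<Sum>i\<in>{0..<k}. x i * y i)" for s and x y :: "nat \<Rightarrow> real"
    by (simp add: sum_distrib_left mult_ac)
  then show ?thesis
    unfolding blockP_mult_vec stack4_scalar_prod sw[OF S(1)] eq sw[OF S(2)] by simp
qed

lemma vec_nonzero_scalar_pos:
  assumes "v \<in> carrier_vec n" "v \<noteq> 0\<^sub>v n"
  shows "(v::real vec) \<bullet> v > 0"
proof -
  obtain i where i: "i < n" "v $ i \<noteq> 0" using assms by (metis carrier_vecD eq_vecI index_zero_vec)
  have "0 < v $ i * v $ i" using i by (simp add: zero_less_mult_iff) linarith
  also have "\<dots> \<le> (\<Sum>i\<in>{0..<n}. v $ i * v $ i)" using i by (intro member_le_sum[of i "{0..<n}" "\<lambda>i. v $ i * v $ i"]) auto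
  also have "\<dots> = v \<bullet> v" using assms by (simp add: scalar_prod_def)
  finally show ?thesis .
qed

lemma ex_stack4':
  assumes "v \<in> carrier_vec ((m + m) + (k + k))"
  obtains x1 x2 x3 x4 where "v = stack4 m k x1 x2 x3 x4"
proof
  show "v = stack4 m k (\<lambda>i. v $ i) (\<lambda>i. v $ (m + i)) (\<lambda>i. v $ (m + m + i)) (\<lambda>i. v $ (m + m + k + i))"
    unfolding stack4_def using assms by (intro eq_vecI) (auto simp: add.assoc)
qed

lemma blockP_pos_def:
  assumes S: "\<And>i j. S1 i j = S1 j i" "\<And>i j. S2 i j = S2 j i" and k: "\<kappa>1 > 0" "\<kappa>2 > 0" and s: "s2 > 0" "s3 > 0" "s4 > 0"
    and l1: "\<And>x. \<kappa>1 * (\<Sum>i\<in>{0..<m}. (x i)^2) \<le> (\<Sum>i\<in>{0..<m}. \<Sum>j\<in>{0..<m}. S1 i j * x i * x j)"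
    and l2: "\<And>x. \<kappa>2 * (\<Sum>i\<in>{0..<m}. (x i)^2) \<le> (\<Sum>i\<in>{0..<m}. \<Sum>j\<in>{0..<m}. S2 i j * x i * x j)"
  shows "pos_def (blockP m k S1 S2 s2 s3 s4) ((m+m)+(k+k))"
  unfolding pos_def_def
proof (intro conjI ballI impI)
  show "blockP m k S1 S2 s2 s3 s4 \<in> carrier_mat ((m+m)+(k+k)) ((m+m)+(k+k))" by (rule blockP_carrier)
  show "transpose_mat (blockP m k S1 S2 s2 s3 s4) = blockP m k S1 S2 s2 s3 s4" by (rule blockP_transpose[OF S])
  fix v :: "real vec" assume v: "v \<in> carrier_vec ((m+m)+(k+k))" "v \<noteq> 0\<^sub>v ((m+m)+(k+k))"
  obtain x1 x2 x3 x4 where X: "v = stack4 m k x1 x2 x3 x4" by (rule ex_stack4'[OF v(1)])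
  define n1 n2 n3 n4 where "n1 = (\<Sum>i\<in>{0..<m}. (x1 i)^2)" and "n2 = (\<Sum>i\<in>{0..<m}. (x2 i)^2)"
    and "n3 = (\<Sum>i\<in>{0..<k}. (x3 i)^2)" and "n4 = (\<Sum>i\<in>{0..<k}. (x4 i)^2)"
  have n: "n1 \<ge> 0" "n2 \<ge> 0" "n3 \<ge> 0" "n4 \<ge> 0" by (auto simp: n1_def n2_def n3_def n4_def intro: sum_nonneg)
  have "0 < v \<bullet> v" by (rule vec_nonzero_scalar_pos[OF v])
  also have "v \<bullet> v = n1 + n2 + n3 + n4"
    unfolding X stack4_scalar_prod by (simp add: n1_def n2_def n3_def n4_def power2_eq_square)
  finally have pos: "0 < n1 + n2 + n3 + n4" .
  have form: "v \<bullet> (blockP m k S1 S2 s2 s3 s4 *\<^sub>v v) = (\<Sum>i\<in>{0..<m}. \<Sum>j\<in>{0..<m}. S1 i j * x1 i * x1 j)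
     + s2 * (\<Sum>i\<in>{0..<m}. \<Sum>j\<in>{0..<m}. S2 i j * x2 i * x2 j) + s3 * n3 + s4 * n4"
    unfolding X stack4_blockP_form[OF S] by (simp add: n3_def n4_def power2_eq_square)
  have "s2 * (\<kappa>2 * n2) \<le> s2 * (\<Sum>i\<in>{0..<m}. \<Sum>j\<in>{0..<m}. S2 i j * x2 i * x2 j)"
    using l2[of x2] s unfolding n2_def by (intro mult_left_mono) auto
  then have low: "\<kappa>1 * n1 + s2 * (\<kappa>2 * n2) + s3 * n3 + s4 * n4 \<le> v \<bullet> (blockP m k S1 S2 s2 s3 s4 *\<^sub>v v)"
    using l1[of x1] unfolding form n1_def by linarith
  have nn: "0 \<le> \<kappa>1 * n1" "0 \<le> s2 * (\<kappa>2 * n2)" "0 \<le> s3 * n3" "0 \<le> s4 * n4" using n k s by auto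
  consider "n1 > 0" | "n2 > 0" | "n3 > 0" | "n4 > 0" using pos n by linarith
  then have "0 < \<kappa>1 * n1 + s2 * (\<kappa>2 * n2) + s3 * n3 + s4 * n4"
  proof cases
    case 1 then have "0 < \<kappa>1 * n1" using k by simp
    then show ?thesis using nn by linarith
  next
    case 2 then have "0 < s2 * (\<kappa>2 * n2)" using k s by simp
    then show ?thesis using nn by linarith
  next
    case 3 then have "0 < s3 * n3" using s by simp
    then show ?thesis using nn by linarith
  next
    case 4 then have "0 < s4 * n4" using s by simp
    then show ?thesis using nn by linarith
  qed
  then show "v \<bullet> (blockP m k S1 S2 s2 s3 s4 *\<^sub>v v) > 0" using low by linarith
qed

section \<open>Bounds uniform in N, vanishing tails and the choice of weights\<close>

context sturm_liouville begin

text \<open>The flux sum at \<open>\<epsilon> = 1/2\<close>, where the exponent of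
  \<open>lam n\<close> becomes 2. It bounds the row \<open>C1\<close> independently of its
  length.\<close>

lemma flux_over_lam_bounded:
  "\<exists>B\<ge>0. \<forall>I. finite I \<longrightarrow> I \<subseteq> {1..} \<longrightarrow> (\<Sum>n\<in>I. (phid n 0 / lam n)^2) \<le> B"
proof -
  obtain B where B: "\<forall>I. finite I \<and> I \<subseteq> {1..} \<longrightarrow> (\<Sum>n\<in>I. (phid n 0)^2 / lam n powr (3/2 + 1/2)) \<le> B"
    using flux_sum_bounded[of "1/2"] by auto
  have e: "(phid n 0)^2 / lam n powr (3/2 + 1/2) = (phid n 0 / lam n)^2" if "n \<ge> 1" for n
    using lam_pos[OF that] powr_numeral[of "lam n" "num.Bit0 num.One"] by (simp add: power_divide)
  have "(\<Sum>n\<in>I. (phid n 0 / lam n)^2) \<le> B" if "finite I" "I \<subseteq> {1..}" for I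
  proof -
    have "(\<Sum>n\<in>I. (phid n 0 / lam n)^2) = (\<Sum>n\<in>I. (phid n 0)^2 / lam n powr (3/2 + 1/2))"
      using that by (intro sum.cong refl e[symmetric]) auto
    then show ?thesis using B that by simp
  qed
  moreover from this[of "{}"] have "B \<ge> 0" by simp
  ultimately show ?thesis by blast
qed

text \<open>Dividing \<open>betac_eq\<close> by \<open>lam n\<close> gives
  \<open>a n / lam n + (qc / lam n - 1) * b n\<close>. The factors are bounded because
  \<open>lam n \<ge> lam 1\<close>, and Bessel's inequality handles \<open>a n\<close> and
  \<open>b n\<close>.\<close>

lemma betac_over_lam_bounded:
  "\<exists>B\<ge>0. \<forall>I. finite I \<longrightarrow> I \<subseteq> {1..} \<longrightarrow> (\<Sum>n\<in>I. (betac p \<theta>2 phi phid n / lam n)^2) \<le> B"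
proof -
  let ?a = "\<lambda>n. coef (acoef p pd qt \<theta>2) n" and ?b = "\<lambda>n. coef (bcoef \<theta>2) n"
  define ca cb where "ca = 1 / lam 1" and "cb = \<bar>qc\<bar> / lam 1 + 1"
  define B where "B = 2 * (ca^2 * nrm2 (acoef p pd qt \<theta>2) + cb^2 * nrm2 (bcoef \<theta>2))"
  have "(\<Sum>n\<in>I. (betac p \<theta>2 phi phid n / lam n)^2) \<le> B" if I: "finite I" "I \<subseteq> {1..}" for I
  proof -
    have "(betac p \<theta>2 phi phid n / lam n)^2 \<le> 2 * (ca^2 * (?a n)^2 + cb^2 * (?b n)^2)" if "n \<in> I" for n
    proof -
      have n: "n \<ge> 1" using that I by auto
      have l: "lam n > 0" "lam 1 \<le> lam n" using lam_pos[OF n] lam_mono[of 1 n] n by auto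
      have eq: "betac p \<theta>2 phi phid n / lam n = ?a n / lam n + (qc / lam n - 1) * ?b n"
        unfolding betac_eq[OF n] using l by (simp add: field_simps)
      have "(?a n / lam n)^2 \<le> ca^2 * (?a n)^2"
      proof -
        have "1 / lam n \<le> ca" unfolding ca_def using l lam1_pos by (intro divide_left_mono) auto
        then have "(1 / lam n)^2 \<le> ca^2" using l by (intro power_mono) auto
        then have "(1 / lam n)^2 * (?a n)^2 \<le> ca^2 * (?a n)^2" by (intro mult_right_mono) auto
        then show ?thesis by (simp add: power_divide)
      qed
      moreover have "((qc / lam n - 1) * ?b n)^2 \<le> cb^2 * (?b n)^2"
      proof -
        have "\<bar>qc\<bar> / lam n \<le> \<bar>qc\<bar> / lam 1" using l lam1_pos by (intro divide_left_mono) auto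
        moreover have "\<bar>qc / lam n - 1\<bar> \<le> \<bar>qc\<bar> / lam n + 1" using l by (simp add: abs_if split: if_splits)
        ultimately have "\<bar>qc / lam n - 1\<bar> \<le> cb" unfolding cb_def by linarith
        then have "(qc / lam n - 1)^2 \<le> cb^2" by (metis abs_ge_zero power2_abs power_mono)
        then show ?thesis unfolding power_mult_distrib by (intro mult_right_mono) auto
      qed
      ultimately have "2 * ((?a n / lam n)^2 + ((qc / lam n - 1) * ?b n)^2) \<le> 2 * (ca^2 * (?a n)^2 + cb^2 * (?b n)^2)"
        by (intro mult_left_mono add_mono) auto
      with square_sum2_le show ?thesis unfolding eq by (rule order_trans)
    qed
    then have "(\<Sum>n\<in>I. (betac p \<theta>2 phi phid n / lam n)^2) \<le> (\<Sum>n\<in>I. 2 * (ca^2 * (?a n)^2 + cb^2 * (?b n)^2))"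
      by (intro sum_mono)
    also have "\<dots> = 2 * (ca^2 * (\<Sum>n\<in>I. (?a n)^2) + cb^2 * (\<Sum>n\<in>I. (?b n)^2))"
      by (simp add: sum_distrib_left[symmetric] sum.distrib)
    also have "\<dots> \<le> B"
      unfolding B_def by (intro mult_left_mono add_mono bessel I sq_int_continuous acoef_cont bcoef_cont) auto
    finally show ?thesis .
  qed
  moreover have "B \<ge> 0" by (simp add: B_def)
  ultimately show ?thesis by blast
qed

lemma tail2_tendsto_0:
  assumes "sq_int f" shows "(\<lambda>N. tail2 phi f N) \<longlonglongrightarrow> 0"
  unfolding tail2_def by (rule tail_suminf_tendsto_0[OF summable_coef_square[OF assms]])

lemma tail2_nonneg: "sq_int f \<Longrightarrow> tail2 phi f N \<ge> 0"
  unfolding tail2_def by (intro suminf_nonneg summable_coef_square) auto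

lemma Mphi_tendsto_0: "\<epsilon> > 0 \<Longrightarrow> (\<lambda>N. Mphi lam phid N \<epsilon>) \<longlonglongrightarrow> 0"
  unfolding Mphi_def by (rule tail_suminf_tendsto_0[OF summable_Mphi])

text \<open>All constants below are independent of \<open>N\<close>: the block weights \<open>s2, s3, s4\<close> follow the
  cascade \<open>x4 \<rightarrow> x2 \<rightarrow> x1 \<rightarrow> x3\<close>, and \<open>B1\<close>, \<open>C1\<close> enter only through
  \<open>\<Sum> (\<beta>\<^sub>n / \<lambda>\<^sub>n)\<^sup>2\<close> and \<open>\<Sum> (\<phi>\<^sub>n'(0) / \<lambda>\<^sub>n)\<^sup>2\<close>.\<close>

lemma eventually_feasible:
  assumes delta: "\<delta> > 0" and gap: "\<forall>n\<ge>N0+1. - lam n + qc < - \<delta>"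
    and hurwK: "eig_re_lt (A0m lam qc N0 + B0m (betac p \<theta>2 phi phid) N0 * Km K N0) (- \<delta>)"
    and hurwL: "eig_re_lt (A0m lam qc N0 - Lm l N0 * C0m (\<lambda>n. phid n 0) N0) (- \<delta>)"
  shows "\<exists>N1. \<forall>N\<ge>N1. feasible p pd qt qc \<theta>2 lam phi phid K l N0 \<delta> h N"
proof -
  let ?I = "{0..<N0}"
  define bet where "bet = betac p \<theta>2 phi phid"
  define c where "c = (\<lambda>n. phid n 0)"
  define A where "A = A0m lam qc N0 + B0m bet N0 * Km K N0"
  define A' where "A' = A0m lam qc N0 - Lm l N0 * C0m c N0"
  have Ac: "A \<in> carrier_mat N0 N0" "A' \<in> carrier_mat N0 N0"
    by (auto simp: A_def A'_def A0m_def B0m_def Km_def Lm_def C0m_def intro!: minus_carrier_mat)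
  define w where "w = (\<lambda>j. exp ((- lam (j+1) + qc) * h) * l (j+1))"
  obtain S1 \<kappa>1 D1 where S1: "\<kappa>1 > 0" "D1 \<ge> 0" "\<And>i j. S1 i j = S1 j i"
    "\<And>x. \<kappa>1 * (\<Sum>i\<in>?I. (x i)^2) \<le> (\<Sum>i\<in>?I. \<Sum>j\<in>?I. S1 i j * x i * x j)"
    "\<And>x d. 2 * (\<Sum>i\<in>?I. \<Sum>j\<in>?I. S1 i j * x i * ((\<Sum>k\<in>?I. A $$ (j,k) * x k) + w j * d))
      + 2 * \<delta> * (\<Sum>i\<in>?I. \<Sum>j\<in>?I. S1 i j * x i * x j) \<le> - \<kappa>1 * (\<Sum>i\<in>?I. (x i)^2) + D1 * d^2"
    by (rule hurwitz_lyapunov_input[OF Ac(1) hurwK[folded bet_def, folded A_def], where w = w]) (rule that)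
  obtain S2 \<kappa>2 D2 where S2: "\<kappa>2 > 0" "D2 \<ge> 0" "\<And>i j. S2 i j = S2 j i"
    "\<And>x. \<kappa>2 * (\<Sum>i\<in>?I. (x i)^2) \<le> (\<Sum>i\<in>?I. \<Sum>j\<in>?I. S2 i j * x i * x j)"
    "\<And>x d. 2 * (\<Sum>i\<in>?I. \<Sum>j\<in>?I. S2 i j * x i * ((\<Sum>k\<in>?I. A' $$ (j,k) * x k) + (- l (j+1)) * d))
      + 2 * \<delta> * (\<Sum>i\<in>?I. \<Sum>j\<in>?I. S2 i j * x i * x j) \<le> - \<kappa>2 * (\<Sum>i\<in>?I. (x i)^2) + D2 * d^2"
    by (rule hurwitz_lyapunov_input[OF Ac(2) hurwL[folded c_def, folded A'_def], where w = "\<lambda>j. - l (j+1)"]) (rule that)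
  obtain Bc where Bc: "Bc \<ge> 0" "\<forall>I. finite I \<longrightarrow> I \<subseteq> {1..} \<longrightarrow> (\<Sum>n\<in>I. (c n / lam n)^2) \<le> Bc"
    using flux_over_lam_bounded unfolding c_def by blast
  obtain Bb where Bb: "Bb \<ge> 0" "\<forall>I. finite I \<longrightarrow> I \<subseteq> {1..} \<longrightarrow> (\<Sum>n\<in>I. (bet n / lam n)^2) \<le> Bb"
    using betac_over_lam_bounded unfolding bet_def by blast
  \<comment> \<open>By monotonicity of the eigenvalues this margin at the first uncontrolled mode
    holds for all later ones, hence for every \<open>N\<close>.\<close>
  define \<eta> where "\<eta> = lam (N0+1) - qc - \<delta>"
  have \<eta>: "\<eta> > 0" using gap[rule_format, of "N0+1"] by (simp add: \<eta>_def)
  define Kn where "Kn = (\<Sum>i\<in>?I. (K (i+1))^2)"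
  define Cn where "Cn = (\<Sum>i\<in>?I. (c (i+1))^2)"
  have KC: "Kn \<ge> 0" "Cn \<ge> 0" by (auto simp: Kn_def Cn_def intro: sum_nonneg)
  \<comment> \<open>\<open>DE\<close> bounds the square of the whole innovation, the input of the
    predictor block. \<open>DE'\<close> omits the contribution of \<open>x2\<close>, which for the
    error block is already part of the matrix \<open>A'\<close>.\<close>
  define DE where "DE = 3 * (Cn + Bc + 1)"
  define DE' where "DE' = 2 * (Bc + 1)"
  define D3 where "D3 = Kn * Bb / \<eta>"
  have DD: "DE \<ge> 3" "DE' \<ge> 2" "D3 \<ge> 0" using KC Bc Bb \<eta> by (auto simp: DE_def DE'_def D3_def)
  \<comment> \<open>\<open>x2\<close> enters the \<open>x1\<close> estimate with coefficient
    \<open>D1 * DE\<close>, and \<open>s2 * \<kappa>2\<close> exceeds this by 1. \<open>s3\<close>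
    is so small that the influence of \<open>x1\<close> on \<open>x3\<close> costs at most half of
    \<open>\<kappa>1\<close>. \<open>D\<close> gathers all contributions of \<open>x4\<close> and of
    the residual; \<open>s4\<close> and later \<open>\<beta>\<close> are set so that
    \<open>2 * \<eta> * s4\<close> and \<open>\<beta> * exp (- 2 * \<delta> * h)\<close> both equal
    \<open>D + 1\<close>.\<close>
  define s2 where "s2 = (D1 * DE + 1) / \<kappa>2"
  define s3 where "s3 = \<kappa>1 / (2 * (D3 + 1))"
  define D where "D = D1 * DE + s2 * D2 * DE'"
  define s4 where "s4 = (D + 1) / (2 * \<eta>)"
  have s2: "s2 > 0" using S1 S2 DD by (auto simp: s2_def intro!: divide_pos_pos add_nonneg_pos)
  have s3: "s3 > 0" using S1 DD by (auto simp: s3_def)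
  have D: "D \<ge> 0" using S1 S2 s2 DD by (auto simp: D_def)
  have s4: "s4 > 0" using D \<eta> by (auto simp: s4_def intro!: divide_pos_pos)
  \<comment> \<open>Common margin left once the weights are fixed. The terms carrying the tails of
    \<open>a\<close> and \<open>b\<close> are the remaining ones whose coefficients depend on
    \<open>N\<close>; they tend to 0 and eventually fit into this margin.\<close>
  define \<kappa> where "\<kappa> = min (min (\<kappa>1/2) 1) (s3 * \<eta>)"
  have \<kappa>: "\<kappa> > 0" "\<kappa> \<le> \<kappa>1/2" "\<kappa> \<le> 1" "\<kappa> \<le> s3 * \<eta>" using S1 s3 \<eta> by (auto simp: \<kappa>_def)
  define W where "W = (\<Sum>i\<in>?I. (w i)^2)"
  define BN where "BN = (\<Sum>i\<in>?I. (bet (i+1))^2)"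
  define LN where "LN = (\<Sum>i\<in>?I. (- lam (i+1) + qc)^2)"
  have WBL: "W \<ge> 0" "BN \<ge> 0" "LN \<ge> 0" by (auto simp: W_def BN_def LN_def intro: sum_nonneg)
  define D5 where "D5 = Kn * (3 * (LN + BN * Kn + W * DE))"
  have D5: "D5 \<ge> 0" using KC WBL DD by (auto simp: D5_def)
  define \<beta> where "\<beta> = (D + 1) * exp (2 * \<delta> * h)"
  have \<beta>: "\<beta> > 0" "\<beta> * exp (- 2 * \<delta> * h) = D + 1" using D by (auto simp: \<beta>_def exp_minus[symmetric] mult.assoc exp_add[symmetric])
  let ?ra = "\<lambda>N. tail2 phi (acoef p pd qt \<theta>2) N" and ?rb = "\<lambda>N. tail2 phi (bcoef \<theta>2) N"
  have ra: "?ra \<longlonglongrightarrow> 0" and rb: "?rb \<longlonglongrightarrow> 0" by (intro tail2_tendsto_0 sq_int_continuous acoef_cont bcoef_cont)+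
  have "(\<lambda>N. 2 * ?ra N * Kn + 2 * ?rb N * D5) \<longlonglongrightarrow> 2 * 0 * Kn + 2 * 0 * D5"
    by (intro tendsto_intros ra rb)
  then have ev1: "\<forall>\<^sub>F N in sequentially. 2 * ?ra N * Kn + 2 * ?rb N * D5 < \<kappa>"
    using order_tendstoD(2)[of _ 0 sequentially \<kappa>] \<kappa> by simp
  have "(\<lambda>N. \<beta> * Mphi lam phid N (1/2)) \<longlonglongrightarrow> \<beta> * 0"
    by (intro tendsto_intros Mphi_tendsto_0) auto
  from order_tendstoD(2)[OF this, of "1/2"]
  have ev2: "\<forall>\<^sub>F N in sequentially. \<beta> * Mphi lam phid N (1/2) < 1/2" by simp
  have ev3: "\<forall>\<^sub>F N in sequentially. 4 * (qc + \<delta>) \<le> lam (N+1)"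
    using filterlim_at_top[THEN iffD1, OF filterlim_compose[OF lam_at_top filterlim_Suc], rule_format, of "4 * (qc + \<delta>)"] by simp
  have ev4: "\<forall>\<^sub>F N in sequentially. N \<ge> N0" by (rule eventually_ge_at_top)
  have feas: "feasible p pd qt qc \<theta>2 lam phi phid K l N0 \<delta> h N"
    if e1: "2 * ?ra N * Kn + 2 * ?rb N * D5 < \<kappa>" and e2: "\<beta> * Mphi lam phid N (1/2) < 1/2"
      and e3: "4 * (qc + \<delta>) \<le> lam (N+1)" and N: "N \<ge> N0" for N
  proof -
    define P where "P = blockP N0 (N - N0) S1 S2 s2 s3 s4"
    have dim: "(N0 + N0) + ((N - N0) + (N - N0)) = 2 * N" using N by simp
    have Ppd: "pos_def P (2*N)"
      unfolding P_def dim[symmetric] by (rule blockP_pos_def[OF S1(3) S2(3) S1(1) S2(1) s2 s3 s4 S1(4) S2(4)])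
    have P: "P \<in> carrier_mat (2*N) (2*N)" "transpose_mat P = P" using Ppd by (auto simp: pos_def_def)
    have ra0: "?ra N \<ge> 0" "?rb N \<ge> 0" by (intro tail2_nonneg sq_int_continuous acoef_cont bcoef_cont)+
    have nsd: "neg_semidef (Theta1 lam qc bet c K l N0 N h \<delta> (?ra N) (?rb N) P 2 \<beta> 1) (2*N+1)"
      unfolding neg_semidef_def
    proof (intro conjI ballI)
      show "Theta1 lam qc bet c K l N0 N h \<delta> (?ra N) (?rb N) P 2 \<beta> 1 \<in> carrier_mat (2*N+1) (2*N+1)"
        by (rule Theta1_form(1)[OF N P refl refl refl refl])
      fix v :: "real vec" assume "v \<in> carrier_vec (2*N+1)"
      then obtain x1 x2 x3 x4 \<zeta> where v: "v = stack4 N0 (N - N0) x1 x2 x3 x4 @\<^sub>v vec 1 (\<lambda>_. \<zeta>)"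
        unfolding dim[symmetric] by (rule ex_stack4)
      let ?J = "{0..<N - N0}"
      define k where "k = feedback_val K N0 x1"
      define e where "e = innovation lam c N0 N x2 x4 \<zeta>"
      define n1 n2 n3 n4 where "n1 = (\<Sum>i\<in>?I. (x1 i)^2)" and "n2 = (\<Sum>i\<in>?I. (x2 i)^2)"
        and "n3 = (\<Sum>i\<in>?J. (x3 i)^2)" and "n4 = (\<Sum>i\<in>?J. (x4 i)^2)"
      have n: "n1 \<ge> 0" "n2 \<ge> 0" "n3 \<ge> 0" "n4 \<ge> 0" by (auto simp: n1_def n2_def n3_def n4_def intro: sum_nonneg)
      have shift: "(\<Sum>j\<in>?J. f (N0 + j + 1)) = (\<Sum>n\<in>{N0+1..N}. f n)" for f :: "nat \<Rightarrow> real"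
        by (rule sum.reindex_bij_witness[of _ "\<lambda>n. n - N0 - 1" "\<lambda>j. N0 + j + 1"]) (use N in auto)
      define t2 t4 where "t2 = (\<Sum>j\<in>?I. c (j+1) * x2 j)" and "t4 = (\<Sum>j\<in>?J. c (N0+j+1) / lam (N0+j+1) * x4 j)"
      have et: "e = t2 + t4 + \<zeta>" by (simp add: e_def innovation_def t2_def t4_def)
      have t2b: "t2^2 \<le> Cn * n2" unfolding t2_def Cn_def n2_def by (rule sum_Cauchy_Schwarz)
      have t4b: "t4^2 \<le> Bc * n4"
      proof -
        have "t4^2 \<le> (\<Sum>j\<in>?J. (c (N0+j+1) / lam (N0+j+1))^2) * n4" unfolding t4_def n4_def by (rule sum_Cauchy_Schwarz)
        also have "(\<Sum>j\<in>?J. (c (N0+j+1) / lam (N0+j+1))^2) = (\<Sum>n\<in>{N0+1..N}. (c n / lam n)^2)" by (rule shift)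
        also have "\<dots> * n4 \<le> Bc * n4" using n Bc(2)[rule_format, of "{N0+1..N}"] by (intro mult_right_mono) auto
        finally show ?thesis .
      qed
      have kb: "k^2 \<le> Kn * n1" unfolding k_def feedback_val_def Kn_def n1_def by (rule sum_Cauchy_Schwarz)
      have eb: "e^2 \<le> DE * (n2 + n4 + \<zeta>^2)"
      proof -
        have "e^2 \<le> 3 * (t2^2 + t4^2 + \<zeta>^2)" unfolding et by (rule square_sum3_le)
        also have "\<dots> \<le> 3 * (Cn * n2 + Bc * n4 + \<zeta>^2)" using t2b t4b by simp
        also have "\<dots> \<le> 3 * ((Cn + Bc + 1) * (n2 + n4 + \<zeta>^2))"
        proof -
          have "0 \<le> Cn * n4 + Cn * \<zeta>^2 + Bc * n2 + Bc * \<zeta>^2 + n2 + n4" using n KC Bc(1) by simp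
          then show ?thesis by (simp add: algebra_simps)
        qed
        finally show ?thesis unfolding DE_def mult.assoc .
      qed
      have eb': "(t4 + \<zeta>)^2 \<le> DE' * (n4 + \<zeta>^2)"
      proof -
        have "(t4 + \<zeta>)^2 \<le> 2 * (t4^2 + \<zeta>^2)" by (rule square_sum2_le)
        also have "\<dots> \<le> 2 * (Bc * n4 + \<zeta>^2)" using t4b by simp
        also have "\<dots> \<le> 2 * ((Bc + 1) * (n4 + \<zeta>^2))"
        proof -
          have "0 \<le> Bc * \<zeta>^2 + n4" using n Bc(1) by simp
          then show ?thesis by (simp add: algebra_simps)
        qed
        finally show ?thesis unfolding DE'_def mult.assoc .
      qed
      let ?y1 = "field1 lam qc bet l h x1 k e" and ?y2 = "field2 lam qc l x2 e"
        and ?y3 = "field3 lam qc bet N0 x3 k" and ?y4 = "field4 lam qc N0 x4"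
      have y1: "?y1 j = (\<Sum>m\<in>?I. A $$ (j,m) * x1 m) + w j * e" if "j \<in> ?I" for j
      proof -
        have "(A *\<^sub>v vec N0 x1) $ j = (- lam (j+1) + qc) * x1 j + bet (j+1) * k"
          unfolding A_def A0B0K_mult_vec k_def using that by simp
        moreover have "(A *\<^sub>v vec N0 x1) $ j = (\<Sum>m\<in>?I. A $$ (j,m) * x1 m)"
          using that Ac by (simp add: scalar_prod_def)
        ultimately show ?thesis by (simp add: field1_def w_def)
      qed
      have y2: "?y2 j = (\<Sum>m\<in>?I. A' $$ (j,m) * x2 m) + (- l (j+1)) * (t4 + \<zeta>)" if "j \<in> ?I" for j
      proof -
        have "(A' *\<^sub>v vec N0 x2) $ j = (- lam (j+1) + qc) * x2 j - l (j+1) * t2"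
          unfolding A'_def A0LC0_mult_vec t2_def using that by simp
        moreover have "(A' *\<^sub>v vec N0 x2) $ j = (\<Sum>m\<in>?I. A' $$ (j,m) * x2 m)"
          using that Ac by (simp add: scalar_prod_def)
        ultimately show ?thesis unfolding field2_def et by (simp add: algebra_simps)
      qed
      have Q1: "2 * (\<Sum>i\<in>?I. \<Sum>j\<in>?I. S1 i j * x1 i * ?y1 j) + 2 * \<delta> * (\<Sum>i\<in>?I. \<Sum>j\<in>?I. S1 i j * x1 i * x1 j)
          \<le> - \<kappa>1 * n1 + D1 * e^2"
        using S1(5)[of x1 e] by (simp add: y1 n1_def)
      have Q2: "2 * (\<Sum>i\<in>?I. \<Sum>j\<in>?I. S2 i j * x2 i * ?y2 j) + 2 * \<delta> * (\<Sum>i\<in>?I. \<Sum>j\<in>?I. S2 i j * x2 i * x2 j)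
          \<le> - \<kappa>2 * n2 + D2 * (t4 + \<zeta>)^2"
        using S2(5)[of x2 "t4 + \<zeta>"] by (simp add: y2 n2_def)
      have lamb: "- lam (N0+j+1) + qc + \<delta> \<le> - \<eta>" for j
        using lam_mono[of "N0+1" "N0+j+1"] by (simp add: \<eta>_def)
      have Q3: "2 * (\<Sum>i\<in>?J. x3 i * ?y3 i) + 2 * \<delta> * n3 \<le> - \<eta> * n3 + D3 * n1"
      proof -
        define t where "t = (\<Sum>j\<in>?J. bet (N0+j+1) / lam (N0+j+1) * x3 j)"
        have "t^2 \<le> (\<Sum>j\<in>?J. (bet (N0+j+1) / lam (N0+j+1))^2) * n3" unfolding t_def n3_def by (rule sum_Cauchy_Schwarz)
        also have "(\<Sum>j\<in>?J. (bet (N0+j+1) / lam (N0+j+1))^2) = (\<Sum>n\<in>{N0+1..N}. (bet n / lam n)^2)" by (rule shift)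
        also have "\<dots> * n3 \<le> Bb * n3" using n Bb(2)[rule_format, of "{N0+1..N}"] by (intro mult_right_mono) auto
        finally have tb: "t^2 \<le> Bb * n3" .
        have tb': "2 * (t * k) \<le> \<eta> * n3 + D3 * n1"
        proof (cases "Bb = 0")
          case True
          have "t = 0" using tb True by simp
          then show ?thesis using n \<eta> DD by simp
        next
          case False
          then have Bp: "Bb > 0" using Bb by simp
          have "2 * (t * k) \<le> (\<eta> / Bb) * t^2 + k^2 / (\<eta> / Bb)" using \<eta> Bp by (intro young_ineq) auto
          also have "(\<eta> / Bb) * t^2 \<le> (\<eta> / Bb) * (Bb * n3)" using tb \<eta> Bp by (intro mult_left_mono) auto
          also have "(\<eta> / Bb) * (Bb * n3) = \<eta> * n3" using Bp by simp
          finally have 1: "2 * (t * k) \<le> \<eta> * n3 + k^2 / (\<eta> / Bb)" by simp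
          have "k^2 / (\<eta> / Bb) \<le> (Kn * n1) / (\<eta> / Bb)" using kb \<eta> Bp by (intro divide_right_mono) auto
          also have "\<dots> = D3 * n1" by (simp add: D3_def)
          finally show ?thesis using 1 by linarith
        qed
        have "2 * (\<Sum>i\<in>?J. x3 i * ?y3 i) + 2 * \<delta> * n3 = (\<Sum>i\<in>?J. 2 * (- lam (N0+i+1) + qc + \<delta>) * (x3 i)^2) + 2 * (t * k)"
          unfolding field3_def n3_def t_def
          by (simp add: sum_distrib_left sum_distrib_right sum.distrib[symmetric] algebra_simps power2_eq_square)
        also have "(\<Sum>i\<in>?J. 2 * (- lam (N0+i+1) + qc + \<delta>) * (x3 i)^2) \<le> (\<Sum>i\<in>?J. 2 * (- \<eta>) * (x3 i)^2)"
          by (intro sum_mono mult_right_mono mult_left_mono lamb) auto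
        also have "\<dots> = - 2 * \<eta> * n3" by (simp add: n3_def sum_distrib_left)
        finally show ?thesis using tb' by simp
      qed
      have Q4: "2 * (\<Sum>i\<in>?J. x4 i * ?y4 i) + 2 * \<delta> * n4 \<le> - 2 * \<eta> * n4"
      proof -
        have "2 * (\<Sum>i\<in>?J. x4 i * ?y4 i) + 2 * \<delta> * n4 = (\<Sum>i\<in>?J. 2 * (- lam (N0+i+1) + qc + \<delta>) * (x4 i)^2)"
          unfolding field4_def n4_def
          by (simp add: sum_distrib_left sum.distrib[symmetric] algebra_simps power2_eq_square)
        also have "\<dots> \<le> (\<Sum>i\<in>?J. 2 * (- \<eta>) * (x4 i)^2)"
          by (intro sum_mono mult_right_mono mult_left_mono lamb) auto
        also have "\<dots> = - 2 * \<eta> * n4" by (simp add: n4_def sum_distrib_left)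
        finally show ?thesis .
      qed
      have Eb: "(\<Sum>i\<in>?I. K (i+1) * ?y1 i)^2 \<le> D5 * (n1 + n2 + n4 + \<zeta>^2)"
      proof -
        have "(\<Sum>i\<in>?I. K (i+1) * ?y1 i)^2 \<le> Kn * (\<Sum>i\<in>?I. (?y1 i)^2)" unfolding Kn_def by (rule sum_Cauchy_Schwarz)
        also have "(\<Sum>i\<in>?I. (?y1 i)^2) \<le> 3 * (LN * n1 + BN * k^2 + W * e^2)"
        proof -
          have "(\<Sum>i\<in>?I. (?y1 i)^2) \<le> (\<Sum>i\<in>?I. 3 * (((- lam (i+1) + qc) * x1 i)^2 + (bet (i+1) * k)^2 + (w i * e)^2))"
            unfolding field1_def w_def by (intro sum_mono square_sum3_le)
          also have "\<dots> = 3 * ((\<Sum>i\<in>?I. (- lam (i+1) + qc)^2 * (x1 i)^2) + BN * k^2 + W * e^2)"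
            by (simp add: sum_distrib_left[symmetric] sum.distrib power_mult_distrib BN_def W_def sum_distrib_right)
          also have "(\<Sum>i\<in>?I. (- lam (i+1) + qc)^2 * (x1 i)^2) \<le> (\<Sum>i\<in>?I. (- lam (i+1) + qc)^2 * n1)"
            unfolding n1_def by (intro sum_mono mult_left_mono member_le_sum) auto
          also have "\<dots> = LN * n1" by (simp add: LN_def sum_distrib_right)
          finally show ?thesis by simp
        qed
        also have "3 * (LN * n1 + BN * k^2 + W * e^2) \<le> 3 * (LN * n1 + BN * (Kn * n1) + W * (DE * (n2 + n4 + \<zeta>^2)))"
          using kb eb WBL by (intro mult_left_mono add_mono) auto
        also have "\<dots> \<le> 3 * ((LN + BN * Kn + W * DE) * (n1 + n2 + n4 + \<zeta>^2))"
        proof -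
          have "0 \<le> LN * (n2 + n4 + \<zeta>^2) + BN * Kn * (n2 + n4 + \<zeta>^2) + W * DE * n1" using n KC WBL DD by simp
          then show ?thesis by (simp add: algebra_simps)
        qed
        finally show ?thesis using KC(1) unfolding D5_def mult.assoc by (simp add: mult_left_mono)
      qed
      define Ev where "Ev = (\<Sum>i\<in>?I. K (i+1) * ?y1 i)^2"
      have form: "v \<bullet> (Theta1 lam qc bet c K l N0 N h \<delta> (?ra N) (?rb N) P 2 \<beta> 1 *\<^sub>v v) =
          (2 * (\<Sum>i\<in>?I. \<Sum>j\<in>?I. S1 i j * x1 i * ?y1 j) + 2 * \<delta> * (\<Sum>i\<in>?I. \<Sum>j\<in>?I. S1 i j * x1 i * x1 j))
          + s2 * (2 * (\<Sum>i\<in>?I. \<Sum>j\<in>?I. S2 i j * x2 i * ?y2 j) + 2 * \<delta> * (\<Sum>i\<in>?I. \<Sum>j\<in>?I. S2 i j * x2 i * x2 j))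
          + s3 * (2 * (\<Sum>i\<in>?J. x3 i * ?y3 i) + 2 * \<delta> * n3) + s4 * (2 * (\<Sum>i\<in>?J. x4 i * ?y4 i) + 2 * \<delta> * n4)
          + 2 * ?ra N * k^2 - (D + 1) * \<zeta>^2 + 2 * ?rb N * Ev"
        unfolding v Theta1_form(2)[OF N P k_def e_def refl refl] unfolding P_def stack4_blockP_form[OF S1(3) S2(3)] Ev_def \<beta>(2)
        by (simp add: n3_def n4_def power2_eq_square algebra_simps)
      have i1: "D1 * e^2 \<le> D1 * (DE * (n2 + n4 + \<zeta>^2))" using eb S1 by (intro mult_left_mono) auto
      have i2: "s2 * (2 * (\<Sum>i\<in>?I. \<Sum>j\<in>?I. S2 i j * x2 i * ?y2 j) + 2 * \<delta> * (\<Sum>i\<in>?I. \<Sum>j\<in>?I. S2 i j * x2 i * x2 j))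
          \<le> s2 * (- \<kappa>2 * n2 + D2 * (DE' * (n4 + \<zeta>^2)))"
        using Q2 mult_left_mono[OF eb' S2(2)] s2 by (intro mult_left_mono) auto
      have i3: "s3 * (2 * (\<Sum>i\<in>?J. x3 i * ?y3 i) + 2 * \<delta> * n3) \<le> s3 * (- \<eta> * n3 + D3 * n1)"
        using Q3 s3 by (intro mult_left_mono) auto
      have i4: "s4 * (2 * (\<Sum>i\<in>?J. x4 i * ?y4 i) + 2 * \<delta> * n4) \<le> s4 * (- 2 * \<eta> * n4)"
        using Q4 s4 by (intro mult_left_mono) auto
      have i5: "2 * ?ra N * k^2 \<le> 2 * ?ra N * (Kn * n1)" using kb ra0 by (intro mult_left_mono) auto
      have i6: "2 * ?rb N * Ev \<le> 2 * ?rb N * (D5 * (n1 + n2 + n4 + \<zeta>^2))" unfolding Ev_def using Eb ra0 by (intro mult_left_mono) auto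
      have j2: "s2 * \<kappa>2 = D1 * DE + 1" using S2 by (simp add: s2_def)
      have j4: "s4 * (2 * \<eta>) = D + 1" using \<eta> by (simp add: s4_def)
      have j3: "s3 * D3 \<le> \<kappa>1 / 2"
      proof -
        have "s3 * D3 = \<kappa>1 / 2 * (D3 / (D3 + 1))" by (simp add: s3_def)
        also have "\<dots> \<le> \<kappa>1 / 2 * 1" using S1 DD by (intro mult_left_mono) auto
        finally show ?thesis by simp
      qed
      have "v \<bullet> (Theta1 lam qc bet c K l N0 N h \<delta> (?ra N) (?rb N) P 2 \<beta> 1 *\<^sub>v v)
        \<le> - \<kappa>1 * n1 + D1 * (DE * (n2 + n4 + \<zeta>^2)) + s2 * (- \<kappa>2 * n2 + D2 * (DE' * (n4 + \<zeta>^2)))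
          + s3 * (- \<eta> * n3 + D3 * n1) + s4 * (- 2 * \<eta> * n4) + 2 * ?ra N * (Kn * n1) - (D + 1) * \<zeta>^2
          + 2 * ?rb N * (D5 * (n1 + n2 + n4 + \<zeta>^2))"
        unfolding form using Q1 i1 i2 i3 i4 i5 i6 by linarith
      also have "\<dots> = (s3 * D3 - \<kappa>1) * n1 + (D1 * DE - s2 * \<kappa>2) * n2 - s3 * \<eta> * n3 + (D - s4 * (2 * \<eta>)) * n4 - \<zeta>^2
          + 2 * ?ra N * Kn * n1 + 2 * ?rb N * D5 * (n1 + n2 + n4 + \<zeta>^2)"
        by (simp add: D_def algebra_simps)
      also have "\<dots> \<le> (- (\<kappa>1 / 2)) * n1 + (- 1) * n2 - s3 * \<eta> * n3 + (- 1) * n4 - \<zeta>^2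
          + 2 * ?ra N * Kn * (n1 + n2 + n4 + \<zeta>^2) + 2 * ?rb N * D5 * (n1 + n2 + n4 + \<zeta>^2)"
      proof -
        have "(s3 * D3 - \<kappa>1) * n1 \<le> (- (\<kappa>1 / 2)) * n1" using j3 n by (intro mult_right_mono) auto
        moreover have "2 * ?ra N * Kn * n1 \<le> 2 * ?ra N * Kn * (n1 + n2 + n4 + \<zeta>^2)" using n KC ra0 by (intro mult_left_mono) auto
        moreover have "(D1 * DE - s2 * \<kappa>2) * n2 = (- 1) * n2" "(D - s4 * (2 * \<eta>)) * n4 = (- 1) * n4" by (simp_all add: j2 j4)
        ultimately show ?thesis by linarith
      qed
      also have "\<dots> \<le> - \<kappa> * (n1 + n2 + n4 + \<zeta>^2) + (2 * ?ra N * Kn + 2 * ?rb N * D5) * (n1 + n2 + n4 + \<zeta>^2)"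
      proof -
        have "\<kappa> * n1 \<le> \<kappa>1 / 2 * n1" "\<kappa> * n2 \<le> 1 * n2" "\<kappa> * n4 \<le> 1 * n4" "\<kappa> * \<zeta>^2 \<le> 1 * \<zeta>^2" "0 \<le> s3 * \<eta> * n3"
          using mult_right_mono[OF \<kappa>(2) n(1)] mult_right_mono[OF \<kappa>(3) n(2)] mult_right_mono[OF \<kappa>(3) n(4)]
            mult_right_mono[OF \<kappa>(3) zero_le_power2[of \<zeta>]] n(3) s3 \<eta> by simp_all
        then show ?thesis by (simp add: algebra_simps)
      qed
      also have "\<dots> = (2 * ?ra N * Kn + 2 * ?rb N * D5 - \<kappa>) * (n1 + n2 + n4 + \<zeta>^2)" by (simp add: algebra_simps)
      also have "\<dots> \<le> 0" using e1 n by (intro mult_nonpos_nonneg) auto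
      finally show "v \<bullet> (Theta1 lam qc bet c K l N0 N h \<delta> (?ra N) (?rb N) P 2 \<beta> 1 *\<^sub>v v) \<le> 0" .
    qed
    have l: "lam (N+1) > 0" by (rule lam_pos) simp
    show ?thesis
      unfolding feasible_def
    \<comment> \<open>For \<open>\<epsilon> = 1/2\<close> the powers of \<open>lam (N+1)\<close> in
      the scalar constraints have exponents 1 and 0. With \<open>\<alpha> = 2\<close> and
      \<open>\<gamma> = 1\<close> they follow from \<open>\<beta> * Mphi < 1/2\<close> and
      \<open>4 * (qc + \<delta>) \<le> lam (N+1)\<close>.\<close>
    proof (rule exI[of _ "1/2"], rule exI[of _ P], rule exI[of _ 2], rule exI[of _ \<beta>], rule exI[of _ 1], intro conjI)
      show "0 < (1/2::real)" "(1/2::real) \<le> 1/2" "(2::real) > 1" "(1::real) > 0" by auto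
      show "pos_def P (2*N)" "\<beta> > 0" by fact+
      show "neg_semidef (Theta1 lam qc (betac p \<theta>2 phi phid) (\<lambda>n. phid n 0) K l N0 N h \<delta> (?ra N) (?rb N) P 2 \<beta> 1) (2*N+1)"
        using nsd unfolding bet_def c_def .
      have "\<beta> * Mphi lam phid N (1/2) * lam (N+1) \<le> 1/2 * lam (N+1)" using e2 l by (intro mult_right_mono) auto
      show "2 * 1 * (- (1 - 1/2) * lam (N+1) + qc + \<delta>) + \<beta> * Mphi lam phid N (1/2) * lam (N+1) powr (1/2 + 1/2) \<le> 0"
      proof -
        have pw: "lam (N+1) powr (1/2 + 1/2) = lam (N+1)" using l by simp
        have "2 * 1 * (- (1 - 1/2) * x + qc + \<delta>) + y \<le> 0" if "4 * (qc + \<delta>) \<le> x" "y \<le> 1/2 * x" for x y :: real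
          using that by simp
        then show ?thesis unfolding pw using e3 \<open>\<beta> * Mphi lam phid N (1/2) * lam (N+1) \<le> 1/2 * lam (N+1)\<close>
by blast
      qed
      show "2 * 1 * (1 - 1/2) - \<beta> * Mphi lam phid N (1/2) / lam (N+1) powr (1/2 - 1/2) \<ge> 0"
        using e2 l by simp
    qed
  qed
  have "\<forall>\<^sub>F N in sequentially. feasible p pd qt qc \<theta>2 lam phi phid K l N0 \<delta> h N"
    using ev1 ev2 ev3 ev4 by eventually_elim (rule feas)
  then show ?thesis by (simp add: eventually_sequentially)
qed

end

section \<open>Modal trajectories\<close>

text \<open>Differentiability and the rate are asked for only in the open interval: plant modes are
  differentiable only at positive times, and the bound on the output history is available only
  strictly between 0 and \<open>h\<close>. The constant \<open>r\<close> carries a forcing term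
  along with \<open>f\<close>.\<close>

lemma gronwall:
  fixes f f' :: "real \<Rightarrow> real"
  assumes f: "continuous_on {0..T} f" and d: "\<And>t. 0 < t \<Longrightarrow> t < T \<Longrightarrow> (f has_real_derivative f' t) (at t)"
    and le: "\<And>t. 0 < t \<Longrightarrow> t < T \<Longrightarrow> f' t \<le> C * (f t + r)" and t: "0 \<le> t" "t \<le> T"
  shows "f t + r \<le> exp (C * t) * (f 0 + r)"
proof (cases "t = 0")
  case False
  define g where "g = (\<lambda>t. exp (- C * t) * (f t + r))"
  have "g t \<le> g 0"
  proof (rule DERIV_nonpos_imp_decreasing_open[of 0 t g])
    show "0 \<le> t" by (rule t)
    show "continuous_on {0..t} g"
      unfolding g_def using t by (intro continuous_intros continuous_on_subset[OF f]) auto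
    fix s assume s: "0 < s" "s < t"
    have "(g has_real_derivative exp (- C * s) * (f' s - C * (f s + r))) (at s)"
      unfolding g_def using d[of s] s t by (auto intro!: derivative_eq_intros simp: algebra_simps)
    moreover have "exp (- C * s) * (f' s - C * (f s + r)) \<le> 0"
      using le[of s] s t by (intro mult_nonneg_nonpos) auto
    ultimately show "\<exists>y. (g has_real_derivative y) (at s) \<and> y \<le> 0" by blast
  qed
  then have "exp (C * t) * g t \<le> exp (C * t) * g 0" by (intro mult_left_mono) auto
  also have "exp (C * t) * g t = exp (C * t + - C * t) * (f t + r)"
    unfolding g_def exp_add by (simp only: mult.assoc)
  also have "\<dots> = f t + r" by simp
  also have "exp (C * t) * g 0 = exp (C * t) * (f 0 + r)" by (simp add: g_def)
  finally show ?thesis .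
qed simp

lemma sum_squares_rate:
  fixes f m g1 g2 :: "nat \<Rightarrow> real"
  assumes "\<And>n. n \<in> I \<Longrightarrow> m n \<le> L"
  shows "(\<Sum>n\<in>I. 2 * f n * (m n * f n + g1 n * p - g2 n * q))
    \<le> (2 * L + 2) * (\<Sum>n\<in>I. (f n)^2) + (\<Sum>n\<in>I. (g1 n)^2) * p^2 + (\<Sum>n\<in>I. (g2 n)^2) * q^2"
proof -
  have "(\<Sum>n\<in>I. 2 * f n * (m n * f n + g1 n * p - g2 n * q))
      \<le> (\<Sum>n\<in>I. (2 * L + 2) * (f n)^2 + (g1 n)^2 * p^2 + (g2 n)^2 * q^2)"
  proof (rule sum_mono)
    fix n assume n: "n \<in> I"
    have "m n * (f n)^2 \<le> L * (f n)^2" using assms[OF n] by (intro mult_right_mono) auto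
    moreover have "2 * (f n * (g1 n * p)) \<le> (f n)^2 + (g1 n * p)^2"
      using young_ineq[of 1 "f n" "g1 n * p"] by simp
    moreover have "2 * (f n * (- g2 n * q)) \<le> (f n)^2 + (- g2 n * q)^2"
      using young_ineq[of 1 "f n" "- g2 n * q"] by simp
    moreover have "2 * f n * (m n * f n + g1 n * p - g2 n * q)
      = 2 * (m n * (f n)^2) + 2 * (f n * (g1 n * p)) + 2 * (f n * (- g2 n * q))"
      by (simp add: algebra_simps power2_eq_square)
    moreover have "(g1 n * p)^2 = (g1 n)^2 * p^2" "(- g2 n * q)^2 = (g2 n)^2 * q^2"
      "(2 * L + 2) * (f n)^2 = 2 * (L * (f n)^2) + 2 * (f n)^2"
      by (simp_all add: power_mult_distrib algebra_simps)
    ultimately show "2 * f n * (m n * f n + g1 n * p - g2 n * q) \<le> (2 * L + 2) * (f n)^2 + (g1 n)^2 * p^2 + (g2 n)^2 * q^2"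
      by linarith
  qed
  then show ?thesis by (simp add: sum.distrib sum_distrib_left sum_distrib_right)
qed

text \<open>The plant reduced to sequences: growth of \<open>lam\<close> and square sums of
  \<open>a\<close>, \<open>b\<close> and \<open>c n / lam n\<close>, bounded over finite index sets
  so that they apply directly to truncations. No function of the space variable occurs until the
  final section.\<close>

locale modal_data =
  fixes lam a b c bet K l :: "nat \<Rightarrow> real" and qc \<delta> h A2 B2 C2 :: real and N0 N :: nat
  assumes lam_pos: "\<And>n. n \<ge> 1 \<Longrightarrow> lam n > 0"
    and lam_mono: "\<And>m n. 1 \<le> m \<Longrightarrow> m \<le> n \<Longrightarrow> lam m \<le> lam n"
    and h: "h > 0" and delta: "\<delta> > 0" and N0N: "N0 \<le> N"
    and bet: "\<And>n. n \<ge> 1 \<Longrightarrow> bet n = a n + (qc - lam n) * b n"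
    and a2: "\<And>I. finite I \<Longrightarrow> I \<subseteq> {1..} \<Longrightarrow> (\<Sum>n\<in>I. (a n)^2) \<le> A2"
    and b2: "\<And>I. finite I \<Longrightarrow> I \<subseteq> {1..} \<Longrightarrow> (\<Sum>n\<in>I. (b n)^2) \<le> B2"
    and c2: "\<And>I. finite I \<Longrightarrow> I \<subseteq> {1..} \<Longrightarrow> (\<Sum>n\<in>I. (c n / lam n)^2) \<le> C2"
begin

definition mu :: "nat \<Rightarrow> real" where "mu n = - lam n + qc"

definition innov :: "(nat \<Rightarrow> real \<Rightarrow> real) \<Rightarrow> (real \<Rightarrow> real) \<Rightarrow> (real \<Rightarrow> real) \<Rightarrow> real \<Rightarrow> real" where
  "innov zh u y t = (\<Sum>k=1..N. (zh k t + b k * u (t - h)) * c k) - y t"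

text \<open>Extending \<open>l\<close> by zero lets one equation describe both kinds of observer
  modes.\<close>

definition gain :: "nat \<Rightarrow> real" where "gain n = (if n \<le> N0 then l n else 0)"

abbreviation pred :: "(nat \<Rightarrow> real \<Rightarrow> real) \<Rightarrow> (real \<Rightarrow> real) \<Rightarrow> nat \<Rightarrow> real \<Rightarrow> real" where
  "pred zh u n t \<equiv> ZA lam qc bet h zh u n t"

text \<open>The derivative of \<open>u\<close> as predicted by the dynamics of the predictor, stated
  as a formula so that it can be estimated like any other term. After \<open>t = h\<close> it equals
  \<open>K\<close> times the first component of the closed-loop vector field.\<close>

definition udot :: "(nat \<Rightarrow> real \<Rightarrow> real) \<Rightarrow> (real \<Rightarrow> real) \<Rightarrow> (real \<Rightarrow> real) \<Rightarrow> real \<Rightarrow> real" where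
  "udot zh u y t = (\<Sum>n=1..N0. K n * (mu n * pred zh u n t + bet n * u t - exp (mu n * h) * gain n * innov zh u y t))"

text \<open>\<open>zn n t\<close> is the \<open>n\<close>-th modal coefficient of the plant state, \<open>zn n t + b n * u t\<close> that of the
  homogenised state \<open>w\<close>; \<open>Y\<close> bounds the initial output history and \<open>W\<close> the graph norm
  of \<open>w\<^sub>0\<close>.\<close>

definition modal_trajectory ::
  "(nat \<Rightarrow> real \<Rightarrow> real) \<Rightarrow> (nat \<Rightarrow> real \<Rightarrow> real) \<Rightarrow> (real \<Rightarrow> real) \<Rightarrow> (real \<Rightarrow> real) \<Rightarrow> real \<Rightarrow> real \<Rightarrow> bool" where
  "modal_trajectory zn zh u y Y W \<longleftrightarrow>
     continuous_on UNIV u \<and> (\<forall>\<tau>\<le>0. u \<tau> = u 0) \<and>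
     (\<forall>t\<ge>0. u t = (\<Sum>n=1..N0. K n * pred zh u n t)) \<and>
     (\<forall>n\<in>{1..N}. \<forall>t\<ge>0. (zh n has_real_derivative
        (mu n * zh n t + bet n * u (t - h) - gain n * innov zh u y t)) (at t within {0..})) \<and>
     (\<forall>n\<ge>1. continuous_on {0..} (zn n)) \<and>
     (\<forall>n\<ge>1. \<forall>t>0. (zn n has_real_derivative (mu n * zn n t + bet n * u t)) (at t)) \<and>
     (\<forall>t. 0 < t \<and> t < h \<longrightarrow> \<bar>y t\<bar> \<le> Y) \<and>
     (\<forall>t\<ge>h. (\<lambda>M. \<Sum>n=1..M. (zn n (t - h) + b n * u (t - h)) * c n) \<longlonglongrightarrow> y t) \<and>
     (\<forall>T. \<exists>B. \<forall>s\<in>{0..T}. \<forall>M. (\<Sum>n=1..M. (lam n)^2 * (zn n s + b n * u s)^2) \<le> B) \<and>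
     (\<forall>M. (\<Sum>n=1..M. (lam n)^2 * (zn n 0 + b n * u 0)^2) \<le> W)"

definition init_energy :: "(nat \<Rightarrow> real \<Rightarrow> real) \<Rightarrow> (real \<Rightarrow> real) \<Rightarrow> real \<Rightarrow> real \<Rightarrow> real" where
  "init_energy zh u Y W = W + (\<Sum>n=1..N. (zh n 0)^2) + (u 0)^2 + Y^2"

lemma A2_nonneg: "A2 \<ge> 0" and B2_nonneg: "B2 \<ge> 0" and C2_nonneg: "C2 \<ge> 0"
  using a2[of "{}"] b2[of "{}"] c2[of "{}"] by auto

end

locale modal_solution = modal_data +
  fixes zn zh :: "nat \<Rightarrow> real \<Rightarrow> real" and u y :: "real \<Rightarrow> real" and Y W :: real
  assumes traj: "modal_trajectory zn zh u y Y W"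
begin

abbreviation w :: "nat \<Rightarrow> real \<Rightarrow> real" where "w n t \<equiv> zn n t + b n * u t"
abbreviation R0 :: real where "R0 \<equiv> init_energy zh u Y W"
abbreviation inn :: "real \<Rightarrow> real" where "inn t \<equiv> innov zh u y t"
abbreviation up :: "real \<Rightarrow> real" where "up t \<equiv> udot zh u y t"

lemma u_cont: "continuous_on A u"
  and u_past: "\<And>\<tau>. \<tau> \<le> 0 \<Longrightarrow> u \<tau> = u 0"
  and u_eq: "\<And>t. t \<ge> 0 \<Longrightarrow> u t = (\<Sum>n=1..N0. K n * pred zh u n t)"
  and zh_deriv: "\<And>n t. n \<in> {1..N} \<Longrightarrow> t \<ge> 0 \<Longrightarrow> (zh n has_real_derivative
        (mu n * zh n t + bet n * u (t - h) - gain n * inn t)) (at t within {0..})"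
  and zn_cont: "\<And>n. n \<ge> 1 \<Longrightarrow> continuous_on {0..} (zn n)"
  and zn_deriv: "\<And>n t. n \<ge> 1 \<Longrightarrow> t > 0 \<Longrightarrow> (zn n has_real_derivative (mu n * zn n t + bet n * u t)) (at t)"
  and y_bound: "\<And>t. 0 < t \<Longrightarrow> t < h \<Longrightarrow> \<bar>y t\<bar> \<le> Y"
  and y_lim: "\<And>t. t \<ge> h \<Longrightarrow> (\<lambda>M. \<Sum>n=1..M. w n (t - h) * c n) \<longlonglongrightarrow> y t"
  and w_bound: "\<And>T. \<exists>B. \<forall>s\<in>{0..T}. \<forall>M. (\<Sum>n=1..M. (lam n)^2 * (w n s)^2) \<le> B"
  and w0_bound: "\<And>M. (\<Sum>n=1..M. (lam n)^2 * (w n 0)^2) \<le> W"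
proof -
  note t = traj[unfolded modal_trajectory_def]
  show "continuous_on A u" for A by (rule continuous_on_subset[OF conjunct1[OF t] subset_UNIV])
  show "\<And>\<tau>. \<tau> \<le> 0 \<Longrightarrow> u \<tau> = u 0" using t by blast
  show "\<And>t. t \<ge> 0 \<Longrightarrow> u t = (\<Sum>n=1..N0. K n * pred zh u n t)" using t by blast
  show "\<And>n t. n \<in> {1..N} \<Longrightarrow> t \<ge> 0 \<Longrightarrow> (zh n has_real_derivative
        (mu n * zh n t + bet n * u (t - h) - gain n * inn t)) (at t within {0..})" using t by blast
  show "\<And>n. n \<ge> 1 \<Longrightarrow> continuous_on {0..} (zn n)" using t by blast
  show "\<And>n t. n \<ge> 1 \<Longrightarrow> t > 0 \<Longrightarrow> (zn n has_real_derivative (mu n * zn n t + bet n * u t)) (at t)" using t by blast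
  show "\<And>t. 0 < t \<Longrightarrow> t < h \<Longrightarrow> \<bar>y t\<bar> \<le> Y" using t by blast
  show "\<And>t. t \<ge> h \<Longrightarrow> (\<lambda>M. \<Sum>n=1..M. w n (t - h) * c n) \<longlonglongrightarrow> y t" using t by blast
  show "\<And>T. \<exists>B. \<forall>s\<in>{0..T}. \<forall>M. (\<Sum>n=1..M. (lam n)^2 * (w n s)^2) \<le> B" using t by blast
  show "\<And>M. (\<Sum>n=1..M. (lam n)^2 * (w n 0)^2) \<le> W" using t by blast
qed

lemma W_nonneg: "W \<ge> 0" using w0_bound[of 0] by simp

lemma zh_deriv_at:
  assumes "n \<in> {1..N}" "t > 0"
  shows "(zh n has_real_derivative (mu n * zh n t + bet n * u (t - h) - gain n * inn t)) (at t)"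
proof -
  have "at t within {0..} = at t" using assms by (intro at_within_interior) (simp add: interior_real_atLeast)
  then show ?thesis using zh_deriv[OF assms(1), of t] assms(2) by simp
qed

lemma zh_cont: "n \<in> {1..N} \<Longrightarrow> continuous_on {0..} (zh n)"
  unfolding continuous_on_eq_continuous_within
proof
  fix t :: real assume "n \<in> {1..N}" "t \<in> {0..}"
  then show "continuous (at t within {0..}) (zh n)" using zh_deriv[of n t] by (auto intro: DERIV_continuous)
qed

text \<open>Factoring \<open>exp (mu n * (t - s))\<close> takes \<open>t\<close> out of the
  integrand, so the integral over the moving window becomes a difference of values of one fixed
  primitive. The primitive starts at \<open>- h\<close>, where the window for \<open>t = 0\<close>
  begins.\<close>

lemma pred_repr:
  obtains Gi where "continuous_on {-h..} Gi"
    "\<And>t. t > - h \<Longrightarrow> (Gi has_real_derivative exp (- mu n * t) * bet n * u t) (at t)"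
    "\<And>t. t \<ge> 0 \<Longrightarrow> pred zh u n t = exp (mu n * h) * zh n t + exp (mu n * t) * (Gi t - Gi (t - h))"
proof -
  define g where "g = (\<lambda>s. exp (- mu n * s) * bet n * u s)"
  have gc: "continuous_on A g" for A unfolding g_def by (intro continuous_intros u_cont)
  have gi: "g integrable_on {x..y}" for x y by (intro integrable_continuous_interval gc)
  define Gi where "Gi = (\<lambda>t. integral {-h..t} g)"
  have w: "(Gi has_real_derivative g t) (at t within {-h..T})" if "t \<in> {-h..T}" for t T
    unfolding Gi_def has_real_derivative_iff_has_vector_derivative
    using that by (intro integral_has_vector_derivative gc)
  show thesis
  proof (rule that[of Gi])
    show "(Gi has_real_derivative exp (- mu n * t) * bet n * u t) (at t)" if "t > - h" for t
    proof -
      have "at t within {-h..t+1} = at t" using that by (intro at_within_interior) simp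
      then show ?thesis using w[of t "t+1"] that by (simp add: g_def)
    qed
    show "continuous_on {-h..} Gi"
      unfolding continuous_on_eq_continuous_within
    proof
      fix t assume t: "t \<in> {-h..}"
      have "continuous (at t within {-h..t+1}) Gi" using w[of t "t+1"] t by (auto intro: DERIV_continuous)
      moreover have "at t within {-h..t+1} = at t within {-h..}"
        by (rule at_within_nhd[of _ "{t-1<..<t+1}"]) auto
      ultimately show "continuous (at t within {-h..}) Gi" by simp
    qed
    fix t :: real assume t: "t \<ge> 0"
    have "integral {t - h..t} (\<lambda>s. exp ((- lam n + qc) * (t - s)) * bet n * u s) = integral {t - h..t} (\<lambda>s. exp (mu n * t) * g s)"
    proof (rule integral_cong)
      fix s :: real
      have "exp (mu n * t) * exp (- mu n * s) = exp ((- lam n + qc) * (t - s))"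
        by (simp add: exp_add[symmetric] mu_def algebra_simps)
      then show "exp ((- lam n + qc) * (t - s)) * bet n * u s = exp (mu n * t) * g s"
        by (simp only: g_def mult.assoc[symmetric])
    qed
    also have "\<dots> = exp (mu n * t) * integral {t - h..t} g" by simp
    also have "integral {t - h..t} g = Gi t - Gi (t - h)"
      unfolding Gi_def using Henstock_Kurzweil_Integration.integral_combine[of "-h" "t - h" t g] gi t h by (simp add: algebra_simps)
    finally show "pred zh u n t = exp (mu n * h) * zh n t + exp (mu n * t) * (Gi t - Gi (t - h))"
      unfolding ZA_def by (simp add: mu_def)
  qed
qed

lemma pred_cont:
  assumes "n \<in> {1..N}" shows "continuous_on {0..} (pred zh u n)"
proof -
  obtain Gi where G: "continuous_on {-h..} Gi"
    "\<And>t. t \<ge> 0 \<Longrightarrow> pred zh u n t = exp (mu n * h) * zh n t + exp (mu n * t) * (Gi t - Gi (t - h))"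
    by (rule pred_repr[of n], rule that) auto
  have "continuous_on {0..} (\<lambda>t. exp (mu n * h) * zh n t + exp (mu n * t) * (Gi t - Gi (t - h)))"
    using h by (intro continuous_intros zh_cont assms continuous_on_subset[OF G(1)] continuous_on_compose2[OF G(1)]) auto
  then show ?thesis by (rule continuous_on_eq) (use G(2) in auto)
qed

text \<open>The Artstein reduction: differentiating the lower limit of the window produces
  \<open>- exp (mu n * h) * bet n * u (t - h)\<close>, which cancels the delayed input in the
  observer equation. What remains is driven by the present input and by the innovation.\<close>

lemma pred_deriv:
  assumes n: "n \<in> {1..N}" and t: "t > 0"
  shows "(pred zh u n has_real_derivative (mu n * pred zh u n t + bet n * u t - exp (mu n * h) * gain n * inn t)) (at t)"
proof -
  obtain Gi where G: "\<And>t. t > - h \<Longrightarrow> (Gi has_real_derivative exp (- mu n * t) * bet n * u t) (at t)"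
    "\<And>t. t \<ge> 0 \<Longrightarrow> pred zh u n t = exp (mu n * h) * zh n t + exp (mu n * t) * (Gi t - Gi (t - h))"
    by (rule pred_repr[of n], rule that) auto
  have d1: "(Gi has_real_derivative exp (- mu n * t) * bet n * u t) (at t)" using G(1)[of t] t h by simp
  have d2: "((\<lambda>t. Gi (t - h)) has_real_derivative exp (- mu n * (t - h)) * bet n * u (t - h)) (at t)"
    using DERIV_shift[of Gi "exp (- mu n * (t - h)) * bet n * u (t - h)" t "-h"] G(1)[of "t - h"] t by simp
  have "((\<lambda>t. exp (mu n * h) * zh n t + exp (mu n * t) * (Gi t - Gi (t - h))) has_real_derivative
     (exp (mu n * h) * (mu n * zh n t + bet n * u (t - h) - gain n * inn t) +
      (exp (mu n * t) * mu n * (Gi t - Gi (t - h))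
       + exp (mu n * t) * (exp (- mu n * t) * bet n * u t - exp (- mu n * (t - h)) * bet n * u (t - h))))) (at t)"
    using d1 d2 zh_deriv_at[OF n t] by (auto intro!: derivative_eq_intros)
  also have "exp (mu n * h) * (mu n * zh n t + bet n * u (t - h) - gain n * inn t) +
      (exp (mu n * t) * mu n * (Gi t - Gi (t - h))
       + exp (mu n * t) * (exp (- mu n * t) * bet n * u t - exp (- mu n * (t - h)) * bet n * u (t - h)))
     = mu n * pred zh u n t + bet n * u t - exp (mu n * h) * gain n * inn t"
  proof -
    have "exp (mu n * t) * exp (- mu n * t) = 1" "exp (mu n * t) * exp (- mu n * (t - h)) = exp (mu n * h)"
      by (simp_all add: exp_add[symmetric] algebra_simps)
    then have q: "exp (mu n * t) * (exp (- mu n * t) * bet n * u t - exp (- mu n * (t - h)) * bet n * u (t - h))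
      = bet n * u t - exp (mu n * h) * bet n * u (t - h)"
      by (simp only: right_diff_distrib mult.assoc[symmetric] mult_1)
    have p: "pred zh u n t = exp (mu n * h) * zh n t + exp (mu n * t) * (Gi t - Gi (t - h))" using G(2) t by simp
    show ?thesis unfolding q p by (simp only: algebra_simps)
  qed
  finally have D: "((\<lambda>t. exp (mu n * h) * zh n t + exp (mu n * t) * (Gi t - Gi (t - h))) has_real_derivative
     mu n * pred zh u n t + bet n * u t - exp (mu n * h) * gain n * inn t) (at t)" .
  show ?thesis
    using D by (rule has_field_derivative_transform_within_open[where S = "{0<..}"]) (use t G(2) in auto)
qed

lemma u_deriv:
  assumes "t > 0" shows "(u has_real_derivative up t) (at t)"
proof -
  have "((\<lambda>t. \<Sum>n=1..N0. K n * pred zh u n t) has_real_derivative up t) (at t)"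
    unfolding udot_def using N0N assms by (intro DERIV_sum DERIV_cmult pred_deriv) auto
  then show ?thesis
    by (rule has_field_derivative_transform_within_open[where S = "{0<..}"]) (use assms u_eq in auto)
qed

lemma w_cont: "n \<ge> 1 \<Longrightarrow> continuous_on {0..} (w n)"
  by (intro continuous_intros zn_cont u_cont)

text \<open>Adding \<open>b n * u\<close> to the mode trades the boundary coefficient
  \<open>bet n\<close> for \<open>a n\<close> acting on \<open>u\<close> and \<open>b n\<close>
  acting on its derivative, by the relation \<open>bet\<close>.\<close>

lemma w_deriv:
  assumes n: "n \<ge> 1" and t: "t > 0"
  shows "((\<lambda>t. w n t) has_real_derivative (mu n * w n t + a n * u t + b n * up t)) (at t)"
  using zn_deriv[OF n t] u_deriv[OF t]
  by (auto intro!: derivative_eq_intros simp: bet[OF n] mu_def algebra_simps)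

end

section \<open>A priori bounds on the first delay interval\<close>

context modal_data begin

text \<open>For \<open>0 < t < h\<close> the delayed input is the constant \<open>u 0\<close> and
  the output is bounded by \<open>Y\<close>, so the observer is a linear system that does not see
  the plant. One Gronwall estimate bounds it, hence the innovation; a second one bounds the
  predictor, in which \<open>u\<close> is a linear feedback. \<open>u\<close> and its derivative
  follow.\<close>

lemma apriori_observer:
  "\<exists>C\<ge>0. \<forall>zn zh u y Y W. modal_trajectory zn zh u y Y W \<longrightarrow>
     (\<forall>t\<in>{0..h}. (\<Sum>n=1..N. (zh n t)^2) \<le> C * init_energy zh u Y W \<and>
        (\<Sum>n=1..N. (pred zh u n t)^2) \<le> C * init_energy zh u Y W \<and>
        (u t)^2 \<le> C * init_energy zh u Y W \<and> (0 < t \<and> t < h \<longrightarrow> (udot zh u y t)^2 \<le> C * init_energy zh u Y W))"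
proof -
  let ?I = "{1..N}"
  define L where "L = (\<Sum>n\<in>?I. \<bar>mu n\<bar>)"
  have L: "mu n \<le> L" if "n \<in> ?I" for n
  proof -
    have "\<bar>mu n\<bar> \<le> L" unfolding L_def using that by (intro member_le_sum) auto
    then show ?thesis by simp
  qed
  have L0: "L \<ge> 0" by (simp add: L_def sum_nonneg)
  define Cc Cbc Bn Ln Ln' Kn where "Cc = (\<Sum>n\<in>?I. (c n)^2)" and "Cbc = (\<Sum>n\<in>?I. b n * c n)^2"
    and "Bn = (\<Sum>n\<in>?I. (bet n)^2)" and "Ln = (\<Sum>n\<in>?I. (gain n)^2)" and "Ln' = (\<Sum>n\<in>?I. (exp (mu n * h) * gain n)^2)"
    and "Kn = (\<Sum>n\<in>{1..N0}. (K n)^2)"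
  have nn: "Cc \<ge> 0" "Cbc \<ge> 0" "Bn \<ge> 0" "Ln \<ge> 0" "Ln' \<ge> 0" "Kn \<ge> 0"
    by (auto simp: Cc_def Cbc_def Bn_def Ln_def Ln'_def Kn_def intro!: sum_nonneg)
  define Ci where "Ci = 3 * (Cc + Cbc + 1)"
  have Ci: "Ci \<ge> 0" using nn by (simp add: Ci_def)
  define CG where "CG = 2 * L + 2 + Bn + Ln * Ci"
  have CG: "CG \<ge> 0" using nn Ci L0 by (simp add: CG_def)
  define C1 where "C1 = exp (CG * h)"
  define Cr where "Cr = Ci * C1"
  define CH where "CH = 2 * L + 2 + Bn * Kn + Ln'"
  have CH: "CH \<ge> 0" using nn L0 by (simp add: CH_def)
  define E2 where "E2 = (\<Sum>n\<in>?I. (exp (mu n * h))^2)"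
  define J2 where "J2 = (\<Sum>n\<in>?I. (integral {- h..0} (\<lambda>s. exp (mu n * (0 - s)) * bet n))^2)"
  define Cp0 where "Cp0 = 2 * (E2 + J2)"
  define C2' where "C2' = exp (CH * h) * (Cp0 + Cr)"
  define Cu where "Cu = Kn * C2'"
  define Cud where "Cud = Kn * (3 * (L^2 * C2' + Bn * Cu + Ln' * Cr))"
  have pos: "C1 \<ge> 0" "Cr \<ge> 0" "E2 \<ge> 0" "J2 \<ge> 0" "Cp0 \<ge> 0"
    using Ci by (auto simp: C1_def Cr_def E2_def J2_def Cp0_def intro!: sum_nonneg add_nonneg_nonneg)
  have pos2: "C2' \<ge> 0" "Cu \<ge> 0" "Cud \<ge> 0"
    using pos nn by (auto simp: C2'_def Cu_def Cud_def)
  define C where "C = C1 + C2' + Cu + Cud"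
  have "(\<Sum>n=1..N. (zh n t)^2) \<le> C * init_energy zh u Y W \<and>
        (\<Sum>n=1..N. (pred zh u n t)^2) \<le> C * init_energy zh u Y W \<and>
        (u t)^2 \<le> C * init_energy zh u Y W \<and> (0 < t \<and> t < h \<longrightarrow> (udot zh u y t)^2 \<le> C * init_energy zh u Y W)"
    if tr: "modal_trajectory zn zh u y Y W" and t: "t \<in> {0..h}" for zn zh u y Y W t
  proof -
    interpret modal_solution lam a b c bet K l qc \<delta> h A2 B2 C2 N0 N zn zh u y Y W
      by unfold_locales (rule tr)
    \<comment> \<open>The constant forcing of the observer on this interval, carried as the additive
      constant of the Gronwall lemma.\<close>
    define r where "r = (u 0)^2 + Y^2"
    define G where "G = (\<lambda>t. \<Sum>n\<in>?I. (zh n t)^2)"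
    define H where "H = (\<lambda>t. \<Sum>n\<in>?I. (pred zh u n t)^2)"
    have G0: "G t \<ge> 0" "H t \<ge> 0" for t by (auto simp: G_def H_def intro: sum_nonneg)
    have r0: "r \<ge> 0" by (simp add: r_def)
    have GR: "G 0 + r \<le> R0" unfolding G_def r_def init_energy_def using W_nonneg by simp
    have R0: "R0 \<ge> 0" using GR G0[of 0] r0 by linarith
    have ib: "(inn t)^2 \<le> Ci * (G t + r)" if "0 < t" "t < h" for t
    proof -
      have e: "inn t = (\<Sum>k\<in>?I. c k * zh k t) + u 0 * (\<Sum>k\<in>?I. b k * c k) + (- y t)"
        unfolding innov_def using u_past[of "t - h"] that
        by (simp add: distrib_right distrib_left sum.distrib sum_distrib_left mult_ac)
      have "(inn t)^2 \<le> 3 * ((\<Sum>k\<in>?I. c k * zh k t)^2 + (u 0 * (\<Sum>k\<in>?I. b k * c k))^2 + (- y t)^2)"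
        unfolding e by (rule square_sum3_le)
      also have "(\<Sum>k\<in>?I. c k * zh k t)^2 \<le> Cc * G t" unfolding Cc_def G_def by (rule sum_Cauchy_Schwarz)
      also have "(u 0 * (\<Sum>k\<in>?I. b k * c k))^2 = Cbc * (u 0)^2" by (simp add: Cbc_def power_mult_distrib)
      also have "(- y t)^2 \<le> Y^2" using power_mono[OF y_bound[OF that], of 2] by simp
      finally have 1: "(inn t)^2 \<le> 3 * (Cc * G t + Cbc * (u 0)^2 + Y^2)" by simp
      have "Cc * G t + Cbc * (u 0)^2 + Y^2 \<le> (Cc + Cbc + 1) * (G t + r)"
      proof -
        have "0 \<le> Cc * (u 0)^2 + Cc * Y^2 + Cbc * G t + Cbc * Y^2 + G t + (u 0)^2" using nn G0 by simp
        then show ?thesis by (simp add: r_def algebra_simps)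
      qed
      then have "3 * (Cc * G t + Cbc * (u 0)^2 + Y^2) \<le> Ci * (G t + r)" unfolding Ci_def mult.assoc by (rule mult_left_mono) simp
      with 1 show ?thesis by (rule order_trans)
    qed
    have Gb: "G t + r \<le> exp (CG * t) * (G 0 + r)" if "0 \<le> t" "t \<le> h" for t
    proof (rule gronwall[of h G "\<lambda>t. \<Sum>n\<in>?I. 2 * zh n t * (mu n * zh n t + bet n * u 0 - gain n * inn t)"])
      show "continuous_on {0..h} G" unfolding G_def
        by (intro continuous_intros continuous_on_subset[OF zh_cont]) auto
      fix s assume s: "0 < s" "s < h"
      show "(G has_real_derivative (\<Sum>n\<in>?I. 2 * zh n s * (mu n * zh n s + bet n * u 0 - gain n * inn s))) (at s)"
        unfolding G_def
      proof (rule DERIV_sum)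
        fix n assume n: "n \<in> ?I"
        have "u (s - h) = u 0" using u_past[of "s - h"] s by simp
        then show "((\<lambda>t. (zh n t)^2) has_real_derivative 2 * zh n s * (mu n * zh n s + bet n * u 0 - gain n * inn s)) (at s)"
          using zh_deriv_at[OF n s(1)] by (auto intro!: derivative_eq_intros)
      qed
      have "(\<Sum>n\<in>?I. 2 * zh n s * (mu n * zh n s + bet n * u 0 - gain n * inn s))
        \<le> (2 * L + 2) * G s + Bn * (u 0)^2 + Ln * (inn s)^2"
        unfolding G_def Bn_def Ln_def by (rule sum_squares_rate[OF L])
      also have "\<dots> \<le> (2 * L + 2) * (G s + r) + Bn * (G s + r) + Ln * (Ci * (G s + r))"
        using L0 nn G0[of s] ib[OF s] r0 by (intro add_mono mult_left_mono) (auto simp: r_def)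
      also have "\<dots> = CG * (G s + r)" by (simp add: CG_def algebra_simps)
      finally show "(\<Sum>n\<in>?I. 2 * zh n s * (mu n * zh n s + bet n * u 0 - gain n * inn s)) \<le> CG * (G s + r)" .
    qed (use that in auto)
    have Gb': "G t + r \<le> C1 * R0" if "0 \<le> t" "t \<le> h" for t
    proof -
      have "exp (CG * t) \<le> C1" unfolding C1_def using CG that by (simp add: mult_left_mono)
      then have "exp (CG * t) * (G 0 + r) \<le> C1 * R0" using GR G0[of 0] r0 pos(1) by (intro mult_mono) auto
      then show ?thesis using Gb[OF that] by linarith
    qed
    have ib': "(inn t)^2 \<le> Cr * R0" if "0 < t" "t < h" for t
    proof -
      have "Ci * (G t + r) \<le> Ci * (C1 * R0)" using Gb'[of t] that Ci by (intro mult_left_mono) auto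
      then show ?thesis using ib[OF that] by (simp add: Cr_def)
    qed
    have ub: "(u t)^2 \<le> Kn * H t" if "t \<ge> 0" for t
    proof -
      have "(u t)^2 \<le> Kn * (\<Sum>n=1..N0. (pred zh u n t)^2)"
        unfolding u_eq[OF that] Kn_def by (rule sum_Cauchy_Schwarz)
      also have "(\<Sum>n=1..N0. (pred zh u n t)^2) \<le> H t" unfolding H_def using N0N by (intro sum_mono2) auto
      finally show ?thesis using nn by (simp add: mult_left_mono)
    qed
    have H0: "H 0 \<le> Cp0 * R0"
    proof -
      have e: "pred zh u n 0 = exp (mu n * h) * zh n 0 + integral {- h..0} (\<lambda>s. exp (mu n * (0 - s)) * bet n) * u 0" if "n \<in> ?I" for n
      proof -
        have "integral {0 - h..0} (\<lambda>s. exp ((- lam n + qc) * (0 - s)) * bet n * u s)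
          = integral {- h..0} (\<lambda>s. exp (mu n * (0 - s)) * bet n * u 0)"
        proof -
          have "integral {- h..0} (\<lambda>s. exp ((- lam n + qc) * (0 - s)) * bet n * u s)
            = integral {- h..0} (\<lambda>s. exp (mu n * (0 - s)) * bet n * u 0)"
          proof (rule integral_cong)
            fix s :: real assume "s \<in> {- h..0}"
            then have "u s = u 0" by (intro u_past) simp
            then show "exp ((- lam n + qc) * (0 - s)) * bet n * u s = exp (mu n * (0 - s)) * bet n * u 0"
              by (simp only: mu_def)
          qed
          then show ?thesis by simp
        qed
        then show ?thesis unfolding ZA_def by (simp add: mu_def)
      qed
      have "H 0 \<le> (\<Sum>n\<in>?I. 2 * ((exp (mu n * h) * zh n 0)^2 + (integral {- h..0} (\<lambda>s. exp (mu n * (0 - s)) * bet n) * u 0)^2))"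
        unfolding H_def using e by (intro sum_mono) (simp only: square_sum2_le)
      also have "\<dots> = 2 * ((\<Sum>n\<in>?I. (exp (mu n * h))^2 * (zh n 0)^2) + J2 * (u 0)^2)"
        by (simp add: J2_def sum_distrib_left sum_distrib_right sum.distrib power_mult_distrib)
      also have "(\<Sum>n\<in>?I. (exp (mu n * h))^2 * (zh n 0)^2) \<le> (\<Sum>n\<in>?I. (exp (mu n * h))^2 * R0)"
      proof (rule sum_mono, rule mult_left_mono)
        fix n assume n: "n \<in> ?I"
        have "(zh n 0)^2 \<le> G 0" unfolding G_def using n by (intro member_le_sum) auto
        then show "(zh n 0)^2 \<le> R0" using GR r0 by linarith
      qed auto
      also have "\<dots> = E2 * R0" by (simp add: E2_def sum_distrib_right)
      also have "J2 * (u 0)^2 \<le> J2 * R0"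
      proof (rule mult_left_mono[OF _ pos(4)])
        show "(u 0)^2 \<le> R0" using GR G0(1)[of 0] unfolding r_def by (smt (verit) zero_le_power2)
      qed
      finally show ?thesis by (simp add: Cp0_def algebra_simps)
    qed
    \<comment> \<open>The first Gronwall step bounds the squared innovation by this constant, which
      then acts as forcing for the predictor.\<close>
    define \<rho> where "\<rho> = Cr * R0"
    have \<rho>: "\<rho> \<ge> 0" using pos R0 by (simp add: \<rho>_def)
    have Hb: "H t + \<rho> \<le> exp (CH * t) * (H 0 + \<rho>)" if "0 \<le> t" "t \<le> h" for t
    proof (rule gronwall[of h H "\<lambda>t. \<Sum>n\<in>?I. 2 * pred zh u n t * (mu n * pred zh u n t + bet n * u t - (exp (mu n * h) * gain n) * inn t)"])
      show "continuous_on {0..h} H" unfolding H_def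
        by (intro continuous_intros continuous_on_subset[OF pred_cont]) auto
      fix s assume s: "0 < s" "s < h"
      show "(H has_real_derivative (\<Sum>n\<in>?I. 2 * pred zh u n s * (mu n * pred zh u n s + bet n * u s - (exp (mu n * h) * gain n) * inn s))) (at s)"
        unfolding H_def
      proof (rule DERIV_sum)
        fix n assume n: "n \<in> ?I"
        show "((\<lambda>t. (pred zh u n t)^2) has_real_derivative 2 * pred zh u n s * (mu n * pred zh u n s + bet n * u s - (exp (mu n * h) * gain n) * inn s)) (at s)"
          using pred_deriv[OF n s(1)] by (auto intro!: derivative_eq_intros)
      qed
      have "(\<Sum>n\<in>?I. 2 * pred zh u n s * (mu n * pred zh u n s + bet n * u s - (exp (mu n * h) * gain n) * inn s))
        \<le> (2 * L + 2) * H s + Bn * (u s)^2 + Ln' * (inn s)^2"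
        unfolding H_def Bn_def Ln'_def by (rule sum_squares_rate[OF L])
      also have "\<dots> \<le> (2 * L + 2) * (H s + \<rho>) + Bn * (Kn * (H s + \<rho>)) + Ln' * (H s + \<rho>)"
      proof (intro add_mono mult_left_mono)
        have "Kn * H s \<le> Kn * (H s + \<rho>)" using nn \<rho> by (intro mult_left_mono) auto
        then show "(u s)^2 \<le> Kn * (H s + \<rho>)" using ub[of s] s by linarith
        show "(inn s)^2 \<le> H s + \<rho>" using ib'[OF s] G0[of s] by (simp add: \<rho>_def)
      qed (use L0 nn \<rho> in auto)
      also have "\<dots> = CH * (H s + \<rho>)" by (simp add: CH_def algebra_simps)
      finally show "(\<Sum>n\<in>?I. 2 * pred zh u n s * (mu n * pred zh u n s + bet n * u s - (exp (mu n * h) * gain n) * inn s)) \<le> CH * (H s + \<rho>)" .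
    qed (use that in auto)
    have Hb': "H t \<le> C2' * R0" if "0 \<le> t" "t \<le> h" for t
    proof -
      have "exp (CH * t) \<le> exp (CH * h)" using CH that by (simp add: mult_left_mono)
      then have "exp (CH * t) * (H 0 + \<rho>) \<le> exp (CH * h) * (Cp0 * R0 + \<rho>)" using H0 G0[of 0] \<rho> by (intro mult_mono) auto
      also have "\<dots> = C2' * R0" by (simp add: C2'_def \<rho>_def algebra_simps)
      finally show ?thesis using Hb[OF that] \<rho> by linarith
    qed
    have ub': "(u t)^2 \<le> Cu * R0" if "0 \<le> t" "t \<le> h" for t
      using ub[OF that(1)] mult_left_mono[OF Hb'[OF that] nn(6)] by (simp add: Cu_def)
    have udb: "(up t)^2 \<le> Cud * R0" if "0 < t" "t < h" for t
    proof -
      have "(up t)^2 \<le> Kn * (\<Sum>n=1..N0. (mu n * pred zh u n t + bet n * u t - exp (mu n * h) * gain n * inn t)^2)"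
        unfolding udot_def Kn_def by (rule sum_Cauchy_Schwarz)
      also have "(\<Sum>n=1..N0. (mu n * pred zh u n t + bet n * u t - exp (mu n * h) * gain n * inn t)^2)
        \<le> (\<Sum>n\<in>?I. (mu n * pred zh u n t + bet n * u t - exp (mu n * h) * gain n * inn t)^2)"
        using N0N by (intro sum_mono2) auto
      also have "\<dots> \<le> (\<Sum>n\<in>?I. 3 * (L^2 * (pred zh u n t)^2 + (bet n)^2 * (u t)^2 + (exp (mu n * h) * gain n)^2 * (inn t)^2))"
      proof (rule sum_mono)
        fix n assume n: "n \<in> ?I"
        have "\<bar>mu n\<bar> \<le> L" unfolding L_def using n by (intro member_le_sum) auto
        then have "(mu n)^2 \<le> L^2" by (metis abs_ge_zero power2_abs power_mono)
        then have "(mu n * pred zh u n t)^2 \<le> L^2 * (pred zh u n t)^2" unfolding power_mult_distrib by (intro mult_right_mono) auto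
        moreover have "(mu n * pred zh u n t + bet n * u t + (- (exp (mu n * h) * gain n * inn t)))^2
          \<le> 3 * ((mu n * pred zh u n t)^2 + (bet n * u t)^2 + (- (exp (mu n * h) * gain n * inn t))^2)"
          by (rule square_sum3_le)
        ultimately show "(mu n * pred zh u n t + bet n * u t - exp (mu n * h) * gain n * inn t)^2
          \<le> 3 * (L^2 * (pred zh u n t)^2 + (bet n)^2 * (u t)^2 + (exp (mu n * h) * gain n)^2 * (inn t)^2)"
          by (simp add: power_mult_distrib)
      qed
      also have "\<dots> = 3 * (L^2 * H t + Bn * (u t)^2 + Ln' * (inn t)^2)"
        by (simp add: H_def Bn_def Ln'_def sum_distrib_left sum_distrib_right sum.distrib)
      also have "\<dots> \<le> 3 * (L^2 * (C2' * R0) + Bn * (Cu * R0) + Ln' * (Cr * R0))"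
        using that nn by (intro mult_left_mono add_mono Hb' ub' ib') auto
      also have "Kn * \<dots> = Cud * R0" by (simp add: Cud_def algebra_simps)
      finally show ?thesis using nn by (simp add: mult_left_mono)
    qed
    have tt: "0 \<le> t" "t \<le> h" using t by auto
    have le: "C1 * R0 \<le> C * R0" "C2' * R0 \<le> C * R0" "Cu * R0 \<le> C * R0" "Cud * R0 \<le> C * R0"
      using pos pos2 R0 by (auto simp: C_def intro!: mult_right_mono)
    show ?thesis
      using Gb'[OF tt] r0 Hb'[OF tt] ub'[OF tt] udb[of t] le unfolding G_def H_def by (intro conjI impI; force)
  qed
  moreover have "C \<ge> 0" using pos pos2 by (simp add: C_def)
  ultimately show ?thesis by blast
qed

end

section \<open>Quadratic forms and integrals along trajectories\<close>

lemma integral_deriv_at: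
  fixes g :: "real \<Rightarrow> real"
  assumes g: "continuous_on {0..} g" and t: "t > 0"
  shows "((\<lambda>t. integral {0..t} g) has_real_derivative g t) (at t)"
proof -
  have "((\<lambda>t. integral {0..t} g) has_real_derivative g t) (at t within {0..t+1})"
    unfolding has_real_derivative_iff_has_vector_derivative
    using t by (intro integral_has_vector_derivative continuous_on_subset[OF g]) auto
  moreover have "at t within {0..t+1} = at t" using t by (intro at_within_interior) simp
  ultimately show ?thesis by simp
qed

lemma integral_continuous_halfline:
  fixes g :: "real \<Rightarrow> real"
  assumes g: "continuous_on {0..} g"
  shows "continuous_on {0..T} (\<lambda>t. integral {0..t} g)"
  by (intro indefinite_integral_continuous_1 integrable_continuous_interval continuous_on_subset[OF g]) auto

lemma sum_atLeast1_shift: "(\<Sum>n=1..m. f n) = (\<Sum>i\<in>{0..<m}. f (i+1))" for f :: "nat \<Rightarrow> real"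
  by (rule sum.reindex_bij_witness[of _ "\<lambda>i. i + 1" "\<lambda>n. n - 1"]) auto

lemma sum_shift_above: "(\<Sum>j\<in>{0..<N-N0}. f (N0+j+1)) = (\<Sum>n\<in>{N0+1..N}. f n)" for f :: "nat \<Rightarrow> real"
  by (rule sum.reindex_bij_witness[of _ "\<lambda>n. n - N0 - 1" "\<lambda>j. N0 + j + 1"]) auto

lemma stack4_form_deriv:
  fixes P :: "real mat" and x1 x2 x3 x4 :: "real \<Rightarrow> nat \<Rightarrow> real"
  assumes P: "P \<in> carrier_mat n n" and sym: "transpose_mat P = P" and n: "n = (m+m)+(k+k)"
    and d1: "\<And>i. i < m \<Longrightarrow> ((\<lambda>t. x1 t i) has_real_derivative y1 i) (at s)"
    and d2: "\<And>i. i < m \<Longrightarrow> ((\<lambda>t. x2 t i) has_real_derivative y2 i) (at s)"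
    and d3: "\<And>i. i < k \<Longrightarrow> ((\<lambda>t. x3 t i) has_real_derivative y3 i) (at s)"
    and d4: "\<And>i. i < k \<Longrightarrow> ((\<lambda>t. x4 t i) has_real_derivative y4 i) (at s)"
  shows "((\<lambda>t. stack4 m k (x1 t) (x2 t) (x3 t) (x4 t) \<bullet> (P *\<^sub>v stack4 m k (x1 t) (x2 t) (x3 t) (x4 t)))
    has_real_derivative 2 * (stack4 m k y1 y2 y3 y4 \<bullet> (P *\<^sub>v stack4 m k (x1 s) (x2 s) (x3 s) (x4 s)))) (at s)"
proof -
  define X where "X = (\<lambda>t. stack4 m k (x1 t) (x2 t) (x3 t) (x4 t))"
  define Y where "Y = stack4 m k y1 y2 y3 y4"
  have Xc: "X t \<in> carrier_vec n" for t unfolding X_def n by (rule stack4_carrier)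
  have Yc: "Y \<in> carrier_vec n" unfolding Y_def n by (rule stack4_carrier)
  have dX: "((\<lambda>t. X t $ i) has_real_derivative Y $ i) (at s)" if "i < n" for i
  proof -
    consider "i < m" | "m \<le> i" "i < m + m" | "m + m \<le> i" "i < m + m + k" | "m + m + k \<le> i" by linarith
    then show ?thesis
    proof cases
      case 1
      then have "(\<lambda>t. X t $ i) = (\<lambda>t. x1 t i)" "Y $ i = y1 i" by (auto simp: X_def Y_def stack4_def)
      then show ?thesis using d1[OF 1] by simp
    next
      case 2
      then have "(\<lambda>t. X t $ i) = (\<lambda>t. x2 t (i - m))" "Y $ i = y2 (i - m)" by (auto simp: X_def Y_def stack4_def)
      then show ?thesis using d2[of "i - m"] 2 by simp
    next
      case 3
      then have "i - (m + m) < k" by linarith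
      with 3 have "(\<lambda>t. X t $ i) = (\<lambda>t. x3 t (i - (m+m)))" "Y $ i = y3 (i - (m+m))" by (auto simp: X_def Y_def stack4_def)
      then show ?thesis using d3[of "i - (m+m)"] 3 by simp
    next
      case 4
      have "\<not> i < m + m" "\<not> i - (m+m) < k" "i - (m+m) - k < k" using 4 that n by linarith+
      then have "(\<lambda>t. X t $ i) = (\<lambda>t. x4 t (i - (m+m) - k))" "Y $ i = y4 (i - (m+m) - k)"
        using that n unfolding X_def Y_def stack4_def by (simp_all del: diff_diff_left)
      then show ?thesis using d4[of "i - (m+m) - k"] 4 that n by simp
    qed
  qed
  have form: "V \<bullet> (P *\<^sub>v U) = (\<Sum>i\<in>{0..<n}. \<Sum>j\<in>{0..<n}. P $$ (i,j) * (V $ i * U $ j))"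
    if "V \<in> carrier_vec n" "U \<in> carrier_vec n" for U V
    using that P by (auto simp: scalar_prod_def sum_distrib_left mult_ac intro!: sum.cong)
  have X_app: "stack4 m k (x1 t) (x2 t) (x3 t) (x4 t) = X t" for t by (simp add: X_def)
  have Ps: "P $$ (i,j) = P $$ (j,i)" if "i < n" "j < n" for i j
    using arg_cong[OF sym, of "\<lambda>A. A $$ (j,i)"] that P by simp
  have "((\<lambda>t. \<Sum>i\<in>{0..<n}. \<Sum>j\<in>{0..<n}. P $$ (i,j) * (X t $ i * X t $ j)) has_real_derivative
     (\<Sum>i\<in>{0..<n}. \<Sum>j\<in>{0..<n}. P $$ (i,j) * (Y $ i * X s $ j + Y $ j * X s $ i))) (at s)"
    by (intro DERIV_sum DERIV_cmult DERIV_mult dX) auto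
  also have "(\<Sum>i\<in>{0..<n}. \<Sum>j\<in>{0..<n}. P $$ (i,j) * (Y $ i * X s $ j + Y $ j * X s $ i))
    = (\<Sum>i\<in>{0..<n}. \<Sum>j\<in>{0..<n}. P $$ (i,j) * (Y $ i * X s $ j)) + (\<Sum>i\<in>{0..<n}. \<Sum>j\<in>{0..<n}. P $$ (i,j) * (Y $ j * X s $ i))"
    by (simp add: distrib_left sum.distrib)
  also have "(\<Sum>i\<in>{0..<n}. \<Sum>j\<in>{0..<n}. P $$ (i,j) * (Y $ j * X s $ i)) = (\<Sum>i\<in>{0..<n}. \<Sum>j\<in>{0..<n}. P $$ (i,j) * (Y $ i * X s $ j))"
    by (subst sum.swap) (intro sum.cong refl, use Ps in auto)
  finally show ?thesis
    unfolding X_app Y_def[symmetric] form[OF Xc Xc] form[OF Yc Xc] by simp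
qed

lemma stack4_form_le:
  fixes P :: "real mat"
  assumes P: "P \<in> carrier_mat n n" and n: "n = (m+m)+(k+k)"
  shows "\<exists>C\<ge>0. \<forall>x1 x2 x3 x4. stack4 m k x1 x2 x3 x4 \<bullet> (P *\<^sub>v stack4 m k x1 x2 x3 x4)
    \<le> C * ((\<Sum>i\<in>{0..<m}. (x1 i)^2) + (\<Sum>i\<in>{0..<m}. (x2 i)^2) + (\<Sum>i\<in>{0..<k}. (x3 i)^2) + (\<Sum>i\<in>{0..<k}. (x4 i)^2))"
proof (intro exI[of _ "\<Sum>i\<in>{0..<n}. \<Sum>j\<in>{0..<n}. \<bar>P $$ (i,j)\<bar>"] conjI allI)
  fix x1 x2 x3 x4
  define X where "X = stack4 m k x1 x2 x3 x4"
  have X: "X \<in> carrier_vec n" unfolding X_def n by (rule stack4_carrier)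
  have XX: "(\<Sum>i\<in>{0..<m}. (x1 i)^2) + (\<Sum>i\<in>{0..<m}. (x2 i)^2) + (\<Sum>i\<in>{0..<k}. (x3 i)^2) + (\<Sum>i\<in>{0..<k}. (x4 i)^2) = X \<bullet> X"
    unfolding X_def stack4_scalar_prod by (simp add: power2_eq_square)
  have sq: "(X $ i)^2 \<le> X \<bullet> X" if "i < n" for i
  proof -
    have "X $ i * X $ i \<le> (\<Sum>i\<in>{0..<n}. X $ i * X $ i)"
      using that by (intro member_le_sum[of i "{0..<n}" "\<lambda>i. X $ i * X $ i"]) auto
    then show ?thesis using X by (simp add: scalar_prod_def power2_eq_square)
  qed
  have "X \<bullet> (P *\<^sub>v X) = (\<Sum>i\<in>{0..<n}. \<Sum>j\<in>{0..<n}. P $$ (i,j) * (X $ i * X $ j))"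
    using X P by (auto simp: scalar_prod_def sum_distrib_left mult_ac intro!: sum.cong)
  also have "\<dots> \<le> (\<Sum>i\<in>{0..<n}. \<Sum>j\<in>{0..<n}. \<bar>P $$ (i,j)\<bar> * (X \<bullet> X))"
  proof (intro sum_mono)
    fix i j assume ij: "i \<in> {0..<n}" "j \<in> {0..<n}"
    have "\<bar>X $ i * X $ j\<bar> \<le> X \<bullet> X"
    proof -
      have "2 * (\<bar>X $ i\<bar> * \<bar>X $ j\<bar>) \<le> (X $ i)^2 + (X $ j)^2" using young_ineq[of 1 "\<bar>X $ i\<bar>" "\<bar>X $ j\<bar>"] by simp
      then show ?thesis using sq[of i] sq[of j] ij by (simp add: abs_mult)
    qed
    then have "\<bar>P $$ (i,j)\<bar> * \<bar>X $ i * X $ j\<bar> \<le> \<bar>P $$ (i,j)\<bar> * (X \<bullet> X)" by (intro mult_left_mono) auto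
    with abs_ge_self[of "P $$ (i,j) * (X $ i * X $ j)"]
    show "P $$ (i,j) * (X $ i * X $ j) \<le> \<bar>P $$ (i,j)\<bar> * (X \<bullet> X)"
      unfolding abs_mult[of "P $$ (i,j)"] by (rule order_trans)
  qed
  also have "\<dots> = (\<Sum>i\<in>{0..<n}. \<Sum>j\<in>{0..<n}. \<bar>P $$ (i,j)\<bar>) * (X \<bullet> X)" by (simp add: sum_distrib_right)
  finally show "stack4 m k x1 x2 x3 x4 \<bullet> (P *\<^sub>v stack4 m k x1 x2 x3 x4)
    \<le> (\<Sum>i\<in>{0..<n}. \<Sum>j\<in>{0..<n}. \<bar>P $$ (i,j)\<bar>) * ((\<Sum>i\<in>{0..<m}. (x1 i)^2) + (\<Sum>i\<in>{0..<m}. (x2 i)^2) + (\<Sum>i\<in>{0..<k}. (x3 i)^2) + (\<Sum>i\<in>{0..<k}. (x4 i)^2))"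
    unfolding XX X_def .
qed (auto intro!: sum_nonneg)

lemma stack4_form_ge:
  fixes P :: "real mat"
  assumes P: "pos_def P n" and n: "n = (m+m)+(k+k)"
  shows "\<exists>C>0. \<forall>x1 x2 x3 x4. C * ((\<Sum>i\<in>{0..<m}. (x1 i)^2) + (\<Sum>i\<in>{0..<m}. (x2 i)^2) + (\<Sum>i\<in>{0..<k}. (x3 i)^2) + (\<Sum>i\<in>{0..<k}. (x4 i)^2))
    \<le> stack4 m k x1 x2 x3 x4 \<bullet> (P *\<^sub>v stack4 m k x1 x2 x3 x4)"
proof -
  have Pc: "P \<in> carrier_mat n n" using P by (simp add: pos_def_def)
  have form: "X \<bullet> (P *\<^sub>v X) = (\<Sum>i\<in>{0..<n}. \<Sum>j\<in>{0..<n}. P $$ (i,j) * X $ i * X $ j)" if "X \<in> carrier_vec n" for X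
    using that Pc by (auto simp: scalar_prod_def sum_distrib_left mult_ac intro!: sum.cong)
  have pos: "0 < (\<Sum>i\<in>{0..<n}. \<Sum>j\<in>{0..<n}. P $$ (i,j) * x i * x j)" if "\<exists>i<n. x i \<noteq> 0" for x
  proof -
    have "vec n x \<noteq> 0\<^sub>v n"
    proof
      assume a: "vec n x = 0\<^sub>v n"
      have "x i = 0" if "i < n" for i using arg_cong[OF a, of "\<lambda>v. v $ i"] that by simp
      then show False using that by blast
    qed
    then have "0 < vec n x \<bullet> (P *\<^sub>v vec n x)" using P unfolding pos_def_def by simp
    then show ?thesis unfolding form[OF vec_carrier] by simp
  qed
  obtain C where C: "C > 0" "\<And>x. C * (\<Sum>i\<in>{0..<n}. (x i)^2) \<le> (\<Sum>i\<in>{0..<n}. \<Sum>j\<in>{0..<n}. P $$ (i,j) * x i * x j)"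
    using quadratic_form_coercive[of n "\<lambda>i j. P $$ (i,j)", OF pos] by blast
  show ?thesis
  proof (intro exI[of _ C] conjI allI C(1))
    fix x1 x2 x3 x4
    define X where "X = stack4 m k x1 x2 x3 x4"
    have X: "X \<in> carrier_vec n" unfolding X_def n by (rule stack4_carrier)
    have "(\<Sum>i\<in>{0..<m}. (x1 i)^2) + (\<Sum>i\<in>{0..<m}. (x2 i)^2) + (\<Sum>i\<in>{0..<k}. (x3 i)^2) + (\<Sum>i\<in>{0..<k}. (x4 i)^2) = X \<bullet> X"
      unfolding X_def stack4_scalar_prod by (simp add: power2_eq_square)
    also have "\<dots> = (\<Sum>i\<in>{0..<n}. (X $ i)^2)" using X by (simp add: scalar_prod_def power2_eq_square)
    finally show "C * ((\<Sum>i\<in>{0..<m}. (x1 i)^2) + (\<Sum>i\<in>{0..<m}. (x2 i)^2) + (\<Sum>i\<in>{0..<k}. (x3 i)^2) + (\<Sum>i\<in>{0..<k}. (x4 i)^2))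
      \<le> stack4 m k x1 x2 x3 x4 \<bullet> (P *\<^sub>v stack4 m k x1 x2 x3 x4)"
      unfolding X_def[symmetric] form[OF X] using C(2)[of "\<lambda>i. X $ i"] by simp
  qed
qed

context modal_data begin

lemma sum_lam_le_sum_lam2:
  assumes "I \<subseteq> {1..}"
  shows "(\<Sum>n\<in>I. lam n * (f n)^2) \<le> (\<Sum>n\<in>I. (lam n)^2 * (f n)^2) / lam 1"
proof -
  have "lam n * (f n)^2 \<le> (lam n)^2 * (f n)^2 / lam 1" if "n \<in> I" for n
  proof -
    have n: "n \<ge> 1" using that assms by auto
    have "lam 1 * lam n \<le> lam n * lam n" using lam_mono[of 1 n] lam_pos[OF n] n by (intro mult_right_mono) auto
    then have "(lam 1 * lam n) * (f n)^2 \<le> (lam n * lam n) * (f n)^2" by (rule mult_right_mono) simp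
    then show ?thesis using lam_pos[of 1] by (simp add: field_simps power2_eq_square)
  qed
  from sum_mono[OF this] show ?thesis by (simp add: sum_divide_distrib)
qed

text \<open>Energy estimate for the homogenised modes, uniform in the truncation \<open>M\<close>.
  The derivative of the energy contains \<open>- 2 * D\<close>; Young's inequality spends one
  \<open>D\<close> on the inputs, and integrating the other gives the time integral of
  \<open>\<Sum> (lam n)^2 * (w n)^2\<close>. That integral bounds the memory term of the functional
  at \<open>t = h\<close>.\<close>

lemma apriori_state:
  "\<exists>C\<ge>0. \<forall>zn zh u y Y W. modal_trajectory zn zh u y Y W \<longrightarrow>
     (\<forall>M. (\<forall>t\<in>{0..h}. (\<Sum>n=1..M. lam n * (zn n t + b n * u t)^2) \<le> C * init_energy zh u Y W) \<and>
        integral {0..h} (\<lambda>t. \<Sum>n=1..M. (lam n)^2 * (zn n t + b n * u t)^2) \<le> C * init_energy zh u Y W)"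
proof -
  obtain C where C: "C \<ge> 0" and CC: "\<forall>zn zh u y Y W. modal_trajectory zn zh u y Y W \<longrightarrow>
     (\<forall>t\<in>{0..h}. (\<Sum>n=1..N. (zh n t)^2) \<le> C * init_energy zh u Y W \<and>
        (\<Sum>n=1..N. (pred zh u n t)^2) \<le> C * init_energy zh u Y W \<and>
        (u t)^2 \<le> C * init_energy zh u Y W \<and> (0 < t \<and> t < h \<longrightarrow> (udot zh u y t)^2 \<le> C * init_energy zh u Y W))"
    using apriori_observer by blast
  define Q where "Q = 2 * \<bar>qc\<bar> + 1"
  define Cr where "Cr = 2 * (A2 + B2) * C"
  define C' where "C' = exp (Q * h) * (1 / lam 1 + Cr)"
  define Q' where "Q' = 2 * \<bar>qc\<bar> * C' + Cr"
  define C'' where "C'' = 1 / lam 1 + Q' * h"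
  have l1: "lam 1 > 0" by (rule lam_pos) simp
  have pos: "Q \<ge> 0" "Cr \<ge> 0" using C A2_nonneg B2_nonneg by (auto simp: Q_def Cr_def)
  then have pos2: "C' \<ge> 0" using l1 by (simp add: C'_def)
  then have pos3: "Q' \<ge> 0" "C'' \<ge> 0" using pos l1 h by (auto simp: Q'_def C''_def)
  have "(\<forall>t\<in>{0..h}. (\<Sum>n=1..M. lam n * (zn n t + b n * u t)^2) \<le> (C' + C'') * init_energy zh u Y W) \<and>
        integral {0..h} (\<lambda>t. \<Sum>n=1..M. (lam n)^2 * (zn n t + b n * u t)^2) \<le> (C' + C'') * init_energy zh u Y W"
    if tr: "modal_trajectory zn zh u y Y W" for zn zh u y Y W M
  proof -
    interpret modal_solution lam a b c bet K l qc \<delta> h A2 B2 C2 N0 N zn zh u y Y W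
      by unfold_locales (rule tr)
    let ?I = "{1..M}"
    define E where "E = (\<lambda>t. \<Sum>n\<in>?I. lam n * (w n t)^2)"
    define D where "D = (\<lambda>t. \<Sum>n\<in>?I. (lam n)^2 * (w n t)^2)"
    have R0: "R0 \<ge> 0" using W_nonneg by (simp add: init_energy_def sum_nonneg)
    have WR: "W \<le> R0" by (simp add: init_energy_def sum_nonneg)
    have D0: "D t \<ge> 0" for t by (auto simp: D_def intro: sum_nonneg)
    have E0: "E t \<ge> 0" for t
      unfolding E_def by (intro sum_nonneg mult_nonneg_nonneg) (auto intro: less_imp_le[OF lam_pos])
    have wc: "continuous_on {0..} D"
      unfolding D_def by (intro continuous_intros w_cont zn_cont u_cont) auto
    have Ec: "continuous_on {0..} E"
      unfolding E_def by (intro continuous_intros w_cont zn_cont u_cont) auto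
    define E' where "E' = (\<lambda>t. \<Sum>n\<in>?I. lam n * (2 * w n t * (mu n * w n t + a n * u t + b n * up t)))"
    have Ed: "(E has_real_derivative E' t) (at t)" if "t > 0" for t
      unfolding E_def E'_def
    proof (intro DERIV_sum DERIV_cmult)
      fix n assume "n \<in> ?I"
      then have "((\<lambda>t. w n t) has_real_derivative (mu n * w n t + a n * u t + b n * up t)) (at t)"
        using w_deriv[of n t] that by simp
      from DERIV_power[OF this, of 2]
      show "((\<lambda>t. (w n t)^2) has_real_derivative 2 * w n t * (mu n * w n t + a n * u t + b n * up t)) (at t)"
        by (rule DERIV_cong) (simp add: algebra_simps)
    qed
    have rate: "E' t \<le> 2 * \<bar>qc\<bar> * E t - D t + Cr * R0" if t: "0 < t" "t < h" for t
    proof -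
      have "E' t \<le> (\<Sum>n\<in>?I. 2 * \<bar>qc\<bar> * (lam n * (w n t)^2) - (lam n)^2 * (w n t)^2 + 2 * ((a n)^2 * (u t)^2 + (b n)^2 * (up t)^2))"
        unfolding E'_def
      proof (rule sum_mono)
        fix n assume n: "n \<in> ?I"
        define g where "g = a n * u t + b n * up t"
        have ln: "lam n > 0" using n lam_pos by simp
        have 1: "2 * ((lam n * w n t) * g) \<le> (lam n * w n t)^2 + g^2" using young_ineq[of 1 "lam n * w n t" g] by simp
        have 2: "g^2 \<le> 2 * ((a n * u t)^2 + (b n * up t)^2)" unfolding g_def by (rule square_sum2_le)
        have 3: "qc * (lam n * (w n t)^2) \<le> \<bar>qc\<bar> * (lam n * (w n t)^2)" using ln by (intro mult_right_mono) auto
        have "lam n * (2 * w n t * (mu n * w n t + a n * u t + b n * up t))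
          = 2 * (qc * (lam n * (w n t)^2)) - 2 * (lam n * w n t)^2 + 2 * ((lam n * w n t) * g)"
          unfolding g_def mu_def by (simp add: algebra_simps power2_eq_square)
        also have "\<dots> \<le> 2 * (\<bar>qc\<bar> * (lam n * (w n t)^2)) - (lam n * w n t)^2 + 2 * ((a n * u t)^2 + (b n * up t)^2)"
          using 1 2 3 by linarith
        finally show "lam n * (2 * w n t * (mu n * w n t + a n * u t + b n * up t))
          \<le> 2 * \<bar>qc\<bar> * (lam n * (w n t)^2) - (lam n)^2 * (w n t)^2 + 2 * ((a n)^2 * (u t)^2 + (b n)^2 * (up t)^2)"
          by (simp add: power_mult_distrib)
      qed
      also have "\<dots> = 2 * \<bar>qc\<bar> * E t - D t + 2 * ((\<Sum>n\<in>?I. (a n)^2) * (u t)^2 + (\<Sum>n\<in>?I. (b n)^2) * (up t)^2)"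
        unfolding E_def D_def by (simp add: sum.distrib sum_subtractf sum_distrib_left sum_distrib_right)
      also have "2 * ((\<Sum>n\<in>?I. (a n)^2) * (u t)^2 + (\<Sum>n\<in>?I. (b n)^2) * (up t)^2) \<le> 2 * (A2 * (C * R0) + B2 * (C * R0))"
        using CC[rule_format, OF tr, of t] t A2_nonneg B2_nonneg by (intro mult_left_mono add_mono mult_mono a2 b2) auto
      also have "\<dots> = Cr * R0" by (simp add: Cr_def algebra_simps)
      finally show ?thesis by simp
    qed
    have Ein: "E 0 \<le> R0 / lam 1"
    proof -
      have "E 0 \<le> (\<Sum>n\<in>?I. (lam n)^2 * (w n 0)^2) / lam 1" unfolding E_def by (intro sum_lam_le_sum_lam2) auto
      also have "\<dots> \<le> R0 / lam 1" using w0_bound[of M] WR l1 by (intro divide_right_mono) auto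
      finally show ?thesis .
    qed
    have Eb: "E t \<le> C' * R0" if t: "0 \<le> t" "t \<le> h" for t
    proof -
      have "E t + Cr * R0 \<le> exp (Q * t) * (E 0 + Cr * R0)"
      proof (rule gronwall[of h E E'])
        show "continuous_on {0..h} E" by (rule continuous_on_subset[OF Ec]) auto
        fix s assume s: "0 < s" "s < h"
        show "(E has_real_derivative E' s) (at s)" by (rule Ed[OF s(1)])
        have "E' s \<le> 2 * \<bar>qc\<bar> * E s + Cr * R0" using rate[OF s] D0[of s] by linarith
        also have "\<dots> \<le> Q * E s + Q * (Cr * R0)"
        proof (rule add_mono)
          show "2 * \<bar>qc\<bar> * E s \<le> Q * E s" using E0[of s] by (intro mult_right_mono) (auto simp: Q_def)
          have "1 * (Cr * R0) \<le> Q * (Cr * R0)" using pos R0 by (intro mult_right_mono) (auto simp: Q_def)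
          then show "Cr * R0 \<le> Q * (Cr * R0)" by simp
        qed
        finally show "E' s \<le> Q * (E s + Cr * R0)" by (simp add: distrib_left)
      qed (use t in auto)
      also have "\<dots> \<le> exp (Q * h) * (R0 / lam 1 + Cr * R0)"
        using Ein t pos R0 E0[of 0] by (intro mult_mono) (auto intro: mult_left_mono)
      also have "\<dots> = C' * R0" by (simp add: C'_def algebra_simps)
      finally show ?thesis using pos R0 by (smt (verit) mult_nonneg_nonneg)
    qed
    have Db: "integral {0..h} D \<le> C'' * R0"
    proof -
      \<comment> \<open>Adding the running integral of \<open>D\<close> and subtracting the linear
        forcing turns the rate inequality into monotonicity, so the dissipation is integrated
        without assuming the derivative of \<open>E\<close> integrable.\<close>
      define \<Phi> where "\<Phi> = (\<lambda>t. E t + integral {0..t} D - Q' * R0 * t)"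
      have "\<Phi> h \<le> \<Phi> 0"
      proof (rule DERIV_nonpos_imp_decreasing_open[of 0 h \<Phi>])
        show "continuous_on {0..h} \<Phi>"
          unfolding \<Phi>_def by (intro continuous_intros continuous_on_subset[OF Ec] integral_continuous_halfline wc) auto
        fix t assume t: "0 < t" "t < h"
        have "(\<Phi> has_real_derivative E' t + D t - Q' * R0) (at t)"
          unfolding \<Phi>_def using Ed[OF t(1)] integral_deriv_at[OF wc t(1)] by (auto intro!: derivative_eq_intros)
        moreover have "E' t + D t - Q' * R0 \<le> 0"
        proof -
          have "2 * \<bar>qc\<bar> * E t \<le> 2 * \<bar>qc\<bar> * (C' * R0)" using Eb[of t] t by (intro mult_left_mono) auto
          then show ?thesis using rate[OF t] by (simp add: Q'_def algebra_simps)
        qed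
        ultimately show "\<exists>y. (\<Phi> has_real_derivative y) (at t) \<and> y \<le> 0" by blast
      qed (use h in simp)
      then have "integral {0..h} D \<le> E 0 + Q' * R0 * h" using E0[of h] by (simp add: \<Phi>_def)
      also have "\<dots> \<le> C'' * R0" using Ein by (simp add: C''_def algebra_simps)
      finally show ?thesis .
    qed
    have "C' * R0 \<le> (C' + C'') * R0" "C'' * R0 \<le> (C' + C'') * R0" using pos2 pos3 R0 by (auto intro: mult_right_mono)
    then show ?thesis using Eb Db unfolding E_def D_def by fastforce
  qed
  then show ?thesis using pos2 pos3 by (intro exI[of _ "C' + C''"]) auto
qed

end

section \<open>The Lyapunov functional\<close>

text \<open>The numbers \<open>ra\<close>, \<open>rb\<close>, \<open>m\<close> stand for the tail
  sums of the constraints and are characterised as bounds on finite sums beyond \<open>N\<close>,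
  the only form in which truncated functionals see them.\<close>

locale lyapunov_data = modal_data +
  fixes P :: "real mat" and \<alpha> \<beta> \<gamma> \<epsilon> ra rb m :: real
  assumes P_pd: "pos_def P (2*N)"
    and alpha: "\<alpha> > 1" and beta: "\<beta> > 0" and gamma: "\<gamma> > 0" and eps: "0 < \<epsilon>" "\<epsilon> \<le> 1/2"
    and theta1: "neg_semidef (Theta1 lam qc bet c K l N0 N h \<delta> ra rb P \<alpha> \<beta> \<gamma>) (2*N+1)"
    and theta2: "2 * \<gamma> * (- (1 - 1/\<alpha>) * lam (N+1) + qc + \<delta>) + \<beta> * m * lam (N+1) powr (1/2 + \<epsilon>) \<le> 0"
    and theta3: "2 * \<gamma> * (1 - 1/\<alpha>) - \<beta> * m / lam (N+1) powr (1/2 - \<epsilon>) \<ge> 0"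
    and ra: "\<And>I. finite I \<Longrightarrow> I \<subseteq> {N+1..} \<Longrightarrow> (\<Sum>n\<in>I. (a n)^2) \<le> ra"
    and rb: "\<And>I. finite I \<Longrightarrow> I \<subseteq> {N+1..} \<Longrightarrow> (\<Sum>n\<in>I. (b n)^2) \<le> rb"
    and mc: "\<And>I. finite I \<Longrightarrow> I \<subseteq> {N+1..} \<Longrightarrow> (\<Sum>n\<in>I. (c n)^2 / lam n powr (3/2 + \<epsilon>)) \<le> m"
begin

lemma m_nonneg: "m \<ge> 0" using mc[of "{}"] by simp

text \<open>The second scalar constraint is the case \<open>n = N + 1\<close>, and the third
  propagates it to all later modes. As \<open>1/2 - \<epsilon> \<ge> 0\<close>, the power of
  \<open>lam n\<close> is at most \<open>lam n / lam (N+1) powr (1/2 - \<epsilon>)\<close>; the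
  left-hand side is then below an affine function of \<open>lam n\<close> with slope
  \<open>- g \<le> 0\<close> which agrees with it at \<open>n = N + 1\<close>.\<close>

lemma dissipation_nonpos:
  assumes n: "n \<ge> N + 1"
  shows "2 * \<gamma> * (- (1 - 1/\<alpha>) * lam n + qc + \<delta>) + \<beta> * m * lam n powr (1/2 + \<epsilon>) \<le> 0"
proof -
  define L where "L = lam (N+1)"
  have L: "L > 0" "L \<le> lam n" using lam_pos lam_mono[of "N+1" n] n by (auto simp: L_def)
  define k where "k = \<beta> * m / L powr (1/2 - \<epsilon>)"
  define g where "g = 2 * \<gamma> * (1 - 1/\<alpha>) - k"
  have g: "g \<ge> 0" using theta3 by (simp add: g_def k_def L_def)
  have e: "x powr (1/2 + \<epsilon>) = x / x powr (1/2 - \<epsilon>)" if "x > 0" for x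
  proof -
    have "x powr (1/2 + \<epsilon>) * x powr (1/2 - \<epsilon>) = x powr 1" unfolding powr_add[symmetric] by simp
    then show ?thesis using that by (simp add: field_simps)
  qed
  have "lam n powr (1/2 + \<epsilon>) \<le> lam n / L powr (1/2 - \<epsilon>)"
  proof -
    have "L powr (1/2 - \<epsilon>) \<le> lam n powr (1/2 - \<epsilon>)" using L eps by (intro powr_mono2) auto
    then show ?thesis unfolding e[OF less_le_trans[OF L]] using L by (intro divide_left_mono) auto
  qed
  then have "\<beta> * m * lam n powr (1/2 + \<epsilon>) \<le> \<beta> * m * (lam n / L powr (1/2 - \<epsilon>))"
    using beta m_nonneg by (intro mult_left_mono) auto
  also have "\<dots> = k * lam n" by (simp add: k_def)
  finally have "2 * \<gamma> * (- (1 - 1/\<alpha>) * lam n + qc + \<delta>) + \<beta> * m * lam n powr (1/2 + \<epsilon>)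
    \<le> - g * lam n + 2 * \<gamma> * (qc + \<delta>)" by (simp add: g_def algebra_simps)
  also have "\<dots> \<le> - g * L + 2 * \<gamma> * (qc + \<delta>)" using mult_left_mono[OF L(2) g] by simp
  also have "\<dots> = 2 * \<gamma> * (- (1 - 1/\<alpha>) * L + qc + \<delta>) + k * L" by (simp add: g_def algebra_simps)
  also have "k * L = \<beta> * m * L powr (1/2 + \<epsilon>)" unfolding e[OF L(1)] by (simp add: k_def)
  also have "2 * \<gamma> * (- (1 - 1/\<alpha>) * L + qc + \<delta>) + \<beta> * m * L powr (1/2 + \<epsilon>) \<le> 0" using theta2 by (simp add: L_def)
  finally show ?thesis .
qed

end

section \<open>State blocks and the truncated functional along one trajectory\<close>

locale lyapunov_solution = lyapunov_data + modal_solution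
begin

text \<open>The observer is fed by the delayed output, so \<open>zh n t\<close> estimates the plant
  mode at time \<open>t - h\<close>.\<close>

definition err :: "nat \<Rightarrow> real \<Rightarrow> real" where "err n t = zn n (t - h) - zh n t"
text \<open>For \<open>s \<ge> 0\<close> the output at time \<open>s + h\<close> is the flux of the
  plant at time \<open>s\<close>, so this is the flux of the modes beyond \<open>N\<close>, obtained
  without writing an infinite sum. \<open>zetM\<close> is its truncation.\<close>

definition zet :: "real \<Rightarrow> real" where "zet s = y (s + h) - (\<Sum>n=1..N. w n s * c n)"
definition zetM :: "nat \<Rightarrow> real \<Rightarrow> real" where "zetM M s = (\<Sum>n\<in>{N+1..M}. w n s * c n)"
definition X1 :: "real \<Rightarrow> nat \<Rightarrow> real" where "X1 t i = pred zh u (i+1) t"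
definition X2 :: "real \<Rightarrow> nat \<Rightarrow> real" where "X2 t i = err (i+1) t"
text \<open>Dividing the predictor by \<open>lam\<close> gives it the input coefficients
  \<open>bet n / lam n\<close>; multiplying the error by \<open>lam\<close> in \<open>X4\<close>
  gives it the output coefficients \<open>c n / lam n\<close>. Both sequences are square-summable,
  which keeps the matrices bounded as \<open>N\<close> grows.\<close>

definition X3 :: "real \<Rightarrow> nat \<Rightarrow> real" where "X3 t j = pred zh u (N0+j+1) t / lam (N0+j+1)"
definition X4 :: "real \<Rightarrow> nat \<Rightarrow> real" where "X4 t j = lam (N0+j+1) * err (N0+j+1) t"
definition XX :: "real \<Rightarrow> real vec" where "XX t = stack4 N0 (N - N0) (X1 t) (X2 t) (X3 t) (X4 t)"
definition NX :: "real \<Rightarrow> real" where "NX t = (\<Sum>i\<in>{0..<N0}. (X1 t i)^2) + (\<Sum>i\<in>{0..<N0}. (X2 t i)^2)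
  + (\<Sum>i\<in>{0..<N-N0}. (X3 t i)^2) + (\<Sum>i\<in>{0..<N-N0}. (X4 t i)^2)"
definition inno :: "real \<Rightarrow> real" where "inno t = innovation lam c N0 N (X2 t) (X4 t) (zet (t - h))"

lemma split_sum: "(\<Sum>n=1..N. f n) = (\<Sum>n=1..N0. f n) + (\<Sum>n\<in>{N0+1..N}. f n)" for f :: "nat \<Rightarrow> real"
proof -
  have "{1..N} = {1..N0} \<union> {N0+1..N}" using N0N by auto
  then show ?thesis by (simp add: sum.union_disjoint)
qed

text \<open>The signs are opposite because \<open>err\<close> is plant minus observer and
  \<open>innov\<close> is estimate minus measurement. From \<open>t = h\<close> on the measurement
  is the flux of the plant at \<open>t - h\<close>, and the terms with
  \<open>b n * u (t - h)\<close> cancel.\<close>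

lemma innov_eq:
  assumes "t \<ge> h" shows "inn t = - inno t"
proof -
  have "(\<Sum>j\<in>{0..<N-N0}. c (N0+j+1) / lam (N0+j+1) * X4 t j) = (\<Sum>j\<in>{0..<N-N0}. c (N0+j+1) * err (N0+j+1) t)"
  proof (rule sum.cong[OF refl])
    fix j show "c (N0+j+1) / lam (N0+j+1) * X4 t j = c (N0+j+1) * err (N0+j+1) t"
      using lam_pos[of "N0+j+1"] by (simp add: X4_def)
  qed
  also have "\<dots> = (\<Sum>n\<in>{N0+1..N}. c n * err n t)" by (rule sum_shift_above)
  moreover have "(\<Sum>j\<in>{0..<N0}. c (j+1) * X2 t j) = (\<Sum>n=1..N0. c n * err n t)"
    unfolding sum_atLeast1_shift by (simp add: X2_def)
  ultimately have "inno t = (\<Sum>n=1..N. c n * err n t) + zet (t - h)"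
    unfolding inno_def innovation_def split_sum by simp
  moreover have "inn t = (\<Sum>k=1..N. (zh k t + b k * u (t - h)) * c k) - (\<Sum>n=1..N. w n (t - h) * c n) - zet (t - h)"
    unfolding innov_def zet_def by simp
  moreover have "(\<Sum>k=1..N. (zh k t + b k * u (t - h)) * c k) - (\<Sum>n=1..N. w n (t - h) * c n) = - (\<Sum>n=1..N. c n * err n t)"
    unfolding sum_subtractf[symmetric] sum_negf[symmetric] by (intro sum.cong) (auto simp: err_def algebra_simps)
  ultimately show ?thesis by simp
qed

lemma feedback_eq: "t \<ge> 0 \<Longrightarrow> feedback_val K N0 (X1 t) = u t"
  unfolding feedback_val_def u_eq sum_atLeast1_shift by (simp add: X1_def)

text \<open>The delayed plant and the observer receive the same input \<open>u (t - h)\<close>,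
  which cancels. The plant mode is differentiable only at positive times, hence
  \<open>t > h\<close>.\<close>

lemma err_deriv:
  assumes n: "n \<in> {1..N}" and t: "t > h"
  shows "(err n has_real_derivative (mu n * err n t + gain n * inn t)) (at t)"
proof -
  have "((\<lambda>t. zn n (t - h)) has_real_derivative mu n * zn n (t - h) + bet n * u (t - h)) (at t)"
    using DERIV_shift[of "zn n" "mu n * zn n (t - h) + bet n * u (t - h)" t "-h"] zn_deriv[of n "t - h"] n t by simp
  from DERIV_diff[OF this zh_deriv_at[OF n, of t]] t h
  have "((\<lambda>t. zn n (t - h) - zh n t) has_real_derivative
    mu n * zn n (t - h) + bet n * u (t - h) - (mu n * zh n t + bet n * u (t - h) - gain n * inn t)) (at t)" by simp
  then show ?thesis unfolding err_def[abs_def] by (rule DERIV_cong) (simp add: algebra_simps)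
qed

lemma X_derivs:
  assumes t: "t > h"
  shows "\<And>i. i < N0 \<Longrightarrow> ((\<lambda>t. X1 t i) has_real_derivative field1 lam qc bet l h (X1 t) (u t) (inno t) i) (at t)"
    and "\<And>i. i < N0 \<Longrightarrow> ((\<lambda>t. X2 t i) has_real_derivative field2 lam qc l (X2 t) (inno t) i) (at t)"
    and "\<And>j. j < N - N0 \<Longrightarrow> ((\<lambda>t. X3 t j) has_real_derivative field3 lam qc bet N0 (X3 t) (u t) j) (at t)"
    and "\<And>j. j < N - N0 \<Longrightarrow> ((\<lambda>t. X4 t j) has_real_derivative field4 lam qc N0 (X4 t) j) (at t)"
proof -
  have t0: "t > 0" using t h by simp
  note ie = innov_eq[of t]
  fix i assume i: "i < N0"
  have iN: "i + 1 \<in> {1..N}" using i N0N by auto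
  have g: "gain (Suc i) = l (Suc i)" using i by (simp add: gain_def)
  show "((\<lambda>t. X1 t i) has_real_derivative field1 lam qc bet l h (X1 t) (u t) (inno t) i) (at t)"
    unfolding X1_def[abs_def] by (rule DERIV_cong[OF pred_deriv[OF iN t0]])
      (use ie t in \<open>simp add: field1_def g mu_def X1_def\<close>)
  show "((\<lambda>t. X2 t i) has_real_derivative field2 lam qc l (X2 t) (inno t) i) (at t)"
    unfolding X2_def[abs_def] by (rule DERIV_cong[OF err_deriv[OF iN t]])
      (use ie t in \<open>simp add: field2_def g mu_def X2_def\<close>)
next
  have t0: "t > 0" using t h by simp
  fix j assume j: "j < N - N0"
  have jN: "N0 + j + 1 \<in> {1..N}" using j by auto
  have g: "gain (Suc (N0+j)) = 0" by (simp add: gain_def)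
  show "((\<lambda>t. X3 t j) has_real_derivative field3 lam qc bet N0 (X3 t) (u t) j) (at t)"
    unfolding X3_def[abs_def]
    by (rule DERIV_cong[OF DERIV_cdivide[OF pred_deriv[OF jN t0]]])
      (simp add: field3_def g mu_def X3_def add_divide_distrib)
  show "((\<lambda>t. X4 t j) has_real_derivative field4 lam qc N0 (X4 t) j) (at t)"
    unfolding X4_def[abs_def]
    by (rule DERIV_cong[OF DERIV_cmult[OF err_deriv[OF jN t]]])
      (simp add: field4_def g mu_def X4_def)
qed

lemma P_car: "P \<in> carrier_mat (2*N) (2*N)" "transpose_mat P = P"
  using P_pd by (auto simp: pos_def_def)

lemma dim_eq: "2 * N = (N0 + N0) + ((N - N0) + (N - N0))" using N0N by simp

definition YY :: "real \<Rightarrow> real vec" where "YY t = stack4 N0 (N - N0) (field1 lam qc bet l h (X1 t) (u t) (inno t))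
  (field2 lam qc l (X2 t) (inno t)) (field3 lam qc bet N0 (X3 t) (u t)) (field4 lam qc N0 (X4 t))"

lemma XX_form_deriv:
  assumes "t > h"
  shows "((\<lambda>t. XX t \<bullet> (P *\<^sub>v XX t)) has_real_derivative 2 * (YY t \<bullet> (P *\<^sub>v XX t))) (at t)"
  unfolding XX_def YY_def by (rule stack4_form_deriv[OF P_car dim_eq X_derivs[OF assms]])

lemma up_eq:
  assumes "t \<ge> h"
  shows "up t = (\<Sum>i\<in>{0..<N0}. K (i+1) * field1 lam qc bet l h (X1 t) (u t) (inno t) i)"
  unfolding udot_def sum_atLeast1_shift
  by (intro sum.cong refl) (auto simp: field1_def X1_def mu_def gain_def innov_eq[OF assms])

text \<open>The semidefinite constraint evaluated at the state and the delayed residual. The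
  negative terms in \<open>u\<close> and \<open>up\<close> are reserved for the inputs of the modes
  beyond \<open>N\<close>; the positive residual term will be paid by the memory integral.\<close>

lemma XX_form_rate:
  assumes t: "t > h"
  shows "2 * (YY t \<bullet> (P *\<^sub>v XX t)) + 2 * \<delta> * (XX t \<bullet> (P *\<^sub>v XX t))
    \<le> - \<alpha> * \<gamma> * ra * (u t)^2 - \<alpha> * \<gamma> * rb * (up t)^2 + \<beta> * exp (- 2 * \<delta> * h) * (zet (t - h))^2"
proof -
  have k: "u t = feedback_val K N0 (X1 t)" using feedback_eq[of t] t h by simp
  note TF = Theta1_form(2)[OF N0N P_car k inno_def XX_def YY_def, where \<delta> = \<delta> and ra = ra and rb = rb and \<alpha> = \<alpha> and \<beta> = \<beta> and \<gamma> = \<gamma>]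
  have "XX t @\<^sub>v vec 1 (\<lambda>_. zet (t - h)) \<in> carrier_vec (2*N+1)"
    unfolding XX_def dim_eq by (intro append_carrier_vec stack4_carrier vec_carrier)
  then have "(XX t @\<^sub>v vec 1 (\<lambda>_. zet (t - h))) \<bullet> (Theta1 lam qc bet c K l N0 N h \<delta> ra rb P \<alpha> \<beta> \<gamma> *\<^sub>v (XX t @\<^sub>v vec 1 (\<lambda>_. zet (t - h)))) \<le> 0"
    using theta1 unfolding neg_semidef_def by blast
  then show ?thesis unfolding TF up_eq[OF less_imp_le[OF t]] by simp
qed

text \<open>Cauchy--Schwarz after writing each term as \<open>c n / lam n powr q\<close> times
  \<open>lam n powr q * w n s\<close>, with \<open>q\<close> half of the exponent
  \<open>3/2 + \<epsilon>\<close>. That exponent is at most 2, so the dissipation of the energy can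
  dominate the result.\<close>

lemma zetM_square_le:
  "(zetM M s)^2 \<le> m * (\<Sum>n\<in>{N+1..M}. lam n powr (3/2 + \<epsilon>) * (w n s)^2)"
proof -
  define q where "q = (3/2 + \<epsilon>) / 2"
  have q: "(lam n powr q)^2 = lam n powr (3/2 + \<epsilon>)" if "n \<in> {N+1..M}" for n
    unfolding power2_eq_square powr_add[symmetric] by (simp add: q_def)
  have "zetM M s = (\<Sum>n\<in>{N+1..M}. (c n / lam n powr q) * (lam n powr q * w n s))"
    unfolding zetM_def
  proof (rule sum.cong[OF refl])
    fix n assume "n \<in> {N+1..M}"
    then have "lam n powr q \<noteq> 0" using lam_pos[of n] by simp
    then show "w n s * c n = (c n / lam n powr q) * (lam n powr q * w n s)" by simp
  qed
  then have "(zetM M s)^2 \<le> (\<Sum>n\<in>{N+1..M}. (c n / lam n powr q)^2) * (\<Sum>n\<in>{N+1..M}. (lam n powr q * w n s)^2)"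
    by (simp only: sum_Cauchy_Schwarz)
  also have "(\<Sum>n\<in>{N+1..M}. (c n / lam n powr q)^2) = (\<Sum>n\<in>{N+1..M}. (c n)^2 / lam n powr (3/2 + \<epsilon>))"
    by (intro sum.cong refl) (simp add: power_divide q)
  also have "(\<Sum>n\<in>{N+1..M}. (lam n powr q * w n s)^2) = (\<Sum>n\<in>{N+1..M}. lam n powr (3/2 + \<epsilon>) * (w n s)^2)"
    by (intro sum.cong refl) (simp add: power_mult_distrib q)
  also have "(\<Sum>n\<in>{N+1..M}. (c n)^2 / lam n powr (3/2 + \<epsilon>)) * (\<Sum>n\<in>{N+1..M}. lam n powr (3/2 + \<epsilon>) * (w n s)^2)
    \<le> m * (\<Sum>n\<in>{N+1..M}. lam n powr (3/2 + \<epsilon>) * (w n s)^2)"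
    by (intro mult_right_mono mc sum_nonneg) auto
  finally show ?thesis .
qed

text \<open>The same splitting with the cruder weight \<open>lam n\<close>. It matches the
  graph-norm bounds on compact time intervals and serves for convergence of the residual and for the
  memory term at \<open>t = h\<close>.\<close>

lemma output_segment_square_le:
  assumes "I \<subseteq> {1..M}"
  shows "(\<Sum>n\<in>I. w n s * c n)^2 \<le> (\<Sum>n\<in>I. (c n / lam n)^2) * (\<Sum>n=1..M. (lam n)^2 * (w n s)^2)"
proof -
  have "(\<Sum>n\<in>I. w n s * c n) = (\<Sum>n\<in>I. (c n / lam n) * (lam n * w n s))"
  proof (rule sum.cong[OF refl])
    fix n assume "n \<in> I"
    then have "lam n \<noteq> 0" using lam_pos[of n] assms by force
    then show "w n s * c n = (c n / lam n) * (lam n * w n s)" by simp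
  qed
  then have "(\<Sum>n\<in>I. w n s * c n)^2 \<le> (\<Sum>n\<in>I. (c n / lam n)^2) * (\<Sum>n\<in>I. (lam n * w n s)^2)"
    by (simp only: sum_Cauchy_Schwarz)
  also have "\<dots> \<le> (\<Sum>n\<in>I. (c n / lam n)^2) * (\<Sum>n=1..M. (lam n * w n s)^2)"
    using assms by (intro mult_left_mono sum_mono2 sum_nonneg) auto
  finally show ?thesis by (simp add: power_mult_distrib)
qed

text \<open>The truncation error is a tail of the flux series, bounded by the tail of
  \<open>\<Sum> (c n / lam n)^2\<close> times a graph-norm bound valid on all of
  \<open>[0, T]\<close>; hence the uniformity in \<open>s\<close>. Bounds on both factors carry it
  over to the squares.\<close>

lemma zet_uniform:
  assumes "\<eta> > 0"
  shows "\<exists>M0. \<forall>M\<ge>M0. \<forall>s\<in>{0..T}. \<bar>(zet s)^2 - (zetM M s)^2\<bar> \<le> \<eta>"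
proof -
  obtain B0 where B0: "\<forall>s\<in>{0..T}. \<forall>M. (\<Sum>n=1..M. (lam n)^2 * (w n s)^2) \<le> B0" using w_bound by blast
  define B where "B = max B0 0"
  have B: "B \<ge> 0" "\<And>s M. s \<in> {0..T} \<Longrightarrow> (\<Sum>n=1..M. (lam n)^2 * (w n s)^2) \<le> B"
    using B0 by (auto simp: B_def le_max_iff_disj)
  define f where "f = (\<lambda>n. if 0 + 1 \<le> n then (c n / lam n)^2 else 0)"
  have f: "summable f" unfolding f_def by (rule summable_tail_of_bounded_sums[of _ C2]) (use c2 in auto)
  define tl where "tl = (\<lambda>k. \<Sum>n. f (n + k))"
  have tl: "tl \<longlonglongrightarrow> 0" unfolding tl_def by (rule suminf_exist_split2[OF f])
  have tl0: "tl k \<ge> 0" for k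
    unfolding tl_def using summable_ignore_initial_segment[OF f, of k] by (intro suminf_nonneg) (auto simp: f_def)
  have seg: "(\<Sum>n\<in>{M+1..M'}. (c n / lam n)^2) \<le> tl (M+1)" for M M'
  proof -
    have "(\<Sum>n\<in>{M+1..M'}. (c n / lam n)^2) = (\<Sum>n\<in>{0..<M'-M}. f (n + (M+1)))"
      by (rule sum.reindex_bij_witness[of _ "\<lambda>i. i + (M+1)" "\<lambda>n. n - (M+1)"]) (auto simp: f_def)
    also have "\<dots> \<le> tl (M+1)"
      unfolding tl_def using summable_ignore_initial_segment[OF f, of "M+1"] by (intro sum_le_suminf) (auto simp: f_def)
    finally show ?thesis .
  qed
  have lim: "(\<lambda>M. zetM M s) \<longlonglongrightarrow> zet s" if s: "s \<in> {0..T}" for s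
  proof -
    have "(\<lambda>M. \<Sum>n=1..M. w n s * c n) \<longlonglongrightarrow> y (s + h)" using y_lim[of "s + h"] s by simp
    from tendsto_diff[OF this tendsto_const[of "\<Sum>n=1..N. w n s * c n"]]
    have "(\<lambda>M. (\<Sum>n=1..M. w n s * c n) - (\<Sum>n=1..N. w n s * c n)) \<longlonglongrightarrow> zet s" by (simp add: zet_def)
    moreover have "\<forall>\<^sub>F M in sequentially. (\<Sum>n=1..M. w n s * c n) - (\<Sum>n=1..N. w n s * c n) = zetM M s"
    proof (rule eventually_sequentiallyI[of N])
      fix M assume "M \<ge> N"
      then have "{1..M} = {1..N} \<union> {N+1..M}" by auto
      then show "(\<Sum>n=1..M. w n s * c n) - (\<Sum>n=1..N. w n s * c n) = zetM M s"
        by (simp add: sum.union_disjoint zetM_def)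
    qed
    ultimately show ?thesis by (rule Lim_transform_eventually)
  qed
  have zM: "\<bar>zetM M s\<bar> \<le> sqrt (C2 * B)" if s: "s \<in> {0..T}" for M s
  proof -
    have "(zetM M s)^2 \<le> (\<Sum>n\<in>{N+1..M}. (c n / lam n)^2) * (\<Sum>n=1..M. (lam n)^2 * (w n s)^2)"
      unfolding zetM_def by (rule output_segment_square_le) auto
    also have "\<dots> \<le> C2 * B" using C2_nonneg by (intro mult_mono c2 B s sum_nonneg) auto
    finally show ?thesis by (intro real_le_rsqrt) simp
  qed
  have z: "\<bar>zet s\<bar> \<le> sqrt (C2 * B)" if s: "s \<in> {0..T}" for s
    by (rule tendsto_upperbound[OF tendsto_rabs[OF lim[OF s]]]) (use zM[OF s] in auto)
  have close: "\<bar>zet s - zetM M s\<bar> \<le> sqrt (tl (M+1) * B)" if s: "s \<in> {0..T}" and M: "M \<ge> N" for M s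
  proof -
    have "\<bar>zetM M' s - zetM M s\<bar> \<le> sqrt (tl (M+1) * B)" if M': "M' \<ge> M" for M'
    proof -
      have "{N+1..M'} = {N+1..M} \<union> {M+1..M'}" using M M' by auto
      then have "zetM M' s - zetM M s = (\<Sum>n\<in>{M+1..M'}. w n s * c n)"
        unfolding zetM_def by (simp add: sum.union_disjoint)
      moreover have "(\<Sum>n\<in>{M+1..M'}. w n s * c n)^2 \<le> (\<Sum>n\<in>{M+1..M'}. (c n / lam n)^2) * (\<Sum>n=1..M'. (lam n)^2 * (w n s)^2)"
        by (rule output_segment_square_le) auto
      moreover have "\<dots> \<le> tl (M+1) * B" using tl0 by (intro mult_mono seg B s sum_nonneg) auto
      ultimately show ?thesis by (intro real_le_rsqrt) simp
    qed
    then show ?thesis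
      by (intro tendsto_upperbound[OF tendsto_rabs[OF tendsto_diff[OF lim[OF s] tendsto_const]]])
        (auto simp: eventually_sequentially)
  qed
  have "(\<lambda>M. sqrt (tl (M+1) * B) * (2 * sqrt (C2 * B))) \<longlonglongrightarrow> sqrt (0 * B) * (2 * sqrt (C2 * B))"
    using LIMSEQ_Suc[OF tl] by (intro tendsto_intros) simp
  then have "\<forall>\<^sub>F M in sequentially. sqrt (tl (M+1) * B) * (2 * sqrt (C2 * B)) < \<eta>"
    using order_tendstoD(2)[of "\<lambda>M. sqrt (tl (M+1) * B) * (2 * sqrt (C2 * B))" 0 sequentially \<eta>] assms by simp
  then obtain M1 where M1: "\<And>M. M \<ge> M1 \<Longrightarrow> sqrt (tl (M+1) * B) * (2 * sqrt (C2 * B)) < \<eta>"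
    by (auto simp: eventually_sequentially)
  show ?thesis
  proof (intro exI[of _ "max M1 N"] allI impI ballI)
    fix M s assume M: "max M1 N \<le> M" and s: "s \<in> {0..T}"
    have "\<bar>(zet s)^2 - (zetM M s)^2\<bar> = \<bar>zet s - zetM M s\<bar> * \<bar>zet s + zetM M s\<bar>"
      unfolding abs_mult[symmetric] by (simp add: power2_eq_square algebra_simps)
    also have "\<dots> \<le> sqrt (tl (M+1) * B) * (2 * sqrt (C2 * B))"
      using close[OF s, of M] z[OF s] zM[OF s, of M] M tl0 B by (intro mult_mono) auto
    also have "\<dots> \<le> \<eta>" using M1[of M] M by simp
    finally show "\<bar>(zet s)^2 - (zetM M s)^2\<bar> \<le> \<eta>" .
  qed
qed

definition SM :: "nat \<Rightarrow> real \<Rightarrow> real" where "SM M t = (\<Sum>n\<in>{N+1..M}. lam n * (w n t)^2)"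
definition JM :: "nat \<Rightarrow> real \<Rightarrow> real" where "JM M t = integral {0..t} (\<lambda>s. exp (2 * \<delta> * s) * (zetM M s)^2)"
text \<open>The factor \<open>exp (2 * \<delta> * t)\<close> turns decay at rate
  \<open>2 * \<delta>\<close> into monotonicity. The difference of the two \<open>JM\<close> values
  is the integral over the last delay window: its derivative charges the present residual to the
  modes beyond \<open>N\<close> and refunds the delayed one, which the finite-dimensional part has
  to pay.\<close>

definition VM :: "nat \<Rightarrow> real \<Rightarrow> real" where
  "VM M t = exp (2 * \<delta> * t) * (XX t \<bullet> (P *\<^sub>v XX t) + \<gamma> * SM M t) + \<beta> * (JM M t - JM M (t - h))"

lemma zetM_cont: "continuous_on {0..} (zetM M)"
  unfolding zetM_def by (intro continuous_intros zn_cont u_cont) auto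

lemma JM_integrand_cont: "continuous_on {0..} (\<lambda>s. exp (2 * \<delta> * s) * (zetM M s)^2)"
  by (intro continuous_intros zetM_cont)

text \<open>The truncated Lyapunov functional decreases up to the defect between the full residual
  \<open>zet\<close>, which drives the finite-dimensional part, and its truncation \<open>zetM M\<close>.\<close>

lemma VM_rate:
  assumes t: "t > h"
  shows "\<exists>v. (VM M has_real_derivative v) (at t) \<and>
    v \<le> exp (2 * \<delta> * t) * (\<beta> * exp (- 2 * \<delta> * h) * ((zet (t - h))^2 - (zetM M (t - h))^2))"
proof -
  let ?I = "{N+1..M}"
  have t0: "t > 0" "t - h > 0" using t h by auto
  define q q' where "q = XX t \<bullet> (P *\<^sub>v XX t)" and "q' = 2 * (YY t \<bullet> (P *\<^sub>v XX t))"
  define S' where "S' = (\<Sum>n\<in>?I. lam n * (2 * w n t * (mu n * w n t + a n * u t + b n * up t)))"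
  have Sd: "(SM M has_real_derivative S') (at t)"
    unfolding SM_def[abs_def] S'_def
  proof (intro DERIV_sum DERIV_cmult)
    fix n assume "n \<in> ?I"
    then have "((\<lambda>t. w n t) has_real_derivative (mu n * w n t + a n * u t + b n * up t)) (at t)"
      using w_deriv[of n t] t0 by simp
    from DERIV_power[OF this, of 2]
    show "((\<lambda>t. (w n t)^2) has_real_derivative 2 * w n t * (mu n * w n t + a n * u t + b n * up t)) (at t)"
      by (rule DERIV_cong) (simp add: algebra_simps)
  qed
  have J1: "(JM M has_real_derivative exp (2 * \<delta> * t) * (zetM M t)^2) (at t)"
    unfolding JM_def[abs_def] by (rule integral_deriv_at[OF JM_integrand_cont t0(1)])
  have J2: "((\<lambda>t. JM M (t - h)) has_real_derivative exp (2 * \<delta> * (t - h)) * (zetM M (t - h))^2) (at t)"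
    using DERIV_shift[of "JM M" "exp (2 * \<delta> * (t - h)) * (zetM M (t - h))^2" t "-h"]
      integral_deriv_at[OF JM_integrand_cont t0(2), of M] unfolding JM_def[abs_def] by simp
  define v where "v = exp (2 * \<delta> * t) * (2 * \<delta> * (q + \<gamma> * SM M t) + (q' + \<gamma> * S'))
     + \<beta> * (exp (2 * \<delta> * t) * (zetM M t)^2 - exp (2 * \<delta> * (t - h)) * (zetM M (t - h))^2)"
  have "(VM M has_real_derivative v) (at t)"
    unfolding VM_def[abs_def] v_def q_def q'_def
    using XX_form_deriv[OF t] Sd J1 J2 by (auto intro!: derivative_eq_intros simp: algebra_simps)
  moreover have "v \<le> exp (2 * \<delta> * t) * (\<beta> * exp (- 2 * \<delta> * h) * ((zet (t - h))^2 - (zetM M (t - h))^2))"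
  proof -
    have eh: "exp (2 * \<delta> * (t - h)) = exp (2 * \<delta> * t) * exp (- 2 * \<delta> * h)"
      by (simp add: exp_add[symmetric] algebra_simps)
    have tail: "2 * \<delta> * (\<gamma> * SM M t) + \<gamma> * S' + \<beta> * (zetM M t)^2 \<le> \<alpha> * \<gamma> * ra * (u t)^2 + \<alpha> * \<gamma> * rb * (up t)^2"
    proof -
      have tm: "2 * \<delta> * (\<gamma> * (lam n * (w n t)^2)) + \<gamma> * (lam n * (2 * w n t * (mu n * w n t + a n * u t + b n * up t)))
          + \<beta> * (m * (lam n powr (3/2 + \<epsilon>) * (w n t)^2)) \<le> \<alpha> * \<gamma> * ((a n)^2 * (u t)^2 + (b n)^2 * (up t)^2)"
        if n: "n \<in> ?I" for n
      proof -
        have ln: "lam n > 0" using n lam_pos by simp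
        \<comment> \<open>Young's inequality with weight \<open>1 / \<alpha>\<close> is applied to
          both input terms. Together they use \<open>2 / \<alpha>\<close> of the dissipation
          \<open>2 * (lam n * w n t)^2\<close>, which leaves the factor
          \<open>1 - 1 / \<alpha>\<close> of the scalar constraints, and they cost the factor
          \<open>\<alpha>\<close> found in the matrix constraint.\<close>
        have y: "2 * ((lam n * w n t) * g) \<le> 1 / \<alpha> * (lam n * w n t)^2 + \<alpha> * g^2" for g
          using young_ineq[of "1/\<alpha>" "lam n * w n t" g] alpha by (simp add: mult.commute)
        have "\<gamma> * (2 * ((lam n * w n t) * (a n * u t)) + 2 * ((lam n * w n t) * (b n * up t)))
          \<le> \<gamma> * (1 / \<alpha> * (lam n * w n t)^2 + \<alpha> * (a n * u t)^2 + (1 / \<alpha> * (lam n * w n t)^2 + \<alpha> * (b n * up t)^2))"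
          using gamma by (intro mult_left_mono add_mono y) auto
        moreover have "2 * \<delta> * (\<gamma> * (lam n * (w n t)^2)) + \<gamma> * (lam n * (2 * w n t * (mu n * w n t + a n * u t + b n * up t)))
          = 2 * \<gamma> * (- lam n + qc + \<delta>) * (lam n * (w n t)^2)
            + \<gamma> * (2 * ((lam n * w n t) * (a n * u t)) + 2 * ((lam n * w n t) * (b n * up t)))"
          unfolding mu_def by (simp add: algebra_simps power2_eq_square)
        moreover have "\<gamma> * (1 / \<alpha> * (lam n * w n t)^2 + \<alpha> * (a n * u t)^2 + (1 / \<alpha> * (lam n * w n t)^2 + \<alpha> * (b n * up t)^2))
          = 2 * \<gamma> * (1 / \<alpha> * lam n) * (lam n * (w n t)^2) + \<alpha> * \<gamma> * ((a n)^2 * (u t)^2 + (b n)^2 * (up t)^2)"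
          by (simp add: algebra_simps power2_eq_square)
        moreover have "\<beta> * (m * (lam n powr (3/2 + \<epsilon>) * (w n t)^2)) = (\<beta> * m * lam n powr (1/2 + \<epsilon>)) * (lam n * (w n t)^2)"
        proof -
          have "lam n powr (3/2 + \<epsilon>) = lam n powr (1 + (1/2 + \<epsilon>))" by (simp add: algebra_simps)
          also have "\<dots> = lam n powr 1 * lam n powr (1/2 + \<epsilon>)" by (rule powr_add)
          finally show ?thesis using ln by simp
        qed
        moreover have "(2 * \<gamma> * (- (1 - 1/\<alpha>) * lam n + qc + \<delta>) + \<beta> * m * lam n powr (1/2 + \<epsilon>)) * (lam n * (w n t)^2) \<le> 0"
          using dissipation_nonpos[of n] n ln by (intro mult_nonpos_nonneg) auto
        moreover have "(2 * \<gamma> * (- (1 - 1/\<alpha>) * lam n + qc + \<delta>) + \<beta> * m * lam n powr (1/2 + \<epsilon>)) * (lam n * (w n t)^2)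
          = 2 * \<gamma> * (- lam n + qc + \<delta>) * (lam n * (w n t)^2) + 2 * \<gamma> * (1 / \<alpha> * lam n) * (lam n * (w n t)^2)
            + (\<beta> * m * lam n powr (1/2 + \<epsilon>)) * (lam n * (w n t)^2)"
          by (simp add: algebra_simps)
        ultimately show ?thesis by linarith
      qed
      have "\<beta> * (zetM M t)^2 \<le> \<beta> * (m * (\<Sum>n\<in>?I. lam n powr (3/2 + \<epsilon>) * (w n t)^2))"
        using beta by (intro mult_left_mono zetM_square_le) auto
      then have "2 * \<delta> * (\<gamma> * SM M t) + \<gamma> * S' + \<beta> * (zetM M t)^2
        \<le> (\<Sum>n\<in>?I. 2 * \<delta> * (\<gamma> * (lam n * (w n t)^2)) + \<gamma> * (lam n * (2 * w n t * (mu n * w n t + a n * u t + b n * up t)))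
          + \<beta> * (m * (lam n powr (3/2 + \<epsilon>) * (w n t)^2)))"
        unfolding SM_def S'_def sum.distrib sum_distrib_left by simp
      also have "\<dots> \<le> (\<Sum>n\<in>?I. \<alpha> * \<gamma> * ((a n)^2 * (u t)^2 + (b n)^2 * (up t)^2))" by (intro sum_mono tm)
      also have "\<dots> = \<alpha> * \<gamma> * ((\<Sum>n\<in>?I. (a n)^2) * (u t)^2 + (\<Sum>n\<in>?I. (b n)^2) * (up t)^2)"
        by (simp add: sum_distrib_left[symmetric] sum.distrib sum_distrib_right)
      also have "\<dots> \<le> \<alpha> * \<gamma> * (ra * (u t)^2 + rb * (up t)^2)"
        using alpha gamma by (intro mult_left_mono add_mono mult_right_mono ra rb) auto
      finally show ?thesis by (simp add: algebra_simps)
    qed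
    have "2 * \<delta> * q + q' + (2 * \<delta> * (\<gamma> * SM M t) + \<gamma> * S' + \<beta> * (zetM M t)^2) - \<beta> * exp (- 2 * \<delta> * h) * (zetM M (t - h))^2
      \<le> \<beta> * exp (- 2 * \<delta> * h) * (zet (t - h))^2 - \<beta> * exp (- 2 * \<delta> * h) * (zetM M (t - h))^2"
      using XX_form_rate[OF t] tail unfolding q_def q'_def by linarith
    then have "exp (2 * \<delta> * t) * (2 * \<delta> * q + q' + (2 * \<delta> * (\<gamma> * SM M t) + \<gamma> * S' + \<beta> * (zetM M t)^2) - \<beta> * exp (- 2 * \<delta> * h) * (zetM M (t - h))^2)
      \<le> exp (2 * \<delta> * t) * (\<beta> * exp (- 2 * \<delta> * h) * (zet (t - h))^2 - \<beta> * exp (- 2 * \<delta> * h) * (zetM M (t - h))^2)"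
      by (intro mult_left_mono) auto
    moreover have "v = exp (2 * \<delta> * t) * (2 * \<delta> * q + q' + (2 * \<delta> * (\<gamma> * SM M t) + \<gamma> * S' + \<beta> * (zetM M t)^2) - \<beta> * exp (- 2 * \<delta> * h) * (zetM M (t - h))^2)"
      unfolding v_def eh by (simp add: algebra_simps)
    ultimately show ?thesis by (simp only: right_diff_distrib)
  qed
  ultimately show ?thesis by blast
qed

text \<open>Derivatives of the blocks are available only for \<open>t > h\<close>; continuity up to
  \<open>t = h\<close> is what lets the monotonicity argument start from the value at
  \<open>h\<close>.\<close>

lemma XX_comp_cont:
  assumes "i < 2 * N" shows "continuous_on {h..} (\<lambda>t. XX t $ i)"
proof -
  have e: "continuous_on {h..} (err n)" if "n \<in> {1..N}" for n
    unfolding err_def[abs_def]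
  proof (intro continuous_intros)
    show "continuous_on {h..} (\<lambda>t. zn n (t - h))"
      using that by (intro continuous_on_compose2[OF zn_cont[of n]] continuous_intros) auto
    show "continuous_on {h..} (zh n)" using h by (intro continuous_on_subset[OF zh_cont[OF that]]) auto
  qed
  have p: "continuous_on {h..} (pred zh u n)" if "n \<in> {1..N}" for n
    using h by (intro continuous_on_subset[OF pred_cont[OF that]]) auto
  let ?k = "N - N0"
  consider "i < N0" | "N0 \<le> i" "i < N0 + N0" | "N0 + N0 \<le> i" "i - (N0+N0) < ?k" | "N0 + N0 \<le> i" "\<not> i - (N0+N0) < ?k" by linarith
  then show ?thesis
  proof cases
    case 1
    then have eq: "(\<lambda>t. XX t $ i) = (\<lambda>t. X1 t i)" by (auto simp: XX_def stack4_def)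
    show ?thesis unfolding eq X1_def using p[of "i+1"] 1 N0N by simp
  next
    case 2
    then have eq: "(\<lambda>t. XX t $ i) = (\<lambda>t. X2 t (i - N0))" by (auto simp: XX_def stack4_def)
    show ?thesis unfolding eq X2_def using e[of "i-N0+1"] 2 N0N by simp
  next
    case 3
    then have eq: "(\<lambda>t. XX t $ i) = (\<lambda>t. X3 t (i - (N0+N0)))" by (auto simp: XX_def stack4_def)
    show ?thesis unfolding eq X3_def using p[of "N0+(i - (N0+N0))+1"] 3 lam_pos[of "N0+(i - (N0+N0))+1"]
      by (auto intro!: continuous_intros)
  next
    case 4
    have "i - (N0+N0) - ?k < ?k" using 4 assms N0N by linarith
    with 4 have eq: "(\<lambda>t. XX t $ i) = (\<lambda>t. X4 t (i - (N0+N0) - ?k))"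
      unfolding XX_def stack4_def using assms dim_eq by (simp del: diff_diff_left)
    show ?thesis unfolding eq X4_def using e[of "N0+(i - (N0+N0) - ?k)+1"] \<open>i - (N0+N0) - ?k < ?k\<close>
      by (auto intro!: continuous_intros simp del: diff_diff_left)
  qed
qed

lemma VM_cont: "continuous_on {h..T} (VM M)"
proof -
  have XXc: "XX t \<in> carrier_vec (2*N)" for t unfolding XX_def dim_eq by (rule stack4_carrier)
  have "XX t \<bullet> (P *\<^sub>v XX t) = (\<Sum>i\<in>{0..<2*N}. \<Sum>j\<in>{0..<2*N}. P $$ (i,j) * (XX t $ i * XX t $ j))" for t
    using XXc[of t] P_car by (auto simp: scalar_prod_def sum_distrib_left mult_ac intro!: sum.cong)
  moreover have "continuous_on {h..T} (\<lambda>t. \<Sum>i\<in>{0..<2*N}. \<Sum>j\<in>{0..<2*N}. P $$ (i,j) * (XX t $ i * XX t $ j))"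
    by (intro continuous_intros continuous_on_subset[OF XX_comp_cont]) auto
  ultimately have q: "continuous_on {h..T} (\<lambda>t. XX t \<bullet> (P *\<^sub>v XX t))" by simp
  have S: "continuous_on {h..T} (SM M)"
    unfolding SM_def using h by (intro continuous_intros continuous_on_subset[OF zn_cont] u_cont) auto
  have J: "continuous_on {0..T'} (JM M)" for T'
    unfolding JM_def[abs_def] by (rule integral_continuous_halfline[OF JM_integrand_cont])
  have J1: "continuous_on {h..T} (JM M)" using h by (intro continuous_on_subset[OF J[of T]]) auto
  have J2: "continuous_on {h..T} (\<lambda>t. JM M (t - h))"
    by (intro continuous_on_compose2[OF J[of "T - h"]] continuous_intros) auto
  show ?thesis unfolding VM_def[abs_def] by (intro continuous_intros q S J1 J2)
qed

text \<open>Subtracting the linear function \<open>k * t\<close> absorbs the truncation defect,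
  which is at most \<open>\<eta>\<close> on the interval, and makes the difference monotone. For
  fixed \<open>T\<close> the error vanishes with \<open>\<eta>\<close>.\<close>

lemma VM_le:
  assumes T: "T \<ge> h" and \<eta>: "\<eta> \<ge> 0" and close: "\<forall>s\<in>{0..T}. \<bar>(zet s)^2 - (zetM M s)^2\<bar> \<le> \<eta>"
  shows "VM M T \<le> VM M h + (exp (2 * \<delta> * T) * (\<beta> * \<eta>)) * (T - h)"
proof -
  define k where "k = exp (2 * \<delta> * T) * (\<beta> * \<eta>)"
  define g where "g = (\<lambda>t. VM M t - k * t)"
  have "g T \<le> g h"
  proof (rule DERIV_nonpos_imp_decreasing_open[OF T])
    show "continuous_on {h..T} g" unfolding g_def by (intro continuous_intros VM_cont)
    fix t assume t: "h < t" "t < T"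
    obtain v where v: "(VM M has_real_derivative v) (at t)"
      "v \<le> exp (2 * \<delta> * t) * (\<beta> * exp (- 2 * \<delta> * h) * ((zet (t - h))^2 - (zetM M (t - h))^2))"
      using VM_rate[OF t(1)] by blast
    have "(g has_real_derivative v - k) (at t)" unfolding g_def using v(1) by (auto intro!: derivative_eq_intros)
    moreover have "v \<le> k"
    proof -
      have "(zet (t - h))^2 - (zetM M (t - h))^2 \<le> \<eta>" using close[rule_format, of "t - h"] t h by (auto simp: abs_le_iff)
      then have "\<beta> * exp (- 2 * \<delta> * h) * ((zet (t - h))^2 - (zetM M (t - h))^2) \<le> \<beta> * exp (- 2 * \<delta> * h) * \<eta>"
        using beta by (intro mult_left_mono) auto
      also have "\<dots> \<le> \<beta> * 1 * \<eta>" using beta \<eta> delta h by (intro mult_right_mono mult_left_mono) auto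
      finally have "\<beta> * exp (- 2 * \<delta> * h) * ((zet (t - h))^2 - (zetM M (t - h))^2) \<le> \<beta> * \<eta>" by simp
      then have "exp (2 * \<delta> * t) * (\<beta> * exp (- 2 * \<delta> * h) * ((zet (t - h))^2 - (zetM M (t - h))^2)) \<le> exp (2 * \<delta> * t) * (\<beta> * \<eta>)"
        by (intro mult_left_mono) auto
      also have "\<dots> \<le> k" unfolding k_def using t delta beta \<eta> by (intro mult_right_mono) auto
      finally show ?thesis using v(2) by linarith
    qed
    ultimately show "\<exists>y. (g has_real_derivative y) (at t) \<and> y \<le> 0" by (intro exI[of _ "v - k"]) auto
  qed
  then show ?thesis unfolding g_def k_def by (simp add: algebra_simps)
qed

text \<open>This bound and the next two undo the rescaling of the blocks. Here \<open>N\<close> is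
  fixed, so constants that involve \<open>lam N\<close> are harmless.\<close>

lemma pred_sum_le: "(\<Sum>n=1..N. (pred zh u n t)^2) \<le> (1 + (lam N)^2) * NX t"
proof -
  have 1: "(\<Sum>n=1..N0. (pred zh u n t)^2) = (\<Sum>i\<in>{0..<N0}. (X1 t i)^2)"
    unfolding sum_atLeast1_shift by (simp add: X1_def)
  have "(\<Sum>n\<in>{N0+1..N}. (pred zh u n t)^2) = (\<Sum>j\<in>{0..<N-N0}. (pred zh u (N0+j+1) t)^2)"
    by (rule sum_shift_above[symmetric])
  also have "\<dots> \<le> (\<Sum>j\<in>{0..<N-N0}. (lam N)^2 * (X3 t j)^2)"
  proof (rule sum_mono)
    fix j assume j: "j \<in> {0..<N-N0}"
    have l: "lam (N0+j+1) > 0" "lam (N0+j+1) \<le> lam N" using lam_pos lam_mono[of "N0+j+1" N] j by auto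
    have "(pred zh u (N0+j+1) t)^2 = (lam (N0+j+1))^2 * (X3 t j)^2"
      using l unfolding X3_def by (simp add: power_divide)
    also have "\<dots> \<le> (lam N)^2 * (X3 t j)^2" using l by (intro mult_right_mono power_mono) auto
    finally show "(pred zh u (N0+j+1) t)^2 \<le> (lam N)^2 * (X3 t j)^2" .
  qed
  also have "\<dots> = (lam N)^2 * (\<Sum>j\<in>{0..<N-N0}. (X3 t j)^2)" by (simp add: sum_distrib_left)
  finally have 2: "(\<Sum>n\<in>{N0+1..N}. (pred zh u n t)^2) \<le> (lam N)^2 * (\<Sum>j\<in>{0..<N-N0}. (X3 t j)^2)" .
  have n: "(\<Sum>i\<in>{0..<N0}. (X1 t i)^2) \<le> NX t" "(\<Sum>j\<in>{0..<N-N0}. (X3 t j)^2) \<le> NX t"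
    unfolding NX_def by (simp_all add: sum_nonneg add_nonneg_nonneg)
  have "(lam N)^2 * (\<Sum>j\<in>{0..<N-N0}. (X3 t j)^2) \<le> (lam N)^2 * NX t" using n by (intro mult_left_mono) auto
  then show ?thesis using 1 2 n unfolding split_sum by (simp add: distrib_right)
qed

lemma err_sum_le: "(\<Sum>n=1..N. (err n t)^2) \<le> (1 + 1 / (lam 1)^2) * NX t"
proof -
  have 1: "(\<Sum>n=1..N0. (err n t)^2) = (\<Sum>i\<in>{0..<N0}. (X2 t i)^2)"
    unfolding sum_atLeast1_shift by (simp add: X2_def)
  have l1: "lam 1 > 0" by (rule lam_pos) simp
  have "(\<Sum>n\<in>{N0+1..N}. (err n t)^2) = (\<Sum>j\<in>{0..<N-N0}. (err (N0+j+1) t)^2)"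
    by (rule sum_shift_above[symmetric])
  also have "\<dots> \<le> (\<Sum>j\<in>{0..<N-N0}. 1 / (lam 1)^2 * (X4 t j)^2)"
  proof (rule sum_mono)
    fix j assume j: "j \<in> {0..<N-N0}"
    have "(lam 1)^2 \<le> (lam (N0+j+1))^2" using l1 lam_mono[of 1 "N0+j+1"] by (intro power_mono) auto
    then have "(lam 1)^2 * (err (N0+j+1) t)^2 \<le> (X4 t j)^2"
      unfolding X4_def power_mult_distrib by (rule mult_right_mono) simp
    then show "(err (N0+j+1) t)^2 \<le> 1 / (lam 1)^2 * (X4 t j)^2" using l1 by (simp add: field_simps)
  qed
  also have "\<dots> = 1 / (lam 1)^2 * (\<Sum>j\<in>{0..<N-N0}. (X4 t j)^2)" by (simp add: sum_distrib_left)
  finally have 2: "(\<Sum>n\<in>{N0+1..N}. (err n t)^2) \<le> 1 / (lam 1)^2 * (\<Sum>j\<in>{0..<N-N0}. (X4 t j)^2)" .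
  have n: "(\<Sum>i\<in>{0..<N0}. (X2 t i)^2) \<le> NX t" "(\<Sum>j\<in>{0..<N-N0}. (X4 t j)^2) \<le> NX t"
    unfolding NX_def by (simp_all add: sum_nonneg add_nonneg_nonneg)
  have "1 / (lam 1)^2 * (\<Sum>j\<in>{0..<N-N0}. (X4 t j)^2) \<le> 1 / (lam 1)^2 * NX t" using n by (intro mult_left_mono) auto
  then show ?thesis using 1 2 n unfolding split_sum distrib_right by linarith
qed

lemma NX_le: "NX t \<le> (1 + 1 / (lam 1)^2) * (\<Sum>n=1..N. (pred zh u n t)^2) + (1 + (lam N)^2) * (\<Sum>n=1..N. (err n t)^2)"
proof -
  have l1: "lam 1 > 0" by (rule lam_pos) simp
  define p1 p2 e1 e2 where "p1 = (\<Sum>n=1..N0. (pred zh u n t)^2)" and "p2 = (\<Sum>n\<in>{N0+1..N}. (pred zh u n t)^2)"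
    and "e1 = (\<Sum>n=1..N0. (err n t)^2)" and "e2 = (\<Sum>n\<in>{N0+1..N}. (err n t)^2)"
  have nn: "p1 \<ge> 0" "p2 \<ge> 0" "e1 \<ge> 0" "e2 \<ge> 0" by (auto simp: p1_def p2_def e1_def e2_def intro: sum_nonneg)
  have 1: "(\<Sum>i\<in>{0..<N0}. (X1 t i)^2) = p1" "(\<Sum>i\<in>{0..<N0}. (X2 t i)^2) = e1"
    unfolding p1_def e1_def sum_atLeast1_shift by (simp_all add: X1_def X2_def)
  have "(\<Sum>j\<in>{0..<N-N0}. (X3 t j)^2) \<le> (\<Sum>j\<in>{0..<N-N0}. 1 / (lam 1)^2 * (pred zh u (N0+j+1) t)^2)"
  proof (rule sum_mono)
    fix j
    have "(lam 1)^2 \<le> (lam (N0+j+1))^2" using l1 lam_mono[of 1 "N0+j+1"] by (intro power_mono) auto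
    then have "1 / (lam (N0+j+1))^2 \<le> 1 / (lam 1)^2" using l1 lam_pos[of "N0+j+1"] by (intro divide_left_mono) auto
    then have "1 / (lam (N0+j+1))^2 * (pred zh u (N0+j+1) t)^2 \<le> 1 / (lam 1)^2 * (pred zh u (N0+j+1) t)^2"
      by (rule mult_right_mono) simp
    then show "(X3 t j)^2 \<le> 1 / (lam 1)^2 * (pred zh u (N0+j+1) t)^2" unfolding X3_def by (simp add: power_divide)
  qed
  also have "\<dots> = 1 / (lam 1)^2 * p2" unfolding p2_def sum_shift_above[symmetric] by (simp add: sum_distrib_left)
  finally have 3: "(\<Sum>j\<in>{0..<N-N0}. (X3 t j)^2) \<le> 1 / (lam 1)^2 * p2" .
  have "(\<Sum>j\<in>{0..<N-N0}. (X4 t j)^2) \<le> (\<Sum>j\<in>{0..<N-N0}. (lam N)^2 * (err (N0+j+1) t)^2)"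
  proof (rule sum_mono)
    fix j assume j: "j \<in> {0..<N-N0}"
    have l: "lam (N0+j+1) > 0" "lam (N0+j+1) \<le> lam N" using lam_pos lam_mono[of "N0+j+1" N] j by auto
    show "(X4 t j)^2 \<le> (lam N)^2 * (err (N0+j+1) t)^2"
      unfolding X4_def power_mult_distrib using l by (intro mult_right_mono power_mono) auto
  qed
  also have "\<dots> = (lam N)^2 * e2" unfolding e2_def sum_shift_above[symmetric] by (simp add: sum_distrib_left)
  finally have 4: "(\<Sum>j\<in>{0..<N-N0}. (X4 t j)^2) \<le> (lam N)^2 * e2" .
  have "(1 + r) * (p1 + p2) + (1 + s) * (e1 + e2) = p1 + e1 + r * p2 + s * e2 + (p2 + e2 + r * p1 + s * e1)" for r s
    by (simp add: algebra_simps)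
  from this[of "1 / (lam 1)^2" "(lam N)^2"]
  have "(1 + 1 / (lam 1)^2) * (p1 + p2) + (1 + (lam N)^2) * (e1 + e2) =
    p1 + e1 + 1 / (lam 1)^2 * p2 + (lam N)^2 * e2 + (p2 + e2 + 1 / (lam 1)^2 * p1 + (lam N)^2 * e1)" .
  moreover have "0 \<le> p2 + e2 + 1 / (lam 1)^2 * p1 + (lam N)^2 * e1" using nn by simp
  ultimately have "p1 + e1 + 1 / (lam 1)^2 * p2 + (lam N)^2 * e2 \<le> (1 + 1 / (lam 1)^2) * (p1 + p2) + (1 + (lam N)^2) * (e1 + e2)" by linarith
  then show ?thesis using 1 3 4 unfolding NX_def split_sum p1_def[symmetric] p2_def[symmetric] e1_def[symmetric] e2_def[symmetric] by linarith
qed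

end

section \<open>From the functional to exponential decay of all modes\<close>

context lyapunov_data begin

text \<open>The value of the functional at \<open>t = h\<close> is bounded by the initial energy
  through the a priori estimates, uniformly in the truncation. Monotonicity up to the defect and
  coercivity of \<open>P\<close> then give the rate, the truncation being sent to infinity while the
  modes in the conclusion stay fixed.\<close>

lemma decay_after_delay:
  "\<exists>C\<ge>0. \<forall>zn zh u y Y W. modal_trajectory zn zh u y Y W \<longrightarrow>
     (\<forall>t\<ge>h. (\<Sum>n=1..N. (pred zh u n t)^2) \<le> C * (exp (- 2 * \<delta> * t) * init_energy zh u Y W) \<and>
       (\<Sum>n=1..N. (zn n (t - h) - zh n t)^2) \<le> C * (exp (- 2 * \<delta> * t) * init_energy zh u Y W) \<and>
       (\<forall>M. (\<Sum>n\<in>{N+1..M}. lam n * (zn n t + b n * u t)^2) \<le> C * (exp (- 2 * \<delta> * t) * init_energy zh u Y W)))"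
proof -
  obtain Ca where Ca: "Ca \<ge> 0" and CCa: "\<forall>zn zh u y Y W. modal_trajectory zn zh u y Y W \<longrightarrow>
     (\<forall>t\<in>{0..h}. (\<Sum>n=1..N. (zh n t)^2) \<le> Ca * init_energy zh u Y W \<and>
        (\<Sum>n=1..N. (pred zh u n t)^2) \<le> Ca * init_energy zh u Y W \<and>
        (u t)^2 \<le> Ca * init_energy zh u Y W \<and> (0 < t \<and> t < h \<longrightarrow> (udot zh u y t)^2 \<le> Ca * init_energy zh u Y W))"
    using apriori_observer by blast
  obtain Cs where Cs: "Cs \<ge> 0" and CCs: "\<forall>zn zh u y Y W. modal_trajectory zn zh u y Y W \<longrightarrow>
     (\<forall>M. (\<forall>t\<in>{0..h}. (\<Sum>n=1..M. lam n * (zn n t + b n * u t)^2) \<le> Cs * init_energy zh u Y W) \<and>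
        integral {0..h} (\<lambda>t. \<Sum>n=1..M. (lam n)^2 * (zn n t + b n * u t)^2) \<le> Cs * init_energy zh u Y W)"
    using apriori_state by blast
  have Pc: "P \<in> carrier_mat (2*N) (2*N)" using P_pd by (simp add: pos_def_def)
  have dim: "2 * N = (N0 + N0) + ((N - N0) + (N - N0))" using N0N by simp
  obtain Pn where Pn: "Pn \<ge> 0" "\<forall>x1 x2 x3 x4. stack4 N0 (N - N0) x1 x2 x3 x4 \<bullet> (P *\<^sub>v stack4 N0 (N - N0) x1 x2 x3 x4)
    \<le> Pn * ((\<Sum>i\<in>{0..<N0}. (x1 i)^2) + (\<Sum>i\<in>{0..<N0}. (x2 i)^2) + (\<Sum>i\<in>{0..<N - N0}. (x3 i)^2) + (\<Sum>i\<in>{0..<N - N0}. (x4 i)^2))"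
    using stack4_form_le[OF Pc dim] by blast
  obtain cP where cP: "cP > 0" "\<forall>x1 x2 x3 x4. cP * ((\<Sum>i\<in>{0..<N0}. (x1 i)^2) + (\<Sum>i\<in>{0..<N0}. (x2 i)^2) + (\<Sum>i\<in>{0..<N - N0}. (x3 i)^2) + (\<Sum>i\<in>{0..<N - N0}. (x4 i)^2))
    \<le> stack4 N0 (N - N0) x1 x2 x3 x4 \<bullet> (P *\<^sub>v stack4 N0 (N - N0) x1 x2 x3 x4)"
    using stack4_form_ge[OF P_pd dim] by blast
  have l1: "lam 1 > 0" by (rule lam_pos) simp
  \<comment> \<open>The error at the starting time is \<open>w n 0 - b n * u 0 - zh n h\<close>; its
    three terms are bounded by the initial graph norm, by \<open>B2\<close> and by the observer
    estimate.\<close>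
  define Ce where "Ce = 3 * (1 / (lam 1)^2 + B2 + Ca)"
  define CN where "CN = (1 + 1 / (lam 1)^2) * Ca + (1 + (lam N)^2) * Ce"
  define CV where "CV = exp (2 * \<delta> * h) * (Pn * CN + \<gamma> * Cs) + \<beta> * (exp (2 * \<delta> * h) * C2 * Cs)"
  have Ce: "Ce \<ge> 0" using Ca B2_nonneg by (simp add: Ce_def)
  have CN: "CN \<ge> 0" using Ca Ce by (simp add: CN_def)
  have CV: "CV \<ge> 0" using CN Pn Cs gamma beta C2_nonneg by (simp add: CV_def)
  define C where "C = (1 + (lam N)^2) * (CV / cP) + (1 + 1 / (lam 1)^2) * (CV / cP) + CV / \<gamma>"
  have nn: "0 \<le> (1 + (lam N)^2) * (CV / cP)" "0 \<le> (1 + 1 / (lam 1)^2) * (CV / cP)" "0 \<le> CV / \<gamma>"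
    using CV cP gamma by auto
  then have C: "C \<ge> 0" by (simp add: C_def)
  have "(\<Sum>n=1..N. (pred zh u n t)^2) \<le> C * (exp (- 2 * \<delta> * t) * init_energy zh u Y W) \<and>
       (\<Sum>n=1..N. (zn n (t - h) - zh n t)^2) \<le> C * (exp (- 2 * \<delta> * t) * init_energy zh u Y W) \<and>
       (\<forall>M. (\<Sum>n\<in>{N+1..M}. lam n * (zn n t + b n * u t)^2) \<le> C * (exp (- 2 * \<delta> * t) * init_energy zh u Y W))"
    if tr: "modal_trajectory zn zh u y Y W" and t: "t \<ge> h" for zn zh u y Y W t
  proof -
    interpret lyapunov_solution lam a b c bet K l qc \<delta> h A2 B2 C2 N0 N P \<alpha> \<beta> \<gamma> \<epsilon> ra rb m zn zh u y Y W
      by unfold_locales (rule tr)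
    have R0: "R0 \<ge> 0" using W_nonneg by (simp add: init_energy_def sum_nonneg)
    have WR: "W \<le> R0" "(u 0)^2 \<le> R0" using W_nonneg by (simp_all add: init_energy_def sum_nonneg)
    have PX: "XX s \<bullet> (P *\<^sub>v XX s) \<le> Pn * NX s" "cP * NX s \<le> XX s \<bullet> (P *\<^sub>v XX s)" for s
      unfolding XX_def NX_def using Pn(2) cP(2) by blast+
    have NX0: "NX s \<ge> 0" for s unfolding NX_def by (intro add_nonneg_nonneg sum_nonneg) auto
    have S0: "lam n * (w n s)^2 \<ge> 0" if "n \<in> {N+1..M}" for n M s using lam_pos[of n] that by simp
    have eh: "(\<Sum>n=1..N. (err n h)^2) \<le> Ce * R0"
    proof -
      have "(\<Sum>n=1..N. (err n h)^2) \<le> (\<Sum>n=1..N. 3 * ((w n 0)^2 + (b n)^2 * (u 0)^2 + (zh n h)^2))"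
      proof (rule sum_mono)
        fix n
        have "(err n h)^2 = (w n 0 + (- b n * u 0) + (- zh n h))^2" by (simp add: err_def)
        also have "\<dots> \<le> 3 * ((w n 0)^2 + (- b n * u 0)^2 + (- zh n h)^2)" by (rule square_sum3_le)
        finally show "(err n h)^2 \<le> 3 * ((w n 0)^2 + (b n)^2 * (u 0)^2 + (zh n h)^2)" by (simp add: power_mult_distrib)
      qed
      also have "\<dots> = 3 * ((\<Sum>n=1..N. (w n 0)^2) + (\<Sum>n=1..N. (b n)^2) * (u 0)^2 + (\<Sum>n=1..N. (zh n h)^2))"
        by (simp add: sum_distrib_left sum_distrib_right sum.distrib)
      also have "(\<Sum>n=1..N. (w n 0)^2) \<le> 1 / (lam 1)^2 * R0"
      proof -
        have "(\<Sum>n=1..N. (w n 0)^2) \<le> (\<Sum>n=1..N. 1 / (lam 1)^2 * ((lam n)^2 * (w n 0)^2))"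
        proof (rule sum_mono)
          fix n assume "n \<in> {1..N}"
          then have "(lam 1)^2 \<le> (lam n)^2" using l1 lam_mono[of 1 n] by (intro power_mono) auto
          then have "(lam 1)^2 * (w n 0)^2 \<le> (lam n)^2 * (w n 0)^2" by (rule mult_right_mono) simp
          then show "(w n 0)^2 \<le> 1 / (lam 1)^2 * ((lam n)^2 * (w n 0)^2)" using l1 by (simp add: field_simps)
        qed
        also have "\<dots> = 1 / (lam 1)^2 * (\<Sum>n=1..N. (lam n)^2 * (w n 0)^2)" by (simp add: sum_distrib_left)
        also have "\<dots> \<le> 1 / (lam 1)^2 * R0" using w0_bound[of N] WR by (intro mult_left_mono) auto
        finally show ?thesis .
      qed
      also have "(\<Sum>n=1..N. (b n)^2) * (u 0)^2 \<le> B2 * R0" using WR B2_nonneg by (intro mult_mono b2) auto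
      also have "(\<Sum>n=1..N. (zh n h)^2) \<le> Ca * R0" using CCa[rule_format, OF tr, of h] h by auto
      finally show ?thesis by (simp add: Ce_def algebra_simps)
    qed
    have NXh: "NX h \<le> CN * R0"
    proof -
      have "NX h \<le> (1 + 1 / (lam 1)^2) * (\<Sum>n=1..N. (pred zh u n h)^2) + (1 + (lam N)^2) * (\<Sum>n=1..N. (err n h)^2)" by (rule NX_le)
      also have "\<dots> \<le> (1 + 1 / (lam 1)^2) * (Ca * R0) + (1 + (lam N)^2) * (Ce * R0)"
        using CCa[rule_format, OF tr, of h] h eh by (intro add_mono mult_left_mono) auto
      finally show ?thesis by (simp add: CN_def algebra_simps)
    qed
    have VMh: "VM M h \<le> CV * R0" for M
    proof -
      have "XX h \<bullet> (P *\<^sub>v XX h) \<le> Pn * (CN * R0)" using PX(1)[of h] mult_left_mono[OF NXh Pn(1)] by linarith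
      moreover have "SM M h \<le> Cs * R0"
      proof -
        have "SM M h \<le> (\<Sum>n=1..M. lam n * (w n h)^2)"
          unfolding SM_def by (intro sum_mono2) (auto intro!: mult_nonneg_nonneg less_imp_le[OF lam_pos])
        also have "\<dots> \<le> Cs * R0" using CCs[rule_format, OF tr, of M] h by auto
        finally show ?thesis .
      qed
      then have "\<gamma> * SM M h \<le> \<gamma> * (Cs * R0)" using gamma by (intro mult_left_mono) auto
      \<comment> \<open>Bounds on the energy at each time do not control the flux residual; the
        integrated dissipation from \<open>apriori_state\<close> does.\<close>
      moreover have "JM M h \<le> exp (2 * \<delta> * h) * C2 * (Cs * R0)"
      proof -
        have ci: "continuous_on {0..h} (\<lambda>s. \<Sum>n=1..M. (lam n)^2 * (w n s)^2)"
          by (intro continuous_intros continuous_on_subset[OF zn_cont] u_cont) auto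
        have "JM M h \<le> integral {0..h} (\<lambda>s. exp (2 * \<delta> * h) * C2 * (\<Sum>n=1..M. (lam n)^2 * (w n s)^2))"
          unfolding JM_def
        proof (rule integral_le)
          show "(\<lambda>s. exp (2 * \<delta> * s) * (zetM M s)^2) integrable_on {0..h}"
            by (intro integrable_continuous_interval continuous_on_subset[OF JM_integrand_cont]) auto
          show "(\<lambda>s. exp (2 * \<delta> * h) * C2 * (\<Sum>n=1..M. (lam n)^2 * (w n s)^2)) integrable_on {0..h}"
            by (intro integrable_continuous_interval continuous_intros ci)
          fix s assume s: "s \<in> {0..h}"
          have "(zetM M s)^2 \<le> (\<Sum>n\<in>{N+1..M}. (c n / lam n)^2) * (\<Sum>n=1..M. (lam n)^2 * (w n s)^2)"
            unfolding zetM_def by (rule output_segment_square_le) auto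
          also have "\<dots> \<le> C2 * (\<Sum>n=1..M. (lam n)^2 * (w n s)^2)" by (intro mult_right_mono c2 sum_nonneg) auto
          finally have "exp (2 * \<delta> * s) * (zetM M s)^2 \<le> exp (2 * \<delta> * h) * (C2 * (\<Sum>n=1..M. (lam n)^2 * (w n s)^2))"
            using s delta by (intro mult_mono) auto
          then show "exp (2 * \<delta> * s) * (zetM M s)^2 \<le> exp (2 * \<delta> * h) * C2 * (\<Sum>n=1..M. (lam n)^2 * (w n s)^2)" by (simp only: mult.assoc)
        qed
        also have "\<dots> = exp (2 * \<delta> * h) * C2 * integral {0..h} (\<lambda>s. \<Sum>n=1..M. (lam n)^2 * (w n s)^2)" by (rule integral_mult_right)
        also have "\<dots> \<le> exp (2 * \<delta> * h) * C2 * (Cs * R0)"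
          using CCs[rule_format, OF tr, of M] C2_nonneg by (intro mult_left_mono) auto
        finally show ?thesis .
      qed
      then have "\<beta> * JM M h \<le> \<beta> * (exp (2 * \<delta> * h) * C2 * (Cs * R0))" using beta by (intro mult_left_mono) auto
      moreover have "VM M h = exp (2 * \<delta> * h) * (XX h \<bullet> (P *\<^sub>v XX h) + \<gamma> * SM M h) + \<beta> * JM M h"
        by (simp add: VM_def JM_def[of M 0])
      moreover have "exp (2 * \<delta> * h) * (x + z) + k \<le> exp (2 * \<delta> * h) * (x' + z') + k'"
        if "x \<le> x'" "z \<le> z'" "k \<le> k'" for x x' z z' k k' :: real
        by (rule add_mono[OF mult_left_mono[OF add_mono[OF that(1,2)]] that(3)]) simp
      ultimately have "VM M h \<le> exp (2 * \<delta> * h) * (Pn * (CN * R0) + \<gamma> * (Cs * R0)) + \<beta> * (exp (2 * \<delta> * h) * C2 * (Cs * R0))"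
        by (simp only:)
      also have "\<dots> = CV * R0" by (simp add: CV_def algebra_simps)
      finally show ?thesis .
    qed
    have key: "exp (2 * \<delta> * t) * (cP * NX t + \<gamma> * SM M0 t) \<le> CV * R0" for M0
    proof (rule field_le_epsilon)
      fix e :: real assume e: "e > 0"
      \<comment> \<open>Chosen so that a defect of \<open>e / k\<close> contributes at most
        \<open>e\<close> up to time \<open>t\<close>; the summand 1 keeps \<open>k\<close> positive
        when \<open>t = h\<close>.\<close>
      define k where "k = exp (2 * \<delta> * t) * \<beta> * (t - h + 1)"
      have k: "k > 0" using beta t by (simp add: k_def)
      obtain M1 where M1: "\<forall>M\<ge>M1. \<forall>s\<in>{0..t}. \<bar>(zet s)^2 - (zetM M s)^2\<bar> \<le> e / k"
        using zet_uniform[of "e / k" t] e k by auto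
      define M where "M = max M0 M1"
      have "VM M t \<le> VM M h + (exp (2 * \<delta> * t) * (\<beta> * (e / k))) * (t - h)"
        using M1 e k by (intro VM_le[OF t]) (auto simp: M_def)
      also have "(exp (2 * \<delta> * t) * (\<beta> * (e / k))) * (t - h) \<le> e"
      proof -
        have "(exp (2 * \<delta> * t) * (\<beta> * (e / k))) * (t - h) = (exp (2 * \<delta> * t) * \<beta> * (t - h)) * (e / k)" by simp
        also have "\<dots> \<le> k * (e / k)" using beta e k unfolding k_def by (intro mult_right_mono) auto
        also have "\<dots> = e" using k by simp
        finally show ?thesis .
      qed
      finally have 1: "VM M t \<le> CV * R0 + e" using VMh[of M] by linarith
      have "JM M (t - h) \<le> JM M t"
        unfolding JM_def using t h
        by (intro integral_subset_le integrable_continuous_interval continuous_on_subset[OF JM_integrand_cont]) auto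
      then have J: "0 \<le> \<beta> * (JM M t - JM M (t - h))" using beta by simp
      have "SM M0 t \<le> SM M t" unfolding SM_def M_def using S0 by (intro sum_mono2) auto
      then have "cP * NX t + \<gamma> * SM M0 t \<le> XX t \<bullet> (P *\<^sub>v XX t) + \<gamma> * SM M t"
        using PX(2)[of t] gamma by (intro add_mono mult_left_mono) auto
      then have "exp (2 * \<delta> * t) * (cP * NX t + \<gamma> * SM M0 t) \<le> exp (2 * \<delta> * t) * (XX t \<bullet> (P *\<^sub>v XX t) + \<gamma> * SM M t)"
        by (rule mult_left_mono) simp
      then show "exp (2 * \<delta> * t) * (cP * NX t + \<gamma> * SM M0 t) \<le> CV * R0 + e"
        using 1 J unfolding VM_def by linarith
    qed
    define E where "E = exp (- 2 * \<delta> * t) * R0"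
    have E0: "E \<ge> 0" using R0 by (simp add: E_def)
    have key2: "cP * NX t + \<gamma> * SM M0 t \<le> CV * E" for M0
    proof -
      have "cP * NX t + \<gamma> * SM M0 t = exp (- 2 * \<delta> * t) * (exp (2 * \<delta> * t) * (cP * NX t + \<gamma> * SM M0 t))"
        unfolding mult.assoc[symmetric] exp_add[symmetric] by simp
      also have "\<dots> \<le> exp (- 2 * \<delta> * t) * (CV * R0)" by (intro mult_left_mono key) auto
      also have "\<dots> = CV * E" by (simp add: E_def)
      finally show ?thesis .
    qed
    have SM0: "SM M0 t \<ge> 0" for M0 unfolding SM_def by (intro sum_nonneg S0)
    have NXt: "NX t \<le> CV / cP * E"
    proof -
      have "cP * NX t \<le> CV * E" using key2[of 0] SM0[of 0] gamma by (smt (verit) mult_nonneg_nonneg)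
      then show ?thesis using cP by (simp add: field_simps)
    qed
    have SMt: "SM M0 t \<le> CV / \<gamma> * E" for M0
    proof -
      have "0 \<le> cP * NX t" using NX0[of t] cP by simp
      then have "\<gamma> * SM M0 t \<le> CV * E" using key2[of M0] by linarith
      then show ?thesis using gamma by (simp add: field_simps)
    qed
    have "(\<Sum>n=1..N. (pred zh u n t)^2) \<le> (1 + (lam N)^2) * (CV / cP * E)"
      by (rule order_trans[OF pred_sum_le mult_left_mono[OF NXt]]) simp
    moreover have "(\<Sum>n=1..N. (err n t)^2) \<le> (1 + 1 / (lam 1)^2) * (CV / cP * E)"
      by (rule order_trans[OF err_sum_le mult_left_mono[OF NXt]]) simp
    moreover have "(1 + (lam N)^2) * (CV / cP) * E \<le> C * E" "(1 + 1 / (lam 1)^2) * (CV / cP) * E \<le> C * E" "CV / \<gamma> * E \<le> C * E"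
      unfolding C_def by (intro mult_right_mono E0; use nn in linarith)+
    ultimately show ?thesis
      using SMt unfolding E_def[symmetric] SM_def err_def mult.assoc[symmetric]
      by (meson order_trans)
  qed
  then show ?thesis using C by blast
qed

text \<open>Everything is recovered from the decaying quantities: \<open>u\<close> from the
  predictor by feedback; \<open>zh\<close> by inverting the predictor formula, whose window integral
  involves only \<open>u\<close>; the first \<open>N\<close> plant modes by comparing the plant at
  \<open>t\<close> with the observer at \<open>t + h\<close>. Times up to \<open>h\<close> are
  covered by the a priori bounds.\<close>

lemma modal_decay:
  "\<exists>C\<ge>0. \<forall>zn zh u y Y W. modal_trajectory zn zh u y Y W \<longrightarrow>
     (\<forall>t\<ge>0. \<forall>M. (\<Sum>n=1..M. lam n * (zn n t + b n * u t)^2) \<le> C * (exp (- 2 * \<delta> * t) * init_energy zh u Y W) \<and>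
       (u t)^2 \<le> C * (exp (- 2 * \<delta> * t) * init_energy zh u Y W) \<and>
       (\<Sum>n=1..N. (zh n t)^2) \<le> C * (exp (- 2 * \<delta> * t) * init_energy zh u Y W))"
proof -
  obtain Ca where Ca: "Ca \<ge> 0" and CCa: "\<forall>zn zh u y Y W. modal_trajectory zn zh u y Y W \<longrightarrow>
     (\<forall>t\<in>{0..h}. (\<Sum>n=1..N. (zh n t)^2) \<le> Ca * init_energy zh u Y W \<and>
        (\<Sum>n=1..N. (pred zh u n t)^2) \<le> Ca * init_energy zh u Y W \<and>
        (u t)^2 \<le> Ca * init_energy zh u Y W \<and> (0 < t \<and> t < h \<longrightarrow> (udot zh u y t)^2 \<le> Ca * init_energy zh u Y W))"
    using apriori_observer by blast
  obtain Cs where Cs: "Cs \<ge> 0" and CCs: "\<forall>zn zh u y Y W. modal_trajectory zn zh u y Y W \<longrightarrow>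
     (\<forall>M. (\<forall>t\<in>{0..h}. (\<Sum>n=1..M. lam n * (zn n t + b n * u t)^2) \<le> Cs * init_energy zh u Y W) \<and>
        integral {0..h} (\<lambda>t. \<Sum>n=1..M. (lam n)^2 * (zn n t + b n * u t)^2) \<le> Cs * init_energy zh u Y W)"
    using apriori_state by blast
  obtain CD where CD: "CD \<ge> 0" and CCD: "\<forall>zn zh u y Y W. modal_trajectory zn zh u y Y W \<longrightarrow>
     (\<forall>t\<ge>h. (\<Sum>n=1..N. (pred zh u n t)^2) \<le> CD * (exp (- 2 * \<delta> * t) * init_energy zh u Y W) \<and>
       (\<Sum>n=1..N. (zn n (t - h) - zh n t)^2) \<le> CD * (exp (- 2 * \<delta> * t) * init_energy zh u Y W) \<and>
       (\<forall>M. (\<Sum>n\<in>{N+1..M}. lam n * (zn n t + b n * u t)^2) \<le> CD * (exp (- 2 * \<delta> * t) * init_energy zh u Y W)))"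
    using decay_after_delay by blast
  \<comment> \<open>The price of moving the exponential envelope by one delay. It also converts the
    undecayed bounds on \<open>[0, h]\<close> into decaying ones.\<close>
  define G where "G = exp (2 * \<delta> * h)"
  have G: "G \<ge> 1" using delta h by (simp add: G_def)
  define Kn where "Kn = (\<Sum>n\<in>{1..N0}. (K n)^2)"
  define Cu where "Cu = Kn * CD + Ca * G + 1"
  define Cz where "Cz = (\<lambda>n. 2 * (exp (- mu n * h))^2 * (CD + (h * (exp (\<bar>mu n\<bar> * h) * \<bar>bet n\<bar>))^2 * (Cu * G)) + Ca * G)"
  define Cw where "Cw = (\<Sum>n=1..N. lam n * (2 * (2 * (CD + Cz n) + (b n)^2 * Cu)))"
  have Kn: "Kn \<ge> 0" by (simp add: Kn_def sum_nonneg)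
  have Cu: "Cu \<ge> 0" using Kn CD Ca G by (simp add: Cu_def)
  have Cz: "Cz n \<ge> 0" for n using CD Cu G Ca by (simp add: Cz_def)
  have Cw: "Cw \<ge> 0" unfolding Cw_def using CD Cz Cu lam_pos by (intro sum_nonneg mult_nonneg_nonneg add_nonneg_nonneg) (auto simp: less_imp_le)
  define C where "C = Cw + CD + Cs * G + Cu + (\<Sum>n=1..N. Cz n)"
  have C: "C \<ge> 0" using Cw CD Cs G Cu Cz by (simp add: C_def sum_nonneg)
  have "(\<Sum>n=1..M. lam n * (zn n t + b n * u t)^2) \<le> C * (exp (- 2 * \<delta> * t) * init_energy zh u Y W) \<and>
       (u t)^2 \<le> C * (exp (- 2 * \<delta> * t) * init_energy zh u Y W) \<and>
       (\<Sum>n=1..N. (zh n t)^2) \<le> C * (exp (- 2 * \<delta> * t) * init_energy zh u Y W)"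
    if tr: "modal_trajectory zn zh u y Y W" and t: "t \<ge> 0" for zn zh u y Y W t M
  proof -
    interpret modal_solution lam a b c bet K l qc \<delta> h A2 B2 C2 N0 N zn zh u y Y W
      by unfold_locales (rule tr)
    define E where "E = (\<lambda>t. exp (- 2 * \<delta> * t) * R0)"
    have R0: "R0 \<ge> 0" "(u 0)^2 \<le> R0" using W_nonneg by (simp_all add: init_energy_def sum_nonneg)
    have E0: "E t \<ge> 0" for t using R0 by (simp add: E_def)
    have Eshift: "E s \<le> G * E t" if "t - h \<le> s" for s t
    proof -
      have "exp (- 2 * \<delta> * s) \<le> exp (2 * \<delta> * h + - 2 * \<delta> * t)"
        using mult_left_mono[OF that, of "2 * \<delta>"] delta by (simp add: algebra_simps)
      then show ?thesis unfolding E_def G_def exp_add using R0 by (simp add: mult_right_mono mult.assoc[symmetric])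
    qed
    have RE: "R0 \<le> G * E t" if "t \<le> h" for t using Eshift[of t 0] that by (simp add: E_def)
    have D1: "(\<Sum>n=1..N. (pred zh u n t)^2) \<le> CD * E t" "(\<Sum>n=1..N. (zn n (t - h) - zh n t)^2) \<le> CD * E t"
       "(\<Sum>n\<in>{N+1..M}. lam n * (w n t)^2) \<le> CD * E t" if "t \<ge> h" for t M
      using CCD[rule_format, OF tr that] unfolding E_def by blast+
    have ub: "(u t)^2 \<le> Cu * E t" if "t \<ge> - h" for t
    proof -
      consider "t \<le> 0" | "0 \<le> t" "t \<le> h" | "h \<le> t" by linarith
      then have "(u t)^2 \<le> Kn * CD * E t \<or> (u t)^2 \<le> Ca * G * E t \<or> (u t)^2 \<le> E t"
      proof cases
        case 1
        have "(u t)^2 \<le> 1 * R0" using u_past[OF 1] R0 by simp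
        also have "\<dots> \<le> E t" unfolding E_def using 1 delta R0 by (intro mult_right_mono) (auto simp: mult_nonneg_nonpos)
        finally show ?thesis by simp
      next
        case 2
        have "(u t)^2 \<le> Ca * R0" using CCa[rule_format, OF tr, of t] 2 by auto
        also have "\<dots> \<le> Ca * (G * E t)" using RE[OF 2(2)] Ca by (intro mult_left_mono) auto
        finally show ?thesis by (simp add: mult.assoc)
      next
        case 3
        then have t0: "t \<ge> 0" using h by simp
        have "(u t)^2 \<le> Kn * (\<Sum>n=1..N0. (pred zh u n t)^2)" unfolding u_eq[OF t0] Kn_def by (rule sum_Cauchy_Schwarz)
        also have "\<dots> \<le> Kn * (\<Sum>n=1..N. (pred zh u n t)^2)" using Kn N0N by (intro mult_left_mono sum_mono2) auto
        also have "\<dots> \<le> Kn * (CD * E t)" using Kn D1(1)[OF 3] by (intro mult_left_mono)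
        finally show ?thesis by (simp add: mult.assoc)
      qed
      moreover have "Kn * CD * E t \<le> Cu * E t" "Ca * G * E t \<le> Cu * E t" "1 * E t \<le> Cu * E t"
        unfolding Cu_def using Kn CD Ca G E0 by (intro mult_right_mono; simp)+
      ultimately show ?thesis by auto
    qed
    have zb: "(zh n t)^2 \<le> Cz n * E t" if t: "t \<ge> 0" and n: "n \<in> {1..N}" for n t
    proof (cases "t \<le> h")
      case True
      have "(zh n t)^2 \<le> (\<Sum>n=1..N. (zh n t)^2)" using n by (intro member_le_sum) auto
      also have "\<dots> \<le> Ca * R0" using CCa[rule_format, OF tr, of t] True t by auto
      also have "\<dots> \<le> Ca * (G * E t)" using RE[OF True] Ca by (intro mult_left_mono) auto
      also have "\<dots> \<le> Cz n * E t"
        unfolding mult.assoc[symmetric] Cz_def using CD Cu G E0 by (intro mult_right_mono) auto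
      finally show ?thesis .
    next
      case False
      define q where "q = (\<lambda>s. exp ((- lam n + qc) * (t - s)) * bet n * u s)"
      define J where "J = integral {t - h..t} q"
      define U where "U = sqrt (Cu * (G * E t))"
      have qc: "continuous_on {t - h..t} q" unfolding q_def by (intro continuous_intros u_cont)
      have "\<bar>J\<bar> \<le> integral {t - h..t} (\<lambda>s. exp (\<bar>mu n\<bar> * h) * \<bar>bet n\<bar> * U)"
        unfolding J_def
      proof (rule abs_integral_le_integral)
        show "q integrable_on {t - h..t}" by (rule integrable_continuous_interval[OF qc])
        fix s assume s: "s \<in> {t - h..t}"
        have "(u s)^2 \<le> Cu * (G * E t)"
          using ub[of s] mult_left_mono[OF Eshift[of t s] Cu] s False by auto
        then have us: "\<bar>u s\<bar> \<le> U" unfolding U_def by (intro real_le_rsqrt) simp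
        have "(- lam n + qc) * (t - s) \<le> \<bar>mu n\<bar> * h"
        proof -
          have "mu n * (t - s) \<le> \<bar>mu n\<bar> * (t - s)" using s by (intro mult_right_mono) auto
          also have "\<dots> \<le> \<bar>mu n\<bar> * h" using s by (intro mult_left_mono) auto
          finally show ?thesis by (simp add: mu_def)
        qed
        then have ee: "exp ((- lam n + qc) * (t - s)) \<le> exp (\<bar>mu n\<bar> * h)" by simp
        show "\<bar>q s\<bar> \<le> exp (\<bar>mu n\<bar> * h) * \<bar>bet n\<bar> * U"
          unfolding q_def abs_mult abs_exp_cancel by (intro mult_mono ee us) auto
      qed auto
      also have "\<dots> = h * (exp (\<bar>mu n\<bar> * h) * \<bar>bet n\<bar>) * U" using h by simp
      finally have "J^2 \<le> (h * (exp (\<bar>mu n\<bar> * h) * \<bar>bet n\<bar>) * U)^2" by (metis abs_ge_zero power2_abs power_mono)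
      also have "\<dots> = (h * (exp (\<bar>mu n\<bar> * h) * \<bar>bet n\<bar>))^2 * (Cu * (G * E t))"
        unfolding U_def power_mult_distrib[of _ "sqrt _"] using Cu G E0[of t] by simp
      finally have J2: "J^2 \<le> (h * (exp (\<bar>mu n\<bar> * h) * \<bar>bet n\<bar>))^2 * (Cu * (G * E t))" .
      have pr: "(pred zh u n t)^2 \<le> CD * E t"
      proof -
        have "(pred zh u n t)^2 \<le> (\<Sum>n=1..N. (pred zh u n t)^2)" using n by (intro member_le_sum) auto
        then show ?thesis using D1(1)[of t] False by linarith
      qed
      have "pred zh u n t = exp (mu n * h) * zh n t + J" unfolding ZA_def J_def q_def mu_def ..
      then have "exp (- mu n * h) * (pred zh u n t + (- J)) = exp (- mu n * h) * exp (mu n * h) * zh n t" by simp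
      also have "exp (- mu n * h) * exp (mu n * h) = 1" by (simp add: exp_add[symmetric])
      finally have zhe: "zh n t = exp (- mu n * h) * (pred zh u n t + (- J))" by simp
      have "(zh n t)^2 = (exp (- mu n * h))^2 * (pred zh u n t + (- J))^2" unfolding zhe power_mult_distrib ..
      also have "\<dots> \<le> (exp (- mu n * h))^2 * (2 * ((pred zh u n t)^2 + (- J)^2))" by (intro mult_left_mono square_sum2_le) auto
      also have "\<dots> \<le> (exp (- mu n * h))^2 * (2 * (CD * E t + (h * (exp (\<bar>mu n\<bar> * h) * \<bar>bet n\<bar>))^2 * (Cu * (G * E t))))"
        using pr J2 by (intro mult_left_mono add_mono) auto
      also have "\<dots> = (2 * (exp (- mu n * h))^2 * (CD + (h * (exp (\<bar>mu n\<bar> * h) * \<bar>bet n\<bar>))^2 * (Cu * G))) * E t"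
        by (simp only: algebra_simps)
      also have "\<dots> \<le> Cz n * E t" unfolding Cz_def using Ca G E0 by (intro mult_right_mono) auto
      finally show ?thesis .
    qed
    \<comment> \<open>The error at time \<open>t + h\<close> is
      \<open>zn n t - zh n (t + h)\<close>, so already for \<open>t \<ge> 0\<close> the decay
      estimate valid from time \<open>h\<close> on is applicable.\<close>
    have wb: "(w n t)^2 \<le> 2 * (2 * (CD + Cz n) + (b n)^2 * Cu) * E t" if t: "t \<ge> 0" and n: "n \<in> {1..N}" for n t
    proof -
      have Em: "E (t + h) \<le> E t" unfolding E_def using delta h R0 by (intro mult_right_mono) auto
      have "(zn n (t + h - h) - zh n (t + h))^2 \<le> (\<Sum>n=1..N. (zn n (t + h - h) - zh n (t + h))^2)" using n by (intro member_le_sum) auto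
      also have "\<dots> \<le> CD * E (t + h)" using t by (intro D1(2)) auto
      also have "\<dots> \<le> CD * E t" using Em CD by (intro mult_left_mono) auto
      finally have 1: "(zn n t - zh n (t + h))^2 \<le> CD * E t" by simp
      have "(zh n (t + h))^2 \<le> Cz n * E (t + h)" using t h n by (intro zb) auto
      also have "\<dots> \<le> Cz n * E t" using Em Cz by (intro mult_left_mono) auto
      finally have 2: "(zh n (t + h))^2 \<le> Cz n * E t" .
      have "(zn n t)^2 = ((zn n t - zh n (t + h)) + zh n (t + h))^2" by simp
      also have "\<dots> \<le> 2 * ((zn n t - zh n (t + h))^2 + (zh n (t + h))^2)" by (rule square_sum2_le)
      also have "\<dots> \<le> 2 * (CD * E t + Cz n * E t)" using 1 2 by simp
      finally have 3: "(zn n t)^2 \<le> 2 * (CD * E t + Cz n * E t)" .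
      have 4: "(b n * u t)^2 \<le> (b n)^2 * (Cu * E t)" unfolding power_mult_distrib using ub[of t] t h by (intro mult_left_mono) auto
      have "(w n t)^2 \<le> 2 * ((zn n t)^2 + (b n * u t)^2)" by (rule square_sum2_le)
      also have "\<dots> \<le> 2 * (2 * (CD * E t + Cz n * E t) + (b n)^2 * (Cu * E t))" using 3 4 by (rule mult_left_mono[OF add_mono]) simp
      also have "\<dots> = 2 * (2 * (CD + Cz n) + (b n)^2 * Cu) * E t" by (simp add: algebra_simps)
      finally show ?thesis .
    qed
    have wl: "lam n * (w n s)^2 \<ge> 0" if "n \<ge> 1" for n s using lam_pos[OF that] by simp
    have "(\<Sum>n=1..M. lam n * (w n t)^2) \<le> (\<Sum>n=1..N. lam n * (w n t)^2) + (\<Sum>n\<in>{N+1..M}. lam n * (w n t)^2)"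
    proof -
      have "(\<Sum>n=1..M. lam n * (w n t)^2) \<le> (\<Sum>n\<in>{1..N} \<union> {N+1..M}. lam n * (w n t)^2)"
        using wl by (intro sum_mono2) auto
      then show ?thesis by (simp add: sum.union_disjoint)
    qed
    also have "(\<Sum>n=1..N. lam n * (w n t)^2) \<le> Cw * E t"
    proof -
      have "(\<Sum>n=1..N. lam n * (w n t)^2) \<le> (\<Sum>n=1..N. lam n * (2 * (2 * (CD + Cz n) + (b n)^2 * Cu) * E t))"
        using lam_pos t by (intro sum_mono mult_left_mono wb) (auto simp: less_imp_le)
      then show ?thesis unfolding Cw_def sum_distrib_right by (simp only: mult.assoc)
    qed
    also have "(\<Sum>n\<in>{N+1..M}. lam n * (w n t)^2) \<le> (CD + Cs * G) * E t"
    proof (cases "t \<le> h")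
      case True
      have "(\<Sum>n\<in>{N+1..M}. lam n * (w n t)^2) \<le> (\<Sum>n=1..M. lam n * (w n t)^2)" using wl by (intro sum_mono2) auto
      also have "\<dots> \<le> Cs * R0" using CCs[rule_format, OF tr, of M] True t by auto
      also have "\<dots> \<le> Cs * (G * E t)" using RE[OF True] Cs by (intro mult_left_mono) auto
      also have "\<dots> \<le> (CD + Cs * G) * E t" using CD E0[of t] by (simp add: distrib_right)
      finally show ?thesis .
    next
      case False
      then have "(\<Sum>n\<in>{N+1..M}. lam n * (w n t)^2) \<le> CD * E t" by (intro D1(3)) auto
      also have "\<dots> \<le> (CD + Cs * G) * E t" using Cs G E0[of t] by (intro mult_right_mono) auto
      finally show ?thesis .
    qed
    also have "Cw * E t + (CD + Cs * G) * E t = (Cw + CD + Cs * G) * E t" by (simp add: algebra_simps)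
    also have "\<dots> \<le> C * E t"
    proof (rule mult_right_mono[OF _ E0])
      have "(\<Sum>n=1..N. Cz n) \<ge> 0" using Cz by (intro sum_nonneg)
      then show "Cw + CD + Cs * G \<le> C" unfolding C_def using Cu by linarith
    qed
    finally have F1: "(\<Sum>n=1..M. lam n * (w n t)^2) \<le> C * E t" by simp
    have "(u t)^2 \<le> Cu * E t" using t h by (intro ub) auto
    also have "\<dots> \<le> C * E t"
    proof (rule mult_right_mono[OF _ E0])
      have "(\<Sum>n=1..N. Cz n) \<ge> 0" "Cs * G \<ge> 0" using Cz Cs G by (simp_all add: sum_nonneg)
      then show "Cu \<le> C" unfolding C_def using Cw CD by linarith
    qed
    finally have F2: "(u t)^2 \<le> C * E t" .
    have "(\<Sum>n=1..N. (zh n t)^2) \<le> (\<Sum>n=1..N. Cz n * E t)" using t by (intro sum_mono zb) auto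
    also have "\<dots> = (\<Sum>n=1..N. Cz n) * E t" by (simp add: sum_distrib_right)
    also have "\<dots> \<le> C * E t" unfolding C_def using Cw CD Cs G Cu E0 by (intro mult_right_mono) auto
    finally have F3: "(\<Sum>n=1..N. (zh n t)^2) \<le> C * E t" .
    show ?thesis using F1 F2 F3 unfolding E_def by blast
  qed
  then show ?thesis using C by blast
qed

end

section \<open>Closed-loop decay\<close>

context sturm_liouville begin

lemma tail2_bound:
  assumes f: "sq_int f" and I: "finite I" "I \<subseteq> {N+1..}"
  shows "(\<Sum>n\<in>I. (coef f n)^2) \<le> tail2 phi f N"
proof -
  have "(\<Sum>n\<in>I. (coef f n)^2) = (\<Sum>n\<in>I. if N + 1 \<le> n then (coef f n)^2 else 0)"
    using I by (intro sum.cong) auto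
  also have "\<dots> \<le> tail2 phi f N"
    unfolding tail2_def by (intro sum_le_suminf summable_coef_square f I) auto
  finally show ?thesis .
qed

lemma Mphi_bound:
  assumes e: "\<epsilon> > 0" and I: "finite I" "I \<subseteq> {N+1..}"
  shows "(\<Sum>n\<in>I. (phid n 0)^2 / lam n powr (3/2 + \<epsilon>)) \<le> Mphi lam phid N \<epsilon>"
proof -
  have "(\<Sum>n\<in>I. (phid n 0)^2 / lam n powr (3/2 + \<epsilon>)) = (\<Sum>n\<in>I. if N + 1 \<le> n then (phid n 0)^2 / lam n powr (3/2 + \<epsilon>) else 0)"
    using I by (intro sum.cong) auto
  also have "\<dots> \<le> Mphi lam phid N \<epsilon>"
    unfolding Mphi_def by (intro sum_le_suminf summable_Mphi e I) auto
  finally show ?thesis .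
qed

definition hom0 :: "(real \<Rightarrow> real) \<Rightarrow> real \<Rightarrow> real \<Rightarrow> real" where
  "hom0 f v = (\<lambda>x. f x - x^2 / (cos \<theta>2 + 2 * sin \<theta>2) * v)"
definition hom1 :: "(real \<Rightarrow> real) \<Rightarrow> real \<Rightarrow> real \<Rightarrow> real" where
  "hom1 f' v = (\<lambda>x. f' x - 2 * x / (cos \<theta>2 + 2 * sin \<theta>2) * v)"
definition hom2 :: "(real \<Rightarrow> real) \<Rightarrow> real \<Rightarrow> real \<Rightarrow> real" where
  "hom2 f'' v = (\<lambda>x. f'' x - 2 / (cos \<theta>2 + 2 * sin \<theta>2) * v)"

text \<open>The lifting \<open>x^2 / d\<close> has value and slope 0 at the left end, so the left
  condition and the measured flux are untouched, and it has boundary value 1 at the right end. Its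
  coefficients are those of \<open>- bcoef \<theta>2\<close>, which explains the modal shift
  \<open>b n * u\<close>.\<close>

lemma homogenise:
  assumes H: "H2 f f' f''" and bc0: "cos \<theta>1 * f 0 - sin \<theta>1 * f' 0 = 0"
    and bc1: "cos \<theta>2 * f 1 + sin \<theta>2 * f' 1 = v"
  shows "H2 (hom0 f v) (hom1 f' v) (hom2 f'' v)"
    and "cos \<theta>1 * hom0 f v 0 - sin \<theta>1 * hom1 f' v 0 = 0"
    and "cos \<theta>2 * hom0 f v 1 + sin \<theta>2 * hom1 f' v 1 = 0"
    and "\<And>n. n \<ge> 1 \<Longrightarrow> coef (hom0 f v) n = coef f n + coef (bcoef \<theta>2) n * v"
    and "hom1 f' v 0 = f' 0"
proof -
  define d where "d = cos \<theta>2 + 2 * sin \<theta>2"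
  have d: "d > 0" using th2_denominator_pos by (simp add: d_def)
  show "H2 (hom0 f v) (hom1 f' v) (hom2 f'' v)"
    unfolding hom0_def hom1_def hom2_def by (rule H2_diff[OF H H2_lift])
  show "cos \<theta>1 * hom0 f v 0 - sin \<theta>1 * hom1 f' v 0 = 0" using bc0 by (simp add: hom0_def hom1_def)
  have "cos \<theta>2 * hom0 f v 1 + sin \<theta>2 * hom1 f' v 1 = v - (cos \<theta>2 / d + 2 * sin \<theta>2 / d) * v"
  proof -
    have "cos \<theta>2 * hom0 f v 1 + sin \<theta>2 * hom1 f' v 1
      = (cos \<theta>2 * f 1 + sin \<theta>2 * f' 1) - (cos \<theta>2 / d + 2 * sin \<theta>2 / d) * v"
      unfolding hom0_def hom1_def d_def[symmetric] by (simp add: algebra_simps)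
    then show ?thesis unfolding bc1 .
  qed
  also have "\<dots> = 0" using d unfolding add_divide_distrib[symmetric] d_def[symmetric] by simp
  finally show "cos \<theta>2 * hom0 f v 1 + sin \<theta>2 * hom1 f' v 1 = 0" .
  show "hom1 f' v 0 = f' 0" by (simp add: hom1_def)
  fix n :: nat assume n: "n \<ge> 1"
  have "coef (hom0 f v) n = coef (\<lambda>x. f x + v * bcoef \<theta>2 x) n"
    by (rule ip_cong) (simp add: hom0_def bcoef_def)
  also have "\<dots> = coef f n + coef (\<lambda>x. v * bcoef \<theta>2 x) n"
    by (intro ip_add sq_int_cmult sq_int_continuous bcoef_cont H2_continuous(1)[OF H] phi_cont n)
  finally show "coef (hom0 f v) n = coef f n + coef (bcoef \<theta>2) n * v" by (simp only: ip_cmult mult.commute)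
qed

lemma sum_lam2_coef_le:
  assumes H: "H2 f f' f''" and bc0: "cos \<theta>1 * f 0 - sin \<theta>1 * f' 0 = 0"
    and bc1: "cos \<theta>2 * f 1 + sin \<theta>2 * f' 1 = 0"
  shows "(\<Sum>n=1..M. (lam n)^2 * (coef f n)^2) \<le> nrm2 (Aop f f' f'')"
proof -
  have "(\<Sum>n=1..M. (lam n)^2 * (coef f n)^2) = (\<Sum>n=1..M. (coef (Aop f f' f'') n)^2)"
    using coef_Aop[OF H bc0 bc1] by (intro sum.cong) (auto simp: power_mult_distrib)
  also have "\<dots> \<le> nrm2 (Aop f f' f'')" by (intro bessel Aop_sq_int[OF H]) auto
  finally show ?thesis .
qed

lemma nrm2_Aop_le:
  "\<exists>C\<ge>0. \<forall>f f' f''. H2 f f' f'' \<longrightarrow> nrm2 (Aop f f' f'') \<le> C * (nrm2 f + nrm2 f' + nrm2 f'')"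
proof -
  obtain Bq where Bq: "Bq > 0" "\<And>x. x \<in> {0..1} \<Longrightarrow> \<bar>q x\<bar> \<le> Bq" using continuous_on_01_bounded[OF q_cont] by blast
  obtain Bd where Bd: "Bd > 0" "\<And>x. x \<in> {0..1} \<Longrightarrow> \<bar>pd x\<bar> \<le> Bd" using continuous_on_01_bounded[OF pd_cont] by blast
  obtain Bp where Bp: "Bp > 0" "\<And>x. x \<in> {0..1} \<Longrightarrow> \<bar>p x\<bar> \<le> Bp" using continuous_on_01_bounded[OF p_cont] by blast
  define C where "C = 2 * Bq^2 + 4 * Bd^2 + 4 * Bp^2"
  have "nrm2 (Aop f f' f'') \<le> C * (nrm2 f + nrm2 f' + nrm2 f'')" if H: "H2 f f' f''" for f f' f''
  proof -
    note c = H2_continuous[OF H]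
    have s: "sq_int (\<lambda>x. q x * f x)" "sq_int (\<lambda>x. pd x * f' x)" "sq_int (\<lambda>x. p x * f'' x)"
      by (intro sq_int_mult_continuous sq_int_continuous c q_cont pd_cont p_cont)+
    have "Aop f f' f'' = (\<lambda>x. q x * f x + (-1) * (pd x * f' x + p x * f'' x))" by (auto simp: Aop_def)
    then have "nrm2 (Aop f f' f'') \<le> 2 * nrm2 (\<lambda>x. q x * f x) + 2 * nrm2 (\<lambda>x. (-1) * (pd x * f' x + p x * f'' x))"
      using nrm2_add_le[OF s(1) sq_int_cmult[OF sq_int_add[OF s(2,3)], of "-1"]] by simp
    also have "nrm2 (\<lambda>x. (-1) * (pd x * f' x + p x * f'' x)) = nrm2 (\<lambda>x. pd x * f' x + p x * f'' x)"
      by (subst nrm2_cmult) simp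
    finally have 1: "nrm2 (Aop f f' f'') \<le> 2 * nrm2 (\<lambda>x. q x * f x) + 2 * nrm2 (\<lambda>x. pd x * f' x + p x * f'' x)" .
    have 2: "nrm2 (\<lambda>x. pd x * f' x + p x * f'' x) \<le> 2 * nrm2 (\<lambda>x. pd x * f' x) + 2 * nrm2 (\<lambda>x. p x * f'' x)"
      by (rule nrm2_add_le[OF s(2,3)])
    have 3: "nrm2 (\<lambda>x. q x * f x) \<le> Bq^2 * nrm2 f" "nrm2 (\<lambda>x. pd x * f' x) \<le> Bd^2 * nrm2 f'" "nrm2 (\<lambda>x. p x * f'' x) \<le> Bp^2 * nrm2 f''"
      by (intro nrm2_mult_le sq_int_continuous c q_cont pd_cont p_cont Bq Bd Bp; assumption)+
    have "nrm2 (Aop f f' f'') \<le> 2 * Bq^2 * nrm2 f + 4 * Bd^2 * nrm2 f' + 4 * Bp^2 * nrm2 f''"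
      using 1 2 3 by simp
    also have "\<dots> \<le> C * nrm2 f + C * nrm2 f' + C * nrm2 f''"
      unfolding C_def by (intro add_mono mult_right_mono) auto
    finally show ?thesis by (simp add: distrib_left)
  qed
  moreover have "C \<ge> 0" by (simp add: C_def)
  ultimately show ?thesis by blast
qed

end

text \<open>Continuity in the \<open>H^2\<close> norm gives near every time \<open>t\<close> the
  bound \<open>2 * G t + 2\<close>. Times at which \<open>G\<close> exceeds every integer would
  accumulate in the compact interval and contradict this bound at the accumulation point.\<close>

lemma H2_norm_bounded_on_compact:
  fixes z zx zxx :: "real \<Rightarrow> real \<Rightarrow> real"
  assumes H: "\<forall>t\<ge>0. H2 (z t) (zx t) (zxx t)"
    and cont: "\<forall>t\<ge>0. ((\<lambda>s. nrm2 (\<lambda>x. z s x - z t x) + nrm2 (\<lambda>x. zx s x - zx t x)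
                     + nrm2 (\<lambda>x. zxx s x - zxx t x)) \<longlongrightarrow> 0) (at t within {0..})"
  shows "\<exists>B. \<forall>s\<in>{0..T}. nrm2 (z s) + nrm2 (zx s) + nrm2 (zxx s) \<le> B"
proof (rule ccontr)
  define G where "G = (\<lambda>s. nrm2 (z s) + nrm2 (zx s) + nrm2 (zxx s))"
  assume "\<nexists>B. \<forall>s\<in>{0..T}. nrm2 (z s) + nrm2 (zx s) + nrm2 (zxx s) \<le> B"
  then have "\<forall>k::nat. \<exists>s\<in>{0..T}. G s > real k" unfolding G_def by (meson not_le)
  then obtain s where s: "\<And>k. s k \<in> {0..T}" "\<And>k. G (s k) > real k" by metis
  have "compact {0..T}" by simp
  then obtain t r where t: "t \<in> {0..T}" "strict_mono r" "(s \<circ> r) \<longlonglongrightarrow> t"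
    using s(1) unfolding compact_def by metis
  define D where "D = (\<lambda>s. nrm2 (\<lambda>x. z s x - z t x) + nrm2 (\<lambda>x. zx s x - zx t x) + nrm2 (\<lambda>x. zxx s x - zxx t x))"
  have "(D \<longlongrightarrow> 0) (at t within {0..})" using cont t(1) unfolding D_def by auto
  then have "\<forall>\<^sub>F s in at t within {0..}. D s < 1" by (rule order_tendstoD) simp
  then obtain d where d: "d > 0" "\<And>s. s \<in> {0..} \<Longrightarrow> s \<noteq> t \<Longrightarrow> dist s t < d \<Longrightarrow> D s < 1"
    unfolding eventually_at by blast
  have Dt: "D t = 0" by (simp add: D_def nrm2_def)
  have near: "G s \<le> 2 * G t + 2" if "s \<ge> 0" "dist s t < d" for s
  proof -
    have Ds: "D s \<le> 1" using d(2)[of s] that Dt by (cases "s = t") auto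
    have hs: "H2 (z s) (zx s) (zxx s)" "H2 (z t) (zx t) (zxx t)" using H that t by auto
    note c = H2_continuous[OF hs(1)] H2_continuous[OF hs(2)]
    have tri: "nrm2 f \<le> 2 * nrm2 g + 2 * nrm2 (\<lambda>x. f x - g x)" if "sq_int f" "sq_int g" for f g
      using nrm2_add_le[OF that(2) sq_int_diff[OF that]] by simp
    have "nrm2 (z s) \<le> 2 * nrm2 (z t) + 2 * nrm2 (\<lambda>x. z s x - z t x)"
      "nrm2 (zx s) \<le> 2 * nrm2 (zx t) + 2 * nrm2 (\<lambda>x. zx s x - zx t x)"
      "nrm2 (zxx s) \<le> 2 * nrm2 (zxx t) + 2 * nrm2 (\<lambda>x. zxx s x - zxx t x)"
      by (intro tri sq_int_continuous c)+
    moreover have "a + b + c \<le> 2 * (a' + b' + c') + 2"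
      if "a \<le> 2 * a' + 2 * x" "b \<le> 2 * b' + 2 * y" "c \<le> 2 * c' + 2 * w" "x + y + w \<le> 1"
      for a b c a' b' c' x y w :: real using that by simp
    ultimately show ?thesis using Ds unfolding G_def D_def by blast
  qed
  obtain k0 where k0: "\<And>k. k \<ge> k0 \<Longrightarrow> dist ((s \<circ> r) k) t < d"
    using t(3) d(1) unfolding lim_sequentially by blast
  obtain k1 :: nat where k1: "2 * G t + 2 < real k1" using reals_Archimedean2 by blast
  define k where "k = max k0 k1"
  have "k \<le> r k" using t(2) by (rule seq_suble)
  then have "real k1 \<le> real (r k)" by (simp add: k_def)
  moreover have "G (s (r k)) \<le> 2 * G t + 2" using near[of "s (r k)"] s(1)[of "r k"] k0[of k] by (auto simp: k_def)
  ultimately show False using s(2)[of "r k"] k1 by linarith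
qed

section \<open>Classical closed-loop solutions as modal trajectories\<close>

context sturm_liouville begin

text \<open>Pairing with a unit eigenfunction is bounded by the \<open>L^2\<close> norm, so
  continuity and the time derivative in \<open>L^2\<close> pass to the coefficients. The equation,
  which holds only up to a function of norm 0, becomes exact after the pairing, and the boundary
  input appears through Green's identity.\<close>

lemma closed_loop_modes:
  assumes cl: "closed_loop p pd qt qc \<theta>1 \<theta>2 lam phi phid K l N0 N h z0 y0 z zx zxx zt zh u"
    and n: "n \<ge> 1"
  shows "continuous_on {0..} (\<lambda>t. coef (z t) n)"
    and "\<And>t. t > 0 \<Longrightarrow> ((\<lambda>t. coef (z t) n) has_real_derivative
      ((- lam n + qc) * coef (z t) n + betac p \<theta>2 phi phid n * u t)) (at t)"
proof -
  have H: "\<forall>t\<ge>0. H2 (z t) (zx t) (zxx t)"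
    and cont: "\<forall>t\<ge>0. ((\<lambda>s. nrm2 (\<lambda>x. z s x - z t x) + nrm2 (\<lambda>x. zx s x - zx t x)
                     + nrm2 (\<lambda>x. zxx s x - zxx t x)) \<longlongrightarrow> 0) (at t within {0..})"
    and der: "\<forall>t>0. ((\<lambda>s. nrm2 (\<lambda>x. (z s x - z t x) / (s - t) - zt t x)) \<longlongrightarrow> 0) (at t)"
    and zts: "\<forall>t>0. sq_int (zt t)"
    and pde: "\<forall>t>0. nrm2 (\<lambda>x. zt t x - (pd x * zx t x + p x * zxx t x - qt x * z t x)) = 0"
    and bc: "\<forall>t\<ge>0. cos \<theta>1 * z t 0 - sin \<theta>1 * zx t 0 = 0 \<and> cos \<theta>2 * z t 1 + sin \<theta>2 * zx t 1 = u t"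
    using cl unfolding closed_loop_def Let_def by blast+
  have zs: "sq_int (z t)" if "t \<ge> 0" for t
    using H that by (intro sq_int_continuous H2_continuous(1)[of "z t" "zx t" "zxx t"]) auto
  have small: "\<bar>coef f n\<bar> \<le> sqrt (nrm2 f)" if "sq_int f" for f
    using ip_Cauchy_Schwarz[OF that phi_sq_int[OF n]] n
    by (intro real_le_rsqrt) (simp add: nrm2_eq_ip[of "phi n"] phi_orthonormal)
  show "continuous_on {0..} (\<lambda>t. coef (z t) n)"
    unfolding continuous_on_def
  proof
    fix t :: real assume t: "t \<in> {0..}"
    have "((\<lambda>s. coef (z s) n - coef (z t) n) \<longlongrightarrow> 0) (at t within {0..})"
    proof (rule Lim_null_comparison)
      show "\<forall>\<^sub>F s in at t within {0..}. norm (coef (z s) n - coef (z t) n)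
        \<le> sqrt (nrm2 (\<lambda>x. z s x - z t x) + nrm2 (\<lambda>x. zx s x - zx t x) + nrm2 (\<lambda>x. zxx s x - zxx t x))"
        unfolding eventually_at_filter
      proof (rule always_eventually, intro allI impI)
        fix s :: real assume "s \<noteq> t" "s \<in> {0..}"
        then have zz: "sq_int (z s)" "sq_int (z t)" using zs t by auto
        have "coef (z s) n - coef (z t) n = coef (\<lambda>x. z s x - z t x) n" by (rule ip_diff[OF zz phi_sq_int[OF n], symmetric])
        also have "\<bar>\<dots>\<bar> \<le> sqrt (nrm2 (\<lambda>x. z s x - z t x))" by (intro small sq_int_diff zz)
        also have "\<dots> \<le> sqrt (nrm2 (\<lambda>x. z s x - z t x) + nrm2 (\<lambda>x. zx s x - zx t x) + nrm2 (\<lambda>x. zxx s x - zxx t x))"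
          by simp
        finally show "norm (coef (z s) n - coef (z t) n)
          \<le> sqrt (nrm2 (\<lambda>x. z s x - z t x) + nrm2 (\<lambda>x. zx s x - zx t x) + nrm2 (\<lambda>x. zxx s x - zxx t x))" by simp
      qed
      show "((\<lambda>s. sqrt (nrm2 (\<lambda>x. z s x - z t x) + nrm2 (\<lambda>x. zx s x - zx t x) + nrm2 (\<lambda>x. zxx s x - zxx t x))) \<longlongrightarrow> 0) (at t within {0..})"
        using tendsto_real_sqrt[OF cont[rule_format, of t]] t by simp
    qed
    from tendsto_add[OF this tendsto_const[of "coef (z t) n"]]
    show "((\<lambda>t. coef (z t) n) \<longlongrightarrow> coef (z t) n) (at t within {0..})" by simp
  qed
  fix t :: real assume t: "t > 0"
  have zt: "coef (zt t) n = (- lam n + qc) * coef (z t) n + betac p \<theta>2 phi phid n * u t"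
  proof -
    have Ht: "H2 (z t) (zx t) (zxx t)" using H t by simp
    note c = H2_continuous[OF Ht]
    define g where "g = (\<lambda>x. (-1) * Aop (z t) (zx t) (zxx t) x + qc * z t x)"
    have gs: "sq_int g" unfolding g_def by (intro sq_int_add sq_int_cmult Aop_sq_int[OF Ht] sq_int_continuous c)
    have "nrm2 (\<lambda>x. zt t x - g x) = nrm2 (\<lambda>x. zt t x - (pd x * zx t x + p x * zxx t x - qt x * z t x))"
    proof (rule nrm2_cong)
      fix x :: real assume "x \<in> {0..1}"
      then have q: "q x = qc + qt x" using qt_q by simp
      show "zt t x - g x = zt t x - (pd x * zx t x + p x * zxx t x - qt x * z t x)"
        unfolding g_def Aop_def q by (simp add: algebra_simps)
    qed
    also have "\<dots> = 0" using pde t by blast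
    finally have "\<bar>coef (\<lambda>x. zt t x - g x) n\<bar> \<le> 0"
      using small[of "\<lambda>x. zt t x - g x"] sq_int_diff[OF _ gs] zts t by auto
    moreover have "coef (\<lambda>x. zt t x - g x) n = coef (zt t) n - coef g n"
      using zts t by (intro ip_diff gs phi_sq_int n) auto
    ultimately have "coef (zt t) n = coef g n" by simp
    also have "coef g n = coef (\<lambda>x. (-1) * Aop (z t) (zx t) (zxx t) x) n + coef (\<lambda>x. qc * z t x) n"
      unfolding g_def by (intro ip_add sq_int_cmult Aop_sq_int[OF Ht] sq_int_continuous c phi_cont n)
    also have "\<dots> = - coef (Aop (z t) (zx t) (zxx t)) n + qc * coef (z t) n" by (simp only: ip_cmult)
    also have "coef (Aop (z t) (zx t) (zxx t)) n = lam n * coef (z t) n - betac p \<theta>2 phi phid n * u t"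
      using bc t by (intro coef_Aop[OF Ht _ _ n]) auto
    finally show ?thesis by (simp add: algebra_simps)
  qed
  have "((\<lambda>s. (coef (z s) n - coef (z t) n) / (s - t) - coef (zt t) n) \<longlongrightarrow> 0) (at t)"
  proof (rule Lim_null_comparison)
    have "\<forall>\<^sub>F s in at t. s > 0" using order_tendstoD(1)[OF tendsto_ident_at t] .
    then show "\<forall>\<^sub>F s in at t. norm ((coef (z s) n - coef (z t) n) / (s - t) - coef (zt t) n)
      \<le> sqrt (nrm2 (\<lambda>x. (z s x - z t x) / (s - t) - zt t x))"
    proof eventually_elim
      case (elim s)
      have zz: "sq_int (z s)" "sq_int (z t)" "sq_int (zt t)" using zs zts t elim by auto
      have q: "sq_int (\<lambda>x. (1 / (s - t)) * (z s x - z t x))" by (intro sq_int_cmult sq_int_diff zz)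
      have "coef (\<lambda>x. (1 / (s - t)) * (z s x - z t x) - zt t x) n = (1 / (s - t)) * (coef (z s) n - coef (z t) n) - coef (zt t) n"
        using ip_diff[OF q zz(3) phi_sq_int[OF n]] ip_cmult[of "1 / (s - t)" "\<lambda>x. z s x - z t x" "phi n"]
          ip_diff[OF zz(1,2) phi_sq_int[OF n]] by simp
      moreover have "(\<lambda>x. (1 / (s - t)) * (z s x - z t x) - zt t x) = (\<lambda>x. (z s x - z t x) / (s - t) - zt t x)" by simp
      ultimately show ?case using small[OF sq_int_diff[OF q zz(3)]] by simp
    qed
    show "((\<lambda>s. sqrt (nrm2 (\<lambda>x. (z s x - z t x) / (s - t) - zt t x))) \<longlongrightarrow> 0) (at t)"
      using tendsto_real_sqrt[OF der[rule_format, OF t]] by simp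
  qed
  from tendsto_add[OF this tendsto_const[of "coef (zt t) n"]]
  show "((\<lambda>t. coef (z t) n) has_real_derivative
      ((- lam n + qc) * coef (z t) n + betac p \<theta>2 phi phid n * u t)) (at t)"
    unfolding has_field_derivative_iff zt[symmetric] by simp
qed

text \<open>The constants are extracted from the abstract modal result before any solution is fixed.
  Each solution is then shown to be a modal trajectory with \<open>Y\<close> the supremum of the
  history and \<open>W\<close> the squared graph norm of the homogenised initial state, and the
  modal bounds are summed back into the \<open>H^1\<close> norm.\<close>

lemma closed_loop_decay:
  assumes delta: "\<delta> > 0" and h: "h > 0" and N: "N \<ge> N0 + 1"
    and feas: "feasible p pd qt qc \<theta>2 lam phi phid K l N0 \<delta> h N"
  shows "\<exists>M>0. \<forall>z0 z0d z0dd y0 z zx zxx zt zh u.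
     H2 z0 z0d z0dd \<and> cos \<theta>1 * z0 0 - sin \<theta>1 * z0d 0 = 0 \<and> (\<exists>C. C-lipschitz_on {-h..0} y0) \<and>
     closed_loop p pd qt qc \<theta>1 \<theta>2 lam phi phid K l N0 N h z0 y0 z zx zxx zt zh u \<longrightarrow>
     (\<forall>t\<ge>0. nrm2 (z t) + nrm2 (zx t) + (\<Sum>n=1..N. (zh n t)^2)
        \<le> M * exp (- 2 * \<delta> * t) *
          (nrm2 (Aop (hom0 z0 (cos \<theta>2 * z0 1 + sin \<theta>2 * z0d 1)) (hom1 z0d (cos \<theta>2 * z0 1 + sin \<theta>2 * z0d 1)) (hom2 z0dd (cos \<theta>2 * z0 1 + sin \<theta>2 * z0d 1)))
           + (\<Sum>n=1..N. (zh n 0)^2) + (cos \<theta>2 * z0 1 + sin \<theta>2 * z0d 1)^2 + (SUP s\<in>{-h..0}. \<bar>y0 s\<bar>)^2))"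
proof -
  define a b c bet where "a = coef (acoef p pd qt \<theta>2)" and "b = coef (bcoef \<theta>2)"
    and "c = (\<lambda>n. phid n 0)" and "bet = betac p \<theta>2 phi phid"
  obtain \<epsilon> P \<alpha> \<beta> \<gamma> where F: "0 < \<epsilon>" "\<epsilon> \<le> 1/2" "pos_def P (2*N)" "\<alpha> > 1" "\<beta> > 0" "\<gamma> > 0"
    "neg_semidef (Theta1 lam qc bet c K l N0 N h \<delta>
       (tail2 phi (acoef p pd qt \<theta>2) N) (tail2 phi (bcoef \<theta>2) N) P \<alpha> \<beta> \<gamma>) (2*N+1)"
    "2 * \<gamma> * (- (1 - 1/\<alpha>) * lam (N+1) + qc + \<delta>) + \<beta> * Mphi lam phid N \<epsilon> * lam (N+1) powr (1/2 + \<epsilon>) \<le> 0"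
    "2 * \<gamma> * (1 - 1/\<alpha>) - \<beta> * Mphi lam phid N \<epsilon> / lam (N+1) powr (1/2 - \<epsilon>) \<ge> 0"
    using feas unfolding feasible_def bet_def c_def by blast
  obtain C2 where C2: "\<forall>I. finite I \<longrightarrow> I \<subseteq> {1..} \<longrightarrow> (\<Sum>n\<in>I. (c n / lam n)^2) \<le> C2"
    using flux_over_lam_bounded unfolding c_def by blast
  have sa: "sq_int (acoef p pd qt \<theta>2)" "sq_int (bcoef \<theta>2)" by (intro sq_int_continuous acoef_cont bcoef_cont)+
  interpret L: lyapunov_data lam a b c bet K l qc \<delta> h "nrm2 (acoef p pd qt \<theta>2)" "nrm2 (bcoef \<theta>2)" C2 N0 N
    P \<alpha> \<beta> \<gamma> \<epsilon> "tail2 phi (acoef p pd qt \<theta>2) N" "tail2 phi (bcoef \<theta>2) N" "Mphi lam phid N \<epsilon>"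
  proof
    show "\<And>n. n \<ge> 1 \<Longrightarrow> lam n > 0" by (rule lam_pos)
    show "\<And>m n. 1 \<le> m \<Longrightarrow> m \<le> n \<Longrightarrow> lam m \<le> lam n" by (rule lam_mono)
    show "N0 \<le> N" using N by simp
    show "\<And>n. n \<ge> 1 \<Longrightarrow> bet n = a n + (qc - lam n) * b n" unfolding bet_def a_def b_def by (rule betac_eq)
    show "\<And>I. finite I \<Longrightarrow> I \<subseteq> {1..} \<Longrightarrow> (\<Sum>n\<in>I. (a n)^2) \<le> nrm2 (acoef p pd qt \<theta>2)" unfolding a_def by (rule bessel[OF sa(1)])
    show "\<And>I. finite I \<Longrightarrow> I \<subseteq> {1..} \<Longrightarrow> (\<Sum>n\<in>I. (b n)^2) \<le> nrm2 (bcoef \<theta>2)" unfolding b_def by (rule bessel[OF sa(2)])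
    show "\<And>I. finite I \<Longrightarrow> I \<subseteq> {1..} \<Longrightarrow> (\<Sum>n\<in>I. (c n / lam n)^2) \<le> C2" using C2 by blast
    show "\<And>I. finite I \<Longrightarrow> I \<subseteq> {N+1..} \<Longrightarrow> (\<Sum>n\<in>I. (a n)^2) \<le> tail2 phi (acoef p pd qt \<theta>2) N" unfolding a_def by (rule tail2_bound[OF sa(1)])
    show "\<And>I. finite I \<Longrightarrow> I \<subseteq> {N+1..} \<Longrightarrow> (\<Sum>n\<in>I. (b n)^2) \<le> tail2 phi (bcoef \<theta>2) N" unfolding b_def by (rule tail2_bound[OF sa(2)])
    show "\<And>I. finite I \<Longrightarrow> I \<subseteq> {N+1..} \<Longrightarrow> (\<Sum>n\<in>I. (c n)^2 / lam n powr (3/2 + \<epsilon>)) \<le> Mphi lam phid N \<epsilon>"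
      unfolding c_def by (rule Mphi_bound[OF F(1)])
  qed (use delta h F in auto)
  obtain C where C: "C \<ge> 0" and CC: "\<forall>zn zh u y Y W. L.modal_trajectory zn zh u y Y W \<longrightarrow>
     (\<forall>t\<ge>0. \<forall>M. (\<Sum>n=1..M. lam n * (zn n t + b n * u t)^2) \<le> C * (exp (- 2 * \<delta> * t) * L.init_energy zh u Y W) \<and>
       (u t)^2 \<le> C * (exp (- 2 * \<delta> * t) * L.init_energy zh u Y W) \<and>
       (\<Sum>n=1..N. (zh n t)^2) \<le> C * (exp (- 2 * \<delta> * t) * L.init_energy zh u Y W))"
    using L.modal_decay by blast
  obtain CA where CA: "CA \<ge> 0" "\<forall>f f' f''. H2 f f' f'' \<longrightarrow> nrm2 (Aop f f' f'') \<le> CA * (nrm2 f + nrm2 f' + nrm2 f'')"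
    using nrm2_Aop_le by blast
  define d where "d = cos \<theta>2 + 2 * sin \<theta>2"
  have d: "d > 0" using th2_denominator_pos by (simp add: d_def)
  have "\<exists>M>0. \<forall>z0 z0d z0dd y0 z zx zxx zt zh u.
     H2 z0 z0d z0dd \<and> cos \<theta>1 * z0 0 - sin \<theta>1 * z0d 0 = 0 \<and> (\<exists>C. C-lipschitz_on {-h..0} y0) \<and>
     closed_loop p pd qt qc \<theta>1 \<theta>2 lam phi phid K l N0 N h z0 y0 z zx zxx zt zh u \<longrightarrow>
     (\<forall>t\<ge>0. nrm2 (z t) + nrm2 (zx t) + (\<Sum>n=1..N. (zh n t)^2)
        \<le> M * exp (- 2 * \<delta> * t) *
          (nrm2 (Aop (hom0 z0 (cos \<theta>2 * z0 1 + sin \<theta>2 * z0d 1)) (hom1 z0d (cos \<theta>2 * z0 1 + sin \<theta>2 * z0d 1)) (hom2 z0dd (cos \<theta>2 * z0 1 + sin \<theta>2 * z0d 1)))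
           + (\<Sum>n=1..N. (zh n 0)^2) + (cos \<theta>2 * z0 1 + sin \<theta>2 * z0d 1)^2 + (SUP s\<in>{-h..0}. \<bar>y0 s\<bar>)^2))"
  proof (rule H1_le_of_partial_sums)
    fix C1 assume C1: "C1 > 0" "\<And>f f' f'' B. H2 f f' f'' \<Longrightarrow> cos \<theta>1 * f 0 - sin \<theta>1 * f' 0 = 0 \<Longrightarrow>
      cos \<theta>2 * f 1 + sin \<theta>2 * f' 1 = 0 \<Longrightarrow> (\<And>M. (\<Sum>n=1..M. lam n * (coef f n)^2) \<le> B) \<Longrightarrow> nrm2 f + nrm2 f' \<le> C1 * B"
    \<comment> \<open>Adding the lifting back doubles the \<open>H^1\<close> bound of the
      homogenised state and adds \<open>2 * (1 + 4) / d^2\<close> times the bound on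
      \<open>u^2\<close>, from the lifting and its derivative. The third term is the observer bound,
      and the final 1 ensures positivity.\<close>
    define Mc where "Mc = 2 * C1 * C + 10 / d^2 * C + C + 1"
    have Mc: "Mc > 0" using C1 C d by (auto simp: Mc_def intro!: add_nonneg_pos)
    show ?thesis
    proof (intro exI[of _ Mc] conjI Mc allI impI)
      fix z0 z0d z0dd y0 z zx zxx zt zh u t
      assume A: "H2 z0 z0d z0dd \<and> cos \<theta>1 * z0 0 - sin \<theta>1 * z0d 0 = 0 \<and> (\<exists>C. C-lipschitz_on {-h..0} y0) \<and>
        closed_loop p pd qt qc \<theta>1 \<theta>2 lam phi phid K l N0 N h z0 y0 z zx zxx zt zh u" and t: "(t::real) \<ge> 0"
      define u0 where "u0 = cos \<theta>2 * z0 1 + sin \<theta>2 * z0d 1"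
      define W where "W = nrm2 (Aop (hom0 z0 u0) (hom1 z0d u0) (hom2 z0dd u0))"
      define Y where "Y = (SUP s\<in>{-h..0}. \<bar>y0 s\<bar>)"
      define y where "y = yN zx y0 h"
      define zn where "zn = (\<lambda>n t. coef (z t) n)"
      have H0: "H2 z0 z0d z0dd" and bc00: "cos \<theta>1 * z0 0 - sin \<theta>1 * z0d 0 = 0" and lip: "\<exists>C. C-lipschitz_on {-h..0} y0"
        and cl: "closed_loop p pd qt qc \<theta>1 \<theta>2 lam phi phid K l N0 N h z0 y0 z zx zxx zt zh u" using A by blast+
      have zinit: "\<forall>x\<in>{0..1}. z 0 x = z0 x"
        and H: "\<forall>t\<ge>0. H2 (z t) (zx t) (zxx t)"
        and cont: "\<forall>t\<ge>0. ((\<lambda>s. nrm2 (\<lambda>x. z s x - z t x) + nrm2 (\<lambda>x. zx s x - zx t x)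
                     + nrm2 (\<lambda>x. zxx s x - zxx t x)) \<longlongrightarrow> 0) (at t within {0..})"
        and bc: "\<forall>t\<ge>0. cos \<theta>1 * z t 0 - sin \<theta>1 * zx t 0 = 0 \<and> cos \<theta>2 * z t 1 + sin \<theta>2 * zx t 1 = u t"
        and upast: "\<forall>\<tau>\<le>0. u \<tau> = cos \<theta>2 * z0 1 + sin \<theta>2 * zx 0 1"
        and ucont: "continuous_on {0..} u"
        and ueq: "\<forall>t\<ge>0. u t = (\<Sum>n=1..N0. K n * ZA lam qc bet h zh u n t)"
        and zhd: "\<forall>n\<in>{1..N}. \<forall>t\<ge>0. (zh n has_real_derivative
         ((- lam n + qc) * zh n t + bet n * u (t - h)
          - (if n \<le> N0 then l n * ((\<Sum>k=1..N. (zh k t + b k * u (t - h)) * phid k 0) - yN zx y0 h t)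
             else 0))) (at t within {0..})"
        using cl unfolding closed_loop_def Let_def bet_def b_def by blast+
      have up0: "u \<tau> = u 0" if "\<tau> \<le> 0" for \<tau> using upast that by simp
      \<comment> \<open>The closed loop expresses the initial input through \<open>zx 0\<close>, the
        estimate through \<open>z0d\<close>. Both are derivatives of the same function on the unit
        interval and hence agree.\<close>
      have zx0: "zx 0 x = z0d x" if x: "x \<in> {0..1}" for x
      proof (rule derivative_unique_01[OF _ _ x])
        show "(z0 has_real_derivative z0d x) (at x within {0..1})" using H0 x unfolding H2_def by blast
        have "(z 0 has_real_derivative zx 0 x) (at x within {0..1})" using H x unfolding H2_def by blast
        then show "(z0 has_real_derivative zx 0 x) (at x within {0..1})"
          by (rule has_field_derivative_transform_within[of _ _ _ _ 1]) (use x zinit in auto)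
      qed
      have u00: "u 0 = u0" using upast zx0[of 1] by (simp add: u0_def)
      have hom: "H2 (hom0 (z s) (u s)) (hom1 (zx s) (u s)) (hom2 (zxx s) (u s))"
        "cos \<theta>1 * hom0 (z s) (u s) 0 - sin \<theta>1 * hom1 (zx s) (u s) 0 = 0"
        "cos \<theta>2 * hom0 (z s) (u s) 1 + sin \<theta>2 * hom1 (zx s) (u s) 1 = 0"
        "\<And>n. n \<ge> 1 \<Longrightarrow> coef (hom0 (z s) (u s)) n = zn n s + b n * u s"
        "hom1 (zx s) (u s) 0 = zx s 0" if "s \<ge> 0" for s
        using homogenise[of "z s" "zx s" "zxx s" "u s"] H bc that unfolding zn_def b_def by blast+
      have tr: "L.modal_trajectory zn zh u y Y W"
        unfolding L.modal_trajectory_def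
      proof (intro conjI allI impI ballI)
        show "continuous_on UNIV u"
        proof -
          have "continuous_on ({..0} \<union> {0..}) u"
          proof (rule continuous_on_closed_Un)
            show "continuous_on {..0} u"
              by (rule continuous_on_eq[OF continuous_on_const[of _ "u 0"]]) (rule up0[symmetric], simp)
          qed (use ucont in auto)
          moreover have "{..0} \<union> {0..} = (UNIV :: real set)" by auto
          ultimately show ?thesis by simp
        qed
        show "u \<tau> = u 0" if "\<tau> \<le> 0" for \<tau> by (rule up0[OF that])
        show "u s = (\<Sum>n=1..N0. K n * ZA lam qc bet h zh u n s)" if "0 \<le> s" for s using ueq that by blast
        show "(zh n has_real_derivative (L.mu n * zh n s + bet n * u (s - h) - L.gain n * L.innov zh u y s)) (at s within {0..})"
          if "n \<in> {1..N}" "0 \<le> s" for n s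
          using zhd[rule_format, OF that] unfolding L.mu_def L.gain_def L.innov_def y_def
          by (rule DERIV_cong) (simp add: c_def)
        show "continuous_on {0..} (zn n)" if "1 \<le> n" for n
          unfolding zn_def by (rule closed_loop_modes(1)[OF cl that])
        show "(zn n has_real_derivative (L.mu n * zn n s + bet n * u s)) (at s)" if "1 \<le> n" "0 < s" for n s
          unfolding zn_def L.mu_def bet_def by (rule closed_loop_modes(2)[OF cl that])
        show "\<bar>y s\<bar> \<le> Y" if s: "0 < s \<and> s < h" for s
        proof -
          have "continuous_on {-h..0} y0" using lip lipschitz_on_continuous_on by blast
          then have "compact ((\<lambda>s. \<bar>y0 s\<bar>) ` {-h..0})" by (intro compact_continuous_image continuous_intros) auto
          then have "bdd_above ((\<lambda>s. \<bar>y0 s\<bar>) ` {-h..0})" by (intro bounded_imp_bdd_above compact_imp_bounded)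
          then have "\<bar>y0 (s - h)\<bar> \<le> Y" unfolding Y_def using s by (intro cSUP_upper) auto
          then show ?thesis using s by (simp add: y_def yN_def)
        qed
        show "(\<lambda>M. \<Sum>n=1..M. (zn n (s - h) + b n * u (s - h)) * c n) \<longlonglongrightarrow> y s" if s: "h \<le> s" for s
        proof -
          have s0: "s - h \<ge> 0" using s by simp
          have "(\<lambda>M. \<Sum>n=1..M. coef (hom0 (z (s - h)) (u (s - h))) n * phid n 0) \<longlonglongrightarrow> hom1 (zx (s - h)) (u (s - h)) 0"
            by (rule flux_expansion[OF hom(1-3)[OF s0]])
          moreover have "(\<Sum>n=1..M. coef (hom0 (z (s - h)) (u (s - h))) n * phid n 0) = (\<Sum>n=1..M. (zn n (s - h) + b n * u (s - h)) * c n)" for M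
            by (intro sum.cong) (auto simp: hom(4)[OF s0] c_def)
          ultimately show ?thesis using s by (simp add: hom(5)[OF s0] y_def yN_def)
        qed
        show "\<exists>B. \<forall>s\<in>{0..T}. \<forall>M. (\<Sum>n=1..M. (lam n)^2 * (zn n s + b n * u s)^2) \<le> B" for T
        proof -
          obtain B1 where B1: "\<forall>s\<in>{0..T}. nrm2 (z s) + nrm2 (zx s) + nrm2 (zxx s) \<le> B1"
            using H2_norm_bounded_on_compact[OF H cont] by blast
          have "compact (u ` {0..T})" by (intro compact_continuous_image continuous_on_subset[OF ucont]) auto
          then have "bounded (u ` {0..T})" by (rule compact_imp_bounded)
          then obtain B2 where B2: "\<forall>s\<in>{0..T}. \<bar>u s\<bar> \<le> B2" unfolding bounded_iff by auto
          \<comment> \<open>The lifting and its two derivatives are bounded by \<open>1/d\<close>,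
            \<open>2/d\<close> and \<open>2/d\<close>, which gives
            \<open>18 = 2 * (1 + 4 + 4)\<close>.\<close>
          have "(\<Sum>n=1..M. (lam n)^2 * (zn n s + b n * u s)^2) \<le> CA * (2 * B1 + 18 / d^2 * B2^2)" if s: "s \<in> {0..T}" for s M
          proof -
            have s0: "s \<ge> 0" using s by simp
            have Hs: "H2 (z s) (zx s) (zxx s)" using H s0 by blast
            note cs = H2_continuous[OF Hs]
            have u2: "(u s)^2 \<le> B2^2" using B2 s by (metis abs_ge_zero power2_abs power_mono)
            have lift: "nrm2 (\<lambda>x. f x - k x * u s) \<le> 2 * nrm2 f + 2 * (e^2 * B2^2)"
              if f: "sq_int f" and k: "continuous_on {0..1} k" and e: "\<And>x. x \<in> {0..1} \<Longrightarrow> \<bar>k x\<bar> \<le> e" for f k e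
            proof -
              have "nrm2 (\<lambda>x. f x + (- (k x * u s))) \<le> 2 * nrm2 f + 2 * nrm2 (\<lambda>x. - (k x * u s))"
                by (intro nrm2_add_le f sq_int_continuous continuous_intros k)
              also have "nrm2 (\<lambda>x. - (k x * u s)) \<le> e^2 * B2^2"
              proof (rule nrm2_le_of_pointwise)
                show "continuous_on {0..1} (\<lambda>x. - (k x * u s))" by (intro continuous_intros k)
                fix x :: real assume "x \<in> {0..1}"
                then have "(k x)^2 \<le> e^2" using e by (metis abs_ge_zero power2_abs power_mono)
                then show "(- (k x * u s))^2 \<le> e^2 * B2^2" using u2 by (simp add: power_mult_distrib mult_mono)
              qed
              finally show ?thesis by simp
            qed
            have l0: "nrm2 (hom0 (z s) (u s)) \<le> 2 * nrm2 (z s) + 2 * ((1/d)^2 * B2^2)"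
              unfolding hom0_def d_def[symmetric] using d
              by (intro lift sq_int_continuous cs continuous_intros) (auto simp: divide_simps power_le_one)
            have l1: "nrm2 (hom1 (zx s) (u s)) \<le> 2 * nrm2 (zx s) + 2 * ((2/d)^2 * B2^2)"
              unfolding hom1_def d_def[symmetric] using d
              by (intro lift sq_int_continuous cs continuous_intros) (auto simp: divide_simps)
            have l2: "nrm2 (hom2 (zxx s) (u s)) \<le> 2 * nrm2 (zxx s) + 2 * ((2/d)^2 * B2^2)"
              unfolding hom2_def d_def[symmetric] using d
              by (intro lift cs continuous_intros) auto
            have "(\<Sum>n=1..M. (lam n)^2 * (zn n s + b n * u s)^2) = (\<Sum>n=1..M. (lam n)^2 * (coef (hom0 (z s) (u s)) n)^2)"
              by (intro sum.cong) (auto simp: hom(4)[OF s0])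
            also have "\<dots> \<le> nrm2 (Aop (hom0 (z s) (u s)) (hom1 (zx s) (u s)) (hom2 (zxx s) (u s)))"
              by (rule sum_lam2_coef_le[OF hom(1-3)[OF s0]])
            also have "\<dots> \<le> CA * (nrm2 (hom0 (z s) (u s)) + nrm2 (hom1 (zx s) (u s)) + nrm2 (hom2 (zxx s) (u s)))"
              using CA(2) hom(1)[OF s0] by blast
            also have "\<dots> \<le> CA * (2 * B1 + 18 / d^2 * B2^2)"
            proof (rule mult_left_mono[OF _ CA(1)])
              have "2 * ((1/d)^2 * B2^2) + 2 * ((2/d)^2 * B2^2) + 2 * ((2/d)^2 * B2^2) = 18 / d^2 * B2^2"
                by (simp add: power_divide field_simps)
              moreover have "nrm2 (z s) + nrm2 (zx s) + nrm2 (zxx s) \<le> B1" using B1 s by blast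
              ultimately show "nrm2 (hom0 (z s) (u s)) + nrm2 (hom1 (zx s) (u s)) + nrm2 (hom2 (zxx s) (u s)) \<le> 2 * B1 + 18 / d^2 * B2^2"
                using l0 l1 l2 by linarith
            qed
            finally show ?thesis .
          qed
          then show ?thesis by blast
        qed
        show "(\<Sum>n=1..M. (lam n)^2 * (zn n 0 + b n * u 0)^2) \<le> W" for M
        proof -
          note h0 = homogenise[OF H0 bc00 u0_def[symmetric]]
          have "coef (z 0) n = coef z0 n" for n by (rule ip_cong) (use zinit in auto)
          then have "(\<Sum>n=1..M. (lam n)^2 * (zn n 0 + b n * u 0)^2) = (\<Sum>n=1..M. (lam n)^2 * (coef (hom0 z0 u0) n)^2)"
            by (intro sum.cong) (auto simp: h0(4) zn_def b_def u00)
          also have "\<dots> \<le> W" unfolding W_def by (rule sum_lam2_coef_le[OF h0(1-3)])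
          finally show ?thesis .
        qed
      qed
      define E where "E = exp (- 2 * \<delta> * t) * L.init_energy zh u Y W"
      note B = CC[rule_format, OF tr t, folded E_def]
      have E0: "E \<ge> 0" unfolding E_def L.init_energy_def W_def by (intro mult_nonneg_nonneg add_nonneg_nonneg sum_nonneg) auto
      define v where "v = u t"
      have Ht: "H2 (z t) (zx t) (zxx t)" using H t by blast
      note cw = H2_continuous[OF hom(1)[OF t]]
      have "nrm2 (hom0 (z t) v) + nrm2 (hom1 (zx t) v) \<le> C1 * (C * E)"
        unfolding v_def
      proof (rule C1(2)[OF hom(1-3)[OF t]])
        fix M
        have "(\<Sum>n=1..M. lam n * (coef (hom0 (z t) (u t)) n)^2) = (\<Sum>n=1..M. lam n * (zn n t + b n * u t)^2)"
          by (intro sum.cong) (auto simp: hom(4)[OF t])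
        then show "(\<Sum>n=1..M. lam n * (coef (hom0 (z t) (u t)) n)^2) \<le> C * E" using B by simp
      qed
      moreover have "nrm2 (z t) \<le> 2 * nrm2 (hom0 (z t) v) + 2 * (1 / d^2 * v^2)"
      proof -
        have "nrm2 (z t) = nrm2 (\<lambda>x. hom0 (z t) v x + x^2 / d * v)" by (simp add: hom0_def d_def)
        also have "\<dots> \<le> 2 * nrm2 (hom0 (z t) v) + 2 * nrm2 (\<lambda>x. x^2 / d * v)"
          unfolding v_def using d by (intro nrm2_add_le sq_int_continuous cw continuous_intros) auto
        also have "nrm2 (\<lambda>x. x^2 / d * v) \<le> 1 / d^2 * v^2"
        proof (rule nrm2_le_of_pointwise)
          show "continuous_on {0..1} (\<lambda>x. x^2 / d * v)" using d by (intro continuous_intros) auto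
          fix x :: real assume "x \<in> {0..1}"
          then have "(x^2)^2 \<le> 1" by (simp add: power_le_one)
          then have "(x^2)^2 / d^2 * v^2 \<le> 1 / d^2 * v^2" by (intro mult_right_mono divide_right_mono) auto
          then show "(x^2 / d * v)^2 \<le> 1 / d^2 * v^2" by (simp add: power_mult_distrib power_divide)
        qed
        finally show ?thesis by simp
      qed
      moreover have "nrm2 (zx t) \<le> 2 * nrm2 (hom1 (zx t) v) + 2 * (4 / d^2 * v^2)"
      proof -
        have "nrm2 (zx t) = nrm2 (\<lambda>x. hom1 (zx t) v x + 2 * x / d * v)" by (simp add: hom1_def d_def)
        also have "\<dots> \<le> 2 * nrm2 (hom1 (zx t) v) + 2 * nrm2 (\<lambda>x. 2 * x / d * v)"
          unfolding v_def using d by (intro nrm2_add_le sq_int_continuous cw continuous_intros) auto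
        also have "nrm2 (\<lambda>x. 2 * x / d * v) \<le> 4 / d^2 * v^2"
        proof (rule nrm2_le_of_pointwise)
          show "continuous_on {0..1} (\<lambda>x. 2 * x / d * v)" using d by (intro continuous_intros) auto
          fix x :: real assume "x \<in> {0..1}"
          then have "(2 * x)^2 \<le> 4" by (simp add: power_mult_distrib power_le_one)
          then have "(2 * x)^2 / d^2 * v^2 \<le> 4 / d^2 * v^2" by (intro mult_right_mono divide_right_mono) auto
          then show "(2 * x / d * v)^2 \<le> 4 / d^2 * v^2" by (simp add: power_mult_distrib power_divide)
        qed
        finally show ?thesis by simp
      qed
      moreover have "1 / d^2 * v^2 \<le> 1 / d^2 * (C * E)" "4 / d^2 * v^2 \<le> 4 / d^2 * (C * E)"
        using B unfolding v_def by (intro mult_left_mono; simp)+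
      moreover have "(\<Sum>n=1..N. (zh n t)^2) \<le> C * E" using B by blast
      ultimately have "nrm2 (z t) + nrm2 (zx t) + (\<Sum>n=1..N. (zh n t)^2)
        \<le> 2 * (C1 * (C * E)) + (2 * (1 / d^2 * (C * E)) + 2 * (4 / d^2 * (C * E))) + C * E" by linarith
      also have "\<dots> = (2 * C1 * C + 10 / d^2 * C + C) * E" by (simp add: algebra_simps)
      also have "\<dots> \<le> Mc * E" unfolding Mc_def using E0 by (intro mult_right_mono) auto
      also have "\<dots> = Mc * exp (- 2 * \<delta> * t) * (W + (\<Sum>n=1..N. (zh n 0)^2) + u0^2 + Y^2)"
        unfolding E_def L.init_energy_def u00 by (simp only: mult.assoc)
      finally show "nrm2 (z t) + nrm2 (zx t) + (\<Sum>n=1..N. (zh n t)^2)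
        \<le> Mc * exp (- 2 * \<delta> * t) *
          (nrm2 (Aop (hom0 z0 (cos \<theta>2 * z0 1 + sin \<theta>2 * z0d 1)) (hom1 z0d (cos \<theta>2 * z0 1 + sin \<theta>2 * z0d 1)) (hom2 z0dd (cos \<theta>2 * z0 1 + sin \<theta>2 * z0d 1)))
           + (\<Sum>n=1..N. (zh n 0)^2) + (cos \<theta>2 * z0 1 + sin \<theta>2 * z0d 1)^2 + (SUP s\<in>{-h..0}. \<bar>y0 s\<bar>)^2)"
        unfolding W_def Y_def u0_def .
    qed
  qed
  then show ?thesis .
qed

end

theorem theorem2:
  fixes \<theta>1 \<theta>2 qc \<delta> h :: real
    and p pd pdd qt q :: "real \<Rightarrow> real"
    and lam :: "nat \<Rightarrow> real" and phi phid phidd :: "nat \<Rightarrow> real \<Rightarrow> real"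
    and N0 :: nat and K l :: "nat \<Rightarrow> real"
  assumes th1: "0 \<le> \<theta>1" "\<theta>1 < pi/2"
    and th2: "0 \<le> \<theta>2" "\<theta>2 \<le> pi/2"
    and p_C2: "\<forall>x\<in>{0..1}. (p has_real_derivative pd x) (at x within {0..1})"
              "\<forall>x\<in>{0..1}. (pd has_real_derivative pdd x) (at x within {0..1})"
              "continuous_on {0..1} pdd"
    and p_pos: "\<forall>x\<in>{0..1}. p x > 0"
    and qt_cont: "continuous_on {0..1} qt"
    and q_cont: "continuous_on {0..1} q"
    and qt_q: "\<forall>x\<in>{0..1}. qt x = q x - qc"
    and q_pos: "\<forall>x\<in>{0..1}. q x > 0"
    and SL: "SL_eigensystem p pd q \<theta>1 \<theta>2 lam phi phid phidd"
    and delta: "\<delta> > 0"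
    and N0: "N0 \<ge> 1"
    and gap: "\<forall>n\<ge>N0+1. - lam n + qc < - \<delta>"
    and K_nz: "\<exists>n\<in>{1..N0}. K n \<noteq> 0"
    and hurwK: "eig_re_lt (A0m lam qc N0 + B0m (betac p \<theta>2 phi phid) N0 * Km K N0) (- \<delta>)"
    and hurwL: "eig_re_lt (A0m lam qc N0 - Lm l N0 * C0m (\<lambda>n. phid n 0) N0) (- \<delta>)"
    and h: "h > 0"
  shows
   "(\<forall>N\<ge>N0+1. feasible p pd qt qc \<theta>2 lam phi phid K l N0 \<delta> h N \<longrightarrow>
      (\<exists>M>0. \<forall>z0 z0d z0dd y0 z zx zxx zt zh u.
         (let u0 = cos \<theta>2 * z0 1 + sin \<theta>2 * z0d 1;
              w0 = (\<lambda>x. z0 x - x^2 / (cos \<theta>2 + 2 * sin \<theta>2) * u0);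
              w0d = (\<lambda>x. z0d x - 2 * x / (cos \<theta>2 + 2 * sin \<theta>2) * u0);
              w0dd = (\<lambda>x. z0dd x - 2 / (cos \<theta>2 + 2 * sin \<theta>2) * u0)
          in
          H2 z0 z0d z0dd \<and>
          cos \<theta>1 * z0 0 - sin \<theta>1 * z0d 0 = 0 \<and>
          u0 = (\<Sum>n=1..N0. K n * ZA lam qc (betac p \<theta>2 phi phid) h zh u n 0) \<and>
          (\<exists>C. C-lipschitz_on {-h..0} y0) \<and> y0 0 = z0d 0 \<and>
          closed_loop p pd qt qc \<theta>1 \<theta>2 lam phi phid K l N0 N h z0 y0 z zx zxx zt zh u
          \<longrightarrow>
          (\<forall>t\<ge>0. nrm2 (z t) + nrm2 (zx t) + (\<Sum>n=1..N. (zh n t)^2)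
             \<le> M * exp (- 2 * \<delta> * t) *
               (nrm2 (\<lambda>x. - (pd x * w0d x + p x * w0dd x) + q x * w0 x)
                + (\<Sum>n=1..N. (zh n 0)^2) + u0^2 + (SUP s\<in>{-h..0}. \<bar>y0 s\<bar>)^2)))))
    \<and> (\<exists>N1. \<forall>N\<ge>N1. feasible p pd qt qc \<theta>2 lam phi phid K l N0 \<delta> h N)"
proof -
  have pd_cont: "continuous_on {0..1} pd"
    using p_C2(2) by (meson DERIV_continuous continuous_on_eq_continuous_within)
  interpret sturm_liouville \<theta>1 \<theta>2 qc p pd qt q lam phi phid phidd
    by unfold_locales (fact th1 th2 p_C2(1) pd_cont p_pos qt_cont q_cont qt_q q_pos SL)+
  show ?thesis
  proof (intro conjI allI impI)
    fix N assume N: "N \<ge> N0 + 1" and feas: "feasible p pd qt qc \<theta>2 lam phi phid K l N0 \<delta> h N"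
    show "\<exists>M>0. \<forall>z0 z0d z0dd y0 z zx zxx zt zh u.
         (let u0 = cos \<theta>2 * z0 1 + sin \<theta>2 * z0d 1;
              w0 = (\<lambda>x. z0 x - x^2 / (cos \<theta>2 + 2 * sin \<theta>2) * u0);
              w0d = (\<lambda>x. z0d x - 2 * x / (cos \<theta>2 + 2 * sin \<theta>2) * u0);
              w0dd = (\<lambda>x. z0dd x - 2 / (cos \<theta>2 + 2 * sin \<theta>2) * u0)
          in
          H2 z0 z0d z0dd \<and>
          cos \<theta>1 * z0 0 - sin \<theta>1 * z0d 0 = 0 \<and>
          u0 = (\<Sum>n=1..N0. K n * ZA lam qc (betac p \<theta>2 phi phid) h zh u n 0) \<and>
          (\<exists>C. C-lipschitz_on {-h..0} y0) \<and> y0 0 = z0d 0 \<and>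
          closed_loop p pd qt qc \<theta>1 \<theta>2 lam phi phid K l N0 N h z0 y0 z zx zxx zt zh u
          \<longrightarrow>
          (\<forall>t\<ge>0. nrm2 (z t) + nrm2 (zx t) + (\<Sum>n=1..N. (zh n t)^2)
             \<le> M * exp (- 2 * \<delta> * t) *
               (nrm2 (\<lambda>x. - (pd x * w0d x + p x * w0dd x) + q x * w0 x)
                + (\<Sum>n=1..N. (zh n 0)^2) + u0^2 + (SUP s\<in>{-h..0}. \<bar>y0 s\<bar>)^2)))"
      using closed_loop_decay[OF delta h N feas, unfolded Aop_def hom0_def hom1_def hom2_def]
      unfolding Let_def by (elim ex_forward) blast
  next
    show "\<exists>N1. \<forall>N\<ge>N1. feasible p pd qt qc \<theta>2 lam phi phid K l N0 \<delta> h N"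
      by (rule eventually_feasible[OF delta gap hurwK hurwL])
  qed
qed

end
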